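(* Suppose the following conditions hold: (i) There are constants $a\in\mathbb R$, $b>0$ such that $L(x,u)\ge a+b|u|$ for all $(x,u)\in\mathbb R^{n+k}$. (ii) There are constants $\tilde a,\tilde b<+\infty$ such that for all $(x,u)\in\mathbb R^{n+k}$ $$|G(x)u|\le(\tilde a+\tilde b|x|)|u|+\tilde bL(x,u),\qquad |f(x)|\le\tilde a+\tilde b\,(|x|+L(x,u)).$$ Suppose also that there is an admissible trajectory, i.e. some $u\in L_1^k[0,1]$ whose trajectory of $\dot x=f(x)+G(x)u$, $x(0)=x^0$, is defined on $[0,1]$ and satisfies $x(1)=x^1$. Then the relaxed problem $$\widehat I(v,w,T)=\int_0^T\lambda(y(t),v(t),w(t))\,dt\to\min,$$ $$\dot\theta=v,\quad\dot y=f(y)v+G(y)w,\quad(v(t),w(t))\in B_k^+\ \text{ for a.e. }t\in[0,T],$$ $$\theta(0)=0,\ \theta(T)=1,\ y(0)=x^0,\ y(T)=x^1,$$ with free $T\in[0,+\infty[$, admits a minimizer; i.e., the original problem of minimizing $\int_0^1L(x,u)\,dt$ subject to $\dot x=f(x)+G(x)u$, $x(0)=x^0$, $x(1)=x^1$, admits a Fréchet generalized minimizer.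
   Context: The vector fields $f,g_1,\dots,g_k$ on $\mathbb R^n$ are locally Lipschitz, $G=(g_1,\dots,g_k)$, $x^0,x^1\in\mathbb R^n$. $L:\mathbb R^{n+k}\to\mathbb R$ is continuous, and convex in $u$. On $\mathbb R^n\times[0,+\infty[\times\mathbb R^k$: $\lambda(y,v,w)=L(y,\frac wv)v$ for $v>0$, $\lambda(y,0,w)=\lim_{\eta\to0^+}L(y,\frac w\eta)\eta\in\,]-\infty,+\infty]$. $B_k^+=\{(v,w)\in\mathbb R\times\mathbb R^k:v\ge0,\ v^2+|w|^2\le1\}$. Controls $(v,w)$ are measurable. Fréchet generalized minimizer: let $\mathcal T$ be the set of increasing (locally) absolutely continuous bijections of $[0,+\infty[$ with (locally) absolutely continuous inverse; locally absolutely continuous functions $g_1,g_2$ on $[0,+\infty[$ are equivalent if $\inf_{\alpha\in\mathcal T}\|g_1-g_2\circ\alpha\|_{L_\infty[0,+\infty[}=0$. $\mathcal F_{k,1}^0$ (generalized controls) is the set of equivalence classes $[(V,W)]$ of locally absolutely continuous $(V,W):[0,+\infty[\to\mathbb R^{1+k}$ with $V(0)=0$, $W(0)=0$, $\dot V\ge0$ a.e., infinite total length, and $V(\infty)>1$. Put $(v,w)=(\dot V,\dot W)$, $V^{\#}(1)=\sup\{s\ge0:V(s)\le1\}$, and let $y_{(v,w)}$ be the maximal solution of $\dot y=f(y)v+G(y)w$, $y(0)=x^0$. A Fréchet generalized minimizer is a $[(V,W)]\in\mathcal F_{k,1}^0$ that minimizes $$I([(V,W)])=\int_0^{V^{\#}(1)}\lambda(y_{(v,w)},v,w)\,d\tau$$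 among all $[(V,W)]\in\mathcal F_{k,1}^0$ such that $y_{(v,w)}$ is defined on $[0,V^{\#}(1)]$ and $y_{(v,w)}(V^{\#}(1))=x^1$. *)

theory Defs
  imports "HOL-Analysis.Analysis" "HOL-Probability.Essential_Supremum"
begin

section \<open>Absolutely continuous functions and Caratheodory solutions\<close>

text \<open>
  The usual epsilon-delta definition. A finite family of non-overlapping subintervals is
  encoded as a finite set of pairs of end points; degenerate pairs contribute nothing.
\<close>

definition abs_continuous_on :: "real \<Rightarrow> real \<Rightarrow> (real \<Rightarrow> 'a::metric_space) \<Rightarrow> bool" where
  "abs_continuous_on a b F \<longleftrightarrow>
     (\<forall>\<epsilon>>0. \<exists>\<delta>>0. \<forall>D. finite D \<longrightarrow>
        (\<forall>(s, t) \<in> D. a \<le> s \<and> s \<le> t \<and> t \<le> b) \<longrightarrow>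
        pairwise (\<lambda>(s, t) (s', t'). {s<..<t} \<inter> {s'<..<t'} = {}) D \<longrightarrow>
        (\<Sum>(s, t)\<in>D. t - s) < \<delta> \<longrightarrow>
        (\<Sum>(s, t)\<in>D. dist (F s) (F t)) < \<epsilon>)"

definition loc_abs_continuous :: "(real \<Rightarrow> 'a::metric_space) \<Rightarrow> bool" where
  "loc_abs_continuous F \<longleftrightarrow> (\<forall>T\<ge>0. abs_continuous_on 0 T F)"

definition solves_ode_on ::
  "real \<Rightarrow> (real \<Rightarrow> 'a \<Rightarrow> 'a) \<Rightarrow> 'a \<Rightarrow> (real \<Rightarrow> 'a::real_normed_vector) \<Rightarrow> bool" where
  "solves_ode_on T F z0 z \<longleftrightarrow>
     abs_continuous_on 0 T z \<and> z 0 = z0 \<and>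
     (AE t in lebesgue_on {0..T}. (z has_vector_derivative F t (z t)) (at t))"

text \<open>
  The maximal solution as the union of all solutions on compact intervals. The description
  operator is well defined at the points of the domain whenever solutions are unique, as
  is the case for the locally Lipschitz vector fields below.
\<close>

definition max_solution_dom ::
  "(real \<Rightarrow> 'a \<Rightarrow> 'a) \<Rightarrow> 'a::real_normed_vector \<Rightarrow> real set" where
  "max_solution_dom F z0 = {T. 0 \<le> T \<and> (\<exists>z. solves_ode_on T F z0 z)}"

definition max_solution ::
  "(real \<Rightarrow> 'a \<Rightarrow> 'a) \<Rightarrow> 'a::real_normed_vector \<Rightarrow> real \<Rightarrow> 'a" where
  "max_solution F z0 t = (THE c. \<exists>z. solves_ode_on t F z0 z \<and> z t = c)"

section \<open>The control system and the extended Lagrangian\<close>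

definition ctrl_map ::
  "('k \<Rightarrow> real^'n \<Rightarrow> real^'n) \<Rightarrow> real^'n \<Rightarrow> real^'k \<Rightarrow> real^'n" where
  "ctrl_map g x u = (\<Sum>i\<in>UNIV. (u $ i) *\<^sub>R g i x)"

definition ctrl_field ::
  "(real^'n \<Rightarrow> real^'n) \<Rightarrow> ('k \<Rightarrow> real^'n \<Rightarrow> real^'n) \<Rightarrow>
   (real \<Rightarrow> real) \<Rightarrow> (real \<Rightarrow> real^'k) \<Rightarrow> real \<Rightarrow> real^'n \<Rightarrow> real^'n" where
  "ctrl_field f g v w t y = v t *\<^sub>R f y + ctrl_map g y (w t)"

text \<open>Only the values for \<open>v \<ge> 0\<close> are meaningful.\<close>

definition ext_lagrangian ::
  "(real^'n \<Rightarrow> real^'k \<Rightarrow> real) \<Rightarrow> real^'n \<Rightarrow> real \<Rightarrow> real^'k \<Rightarrow> ereal" where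
  "ext_lagrangian L y v w =
     (if v > 0 then ereal (L y (w /\<^sub>R v) * v)
      else Lim (at_right 0) (\<lambda>\<eta>. ereal (L y (w /\<^sub>R \<eta>) * \<eta>)))"

text \<open>
  Lebesgue integral over \<open>[0, T]\<close> of an extended-real-valued function, as the difference of
  the integrals of the positive and the negative part. It is the usual integral, with values
  in \<open>]-\<infinity>, +\<infinity>]\<close>, whenever the negative part has a finite integral, which is
  the case for \<open>\<lambda>\<close> along curves if \<open>L x u \<ge> a + b * norm u\<close> with \<open>b > 0\<close>.
\<close>

definition ext_integral :: "real \<Rightarrow> (real \<Rightarrow> ereal) \<Rightarrow> ereal" where
  "ext_integral T h =
     enn2ereal (\<integral>\<^sup>+ t. e2ennreal (h t) \<partial>lebesgue_on {0..T}) -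
     enn2ereal (\<integral>\<^sup>+ t. e2ennreal (- h t) \<partial>lebesgue_on {0..T})"

definition ctrl_cost ::
  "(real^'n \<Rightarrow> real^'n) \<Rightarrow> ('k \<Rightarrow> real^'n \<Rightarrow> real^'n) \<Rightarrow> (real^'n \<Rightarrow> real^'k \<Rightarrow> real) \<Rightarrow> real^'n \<Rightarrow>
   (real \<Rightarrow> real) \<Rightarrow> (real \<Rightarrow> real^'k) \<Rightarrow> real \<Rightarrow> ereal" where
  "ctrl_cost f g L x0 v w T =
     ext_integral T (\<lambda>t. ext_lagrangian L (max_solution (ctrl_field f g v w) x0 t) (v t) (w t))"

definition steers ::
  "(real^'n \<Rightarrow> real^'n) \<Rightarrow> ('k \<Rightarrow> real^'n \<Rightarrow> real^'n) \<Rightarrow> real^'n \<Rightarrow> real^'n \<Rightarrow>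
   (real \<Rightarrow> real) \<Rightarrow> (real \<Rightarrow> real^'k) \<Rightarrow> real \<Rightarrow> bool" where
  "steers f g x0 x1 v w T \<longleftrightarrow>
     T \<in> max_solution_dom (ctrl_field f g v w) x0 \<and>
     max_solution (ctrl_field f g v w) x0 T = x1"

section \<open>The relaxed problem\<close>

definition Bk_plus :: "(real \<times> (real^'k)) set" where
  "Bk_plus = {(v, w). v \<ge> 0 \<and> v\<^sup>2 + (norm w)\<^sup>2 \<le> 1}"

definition relaxed_admissible ::
  "(real^'n \<Rightarrow> real^'n) \<Rightarrow> ('k \<Rightarrow> real^'n \<Rightarrow> real^'n) \<Rightarrow> real^'n \<Rightarrow> real^'n \<Rightarrow>
   (real \<Rightarrow> real) \<Rightarrow> (real \<Rightarrow> real^'k) \<Rightarrow> real \<Rightarrow> bool" where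
  "relaxed_admissible f g x0 x1 v w T \<longleftrightarrow>
     0 \<le> T \<and>
     v \<in> borel_measurable (lebesgue_on {0..T}) \<and>
     w \<in> borel_measurable (lebesgue_on {0..T}) \<and>
     (AE t in lebesgue_on {0..T}. (v t, w t) \<in> Bk_plus) \<and>
     (\<exists>\<theta>. solves_ode_on T (\<lambda>t _. v t) 0 \<theta> \<and> \<theta> T = 1) \<and>
     steers f g x0 x1 v w T"

definition relaxed_minimizer ::
  "(real^'n \<Rightarrow> real^'n) \<Rightarrow> ('k \<Rightarrow> real^'n \<Rightarrow> real^'n) \<Rightarrow> (real^'n \<Rightarrow> real^'k \<Rightarrow> real) \<Rightarrow>
   real^'n \<Rightarrow> real^'n \<Rightarrow> (real \<Rightarrow> real) \<Rightarrow> (real \<Rightarrow> real^'k) \<Rightarrow> real \<Rightarrow> bool" where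
  "relaxed_minimizer f g L x0 x1 v w T \<longleftrightarrow>
     relaxed_admissible f g x0 x1 v w T \<and>
     (\<forall>v' w' T'. relaxed_admissible f g x0 x1 v' w' T' \<longrightarrow>
        ctrl_cost f g L x0 v w T \<le> ctrl_cost f g L x0 v' w' T')"

section \<open>Generalized controls and Frechet generalized minimizers\<close>

text \<open>
  Functions on \<open>[0, +\<infinity>[\<close> are represented by total functions on the reals, of which only
  the values on \<open>{0..}\<close> are ever used. A curve \<open>p\<close> stands for the pair \<open>(V, W)\<close>.
\<close>

definition reparams :: "(real \<Rightarrow> real) set" where
  "reparams = {\<alpha>. bij_betw \<alpha> {0..} {0..} \<and> strict_mono_on {0..} \<alpha> \<and>
     loc_abs_continuous \<alpha> \<and> loc_abs_continuous (inv_into {0..} \<alpha>)}"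

definition frechet_rel :: "((real \<Rightarrow> 'a::real_normed_vector) \<times> (real \<Rightarrow> 'a)) set" where
  "frechet_rel = {(p, q). loc_abs_continuous p \<and> loc_abs_continuous q \<and>
     (INF \<alpha>\<in>reparams. esssup (lebesgue_on {0..}) (\<lambda>t. ereal (norm (p t - q (\<alpha> t))))) = 0}"

definition vel_v :: "(real \<Rightarrow> real \<times> (real^'k)) \<Rightarrow> real \<Rightarrow> real" where
  "vel_v p t = fst (vector_derivative p (at t))"

definition vel_w :: "(real \<Rightarrow> real \<times> (real^'k)) \<Rightarrow> real \<Rightarrow> real^'k" where
  "vel_w p t = snd (vector_derivative p (at t))"

definition control_curves :: "(real \<Rightarrow> real \<times> (real^'k)) set" where
  "control_curves = {p. loc_abs_continuous p \<and> p 0 = (0, 0) \<and>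
     (AE t in lebesgue_on {0..}. vel_v p t \<ge> 0) \<and>
     (\<integral>\<^sup>+ t. ennreal (norm (vector_derivative p (at t))) \<partial>lebesgue_on {0..}) = \<infinity> \<and>
     Lim at_top (\<lambda>t. ereal (fst (p t))) > 1}"

definition generalized_controls :: "(real \<Rightarrow> real \<times> (real^'k)) set set" where
  "generalized_controls = control_curves // frechet_rel"

text \<open>The number \<open>V\<^sup>#(1)\<close>; the set is bounded above because \<open>V\<close> is nondecreasing with \<open>V(\<infinity>) > 1\<close>.\<close>

definition sharp1 :: "(real \<Rightarrow> real \<times> (real^'k)) \<Rightarrow> real" where
  "sharp1 p = Sup {s. 0 \<le> s \<and> fst (p s) \<le> 1}"

definition curve_admissible ::
  "(real^'n \<Rightarrow> real^'n) \<Rightarrow> ('k \<Rightarrow> real^'n \<Rightarrow> real^'n) \<Rightarrow> real^'n \<Rightarrow> real^'n \<Rightarrow>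
   (real \<Rightarrow> real \<times> (real^'k)) \<Rightarrow> bool" where
  "curve_admissible f g x0 x1 p \<longleftrightarrow> steers f g x0 x1 (vel_v p) (vel_w p) (sharp1 p)"

definition curve_cost ::
  "(real^'n \<Rightarrow> real^'n) \<Rightarrow> ('k \<Rightarrow> real^'n \<Rightarrow> real^'n) \<Rightarrow> (real^'n \<Rightarrow> real^'k \<Rightarrow> real) \<Rightarrow> real^'n \<Rightarrow>
   (real \<Rightarrow> real \<times> (real^'k)) \<Rightarrow> ereal" where
  "curve_cost f g L x0 p = ctrl_cost f g L x0 (vel_v p) (vel_w p) (sharp1 p)"

text \<open>
  Admissibility and cost are defined on curves but do not depend on the representative of a
  class. Instead of choosing a representative, the definition below imposes the requirements on
  all representatives of the minimizing class, compared with all representatives of all classes.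
\<close>

definition frechet_generalized_minimizer ::
  "(real^'n \<Rightarrow> real^'n) \<Rightarrow> ('k \<Rightarrow> real^'n \<Rightarrow> real^'n) \<Rightarrow> (real^'n \<Rightarrow> real^'k \<Rightarrow> real) \<Rightarrow>
   real^'n \<Rightarrow> real^'n \<Rightarrow> (real \<Rightarrow> real \<times> (real^'k)) set \<Rightarrow> bool" where
  "frechet_generalized_minimizer f g L x0 x1 C \<longleftrightarrow>
     C \<in> generalized_controls \<and>
     (\<forall>p\<in>C. curve_admissible f g x0 x1 p) \<and>
     (\<forall>D\<in>generalized_controls. \<forall>q\<in>D. curve_admissible f g x0 x1 q \<longrightarrow>
        (\<forall>p\<in>C. curve_cost f g L x0 p \<le> curve_cost f g L x0 q))"

end

theory Submission
  imports Defs "HOL-Complex_Analysis.Great_Picard"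
begin

text \<open>A minimizing sequence of controls is reparametrized by arclength, so that the primitives of the
controls become 1-Lipschitz paths whose lengths are bounded by coercivity and whose trajectories
are bounded by a Gronwall argument. That a path drives a trajectory is expressed without
derivatives, by a second-order estimate for Euler steps; this property survives both
reparametrization and pointwise limits, so Arzela--Ascoli provides a limit path with its
trajectory. The cost is lower semicontinuous: \<open>\<lambda>\<close> is a supremum of linear functions obtained
from affine minorants of \<open>L\<close>, and Fatou's lemma applies to the resulting difference quotients
along the paths. Finally, all representatives of a Frechet class have the same arclength
parametrization, hence the same cost.\<close>

section \<open>Absolutely continuous functions\<close>

text \<open>\<open>L\<close> grows only linearly in the control, so a minimizing sequence may
  concentrate into impulses. In arclength time an impulse occupies an interval with
  \<open>v = 0\<close>, where the cost is the recession function of \<open>L\<close>. Velocities of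
  the reparametrized paths need not converge pointwise, so the passage to the limit works with
  increments over intervals of positive length, both for the trajectory and for the cost.

  Integration against \<open>v\<close> has total mass 1 for every competitor. Hence subtracting the
  constant \<open>min a 0\<close> from \<open>L\<close> changes all costs by one and the same
  number, and \<open>L\<close> may be taken nonnegative, with costs in \<open>ennreal\<close>. The
  same mass, together with coercivity, bounds the arclength of a path of cost at most
  \<open>M\<close> by \<open>1 + M / b\<close>. Resting at the end point is free, so all paths of a
  minimizing sequence can be placed on one interval, as Arzela-Ascoli requires.\<close>

definition interval_family :: "real \<Rightarrow> real \<Rightarrow> (real \<times> real) set \<Rightarrow> bool" where
  "interval_family a b D \<longleftrightarrow> finite D \<and> (\<forall>(s, t)\<in>D. a \<le> s \<and> s < t \<and> t \<le> b) \<and>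
     pairwise (\<lambda>(s, t) (s', t'). {s<..<t} \<inter> {s'<..<t'} = {}) D"

lemma abs_continuous_onD:
  assumes "abs_continuous_on a b F" "\<epsilon> > 0"
  obtains \<delta> where "\<delta> > 0"
    "\<And>D. interval_family a b D \<Longrightarrow> (\<Sum>(s, t)\<in>D. t - s) < \<delta> \<Longrightarrow> (\<Sum>(s, t)\<in>D. dist (F s) (F t)) < \<epsilon>"
proof -
  obtain \<delta> where "\<delta> > 0" and \<delta>: "\<And>D. finite D \<Longrightarrow>
        (\<forall>(s, t) \<in> D. a \<le> s \<and> s \<le> t \<and> t \<le> b) \<Longrightarrow>
        pairwise (\<lambda>(s, t) (s', t'). {s<..<t} \<inter> {s'<..<t'} = {}) D \<Longrightarrow>
        (\<Sum>(s, t)\<in>D. t - s) < \<delta> \<Longrightarrow> (\<Sum>(s, t)\<in>D. dist (F s) (F t)) < \<epsilon>"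
    using assms unfolding abs_continuous_on_def by meson
  show ?thesis
  proof
    show "\<delta> > 0" by fact
    show "(\<Sum>(s, t)\<in>D. dist (F s) (F t)) < \<epsilon>"
      if "interval_family a b D" "(\<Sum>(s, t)\<in>D. t - s) < \<delta>" for D
      using that by (intro \<delta>) (auto simp: interval_family_def)
  qed
qed

text \<open>The families tested here have \<open>s < t\<close>, so that disjoint open intervals are
  linearly ordered. Degenerate pairs, which the definition of absolute continuity admits, contribute
  zero to both sums and are discarded with \<open>E\<close>.\<close>

lemma abs_continuous_onI:
  assumes "\<And>\<epsilon>. \<epsilon> > 0 \<Longrightarrow> \<exists>\<delta>>0. \<forall>D. interval_family a b D \<longrightarrow> (\<Sum>(s, t)\<in>D. t - s) < \<delta> \<longrightarrow>
     (\<Sum>(s, t)\<in>D. dist (F s) (F t)) < \<epsilon>"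
  shows "abs_continuous_on a b F"
  unfolding abs_continuous_on_def
proof (intro allI impI)
  fix \<epsilon> :: real assume "\<epsilon> > 0"
  then obtain \<delta> where "\<delta> > 0" and \<delta>: "\<And>D. interval_family a b D \<Longrightarrow> (\<Sum>(s, t)\<in>D. t - s) < \<delta> \<Longrightarrow>
     (\<Sum>(s, t)\<in>D. dist (F s) (F t)) < \<epsilon>" using assms by meson
  have "(\<Sum>(s, t)\<in>D. dist (F s) (F t)) < \<epsilon>"
    if D: "finite D" "\<forall>(s, t) \<in> D. a \<le> s \<and> s \<le> t \<and> t \<le> b"
      "pairwise (\<lambda>(s, t) (s', t'). {s<..<t} \<inter> {s'<..<t'} = {}) D"
      "(\<Sum>(s, t)\<in>D. t - s) < \<delta>" for D
  proof -
    define E where "E = {x\<in>D. fst x < snd x}"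
    have "interval_family a b E"
      unfolding interval_family_def E_def using D by (auto intro: pairwise_subset)
    moreover have "(\<Sum>x\<in>E. h (fst x) (snd x)) = (\<Sum>x\<in>D. h (fst x) (snd x))"
      if "\<And>s. h s s = 0" for h :: "real \<Rightarrow> real \<Rightarrow> real"
    proof (rule sum.mono_neutral_left)
      show "\<forall>x\<in>D - E. h (fst x) (snd x) = 0"
      proof
        fix x assume "x \<in> D - E"
        then have "fst x = snd x" using D(2) by (auto simp: E_def)
        then show "h (fst x) (snd x) = 0" by (simp add: that)
      qed
    qed (auto simp: E_def D)
    from this[of "\<lambda>s t. t - s"] this[of "\<lambda>s t. dist (F s) (F t)"]
    have "(\<Sum>(s, t)\<in>E. t - s) = (\<Sum>(s, t)\<in>D. t - s)"
      "(\<Sum>(s, t)\<in>E. dist (F s) (F t)) = (\<Sum>(s, t)\<in>D. dist (F s) (F t))"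
      by (simp_all add: split_def)
    ultimately show ?thesis using \<delta>[of E] D(4) by simp
  qed
  with \<open>\<delta> > 0\<close> show "\<exists>\<delta>>0. \<forall>D. finite D \<longrightarrow>
        (\<forall>(s, t) \<in> D. a \<le> s \<and> s \<le> t \<and> t \<le> b) \<longrightarrow>
        pairwise (\<lambda>(s, t) (s', t'). {s<..<t} \<inter> {s'<..<t'} = {}) D \<longrightarrow>
        (\<Sum>(s, t)\<in>D. t - s) < \<delta> \<longrightarrow>
        (\<Sum>(s, t)\<in>D. dist (F s) (F t)) < \<epsilon>" by blast
qed

lemma abs_continuous_on_subinterval:
  assumes "abs_continuous_on a b F" "a \<le> a'" "b' \<le> b"
  shows "abs_continuous_on a' b' F"
proof (rule abs_continuous_onI)
  fix \<epsilon> :: real assume "\<epsilon> > 0"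
  then obtain \<delta> where "\<delta> > 0"
    and \<delta>: "\<And>D. interval_family a b D \<Longrightarrow> (\<Sum>(s, t)\<in>D. t - s) < \<delta> \<Longrightarrow> (\<Sum>(s, t)\<in>D. dist (F s) (F t)) < \<epsilon>"
    using abs_continuous_onD[OF assms(1)] by metis
  moreover have "interval_family a b D" if "interval_family a' b' D" for D
    using that assms(2,3) unfolding interval_family_def by fastforce
  ultimately show "\<exists>\<delta>>0. \<forall>D. interval_family a' b' D \<longrightarrow> (\<Sum>(s, t)\<in>D. t - s) < \<delta> \<longrightarrow>
     (\<Sum>(s, t)\<in>D. dist (F s) (F t)) < \<epsilon>" by blast
qed

text \<open>A common source of absolute continuity: Lipschitz maps, pairs, linear images and
  trajectories all have increments dominated by those of functions already known to be absolutely
  continuous.\<close>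

lemma abs_continuous_on_dominated2:
  assumes "abs_continuous_on a b A" "abs_continuous_on a b B" "c \<ge> 0"
    and "\<And>s t. a \<le> s \<Longrightarrow> s \<le> t \<Longrightarrow> t \<le> b \<Longrightarrow> dist (F s) (F t) \<le> c * (dist (A s) (A t) + dist (B s) (B t))"
  shows "abs_continuous_on a b F"
proof (rule abs_continuous_onI)
  fix \<epsilon> :: real assume "\<epsilon> > 0"
  define e where "e = \<epsilon> / (2 * (c + 1))"
  have "e > 0" using \<open>\<epsilon> > 0\<close> assms(3) by (simp add: e_def)
  obtain \<delta>1 where "\<delta>1 > 0"
    and \<delta>1: "\<And>D. interval_family a b D \<Longrightarrow> (\<Sum>(s, t)\<in>D. t - s) < \<delta>1 \<Longrightarrow> (\<Sum>(s, t)\<in>D. dist (A s) (A t)) < e"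
    using abs_continuous_onD[OF assms(1) \<open>e > 0\<close>] by metis
  obtain \<delta>2 where "\<delta>2 > 0"
    and \<delta>2: "\<And>D. interval_family a b D \<Longrightarrow> (\<Sum>(s, t)\<in>D. t - s) < \<delta>2 \<Longrightarrow> (\<Sum>(s, t)\<in>D. dist (B s) (B t)) < e"
    using abs_continuous_onD[OF assms(2) \<open>e > 0\<close>] by metis
  have "(\<Sum>(s, t)\<in>D. dist (F s) (F t)) < \<epsilon>"
    if D: "interval_family a b D" "(\<Sum>(s, t)\<in>D. t - s) < min \<delta>1 \<delta>2" for D
  proof -
    have "(\<Sum>(s, t)\<in>D. dist (F s) (F t)) \<le> (\<Sum>(s, t)\<in>D. c * (dist (A s) (A t) + dist (B s) (B t)))"
      using D(1) assms(4) unfolding interval_family_def by (intro sum_mono) force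
    also have "\<dots> = c * ((\<Sum>(s, t)\<in>D. dist (A s) (A t)) + (\<Sum>(s, t)\<in>D. dist (B s) (B t)))"
      by (simp add: sum_distrib_left[symmetric] sum.distrib split_def)
    also have "\<dots> \<le> c * (e + e)"
      using less_imp_le[OF \<delta>1[OF D(1)]] less_imp_le[OF \<delta>2[OF D(1)]] D(2) assms(3)
      by (intro mult_left_mono add_mono) auto
    also have "\<dots> < (c + 1) * (e + e)" using \<open>e > 0\<close> by (intro mult_strict_right_mono) auto
    also have "\<dots> = \<epsilon>" using assms(3) by (simp add: e_def divide_simps)
    finally show ?thesis .
  qed
  then show "\<exists>\<delta>>0. \<forall>D. interval_family a b D \<longrightarrow> (\<Sum>(s, t)\<in>D. t - s) < \<delta> \<longrightarrow>
     (\<Sum>(s, t)\<in>D. dist (F s) (F t)) < \<epsilon>"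
    using \<open>\<delta>1 > 0\<close> \<open>\<delta>2 > 0\<close> min_less_iff_conj[of 0 \<delta>1 \<delta>2]
    by (intro exI[of _ "min \<delta>1 \<delta>2"]) presburger
qed

lemma abs_continuous_on_dominated:
  assumes "abs_continuous_on a b A" "c \<ge> 0"
    and "\<And>s t. a \<le> s \<Longrightarrow> s \<le> t \<Longrightarrow> t \<le> b \<Longrightarrow> dist (F s) (F t) \<le> c * dist (A s) (A t)"
  shows "abs_continuous_on a b F"
proof (rule abs_continuous_on_dominated2[OF assms(1,1)])
  show "0 \<le> c / 2" using assms(2) by simp
  show "dist (F s) (F t) \<le> c / 2 * (dist (A s) (A t) + dist (A s) (A t))" if "a \<le> s" "s \<le> t" "t \<le> b" for s t
    using assms(3)[OF that] by simp
qed

lemma abs_continuous_on_id: "abs_continuous_on a b (\<lambda>t::real. t)"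
proof (rule abs_continuous_onI)
  fix \<epsilon> :: real assume "\<epsilon> > 0"
  have "(\<Sum>(s, t)\<in>D. dist s t) = (\<Sum>(s, t)\<in>D. t - s)" if "interval_family a b D" for D
    using that unfolding interval_family_def by (intro sum.cong) (auto simp: dist_real_def)
  with \<open>\<epsilon> > 0\<close> show "\<exists>\<delta>>0. \<forall>D. interval_family a b D \<longrightarrow> (\<Sum>(s, t)\<in>D. t - s) < \<delta> \<longrightarrow>
     (\<Sum>(s, t)\<in>D. dist s t) < \<epsilon>" by auto
qed

lemma abs_continuous_on_lipschitz:
  assumes "c-lipschitz_on {a..b} F"
  shows "abs_continuous_on a b F"
proof (rule abs_continuous_on_dominated[OF abs_continuous_on_id])
  show "dist (F s) (F t) \<le> c * dist s t" if "a \<le> s" "s \<le> t" "t \<le> b" for s t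
    using that by (intro lipschitz_onD[OF assms]) auto
qed (rule lipschitz_on_nonneg[OF assms])

lemma abs_continuous_on_Pair:
  assumes "abs_continuous_on a b F" "abs_continuous_on a b G"
  shows "abs_continuous_on a b (\<lambda>t. (F t, G t))"
proof (rule abs_continuous_on_dominated2[OF assms])
  show "dist (F s, G s) (F t, G t) \<le> 1 * (dist (F s) (F t) + dist (G s) (G t))" for s t
    by (simp add: dist_Pair_Pair sqrt_sum_squares_le_sum)
qed simp

lemma abs_continuous_on_imp_continuous_on:
  assumes "abs_continuous_on a b F"
  shows "continuous_on {a..b} F"
  unfolding continuous_on_iff
proof (intro ballI allI impI)
  fix x \<epsilon> :: real assume x: "x \<in> {a..b}" and "\<epsilon> > 0"
  then obtain \<delta> where "\<delta> > 0"
    and \<delta>: "\<And>D. interval_family a b D \<Longrightarrow> (\<Sum>(s, t)\<in>D. t - s) < \<delta> \<Longrightarrow> (\<Sum>(s, t)\<in>D. dist (F s) (F t)) < \<epsilon>"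
    using abs_continuous_onD[OF assms] by metis
  have "dist (F y) (F x) < \<epsilon>" if "y \<in> {a..b}" "dist y x < \<delta>" for y
  proof (cases "x = y")
    case False
    then have "interval_family a b {(min x y, max x y)}"
      using x that unfolding interval_family_def by auto
    from \<delta>[OF this] have "dist (F (min x y)) (F (max x y)) < \<epsilon>"
      using that(2) by (simp add: dist_real_def abs_real_def min_def max_def split: if_splits)
    then show ?thesis by (cases "x \<le> y") (simp_all add: dist_commute)
  qed (use \<open>\<epsilon> > 0\<close> in auto)
  with \<open>\<delta> > 0\<close> show "\<exists>\<delta>>0. \<forall>y\<in>{a..b}. dist y x < \<delta> \<longrightarrow> dist (F y) (F x) < \<epsilon>" by blast
qed

text \<open>Projecting the end points to \<open>[c, d]\<close> intersects every interval with
  \<open>[c, d]\<close>. This allows a family to be cut at a point that lies inside one of its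
  intervals.\<close>

definition clamp_family :: "real \<Rightarrow> real \<Rightarrow> (real \<times> real) set \<Rightarrow> (real \<times> real) set" where
  "clamp_family c d D = {x \<in> (\<lambda>(s, t). (max c (min d s), max c (min d t))) ` D. fst x < snd x}"

lemma interval_family_clamp:
  assumes "interval_family a b D" "c \<le> d"
  shows "interval_family c d (clamp_family c d D)"
proof -
  have "pairwise (\<lambda>(s, t) (s', t'). {s<..<t} \<inter> {s'<..<t'} = {}) (clamp_family c d D)"
  proof (rule pairwiseI)
    fix x y assume xy: "x \<in> clamp_family c d D" "y \<in> clamp_family c d D" "x \<noteq> y"
    obtain u v where x: "x = (u, v)" by (cases x)
    obtain u' v' where y: "y = (u', v')" by (cases y)
    from xy obtain s t s' t' where st: "(s, t) \<in> D" "(s', t') \<in> D" "(s, t) \<noteq> (s', t')"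
      and uv: "u = max c (min d s)" "v = max c (min d t)" "u' = max c (min d s')" "v' = max c (min d t')"
      unfolding clamp_family_def x y by auto
    have "pairwise (\<lambda>(s, t) (s', t'). {s<..<t} \<inter> {s'<..<t'} = {}) D"
      using assms(1) by (simp add: interval_family_def)
    from pairwiseD[OF this st] have "{s<..<t} \<inter> {s'<..<t'} = {}" by simp
    then have *: "\<not> (s < x \<and> x < t \<and> s' < x \<and> x < t')" for x by auto
    show "(\<lambda>(s, t) (s', t'). {s<..<t} \<inter> {s'<..<t'} = {}) x y"
    proof (rule ccontr)
      assume "\<not> ?thesis"
      then have "{u<..<v} \<inter> {u'<..<v'} \<noteq> {}" by (simp add: x y)
      then obtain x where "x \<in> {u<..<v} \<inter> {u'<..<v'}"
        by blast
      then have "c < x" "x < d" "s < x" "x < t" "s' < x" "x < t'"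
        unfolding Int_iff greaterThanLessThan_iff uv by linarith+
      then show False using *[of x] by simp
    qed
  qed
  moreover have "finite (clamp_family c d D)"
    using assms unfolding interval_family_def clamp_family_def by auto
  moreover have "c \<le> s \<and> s < t \<and> t \<le> d" if "(s, t) \<in> clamp_family c d D" for s t
    using that assms(2) unfolding clamp_family_def by auto
  ultimately show ?thesis unfolding interval_family_def by auto
qed

text \<open>Two different intervals can have the same projection only if it is a single point,
  because their interiors are disjoint. There \<open>h\<close> vanishes, so passing to a set of
  projected pairs loses no term.\<close>

lemma sum_clamp_family:
  fixes h :: "real \<Rightarrow> real \<Rightarrow> 'a::comm_monoid_add"
  assumes D: "interval_family a b D" and h: "\<And>s. h s s = 0"
  shows "(\<Sum>(s, t)\<in>clamp_family c d D. h s t) = (\<Sum>(s, t)\<in>D. h (max c (min d s)) (max c (min d t)))"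
proof -
  define \<phi> where "\<phi> = (\<lambda>(s, t). (max c (min d s), max c (min d t)))"
  have fin: "finite D" using D by (simp add: interval_family_def)
  have "(\<Sum>(s, t)\<in>clamp_family c d D. h s t) = (\<Sum>(s, t)\<in>\<phi> ` D. h s t)"
  proof (rule sum.mono_neutral_left)
    show "finite (\<phi> ` D)" using fin by simp
    show "clamp_family c d D \<subseteq> \<phi> ` D" by (auto simp: clamp_family_def \<phi>_def)
    have "fst x = snd x" if x: "x \<in> \<phi> ` D - clamp_family c d D" for x
    proof -
      obtain s t where st: "(s, t) \<in> D" "x = \<phi> (s, t)" using x by auto
      then have "s < t" using D by (auto simp: interval_family_def)
      then have "fst x \<le> snd x" using st(2) by (simp add: \<phi>_def)
      moreover have "\<not> fst x < snd x" using x by (simp add: clamp_family_def \<phi>_def)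
      ultimately show ?thesis by simp
    qed
    then show "\<forall>x\<in>\<phi> ` D - clamp_family c d D. (case x of (s, t) \<Rightarrow> h s t) = 0"
      by (simp add: h split_def)
  qed
  also have "\<dots> = (\<Sum>x\<in>D. case \<phi> x of (s, t) \<Rightarrow> h s t)"
  proof (rule sum.reindex_nontrivial[OF fin, unfolded o_def])
    fix x y assume xy: "x \<in> D" "y \<in> D" "x \<noteq> y" "\<phi> x = \<phi> y"
    obtain s t where x: "x = (s, t)" by (cases x)
    obtain s' t' where y: "y = (s', t')" by (cases y)
    have "pairwise (\<lambda>(s, t) (s', t'). {s<..<t} \<inter> {s'<..<t'} = {}) D"
      using D by (simp add: interval_family_def)
    from pairwiseD[OF this xy(1,2,3)] have "{s<..<t} \<inter> {s'<..<t'} = {}" by (simp add: x y)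
    moreover have "s < t" "s' < t'"
      using xy(1,2) D unfolding interval_family_def x y by auto
    ultimately have "t \<le> s' \<or> t' \<le> s"
      by (auto simp: Int_greaterThanLessThan)
    then have "fst (\<phi> x) = snd (\<phi> x)"
      using xy(4) \<open>s < t\<close> \<open>s' < t'\<close> unfolding \<phi>_def x y by simp linarith
    then show "(case \<phi> x of (s, t) \<Rightarrow> h s t) = 0" using h by (simp add: split_def)
  qed
  finally show ?thesis by (simp add: \<phi>_def split_def)
qed

text \<open>Lengths are added as measures of disjoint open sets, so the intervals never have to be
  sorted.\<close>

lemma sum_interval_family_le_measure:
  assumes D: "interval_family a b D" and U: "\<And>s t. (s, t) \<in> D \<Longrightarrow> {s<..<t} \<subseteq> U" "U \<in> lmeasurable"
  shows "(\<Sum>(s, t)\<in>D. t - s) \<le> measure lebesgue U"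
proof -
  define I where "I = (\<lambda>(s::real, t). {s<..<t})"
  have fin: "finite D" using D by (simp add: interval_family_def)
  have lm: "I x \<in> lmeasurable" for x by (simp add: I_def split_def)
  have "(\<Sum>(s, t)\<in>D. t - s) = (\<Sum>x\<in>D. measure lebesgue (I x))"
  proof (rule sum.cong[OF refl])
    fix x assume "x \<in> D"
    then have "fst x < snd x" using D by (auto simp: interval_family_def)
    then show "(case x of (s, t) \<Rightarrow> t - s) = measure lebesgue (I x)" by (simp add: I_def split_def)
  qed
  also have "\<dots> = measure lebesgue (\<Union>x\<in>D. I x)"
  proof (rule measure_finite_Union[symmetric, OF fin])
    show "I ` D \<subseteq> sets lebesgue" using lm by (auto simp: fmeasurableD)
    show "emeasure lebesgue (I x) \<noteq> \<infinity>" for x using lm[of x] fmeasurableD2 by (metis infinity_ennreal_def)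
    have pw: "pairwise (\<lambda>(s, t) (s', t'). {s<..<t} \<inter> {s'<..<t'} = {}) D"
      using D by (simp add: interval_family_def)
    show "disjoint_family_on I D"
      unfolding disjoint_family_on_def
    proof (intro ballI impI)
      fix x y assume "x \<in> D" "y \<in> D" "x \<noteq> y"
      from pairwiseD[OF pw this] show "I x \<inter> I y = {}" by (simp add: I_def split_def)
    qed
  qed
  also have "\<dots> \<le> measure lebesgue U"
    using U(1) by (intro measure_mono_fmeasurable U(2) sets.finite_UN fin fmeasurableD[OF lm])
      (auto simp: I_def)
  finally show ?thesis .
qed

corollary sum_interval_family_le:
  assumes "interval_family a b D" "a \<le> b"
  shows "(\<Sum>(s, t)\<in>D. t - s) \<le> b - a"
proof -
  have "{s<..<t} \<subseteq> {a..b}" if "(s, t) \<in> D" for s t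
    using that assms(1) unfolding interval_family_def by fastforce
  from sum_interval_family_le_measure[OF assms(1) this] show ?thesis using assms(2) by simp
qed

section \<open>Total variation of an absolutely continuous function\<close>

definition var_sum :: "(real \<Rightarrow> 'a::metric_space) \<Rightarrow> (real \<times> real) set \<Rightarrow> real" where
  "var_sum F D = (\<Sum>(s, t)\<in>D. dist (F s) (F t))"

text \<open>The usual total variation: filling the gaps of a family to obtain a partition only
  increases the sum. As a supremum of reals it is meaningful once the sums are known to be bounded,
  see \<open>bdd_above_var_sum\<close>.\<close>

definition variation :: "(real \<Rightarrow> 'a::metric_space) \<Rightarrow> real \<Rightarrow> real \<Rightarrow> real" where
  "variation F a b = (SUP D\<in>Collect (interval_family a b). var_sum F D)"

lemma interval_family_empty [simp]: "interval_family a b {}"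
  by (simp add: interval_family_def)

lemma interval_family_mono:
  assumes "interval_family a b D" "a' \<le> a" "b \<le> b'"
  shows "interval_family a' b' D"
  using assms unfolding interval_family_def by fastforce

text \<open>Only an interval with \<open>c\<close> in its interior is changed. It is cut at
  \<open>c\<close>, and the triangle inequality shows that cutting does not decrease the
  sum.\<close>

lemma var_sum_split:
  assumes D: "interval_family a b D" and c: "a \<le> c" "c \<le> b"
  shows "var_sum F D \<le> var_sum F (clamp_family a c D) + var_sum F (clamp_family c b D)"
proof -
  have "var_sum F D \<le> (\<Sum>(s, t)\<in>D. dist (F (max a (min c s))) (F (max a (min c t))) +
      dist (F (max c (min b s))) (F (max c (min b t))))"
    unfolding var_sum_def
  proof (rule sum_mono, clarify)
    fix s t assume "(s, t) \<in> D"
    then have st: "a \<le> s" "s < t" "t \<le> b" using D by (auto simp: interval_family_def)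
    consider "t \<le> c" | "c \<le> s" | "s < c" "c < t" by linarith
    then show "dist (F s) (F t) \<le> dist (F (max a (min c s))) (F (max a (min c t))) +
      dist (F (max c (min b s))) (F (max c (min b t)))"
    proof cases
      case 1
      then have "max a (min c s) = s" "max a (min c t) = t" using st by auto
      then show ?thesis by simp
    next
      case 2
      then have "max c (min b s) = s" "max c (min b t) = t" using st by auto
      then show ?thesis by simp
    next
      case 3
      then have "max a (min c s) = s" "max a (min c t) = c" "max c (min b s) = c" "max c (min b t) = t"
        using st c by auto
      then show ?thesis by (simp add: dist_triangle)
    qed
  qed
  also have "\<dots> = var_sum F (clamp_family a c D) + var_sum F (clamp_family c b D)"
    unfolding var_sum_def
    by (subst (1 2) sum_clamp_family[OF D]) (simp_all add: sum.distrib split_def)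
  finally show ?thesis .
qed

text \<open>Take the \<open>\<delta>\<close> that belongs to \<open>\<epsilon> = 1\<close>: on an
  interval shorter than \<open>\<delta>\<close> all sums stay below 1. The interval
  \<open>[a, b]\<close> is exhausted in steps of length \<open>\<delta> / 2\<close>, each of which
  adds at most 1 to the bound.\<close>

lemma bdd_above_var_sum:
  assumes F: "abs_continuous_on a b F"
  shows "bdd_above (var_sum F ` Collect (interval_family a b))"
proof (cases "a \<le> b")
  case False
  then have "var_sum F D \<le> 0" if "interval_family a b D" for D
    using that by (cases "D = {}") (auto simp: interval_family_def var_sum_def)
  then show ?thesis by (intro bdd_aboveI2) auto
next
  case True
  obtain \<delta> where "\<delta> > 0"
    and \<delta>: "\<And>D. interval_family a b D \<Longrightarrow> (\<Sum>(s, t)\<in>D. t - s) < \<delta> \<Longrightarrow> (\<Sum>(s, t)\<in>D. dist (F s) (F t)) < 1"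
    using abs_continuous_onD[OF F, of 1] by (metis zero_less_one)
  define h where "h = \<delta> / 2"
  have h: "0 < h" "h < \<delta>" using \<open>\<delta> > 0\<close> by (auto simp: h_def)
  have step: "var_sum F D \<le> real n" if "interval_family a c D" "a \<le> c" "c \<le> b" "c \<le> a + n * h" for n c D
    using that
  proof (induction n arbitrary: c D)
    case 0
    then have "D = {}" by (fastforce simp: interval_family_def)
    then show ?case by (simp add: var_sum_def)
  next
    case (Suc n)
    define m where "m = max a (c - h)"
    have m: "a \<le> m" "m \<le> c" "c - m \<le> h" "m \<le> a + n * h" using Suc.prems h by (auto simp: m_def algebra_simps)
    have fam1: "interval_family a m (clamp_family a m D)"
      by (rule interval_family_clamp[OF Suc.prems(1) m(1)])
    have fam2: "interval_family m c (clamp_family m c D)"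
      by (rule interval_family_clamp[OF Suc.prems(1) m(2)])
    have "(\<Sum>(s, t)\<in>clamp_family m c D. t - s) < \<delta>"
      using sum_interval_family_le[OF fam2 m(2)] m h by linarith
    moreover have "interval_family a b (clamp_family m c D)"
      using interval_family_mono[OF fam2] m Suc.prems by auto
    ultimately have "var_sum F (clamp_family m c D) < 1"
      using \<delta> unfolding var_sum_def by blast
    moreover have "var_sum F (clamp_family a m D) \<le> real n"
      using Suc.IH[OF fam1 m(1)] m Suc.prems by simp
    ultimately show ?case
      using var_sum_split[OF Suc.prems(1) m(1,2), of F] by simp
  qed
  obtain n :: nat where "b - a < n * h" using h(1) reals_Archimedean3 by blast
  then show ?thesis using step[of b _ n] True by (intro bdd_aboveI2[of _ _ "real n"]) auto
qed

lemma var_sum_le_variation: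
  assumes "abs_continuous_on a b F" "interval_family a b D"
  shows "var_sum F D \<le> variation F a b"
  unfolding variation_def using assms by (intro cSUP_upper bdd_above_var_sum) auto

lemma variation_le_add:
  assumes F: "abs_continuous_on a b F" and c: "a \<le> c" "c \<le> b"
  shows "variation F a b \<le> variation F a c + variation F c b"
  unfolding variation_def[of F a b]
proof (rule cSUP_least)
  show "Collect (interval_family a b) \<noteq> {}" using interval_family_empty by blast
  fix D assume "D \<in> Collect (interval_family a b)"
  then have D: "interval_family a b D" by simp
  have "var_sum F (clamp_family a c D) \<le> variation F a c" "var_sum F (clamp_family c b D) \<le> variation F c b"
    using c by (auto intro!: var_sum_le_variation interval_family_clamp[OF D] abs_continuous_on_subinterval[OF F])
  with var_sum_split[OF D c, of F] show "var_sum F D \<le> variation F a c + variation F c b" by linarith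
qed

text \<open>The pair \<open>(s, t)\<close> can be appended to every family on \<open>[a, s]\<close>.
  In particular the variation is nondecreasing in its end point.\<close>

lemma dist_le_variation_diff:
  assumes F: "abs_continuous_on a b F" and st: "a \<le> s" "s \<le> t" "t \<le> b"
  shows "dist (F s) (F t) \<le> variation F a t - variation F a s"
proof (cases "s = t")
  case False
  have "var_sum F D \<le> variation F a t - dist (F s) (F t)" if D: "interval_family a s D" for D
  proof -
    have notin: "(s, t) \<notin> D" using D st False by (auto simp: interval_family_def)
    have fin: "finite D" using D by (simp add: interval_family_def)
    have "pairwise (\<lambda>(s, t) (s', t'). {s<..<t} \<inter> {s'<..<t'} = {}) (insert (s, t) D)"
      using D unfolding interval_family_def pairwise_insert by fastforce
    then have "interval_family a t (insert (s, t) D)"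
      using D st False unfolding interval_family_def by fastforce
    from var_sum_le_variation[OF abs_continuous_on_subinterval[OF F] this] st
    have "var_sum F (insert (s, t) D) \<le> variation F a t" by simp
    then show ?thesis using notin fin by (simp add: var_sum_def)
  qed
  then have "variation F a s \<le> variation F a t - dist (F s) (F t)"
    unfolding variation_def[of F a s] using interval_family_empty by (intro cSUP_least) blast+
  then show ?thesis by linarith
qed simp

text \<open>Each interval of \<open>D\<close> is replaced by a family inside it that almost attains
  the variation over it. The union of these families is no longer than \<open>D\<close>, so absolute
  continuity of \<open>F\<close> applies to it.\<close>

lemma abs_continuous_on_variation:
  assumes F: "abs_continuous_on a b F"
  shows "abs_continuous_on a b (variation F a)"
proof (rule abs_continuous_onI)
  fix \<epsilon> :: real assume "\<epsilon> > 0"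
  then obtain \<delta> where "\<delta> > 0"
    and \<delta>: "\<And>D. interval_family a b D \<Longrightarrow> (\<Sum>(s, t)\<in>D. t - s) < \<delta> \<Longrightarrow> (\<Sum>(s, t)\<in>D. dist (F s) (F t)) < \<epsilon> / 2"
    using abs_continuous_onD[OF F, of "\<epsilon> / 2"] by (metis half_gt_zero)
  have "(\<Sum>(s, t)\<in>D. dist (variation F a s) (variation F a t)) < \<epsilon>"
    if D: "interval_family a b D" and small: "(\<Sum>(s, t)\<in>D. t - s) < \<delta>" for D
  proof -
    have fin: "finite D" using D by (simp add: interval_family_def)
    have Dst: "a \<le> fst x \<and> fst x < snd x \<and> snd x \<le> b" if "x \<in> D" for x
      using that D by (auto simp: interval_family_def)
    \<comment> \<open>The defects \<open>\<eta>\<close>, one for each interval of \<open>D\<close>,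
      add up to at most \<open>\<epsilon> / 2\<close>.\<close>
    define \<eta> where "\<eta> = \<epsilon> / (2 * (real (card D) + 1))"
    have "\<eta> > 0" using \<open>\<epsilon> > 0\<close> by (simp add: \<eta>_def)
    have "\<exists>E. interval_family (fst x) (snd x) E \<and> variation F (fst x) (snd x) - \<eta> < var_sum F E"
      if "x \<in> D" for x
    proof -
      have ac: "abs_continuous_on (fst x) (snd x) F"
        using Dst[OF that] by (intro abs_continuous_on_subinterval[OF F]) auto
      have "variation F (fst x) (snd x) - \<eta> < (SUP D\<in>Collect (interval_family (fst x) (snd x)). var_sum F D)"
        using \<open>\<eta> > 0\<close> by (simp add: variation_def)
      then show ?thesis
        using interval_family_empty[of "fst x" "snd x"]
        by (subst (asm) less_cSUP_iff[OF _ bdd_above_var_sum[OF ac]]) (auto intro!: exI[of _ "{}"])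
    qed
    then obtain E where E: "\<And>x. x \<in> D \<Longrightarrow> interval_family (fst x) (snd x) (E x)"
      "\<And>x. x \<in> D \<Longrightarrow> variation F (fst x) (snd x) - \<eta> < var_sum F (E x)" by metis
    have pw: "pairwise (\<lambda>(s, t) (s', t'). {s<..<t} \<inter> {s'<..<t'} = {}) D"
      using D by (simp add: interval_family_def)
    have sep: "{fst u<..<snd u} \<inter> {fst v<..<snd v} = {}"
      if xy: "x \<in> D" "y \<in> D" "x \<noteq> y" and uv: "u \<in> E x" "v \<in> E y" for x y u v
    proof -
      have "{fst x<..<snd x} \<inter> {fst y<..<snd y} = {}"
        using pairwiseD[OF pw xy] by (simp add: split_def)
      moreover have "{fst u<..<snd u} \<subseteq> {fst x<..<snd x}" "{fst v<..<snd v} \<subseteq> {fst y<..<snd y}"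
        using E(1)[OF xy(1)] E(1)[OF xy(2)] uv unfolding interval_family_def by fastforce+
      ultimately show ?thesis by blast
    qed
    have Elt: "fst u < snd u" "fst x \<le> fst u" "snd u \<le> snd x" if "x \<in> D" "u \<in> E x" for x u
      using E(1)[OF that(1)] that(2) unfolding interval_family_def by auto
    have disj: "E x \<inter> E y = {}" if xy: "x \<in> D" "y \<in> D" "x \<noteq> y" for x y
    proof (rule ccontr)
      assume "E x \<inter> E y \<noteq> {}"
      then obtain u where u: "u \<in> E x" "u \<in> E y" by blast
      with sep[OF xy u] Elt[OF xy(1) u(1)] show False by (simp add: greaterThanLessThan_empty_iff)
    qed
    have finE: "finite (E x)" if "x \<in> D" for x using E(1)[OF that] by (simp add: interval_family_def)
    define G where "G = (\<Union>x\<in>D. E x)"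
    have sumG: "(\<Sum>u\<in>G. h u) = (\<Sum>x\<in>D. \<Sum>u\<in>E x. h u)" for h :: "_ \<Rightarrow> real"
      unfolding G_def using fin finE disj by (intro sum.UNION_disjoint) auto
    have "interval_family a b G"
      unfolding interval_family_def
    proof (intro conjI)
      show "finite G" unfolding G_def using fin finE by auto
      show "\<forall>(s, t)\<in>G. a \<le> s \<and> s < t \<and> t \<le> b"
      proof (clarsimp simp: G_def)
        fix s t p q assume "(p, q) \<in> D" "(s, t) \<in> E (p, q)"
        then show "a \<le> s \<and> s < t \<and> t \<le> b" using Elt[of "(p, q)" "(s, t)"] Dst[of "(p, q)"] by auto
      qed
      show "pairwise (\<lambda>(s, t) (s', t'). {s<..<t} \<inter> {s'<..<t'} = {}) G"
      proof (rule pairwiseI)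
        fix u v assume uv: "u \<in> G" "v \<in> G" "u \<noteq> v"
        then obtain x y where xy: "x \<in> D" "u \<in> E x" "y \<in> D" "v \<in> E y" unfolding G_def by blast
        have "{fst u<..<snd u} \<inter> {fst v<..<snd v} = {}"
        proof (cases "x = y")
          case True
          then have "pairwise (\<lambda>(s, t) (s', t'). {s<..<t} \<inter> {s'<..<t'} = {}) (E x)" "v \<in> E x"
            using E(1)[OF xy(1)] xy by (simp_all add: interval_family_def)
          from pairwiseD[OF this(1) xy(2) this(2) uv(3)] show ?thesis by (simp add: split_def)
        next
          case False
          then show ?thesis using sep xy by blast
        qed
        then show "(\<lambda>(s, t) (s', t'). {s<..<t} \<inter> {s'<..<t'} = {}) u v" by (simp add: split_def)
      qed
    qed
    moreover have "(\<Sum>(s, t)\<in>G. t - s) \<le> (\<Sum>(s, t)\<in>D. t - s)"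
      unfolding sumG
    proof (rule sum_mono)
      fix x assume x: "x \<in> D"
      show "(\<Sum>(s, t)\<in>E x. t - s) \<le> (case x of (s, t) \<Rightarrow> t - s)"
        using sum_interval_family_le[OF E(1)[OF x]] Dst[OF x] by (simp add: split_def)
    qed
    ultimately have "(\<Sum>(s, t)\<in>G. dist (F s) (F t)) < \<epsilon> / 2"
      using \<delta> small by fastforce
    then have G: "(\<Sum>x\<in>D. var_sum F (E x)) < \<epsilon> / 2" by (simp add: sumG var_sum_def)
    have "(\<Sum>(s, t)\<in>D. dist (variation F a s) (variation F a t)) \<le> (\<Sum>x\<in>D. var_sum F (E x) + \<eta>)"
    proof (rule sum_mono)
      fix x assume x: "x \<in> D"
      have "abs_continuous_on a (snd x) F" using Dst[OF x] by (intro abs_continuous_on_subinterval[OF F]) auto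
      from variation_le_add[OF this, of "fst x"]
      have "variation F a (snd x) - variation F a (fst x) \<le> variation F (fst x) (snd x)"
        using Dst[OF x] by linarith
      also have "\<dots> \<le> var_sum F (E x) + \<eta>" using E(2)[OF x] by simp
      finally show "(case x of (s, t) \<Rightarrow> dist (variation F a s) (variation F a t)) \<le> var_sum F (E x) + \<eta>"
        using dist_le_variation_diff[OF F, of "fst x" "snd x"] Dst[OF x] zero_le_dist[of "F (fst x)" "F (snd x)"]
        unfolding split_def dist_real_def by linarith
    qed
    also have "\<dots> = (\<Sum>x\<in>D. var_sum F (E x)) + real (card D) * \<eta>" by (simp add: sum.distrib)
    also have "real (card D) * \<eta> \<le> \<epsilon> / 2" using \<open>\<epsilon> > 0\<close> by (simp add: \<eta>_def field_simps)
    finally show ?thesis using G by simp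
  qed
  with \<open>\<delta> > 0\<close> show "\<exists>\<delta>>0. \<forall>D. interval_family a b D \<longrightarrow> (\<Sum>(s, t)\<in>D. t - s) < \<delta> \<longrightarrow>
     (\<Sum>(s, t)\<in>D. dist (variation F a s) (variation F a t)) < \<epsilon>" by blast
qed

text \<open>\<open>G\<close> continues \<open>\<psi>\<close> by constants, so that its Stieltjes
  measure lives on the line and has finite mass. By inner regularity it is enough to show that
  compact null sets \<open>K\<close> have measure zero. Such a \<open>K\<close> is covered by
  finitely many intervals inside an open set of measure below \<open>\<delta>\<close>, and the
  increments of \<open>\<psi>\<close> over them sum to less than \<open>\<epsilon>\<close>.\<close>

lemma interval_measure_clamp_absolutely_continuous:
  fixes \<psi> :: "real \<Rightarrow> real"
  assumes ac: "abs_continuous_on a b \<psi>" and mono: "mono_on {a..b} \<psi>" and ab: "a \<le> b"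
  defines "G \<equiv> \<lambda>x. \<psi> (max a (min b x))"
  shows "emeasure (interval_measure G) UNIV \<le> ennreal (\<psi> b - \<psi> a)"
    and "s \<le> t \<Longrightarrow> emeasure (interval_measure G) {s..t} = ennreal (G t - G s)"
    and "absolutely_continuous lborel (interval_measure G)"
proof -
  define \<mu> where "\<mu> = interval_measure G"
  have cl: "max a (min b x) \<in> {a..b}" for x using ab by auto
  have G_mono: "G x \<le> G y" if "x \<le> y" for x y
    unfolding G_def using that cl[of x] cl[of y] by (intro mono_onD[OF mono]) (auto simp del: atLeastAtMost_iff)
  have G_cont: "continuous_on UNIV G"
    unfolding G_def
    by (rule continuous_on_compose2[OF abs_continuous_on_imp_continuous_on[OF ac]])
       (use cl in \<open>auto intro!: continuous_intros simp del: atLeastAtMost_iff\<close>)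
  have Icc: "emeasure \<mu> {s..t} = ennreal (G t - G s)" if "s \<le> t" for s t
    unfolding \<mu>_def by (rule emeasure_interval_measure_Icc[OF that G_mono G_cont])
  then show "s \<le> t \<Longrightarrow> emeasure (interval_measure G) {s..t} = ennreal (G t - G s)"
    by (simp add: \<mu>_def)
  have setsmu [simp]: "sets \<mu> = sets borel" by (simp add: \<mu>_def)
  have "emeasure \<mu> UNIV = (SUP n. emeasure \<mu> {- real n..real n})"
  proof -
    have "x \<in> (\<Union>n. {- real n..real n})" for x
      using real_arch_simple[of "\<bar>x\<bar>"] by (auto simp: abs_le_iff) (metis minus_le_iff)
    then have "(\<Union>n. {- real n..real n}) = UNIV" by blast
    then show ?thesis
      by (subst SUP_emeasure_incseq) (auto simp: incseq_def)
  qed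
  also have "\<dots> \<le> ennreal (\<psi> b - \<psi> a)"
  proof (rule SUP_least)
    fix n :: nat
    have "G (real n) \<le> \<psi> b" "\<psi> a \<le> G (- real n)"
      unfolding G_def using cl[of "real n"] cl[of "- real n"] ab by (auto intro!: mono_onD[OF mono])
    then show "emeasure \<mu> {- real n..real n} \<le> ennreal (\<psi> b - \<psi> a)"
      by (simp add: Icc ennreal_leI)
  qed
  finally have fin: "emeasure \<mu> UNIV \<le> ennreal (\<psi> b - \<psi> a)" .
  then show "emeasure (interval_measure G) UNIV \<le> ennreal (\<psi> b - \<psi> a)" by (simp add: \<mu>_def)
  have "emeasure \<mu> N = 0" if N: "N \<in> null_sets lborel" for N
  proof -
    have "emeasure \<mu> (space \<mu>) \<noteq> \<infinity>"
      using fin by (auto simp: \<mu>_def top_unique)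
    then have "emeasure \<mu> N = (SUP K\<in>{K. K \<subseteq> N \<and> compact K}. emeasure \<mu> K)"
      using N by (intro inner_regular) auto
    also have "\<dots> \<le> 0"
    proof (rule SUP_least)
      fix K assume "K \<in> {K. K \<subseteq> N \<and> compact K}"
      then have K: "K \<subseteq> N" "compact K" by auto
      have Knull: "emeasure lebesgue K = 0"
      proof -
        have "N \<in> null_sets lebesgue" using N by (simp add: null_sets_completionI)
        then have "K \<in> null_sets lebesgue" using K(1) by (meson negligible_iff_null_sets negligible_subset)
        then show ?thesis by auto
      qed
      have small: "emeasure \<mu> K \<le> ennreal \<epsilon>" if "\<epsilon> > 0" for \<epsilon> :: real
      proof -
        obtain \<delta> where "\<delta> > 0"
          and \<delta>: "\<And>D. interval_family a b D \<Longrightarrow> (\<Sum>(s, t)\<in>D. t - s) < \<delta> \<Longrightarrow> (\<Sum>(s, t)\<in>D. dist (\<psi> s) (\<psi> t)) < \<epsilon>"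
          using abs_continuous_onD[OF ac \<open>\<epsilon> > 0\<close>] by metis
        have Kleb: "K \<in> sets lebesgue" using K(2) by (simp add: compact_imp_closed borel_closed)
        obtain U where U: "open U" "K \<subseteq> U" "U - K \<in> lmeasurable" "emeasure lebesgue (U - K) < ennreal \<delta>"
          using sets_lebesgue_outer_open[OF Kleb \<open>\<delta> > 0\<close>] by metis
        have "K \<in> lmeasurable" using K(2) by (rule lmeasurable_compact)
        then have Ulm: "U \<in> lmeasurable"
          using fmeasurable.Un[OF U(3)] U(2) by (metis Diff_partition Un_commute)
        have "emeasure lebesgue U \<le> emeasure lebesgue (U - K) + emeasure lebesgue K"
          using emeasure_subadditive[of "U - K" lebesgue K] U(2,3) Kleb
          by (simp add: Un_absorb2 fmeasurableD)
        then have "emeasure lebesgue U < ennreal \<delta>" using U(4) Knull by simp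
        then have Um: "measure lebesgue U < \<delta>"
          using \<open>\<delta> > 0\<close> Ulm by (simp add: emeasure_eq_measure2 ennreal_less_iff)
        have "\<exists>e>0. cball x e \<subseteq> U" if "x \<in> K" for x
          using U(1,2) that by (meson open_contains_cball subsetD)
        then obtain e where e: "\<And>x. x \<in> K \<Longrightarrow> e x > 0" "\<And>x. x \<in> K \<Longrightarrow> cball x (e x) \<subseteq> U" by metis
        have "K \<subseteq> (\<Union>x\<in>K. ball x (e x))" using e(1) by force
        then obtain C where C: "C \<subseteq> K" "finite C" "K \<subseteq> (\<Union>x\<in>C. ball x (e x))"
          using compactE_image[OF K(2), of K "\<lambda>x. ball x (e x)"] by auto
        define \<F> where "\<F> = (\<lambda>x. cball x (e x)) ` C"
        have "finite \<F>" using C(2) by (simp add: \<F>_def)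
        moreover have "\<exists>s t. S = cbox s t" if "S \<in> \<F>" for S :: "real set"
          using that by (auto simp: \<F>_def cball_eq_atLeastAtMost)
        \<comment> \<open>The balls of the finite cover may overlap; the division \<open>p\<close>
          covers the same set by intervals with disjoint interiors.\<close>
        ultimately obtain p where p: "p division_of \<Union>\<F>" using elementary_unions_intervals by metis
        have KF: "K \<subseteq> \<Union>\<F>" using C(3) ball_subset_cball unfolding \<F>_def by blast
        have FU: "\<Union>\<F> \<subseteq> U" using C(1) e(2) unfolding \<F>_def by blast
        note pD = division_ofD[OF p]
        have pIcc: "k = {Inf k..Sup k} \<and> Inf k \<le> Sup k" if kp: "k \<in> p" for k
        proof -
          obtain s t where "k = {s..t}" using pD(4)[OF kp] by auto
          moreover from this have "s \<le> t" using pD(3)[OF kp] by auto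
          ultimately show ?thesis by simp
        qed
        define q where "q = {k\<in>p. Inf k < Sup k}"
        define D where "D = (\<lambda>k. (Inf k, Sup k)) ` q"
        have inj: "inj_on (\<lambda>k. (Inf k, Sup k)) q"
          by (rule inj_onI) (metis (no_types, lifting) Pair_inject mem_Collect_eq pIcc q_def)
        have "finite D" using pD(1) by (simp add: D_def q_def)
        then have "bounded (fst ` D \<union> snd ` D)" by (simp add: finite_imp_bounded)
        then obtain B where B: "\<And>x. x \<in> fst ` D \<union> snd ` D \<Longrightarrow> \<bar>x\<bar> \<le> B"
          unfolding bounded_iff by auto
        have D: "interval_family (-B) B D"
          unfolding interval_family_def
        proof (intro conjI)
          show "\<forall>(s, t)\<in>D. - B \<le> s \<and> s < t \<and> t \<le> B"
          proof clarify
            fix s t assume st: "(s, t) \<in> D"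
            then have "\<bar>s\<bar> \<le> B" "\<bar>t\<bar> \<le> B" using B by force+
            moreover have "s < t" using st by (auto simp: D_def q_def)
            ultimately show "- B \<le> s \<and> s < t \<and> t \<le> B" by auto
          qed
          show "pairwise (\<lambda>(s, t) (s', t'). {s<..<t} \<inter> {s'<..<t'} = {}) D"
          proof (rule pairwiseI)
            fix x y assume "x \<in> D" "y \<in> D" "x \<noteq> y"
            then obtain k l where kl: "k \<in> p" "l \<in> p" "x = (Inf k, Sup k)" "y = (Inf l, Sup l)" "k \<noteq> l"
              unfolding D_def q_def by auto
            have "interior k = {Inf k<..<Sup k}" "interior l = {Inf l<..<Sup l}"
              using pIcc[OF kl(1)] pIcc[OF kl(2)] by (metis interior_atLeastAtMost_real)+
            then show "(\<lambda>(s, t) (s', t'). {s<..<t} \<inter> {s'<..<t'} = {}) x y"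
              using pD(5)[OF kl(1,2,5)] kl(3,4) by simp
          qed
        qed fact
        have "{s<..<t} \<subseteq> U" if "(s, t) \<in> D" for s t
        proof -
          from that have "{s..t} \<in> p" using pIcc by (auto simp: D_def q_def)
          then have "{s..t} \<subseteq> U" using pD(2) FU by blast
          then show ?thesis by force
        qed
        from sum_interval_family_le_measure[OF D this Ulm] Um
        have small: "(\<Sum>(s, t)\<in>D. t - s) < \<delta>" by simp
        \<comment> \<open>The intervals may leave \<open>[a, b]\<close>. Clamping shortens them and
          does not change the increments of \<open>G\<close>.\<close>
        have cf: "interval_family a b (clamp_family a b D)" by (rule interval_family_clamp[OF D ab])
        have "(\<Sum>(s, t)\<in>clamp_family a b D. t - s) = (\<Sum>(s, t)\<in>D. max a (min b t) - max a (min b s))"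
          by (rule sum_clamp_family[OF D]) simp
        also have "\<dots> \<le> (\<Sum>(s, t)\<in>D. t - s)"
          using D by (intro sum_mono) (auto simp: interval_family_def)
        finally have "(\<Sum>(s, t)\<in>clamp_family a b D. t - s) < \<delta>" using small by simp
        from \<delta>[OF cf this] have "(\<Sum>(s, t)\<in>D. dist (G s) (G t)) < \<epsilon>"
          using sum_clamp_family[OF D, of "\<lambda>s t. dist (\<psi> s) (\<psi> t)" a b] by (simp add: G_def)
        also have "(\<Sum>(s, t)\<in>D. dist (G s) (G t)) = (\<Sum>(s, t)\<in>D. G t - G s)"
        proof (rule sum.cong[OF refl], clarify)
          fix s t assume "(s, t) \<in> D"
          then have "s \<le> t" by (auto simp: D_def q_def)
          from G_mono[OF this] show "dist (G s) (G t) = G t - G s" by (simp add: dist_real_def)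
        qed
        also have "\<dots> = (\<Sum>k\<in>q. G (Sup k) - G (Inf k))"
          unfolding D_def by (subst sum.reindex[OF inj]) simp
        also have "\<dots> = (\<Sum>k\<in>p. G (Sup k) - G (Inf k))"
        proof (rule sum.mono_neutral_left[OF pD(1)])
          have "Sup k = Inf k" if "k \<in> p - q" for k using pIcc[of k] that by (auto simp: q_def)
          then show "\<forall>k\<in>p - q. G (Sup k) - G (Inf k) = 0" by auto
        qed (auto simp: q_def)
        finally have sump: "(\<Sum>k\<in>p. G (Sup k) - G (Inf k)) < \<epsilon>" .
        have "emeasure \<mu> K \<le> emeasure \<mu> (\<Union>k\<in>p. k)"
        proof (rule emeasure_mono)
          show "K \<subseteq> (\<Union>k\<in>p. k)" using KF pD(6) by simp
          have "k \<in> sets \<mu>" if "k \<in> p" for k using pD(4)[OF that] by auto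
          then show "(\<Union>k\<in>p. k) \<in> sets \<mu>" using pD(1) by (intro sets.finite_UN) auto
        qed
        also have "\<dots> \<le> (\<Sum>k\<in>p. emeasure \<mu> k)"
        proof (rule emeasure_subadditive_finite[OF pD(1)])
          have "k \<in> sets \<mu>" if "k \<in> p" for k using pD(4)[OF that] by auto
          then show "(\<lambda>k. k) ` p \<subseteq> sets \<mu>" by auto
        qed
        also have "\<dots> = (\<Sum>k\<in>p. ennreal (G (Sup k) - G (Inf k)))"
          using pIcc Icc by (intro sum.cong refl) metis
        also have "\<dots> = ennreal (\<Sum>k\<in>p. G (Sup k) - G (Inf k))"
          using pIcc G_mono by (intro sum_ennreal) auto
        also have "\<dots> \<le> ennreal \<epsilon>" using sump by (intro ennreal_leI) simp
        finally show ?thesis .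
      qed
      show "emeasure \<mu> K \<le> 0"
      proof (rule ennreal_le_epsilon)
        fix e :: real assume "0 < e"
        then show "emeasure \<mu> K \<le> 0 + ennreal e" using small[of e] by (simp only: add_0)
      qed
    qed
    finally show ?thesis by simp
  qed
  then show "absolutely_continuous lborel (interval_measure G)"
    unfolding absolutely_continuous_def \<mu>_def by (auto simp: null_sets_def)
qed

text \<open>\<open>\<rho>\<close> is a Radon-Nikodym density of the Stieltjes measure of
  \<open>\<psi>\<close>.\<close>

lemma mono_abs_continuous_integral:
  fixes \<psi> :: "real \<Rightarrow> real"
  assumes ac: "abs_continuous_on a b \<psi>" and mono: "mono_on {a..b} \<psi>" and ab: "a \<le> b"
  obtains \<rho> :: "real \<Rightarrow> real" where "\<rho> \<in> borel_measurable borel" "\<And>x. \<rho> x \<ge> 0" "\<rho> absolutely_integrable_on {a..b}"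
    "\<And>s t. a \<le> s \<Longrightarrow> s \<le> t \<Longrightarrow> t \<le> b \<Longrightarrow> (\<rho> has_integral \<psi> t - \<psi> s) {s..t}"
proof -
  define G where "G = (\<lambda>x. \<psi> (max a (min b x)))"
  define \<mu> where "\<mu> = interval_measure G"
  note im = interval_measure_clamp_absolutely_continuous[OF ac mono ab, folded G_def, folded \<mu>_def]
  obtain f where f: "f \<in> borel_measurable lborel" "density lborel f = \<mu>"
    using sigma_finite_measure.Radon_Nikodym[OF sigma_finite_lborel im(3)] by (auto simp: \<mu>_def)
  have [measurable]: "f \<in> borel_measurable borel" using f(1) by simp
  have "(\<integral>\<^sup>+x. f x \<partial>lborel) = emeasure \<mu> UNIV"
    unfolding f(2)[symmetric] by (subst emeasure_density) auto
  then have "(\<integral>\<^sup>+x. f x \<partial>lborel) \<noteq> \<infinity>" using im(1) by (auto simp: top_unique)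
  then have ae: "AE x in lborel. f x \<noteq> \<infinity>" by (intro nn_integral_PInf_AE) auto
  \<comment> \<open>\<open>f\<close> is finite outside a null set; on that set
    \<open>enn2real\<close> may return its default 0.\<close>
  define \<rho> where "\<rho> = (\<lambda>x. enn2real (f x))"
  have \<rho>_int: "(\<rho> has_integral \<psi> t - \<psi> s) {s..t}" if st: "a \<le> s" "s \<le> t" "t \<le> b" for s t
  proof -
    have "(\<integral>\<^sup>+x. ennreal (\<rho> x * indicator {s..t} x) \<partial>lborel) = (\<integral>\<^sup>+x. f x * indicator {s..t} x \<partial>lborel)"
      using ae by (intro nn_integral_cong_AE) (auto simp: \<rho>_def less_top split: split_indicator)
    also have "\<dots> = emeasure \<mu> {s..t}"
      unfolding f(2)[symmetric] by (subst emeasure_density) auto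
    also have "\<dots> = ennreal (\<psi> t - \<psi> s)"
      using im(2)[OF st(2)] st by (simp add: G_def)
    finally have "((\<lambda>x. \<rho> x * indicator {s..t} x) has_integral \<psi> t - \<psi> s) UNIV"
      using st mono_onD[OF mono, of s t] by (intro nn_integral_has_integral) (auto simp: \<rho>_def)
    moreover have "(\<lambda>x. \<rho> x * indicator {s..t} x) = (\<lambda>x. if x \<in> {s..t} then \<rho> x else 0)" by auto
    ultimately show ?thesis by (simp only: has_integral_restrict_UNIV)
  qed
  show ?thesis
  proof
    show "\<rho> \<in> borel_measurable borel" unfolding \<rho>_def by measurable
    show "\<rho> x \<ge> 0" for x by (simp add: \<rho>_def)
    show "(\<rho> has_integral \<psi> t - \<psi> s) {s..t}" if "a \<le> s" "s \<le> t" "t \<le> b" for s t by (rule \<rho>_int[OF that])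
    show "\<rho> absolutely_integrable_on {a..b}"
      using \<rho>_int[of a b] ab by (intro nonnegative_absolutely_integrable_1) (auto simp: \<rho>_def)
  qed
qed

section \<open>The fundamental theorem of calculus and substitution\<close>

text \<open>Lebesgue measure is complete, hence the exceptional set itself is null, whatever
  \<open>P\<close> is.\<close>

lemma AE_lebesgue_on_iff_negligible:
  assumes "S \<in> sets lebesgue"
  shows "(AE x in lebesgue_on S. P x) \<longleftrightarrow> negligible {x\<in>S. \<not> P x}"
proof -
  have "(AE x in lebesgue_on S. P x) \<longleftrightarrow> (AE x in lebesgue. x \<in> S \<longrightarrow> P x)"
    using assms by (intro AE_restrict_space_iff) auto
  also have "\<dots> \<longleftrightarrow> (\<exists>N\<in>null_sets lebesgue. {x. \<not> (x \<in> S \<longrightarrow> P x)} \<subseteq> N)"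
    by (simp add: eventually_ae_filter)
  also have "\<dots> \<longleftrightarrow> negligible {x\<in>S. \<not> P x}"
  proof -
    have "{x. \<not> (x \<in> S \<longrightarrow> P x)} = {x\<in>S. \<not> P x}" by auto
    then show ?thesis by (metis negligible_iff_null_sets negligible_subset order_refl)
  qed
  finally show ?thesis .
qed

lemma AE_lebesgue_on_subset:
  assumes "AE x in lebesgue_on S. P x" "T \<subseteq> S" "S \<in> sets lebesgue" "T \<in> sets lebesgue"
  shows "AE x in lebesgue_on T. P x"
  using assms by (auto simp: AE_lebesgue_on_iff_negligible elim!: negligible_subset)

lemma has_vector_derivative_at_alt:
  "(F has_vector_derivative v) (at x) \<longleftrightarrow>
     (\<forall>e>0. \<exists>d>0. \<forall>y. \<bar>y - x\<bar> < d \<longrightarrow> norm (F y - F x - (y - x) *\<^sub>R v) \<le> e * \<bar>y - x\<bar>)"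
  unfolding has_vector_derivative_def has_derivative_at_alt
  by (simp add: bounded_linear_scaleR_left)

text \<open>\<open>integrable_ccontinuous_explicit\<close> gives convergence of averages over
  intervals to the right of \<open>x\<close>. Applied to the reflected integrand as well, it covers
  the left side and yields the two-sided derivative.\<close>

lemma indefinite_integral_has_vector_derivative:
  fixes F \<rho> :: "real \<Rightarrow> 'a::euclidean_space"
  assumes \<rho>: "\<rho> absolutely_integrable_on {a..b}"
    and F: "\<And>s t. a \<le> s \<Longrightarrow> s \<le> t \<Longrightarrow> t \<le> b \<Longrightarrow> (\<rho> has_integral F t - F s) {s..t}"
  shows "AE x in lebesgue_on {a..b}. (F has_vector_derivative \<rho> x) (at x)"
proof -
  define r where "r = (\<lambda>x. if x \<in> {a..b} then \<rho> x else 0)"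
  have "r integrable_on UNIV"
    using \<rho> unfolding r_def by (simp only: integrable_restrict_UNIV set_lebesgue_integral_eq_integral(1))
  then have r: "r integrable_on cbox s t" for s t
    using integrable_on_subcbox by blast
  have rm: "(\<lambda>x. r (- x)) integrable_on cbox s t" for s t
    using r[of "-t" "-s"] Henstock_Kurzweil_Integration.integrable_reflect_real[of r "-s" "-t"] by simp
  obtain N1 where N1: "negligible N1" "\<And>x e. x \<notin> N1 \<Longrightarrow> 0 < e \<Longrightarrow>
      \<exists>d>0. \<forall>h. 0 < h \<and> h < d \<longrightarrow> norm (integral (cbox x (x + h *\<^sub>R One)) r /\<^sub>R h ^ DIM(real) - r x) < e"
    using integrable_ccontinuous_explicit[OF r] by metis
  obtain N2 where N2: "negligible N2" "\<And>x e. x \<notin> N2 \<Longrightarrow> 0 < e \<Longrightarrow>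
      \<exists>d>0. \<forall>h. 0 < h \<and> h < d \<longrightarrow> norm (integral (cbox x (x + h *\<^sub>R One)) (\<lambda>x. r (-x)) /\<^sub>R h ^ DIM(real) - r (-x)) < e"
    using integrable_ccontinuous_explicit[OF rm] by metis
  have "negligible (uminus ` N2)"
    by (rule negligible_differentiable_image_negligible[OF _ N2(1)])
      (auto intro!: derivative_intros simp: differentiable_on_def)
  \<comment> \<open>The end points are excluded because nothing is known about \<open>F\<close>
    outside \<open>[a, b]\<close>.\<close>
  then have neg: "negligible (N1 \<union> uminus ` N2 \<union> {a, b})"
    using N1(1) by simp
  have "(F has_vector_derivative \<rho> x) (at x)" if x: "a \<le> x" "x \<le> b" "x \<notin> N1 \<union> uminus ` N2 \<union> {a, b}" for x
    unfolding has_vector_derivative_at_alt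
  proof (intro allI impI)
    fix e :: real assume "e > 0"
    have xab: "a < x" "x < b" using x by auto
    have rx: "r x = \<rho> x" using xab by (simp add: r_def)
    have "x \<notin> N1" "- x \<notin> N2" using x by force+
    from N1(2)[OF this(1) \<open>e > 0\<close>] N2(2)[OF this(2) \<open>e > 0\<close>] obtain d1 d2 where
      d1: "d1 > 0" "\<And>h. 0 < h \<Longrightarrow> h < d1 \<Longrightarrow> norm (integral {x..x + h} r /\<^sub>R h - \<rho> x) < e"
      and d2: "d2 > 0" "\<And>h. 0 < h \<Longrightarrow> h < d2 \<Longrightarrow> norm (integral {- x..- x + h} (\<lambda>x. r (-x)) /\<^sub>R h - \<rho> x) < e"
      by (auto simp: rx)
    define d where "d = Min {d1, d2, x - a, b - x}"
    have d: "d > 0" "d \<le> d1" "d \<le> d2" "d \<le> x - a" "d \<le> b - x"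
      using d1(1) d2(1) xab by (auto simp: d_def)
    have r_int: "integral {s..t} r = F t - F s" if "a \<le> s" "s \<le> t" "t \<le> b" for s t
    proof -
      have "integral {s..t} r = integral {s..t} \<rho>"
        using that by (intro integral_cong) (auto simp: r_def)
      then show ?thesis using F[OF that] by (simp add: integral_unique)
    qed
    have "norm (F y - F x - (y - x) *\<^sub>R \<rho> x) \<le> e * \<bar>y - x\<bar>" if y: "\<bar>y - x\<bar> < d" for y
    proof -
      consider "y = x" | "y > x" | "y < x" by linarith
      then show ?thesis
      proof cases
        case 2
        define h where "h = y - x"
        have h: "0 < h" "h < d1" "y = x + h" using 2 y d by (auto simp: h_def)
        have "integral {x..x + h} r = F y - F x"
          using r_int[of x y] 2 y d xab h by simp
        with d1(2)[OF h(1,2)] have "norm ((F y - F x) /\<^sub>R h - \<rho> x) < e" by simp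
        moreover have "F y - F x - (y - x) *\<^sub>R \<rho> x = h *\<^sub>R ((F y - F x) /\<^sub>R h - \<rho> x)"
          using h by (simp add: algebra_simps)
        ultimately show ?thesis using h by (simp add: mult.commute less_imp_le)
      next
        case 3
        define h where "h = x - y"
        have h: "0 < h" "h < d2" "y = x - h" using 3 y d by (auto simp: h_def)
        have "integral {- x..- x + h} (\<lambda>x. r (-x)) = integral {y..x} r"
          using Henstock_Kurzweil_Integration.integral_reflect_real[of x y r] h by simp
        also have "\<dots> = F x - F y"
          using r_int[of y x] 3 y d xab h by simp
        finally have "norm ((F x - F y) /\<^sub>R h - \<rho> x) < e" using d2(2)[OF h(1,2)] by simp
        moreover have "y - x = - h" by (simp add: h_def)
        then have "F y - F x - (y - x) *\<^sub>R \<rho> x = - (h *\<^sub>R ((F x - F y) /\<^sub>R h - \<rho> x))"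
          using h(1) by (simp add: scaleR_diff_right)
        ultimately show ?thesis using h by (simp add: mult.commute less_imp_le)
      qed simp
    qed
    then show "\<exists>d>0. \<forall>y. \<bar>y - x\<bar> < d \<longrightarrow> norm (F y - F x - (y - x) *\<^sub>R \<rho> x) \<le> e * \<bar>y - x\<bar>"
      using d(1) by blast
  qed
  then have "negligible {x\<in>{a..b}. \<not> (F has_vector_derivative \<rho> x) (at x)}"
    by (intro negligible_subset[OF neg]) auto
  then show ?thesis by (subst AE_lebesgue_on_iff_negligible) auto
qed

text \<open>Jordan decomposition: with the variation \<open>\<psi>\<close>, both
  \<open>\<psi> + F\<close> and \<open>\<psi> - F\<close> are nondecreasing and absolutely
  continuous, and \<open>F\<close> is half their difference.\<close>

lemma abs_continuous_on_real_integral: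
  fixes F :: "real \<Rightarrow> real"
  assumes F: "abs_continuous_on a b F" and ab: "a \<le> b"
  obtains \<rho> :: "real \<Rightarrow> real" where "\<rho> \<in> borel_measurable borel" "\<rho> absolutely_integrable_on {a..b}"
    "\<And>s t. a \<le> s \<Longrightarrow> s \<le> t \<Longrightarrow> t \<le> b \<Longrightarrow> (\<rho> has_integral F t - F s) {s..t}"
proof -
  define \<psi> where "\<psi> = variation F a"
  have \<psi>: "abs_continuous_on a b \<psi>" unfolding \<psi>_def by (rule abs_continuous_on_variation[OF F])
  have dist_le: "\<bar>F t - F s\<bar> \<le> \<psi> t - \<psi> s" if "a \<le> s" "s \<le> t" "t \<le> b" for s t
    using dist_le_variation_diff[OF F that] unfolding \<psi>_def dist_real_def by linarith
  have tri: "dist (\<psi> s + c * F s) (\<psi> t + c * F t) \<le> 1 * (dist (\<psi> s) (\<psi> t) + dist (F s) (F t))"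
    if "\<bar>c\<bar> = 1" for c s t :: real
    using that unfolding dist_real_def by (cases "c \<ge> 0") auto
  have ac: "abs_continuous_on a b (\<lambda>t. \<psi> t + c * F t)" if "\<bar>c\<bar> = 1" for c
    by (rule abs_continuous_on_dominated2[OF \<psi> F _ tri[OF that]]) simp
  have mono: "mono_on {a..b} (\<lambda>t. \<psi> t + c * F t)" if "\<bar>c\<bar> = 1" for c
  proof (rule mono_onI)
    fix s t assume "s \<in> {a..b}" "t \<in> {a..b}" "s \<le> t"
    with dist_le[of s t] that show "\<psi> s + c * F s \<le> \<psi> t + c * F t"
      by (cases "c \<ge> 0") auto
  qed
  obtain \<rho>1 where \<rho>1: "\<rho>1 \<in> borel_measurable borel" "\<rho>1 absolutely_integrable_on {a..b}"
    "\<And>s t. a \<le> s \<Longrightarrow> s \<le> t \<Longrightarrow> t \<le> b \<Longrightarrow> (\<rho>1 has_integral (\<psi> t + 1 * F t) - (\<psi> s + 1 * F s)) {s..t}"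
    using mono_abs_continuous_integral[OF ac mono ab, of 1] by (metis abs_one)
  obtain \<rho>2 where \<rho>2: "\<rho>2 \<in> borel_measurable borel" "\<rho>2 absolutely_integrable_on {a..b}"
    "\<And>s t. a \<le> s \<Longrightarrow> s \<le> t \<Longrightarrow> t \<le> b \<Longrightarrow> (\<rho>2 has_integral (\<psi> t + (-1) * F t) - (\<psi> s + (-1) * F s)) {s..t}"
    using mono_abs_continuous_integral[OF ac mono ab, of "-1"] by (metis abs_minus_cancel abs_one)
  show ?thesis
  proof
    show "(\<lambda>x. (1/2) *\<^sub>R (\<rho>1 x - \<rho>2 x)) \<in> borel_measurable borel" using \<rho>1(1) \<rho>2(1) by measurable
    show "(\<lambda>x. (1/2) *\<^sub>R (\<rho>1 x - \<rho>2 x)) absolutely_integrable_on {a..b}"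
      using \<rho>1(2) \<rho>2(2) by (intro set_integrable_scaleR_right set_integral_diff) auto
    show "((\<lambda>x. (1/2) *\<^sub>R (\<rho>1 x - \<rho>2 x)) has_integral F t - F s) {s..t}"
      if st: "a \<le> s" "s \<le> t" "t \<le> b" for s t
      using has_integral_cmul[OF has_integral_diff[OF \<rho>1(3)[OF st] \<rho>2(3)[OF st]], of "1/2"]
      by (simp add: algebra_simps)
  qed
qed

text \<open>The fundamental theorem of calculus, obtained coordinatewise. The density is Borel,
  which is what makes its composition with a parametrization measurable later.\<close>

theorem abs_continuous_on_integral:
  fixes F :: "real \<Rightarrow> 'a::euclidean_space"
  assumes F: "abs_continuous_on a b F" and ab: "a \<le> b"
  obtains \<rho> :: "real \<Rightarrow> 'a" where "\<rho> \<in> borel_measurable borel" "\<rho> absolutely_integrable_on {a..b}"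
    "\<And>s t. a \<le> s \<Longrightarrow> s \<le> t \<Longrightarrow> t \<le> b \<Longrightarrow> (\<rho> has_integral F t - F s) {s..t}"
    "AE x in lebesgue_on {a..b}. (F has_vector_derivative \<rho> x) (at x)"
proof -
  have "\<exists>\<rho>. \<rho> \<in> borel_measurable borel \<and> \<rho> absolutely_integrable_on {a..b} \<and>
     (\<forall>s t. a \<le> s \<longrightarrow> s \<le> t \<longrightarrow> t \<le> b \<longrightarrow> (\<rho> has_integral F t \<bullet> i - F s \<bullet> i) {s..t})"
    if "i \<in> Basis" for i
  proof -
    have "dist (F s \<bullet> i) (F t \<bullet> i) \<le> 1 * dist (F s) (F t)" for s t
      using Basis_le_norm[OF that, of "F s - F t"] by (simp add: dist_norm inner_diff_left)
    then have "abs_continuous_on a b (\<lambda>t. F t \<bullet> i)"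
      by (intro abs_continuous_on_dominated[OF F, of 1]) auto
    from abs_continuous_on_real_integral[OF this ab] show ?thesis by metis
  qed
  then obtain R where R: "\<And>i. i \<in> Basis \<Longrightarrow> R i \<in> borel_measurable borel"
    "\<And>i. i \<in> Basis \<Longrightarrow> R i absolutely_integrable_on {a..b}"
    "\<And>i s t. i \<in> Basis \<Longrightarrow> a \<le> s \<Longrightarrow> s \<le> t \<Longrightarrow> t \<le> b \<Longrightarrow> (R i has_integral F t \<bullet> i - F s \<bullet> i) {s..t}"
    by metis
  define \<rho> where "\<rho> = (\<lambda>x. \<Sum>i\<in>Basis. R i x *\<^sub>R i)"
  have comp: "(\<lambda>x. \<rho> x \<bullet> i) = R i" if "i \<in> Basis" for i
    unfolding \<rho>_def using that by (auto simp: inner_sum_left inner_Basis if_distrib cong: if_cong)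
  have m: "\<rho> \<in> borel_measurable borel"
    unfolding \<rho>_def using R(1) by (intro borel_measurable_sum borel_measurable_scaleR) auto
  have i: "\<rho> absolutely_integrable_on {a..b}"
    using R(2) comp by (subst absolutely_integrable_componentwise_iff) auto
  have h: "(\<rho> has_integral F t - F s) {s..t}" if "a \<le> s" "s \<le> t" "t \<le> b" for s t
    using R(3)[OF _ that] comp by (subst has_integral_componentwise_iff) (auto simp: inner_diff_left)
  show ?thesis
    using that[OF m i h indefinite_integral_has_vector_derivative[OF i h]] by blast
qed

lemma abs_continuous_on_has_integral_derivative:
  fixes F :: "real \<Rightarrow> 'a::euclidean_space"
  assumes F: "abs_continuous_on a b F" and ab: "a \<le> b"
    and deriv: "AE x in lebesgue_on {a..b}. (F has_vector_derivative \<zeta> x) (at x)"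
  shows "\<zeta> absolutely_integrable_on {a..b}"
    and "\<And>s t. a \<le> s \<Longrightarrow> s \<le> t \<Longrightarrow> t \<le> b \<Longrightarrow> (\<zeta> has_integral F t - F s) {s..t}"
proof -
  obtain \<rho> :: "real \<Rightarrow> 'a" where \<rho>: "\<rho> absolutely_integrable_on {a..b}"
    "\<And>s t. a \<le> s \<Longrightarrow> s \<le> t \<Longrightarrow> t \<le> b \<Longrightarrow> (\<rho> has_integral F t - F s) {s..t}"
    "AE x in lebesgue_on {a..b}. (F has_vector_derivative \<rho> x) (at x)"
    using abs_continuous_on_integral[OF F ab] by metis
  have "AE x in lebesgue_on {a..b}. \<zeta> x = \<rho> x"
    using deriv \<rho>(3) by eventually_elim (rule vector_derivative_unique_at)
  then have neg: "negligible {x\<in>{a..b}. \<not> \<zeta> x = \<rho> x}"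
    by (subst (asm) AE_lebesgue_on_iff_negligible) auto
  show "\<zeta> absolutely_integrable_on {a..b}"
    by (rule absolutely_integrable_spike[OF \<rho>(1) neg]) auto
  show "(\<zeta> has_integral F t - F s) {s..t}" if "a \<le> s" "s \<le> t" "t \<le> b" for s t
    by (rule has_integral_spike[OF neg _ \<rho>(2)[OF that]]) (use that in auto)
qed

lemma abs_continuous_on_norm_diff_le:
  fixes F :: "real \<Rightarrow> 'a::euclidean_space" and \<psi> :: "real \<Rightarrow> real"
  assumes F: "abs_continuous_on a b F" and \<psi>: "abs_continuous_on a b \<psi>"
    and F': "AE x in lebesgue_on {a..b}. (F has_vector_derivative F' x) (at x)"
    and \<psi>': "AE x in lebesgue_on {a..b}. (\<psi> has_vector_derivative \<psi>' x) (at x)"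
    and le: "AE x in lebesgue_on {a..b}. norm (F' x) \<le> \<psi>' x"
    and st: "a \<le> s" "s \<le> t" "t \<le> b"
  shows "norm (F t - F s) \<le> \<psi> t - \<psi> s"
proof -
  have ab: "a \<le> b" using st by simp
  note 1 = abs_continuous_on_has_integral_derivative[OF F ab F']
  note 2 = abs_continuous_on_has_integral_derivative[OF \<psi> ab \<psi>']
  have neg: "negligible {x\<in>{a..b}. \<not> norm (F' x) \<le> \<psi>' x}"
    using le by (subst (asm) AE_lebesgue_on_iff_negligible) auto
  \<comment> \<open>\<open>k\<close> equals \<open>\<psi>'\<close> off a null set and dominates the
    norm of \<open>F'\<close> at every point, as the integral bound demands.\<close>
  define k where "k = (\<lambda>x. if norm (F' x) \<le> \<psi>' x then \<psi>' x else norm (F' x))"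
  have "(k has_integral \<psi> t - \<psi> s) {s..t}"
    by (rule has_integral_spike[OF neg _ 2(2)[OF st]]) (use st in \<open>auto simp: k_def\<close>)
  then have k: "k integrable_on {s..t}" "integral {s..t} k = \<psi> t - \<psi> s"
    by (simp_all only: has_integral_integrable integral_unique)
  have "norm (integral {s..t} F') \<le> integral {s..t} k"
    by (rule integral_norm_bound_integral[OF has_integral_integrable[OF 1(2)[OF st]] k(1)]) (simp add: k_def)
  then show ?thesis using integral_unique[OF 1(2)[OF st]] k(2) by simp
qed

lemma sum_integral_interval_family_le:
  fixes h :: "real \<Rightarrow> real"
  assumes D: "interval_family a b D" and h: "h absolutely_integrable_on {a..b}" "\<And>x. h x \<ge> 0"
  shows "(\<Sum>(s, t)\<in>D. integral {s..t} h) \<le> integral {a..b} h"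
proof -
  have fin: "finite D" using D by (simp add: interval_family_def)
  define I where "I = (\<lambda>(s::real, t). {s<..<t})"
  have pw: "pairwise (\<lambda>(s, t) (s', t'). {s<..<t} \<inter> {s'<..<t'} = {}) D"
    using D by (simp add: interval_family_def)
  have disj: "disjoint_family_on I D"
    unfolding disjoint_family_on_def
  proof (intro ballI impI)
    fix x y assume "x \<in> D" "y \<in> D" "x \<noteq> y"
    from pairwiseD[OF pw this] show "I x \<inter> I y = {}" by (simp add: I_def split_def)
  qed
  have IU: "(\<Union>x\<in>D. I x) \<subseteq> {a..b}" using D unfolding I_def interval_family_def by fastforce
  have hI: "h absolutely_integrable_on I x" if "x \<in> D" for x
    by (rule set_integrable_subset[OF h(1)]) (use that IU in \<open>auto simp: I_def split_def\<close>)
  have "(\<Sum>(s, t)\<in>D. integral {s..t} h) = (\<Sum>x\<in>D. LINT y:I x|lebesgue. h y)"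
  proof (rule sum.cong[OF refl])
    fix x assume x: "x \<in> D"
    show "(case x of (s, t) \<Rightarrow> integral {s..t} h) = (LINT y:I x|lebesgue. h y)"
      using set_lebesgue_integral_eq_integral(2)[OF hI[OF x]]
      by (simp add: I_def split_def integral_open_interval_real)
  qed
  also have "\<dots> = (LINT y:(\<Union>x\<in>D. I x)|lebesgue. h y)"
    using disj hI fin by (intro set_integral_finite_Union[symmetric]) (auto simp: I_def split_def)
  also have "\<dots> \<le> (LINT y:{a..b}|lebesgue. h y)"
    unfolding set_lebesgue_integral_def
  proof (rule integral_mono)
    show "integrable lebesgue (\<lambda>x. indicat_real {a..b} x *\<^sub>R h x)" using h(1) by (simp add: set_integrable_def)
    have "h absolutely_integrable_on (\<Union>x\<in>D. I x)"
      by (rule set_integrable_subset[OF h(1) _ IU]) (use fin in \<open>auto simp: I_def split_def\<close>)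
    then show "integrable lebesgue (\<lambda>x. indicat_real (\<Union> (I ` D)) x *\<^sub>R h x)" by (simp add: set_integrable_def)
    show "indicat_real (\<Union> (I ` D)) x *\<^sub>R h x \<le> indicat_real {a..b} x *\<^sub>R h x" for x
      using IU h(2)[of x] by (auto split: split_indicator)
  qed
  also have "\<dots> = integral {a..b} h" by (rule set_lebesgue_integral_eq_integral(2)[OF h(1)])
  finally show ?thesis .
qed

text \<open>The norm of \<open>\<rho>\<close> is split at height \<open>n\<close>. The truncated
  part contributes at most \<open>n\<close> times the total length of the family; the excess
  \<open>h n\<close> has a small integral over all of \<open>[a, b]\<close> by dominated
  convergence. First \<open>n\<close> is fixed, then \<open>\<delta>\<close>.\<close>

lemma abs_continuous_on_indefinite_integral:
  fixes F \<rho> :: "real \<Rightarrow> 'a::euclidean_space"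
  assumes \<rho>: "\<rho> absolutely_integrable_on {a..b}"
    and F: "\<And>s t. a \<le> s \<Longrightarrow> s \<le> t \<Longrightarrow> t \<le> b \<Longrightarrow> (\<rho> has_integral F t - F s) {s..t}"
  shows "abs_continuous_on a b F"
proof (rule abs_continuous_onI)
  fix \<epsilon> :: real assume "\<epsilon> > 0"
  define h where "h = (\<lambda>n x. norm (\<rho> x) - min (norm (\<rho> x)) (real n))"
  have g: "(\<lambda>x. norm (\<rho> x)) absolutely_integrable_on {a..b}"
    using absolutely_integrable_norm[OF \<rho>] by (simp add: o_def)
  have m: "(\<lambda>x. min (norm (\<rho> x)) (real n)) absolutely_integrable_on {a..b}" for n
    using absolutely_integrable_min[OF g, of "\<lambda>_. real n"] by (simp add: absolutely_integrable_on_const)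
  have h: "h n absolutely_integrable_on {a..b}" for n
    unfolding h_def by (rule set_integral_diff(1)[OF g m])
  have "(\<lambda>n. integral {a..b} (h n)) \<longlonglongrightarrow> integral {a..b} (\<lambda>_. 0)"
  proof (rule dominated_convergence(2))
    show "h n integrable_on {a..b}" for n using h by (rule set_lebesgue_integral_eq_integral(1))
    show "(\<lambda>x. norm (\<rho> x)) integrable_on {a..b}" using g by (rule set_lebesgue_integral_eq_integral(1))
    show "norm (h n x) \<le> norm (\<rho> x)" for n x by (auto simp: h_def)
    show "(\<lambda>n. h n x) \<longlonglongrightarrow> 0" for x
    proof (rule tendsto_eventually)
      obtain N where "norm (\<rho> x) \<le> real N" using real_arch_simple by blast
      then show "\<forall>\<^sub>F n in sequentially. h n x = 0"
        unfolding eventually_sequentially h_def by (intro exI[of _ N]) auto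
    qed
  qed
  then have "(\<lambda>n. integral {a..b} (h n)) \<longlonglongrightarrow> 0" by simp
  then have "\<forall>\<^sub>F n in sequentially. integral {a..b} (h n) < \<epsilon> / 2"
    using \<open>\<epsilon> > 0\<close> by (intro order_tendstoD(2)) auto
  then obtain n where n: "integral {a..b} (h n) < \<epsilon> / 2"
    by (auto simp: eventually_sequentially)
  define \<delta> where "\<delta> = \<epsilon> / (2 * (real n + 1))"
  have "\<delta> > 0" using \<open>\<epsilon> > 0\<close> by (simp add: \<delta>_def)
  have "(\<Sum>(s, t)\<in>D. dist (F s) (F t)) < \<epsilon>"
    if D: "interval_family a b D" and small: "(\<Sum>(s, t)\<in>D. t - s) < \<delta>" for D
  proof -
    have "(\<Sum>(s, t)\<in>D. dist (F s) (F t)) \<le> (\<Sum>(s, t)\<in>D. integral {s..t} (h n) + real n * (t - s))"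
    proof (rule sum_mono, clarify)
      fix s t assume "(s, t) \<in> D"
      then have st: "a \<le> s" "s \<le> t" "t \<le> b" using D by (auto simp: interval_family_def)
      have sub: "{s..t} \<subseteq> {a..b}" using st by auto
      have hi: "h n integrable_on {s..t}"
        by (rule set_lebesgue_integral_eq_integral(1)[OF set_integrable_subset[OF h _ sub]]) simp
      have ci: "(\<lambda>_. real n) integrable_on {s..t}" by (rule integrable_const_ivl)
      have "norm (integral {s..t} \<rho>) \<le> integral {s..t} (\<lambda>x. h n x + real n)"
        by (rule integral_norm_bound_integral[OF has_integral_integrable[OF F[OF st]] integrable_add[OF hi ci]])
           (auto simp: h_def)
      also have "\<dots> = integral {s..t} (h n) + real n * (t - s)"
        using st by (simp add: Henstock_Kurzweil_Integration.integral_add[OF hi ci])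
      finally show "dist (F s) (F t) \<le> integral {s..t} (h n) + real n * (t - s)"
        using integral_unique[OF F[OF st]] by (simp add: dist_norm norm_minus_commute)
    qed
    also have "\<dots> = (\<Sum>(s, t)\<in>D. integral {s..t} (h n)) + real n * (\<Sum>(s, t)\<in>D. t - s)"
      by (simp add: sum.distrib sum_distrib_left split_def)
    also have "\<dots> \<le> integral {a..b} (h n) + real n * \<delta>"
      using sum_integral_interval_family_le[OF D h] small
      by (intro add_mono mult_left_mono) (auto simp: h_def)
    also have "real n * \<delta> \<le> \<epsilon> / 2" using \<open>\<epsilon> > 0\<close> by (simp add: \<delta>_def field_simps)
    finally show ?thesis using n by simp
  qed
  with \<open>\<delta> > 0\<close> show "\<exists>\<delta>>0. \<forall>D. interval_family a b D \<longrightarrow> (\<Sum>(s, t)\<in>D. t - s) < \<delta> \<longrightarrow>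
     (\<Sum>(s, t)\<in>D. dist (F s) (F t)) < \<epsilon>" by blast
qed

section \<open>Change of variables along a nondecreasing absolutely continuous function\<close>

lemma nn_integral_lebesgue_on:
  assumes "S \<in> sets lebesgue"
  shows "(\<integral>\<^sup>+x. f x \<partial>lebesgue_on S) = (\<integral>\<^sup>+x. f x * indicator S x \<partial>lborel)"
  using assms by (simp add: nn_integral_restrict_space nn_integral_completion)

text \<open>The claim is that \<open>\<psi>\<close> maps the measure with density
  \<open>\<psi>'\<close> to Lebesgue measure on its range. Both measures are compared on half lines
  \<open>{x<..}\<close>, whose preimages are intervals. \<open>h\<close> is Borel because
  \<open>\<psi>\<close> may squeeze a set of positive measure into a null set, so preimages of
  Lebesgue sets can fail to be measurable.\<close>

theorem nn_integral_substitution_abs_continuous: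
  fixes \<psi> \<psi>' :: "real \<Rightarrow> real" and h :: "real \<Rightarrow> ennreal"
  assumes ac: "abs_continuous_on a b \<psi>" and mono: "mono_on {a..b} \<psi>" and ab: "a \<le> b"
    and \<psi>': "AE x in lebesgue_on {a..b}. (\<psi> has_vector_derivative \<psi>' x) (at x)"
    and h: "h \<in> borel_measurable borel"
  shows "(\<integral>\<^sup>+x. h (\<psi> x) * ennreal (\<psi>' x) \<partial>lebesgue_on {a..b}) = (\<integral>\<^sup>+y. h y \<partial>lebesgue_on {\<psi> a..\<psi> b})"
proof -
  obtain \<rho> :: "real \<Rightarrow> real" where \<rho>: "\<rho> \<in> borel_measurable borel" "\<And>x. \<rho> x \<ge> 0" "\<rho> absolutely_integrable_on {a..b}"
    "\<And>s t. a \<le> s \<Longrightarrow> s \<le> t \<Longrightarrow> t \<le> b \<Longrightarrow> (\<rho> has_integral \<psi> t - \<psi> s) {s..t}"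
    using mono_abs_continuous_integral[OF ac mono ab] by metis
  note [measurable] = \<rho>(1) h
  have ae: "AE x in lebesgue_on {a..b}. \<psi>' x = \<rho> x"
    using \<psi>' indefinite_integral_has_vector_derivative[OF \<rho>(3) \<rho>(4), simplified]
    by eventually_elim (rule vector_derivative_unique_at)
  have cont: "continuous_on {a..b} \<psi>" by (rule abs_continuous_on_imp_continuous_on[OF ac])
  have \<psi>ab: "\<psi> a \<le> \<psi> b" using mono_onD[OF mono, of a b] ab by simp
  define G where "G = (\<lambda>x. \<psi> (max a (min b x)))"
  have "continuous_on UNIV G"
    unfolding G_def
    by (rule continuous_on_compose2[OF cont]) (use ab in \<open>auto intro!: continuous_intros\<close>)
  then have [measurable]: "G \<in> borel_measurable borel" by (rule borel_measurable_continuous_onI)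
  define M where "M = density lborel (\<lambda>x. ennreal (\<rho> x) * indicator {a..b} x)"
  have [measurable_cong]: "sets M = sets borel" by (simp add: M_def)
  define N where "N = distr M borel G"
  define K where "K = density lborel (indicator {\<psi> a..\<psi> b} :: real \<Rightarrow> ennreal)"
  have N: "emeasure N {x<..} = (\<integral>\<^sup>+t. ennreal (\<rho> t) * indicator {t\<in>{a..b}. x < \<psi> t} t \<partial>lborel)" for x
  proof -
    have "emeasure N {x<..} = emeasure M (G -` {x<..})"
      unfolding N_def by (subst emeasure_distr) (auto simp: M_def)
    also have "\<dots> = (\<integral>\<^sup>+t. ennreal (\<rho> t) * indicator {a..b} t * indicator (G -` {x<..}) t \<partial>lborel)"
      unfolding M_def
    proof (rule emeasure_density)
      have "G -` {x<..} \<inter> space borel \<in> sets borel" by (rule measurable_sets[of G borel borel]) auto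
      then show "G -` {x<..} \<in> sets lborel" by simp
    qed measurable
    also have "\<dots> = (\<integral>\<^sup>+t. ennreal (\<rho> t) * indicator {t\<in>{a..b}. x < \<psi> t} t \<partial>lborel)"
      by (intro nn_integral_cong) (auto simp: G_def split: split_indicator)
    finally show ?thesis .
  qed
  have \<rho>int: "(\<integral>\<^sup>+t. ennreal (\<rho> t) * indicator {c..b} t \<partial>lborel) = ennreal (\<psi> b - \<psi> c)" if "a \<le> c" "c \<le> b" for c
    using nn_integral_has_integral_lebesgue'[OF _ \<rho>(4)[of c b]] \<rho>(2) that by simp
  have eq: "emeasure N {x<..} = emeasure K {x<..}" for x
  proof -
    have K: "emeasure K {x<..} = emeasure lborel ({\<psi> a..\<psi> b} \<inter> {x<..})"
      unfolding K_def by (subst emeasure_density) (auto simp: indicator_inter_arith[symmetric])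
    consider "x < \<psi> a" | "\<psi> a \<le> x" "x \<le> \<psi> b" | "x > \<psi> b" by linarith
    then show ?thesis
    proof cases
      case 1
      have "{t\<in>{a..b}. x < \<psi> t} = {a..b}" using 1 mono_onD[OF mono, of a] ab by force
      moreover have "{\<psi> a..\<psi> b} \<inter> {x<..} = {\<psi> a..\<psi> b}" using 1 by auto
      ultimately show ?thesis unfolding N K using \<rho>int[of a] ab \<psi>ab by simp
    next
      case 2
      \<comment> \<open>\<open>\<psi>\<close> may be flat at height \<open>x\<close>. The last point
        \<open>c\<close> of \<open>S\<close> satisfies \<open>\<psi> c = x\<close>, and
        \<open>\<psi>\<close> exceeds \<open>x\<close> exactly to the right of
        \<open>c\<close>.\<close>
      define S where "S = {t\<in>{a..b}. \<psi> t \<le> x}"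
      have "compact S"
        unfolding S_def using continuous_on_closed_Collect_le[OF cont continuous_on_const, of x]
        by (auto simp: compact_eq_bounded_closed intro: bounded_subset[of "{a..b}"])
      moreover have "a \<in> S" using 2 ab by (simp add: S_def)
      ultimately obtain c where c: "c \<in> S" "\<And>t. t \<in> S \<Longrightarrow> t \<le> c"
        using compact_attains_sup[of S] by auto
      obtain c' where c': "a \<le> c'" "c' \<le> b" "\<psi> c' = x" using IVT'[of \<psi> a x b] 2 ab cont by auto
      have "c' \<le> c" using c' by (intro c(2)) (simp add: S_def)
      then have "\<psi> c = x" using mono_onD[OF mono, of c' c] c(1) c' by (auto simp: S_def)
      have cab: "a \<le> c" "c \<le> b" using c(1) by (auto simp: S_def)
      have set: "{t\<in>{a..b}. x < \<psi> t} = {c<..b}"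
      proof (intro set_eqI iffI)
        fix t assume "t \<in> {t\<in>{a..b}. x < \<psi> t}"
        then show "t \<in> {c<..b}" using mono_onD[OF mono, of t c] cab \<open>\<psi> c = x\<close> by force
      next
        fix t assume "t \<in> {c<..b}"
        then show "t \<in> {t\<in>{a..b}. x < \<psi> t}" using c(2)[of t] cab by (force simp: S_def)
      qed
      have "emeasure N {x<..} = (\<integral>\<^sup>+t. ennreal (\<rho> t) * indicator {c..b} t \<partial>lborel)"
        unfolding N set
        by (intro nn_integral_cong_AE AE_I'[of "{c}"]) (auto split: split_indicator)
      also have "\<dots> = ennreal (\<psi> b - x)" using \<rho>int[OF cab] \<open>\<psi> c = x\<close> by simp
      also have "\<dots> = emeasure lborel {x<..\<psi> b}" using 2 by simp
      also have "{x<..\<psi> b} = {\<psi> a..\<psi> b} \<inter> {x<..}" using 2 by auto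
      finally show ?thesis unfolding K .
    next
      case 3
      have "{t\<in>{a..b}. x < \<psi> t} = {}" using 3 mono_onD[OF mono, of _ b] by force
      moreover have "{\<psi> a..\<psi> b} \<inter> {x<..} = {}" using 3 by auto
      ultimately show ?thesis unfolding N K by simp
    qed
  qed
  have "N = K"
  proof (rule measure_eqI_lessThan)
    show "emeasure N {x<..} < \<infinity>" for x
    proof -
      have "emeasure N {x<..} \<le> (\<integral>\<^sup>+t. ennreal (\<rho> t) * indicator {a..b} t \<partial>lborel)"
        unfolding N by (intro nn_integral_mono) (auto split: split_indicator)
      also have "\<dots> < \<infinity>" using \<rho>int[of a] ab by simp
      finally show ?thesis .
    qed
    show "emeasure N {x<..} = emeasure K {x<..}" for x by (rule eq)
  qed (auto simp: N_def K_def)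
  have "(\<integral>\<^sup>+x. h (\<psi> x) * ennreal (\<psi>' x) \<partial>lebesgue_on {a..b}) = (\<integral>\<^sup>+x. h (\<psi> x) * ennreal (\<rho> x) \<partial>lebesgue_on {a..b})"
    using ae by (intro nn_integral_cong_AE) auto
  also have "\<dots> = (\<integral>\<^sup>+x. (ennreal (\<rho> x) * indicator {a..b} x) * h (G x) \<partial>lborel)"
    by (subst nn_integral_lebesgue_on) (auto intro!: nn_integral_cong simp: G_def mult_ac split: split_indicator)
  also have "\<dots> = (\<integral>\<^sup>+y. h y \<partial>N)"
    unfolding N_def M_def by (subst nn_integral_distr, simp, simp, subst nn_integral_density) auto
  also have "\<dots> = (\<integral>\<^sup>+y. indicator {\<psi> a..\<psi> b} y * h y \<partial>lborel)"
    unfolding \<open>N = K\<close> K_def by (subst nn_integral_density) auto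
  also have "\<dots> = (\<integral>\<^sup>+y. h y \<partial>lebesgue_on {\<psi> a..\<psi> b})"
    by (subst nn_integral_lebesgue_on) (auto simp: mult.commute)
  finally show ?thesis .
qed

section \<open>Systems driven by paths\<close>

text \<open>A control \<open>\<zeta>\<close> is kept together with a primitive \<open>p\<close>.
  Naming \<open>\<zeta>\<close> instead of writing \<open>vector_derivative p\<close> allows it to
  be changed on null sets, and treats given controls and derivatives of curves alike.\<close>

definition has_velocity :: "real \<Rightarrow> (real \<Rightarrow> 'a::real_normed_vector) \<Rightarrow> (real \<Rightarrow> 'a) \<Rightarrow> bool" where
  "has_velocity S p \<zeta> \<longleftrightarrow> abs_continuous_on 0 S p \<and>
     (AE t in lebesgue_on {0..S}. (p has_vector_derivative \<zeta> t) (at t))"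

lemma solves_ode_on_iff: "solves_ode_on S F z0 z \<longleftrightarrow> has_velocity S z (\<lambda>t. F t (z t)) \<and> z 0 = z0"
  by (auto simp: solves_ode_on_def has_velocity_def)

lemma has_velocity_continuous_on: "has_velocity S p \<zeta> \<Longrightarrow> continuous_on {0..S} p"
  by (simp add: has_velocity_def abs_continuous_on_imp_continuous_on)

lemma has_velocity_subinterval:
  assumes "has_velocity S p \<zeta>" "T \<le> S"
  shows "has_velocity T p \<zeta>"
  using assms unfolding has_velocity_def
  by (auto intro: abs_continuous_on_subinterval elim!: AE_lebesgue_on_subset)

lemma has_velocity_bounded_linear:
  assumes "has_velocity S p \<zeta>" "bounded_linear A"
  shows "has_velocity S (\<lambda>t. A (p t)) (\<lambda>t. A (\<zeta> t))"
  unfolding has_velocity_def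
proof
  interpret A: bounded_linear A by fact
  obtain c where c: "c \<ge> 0" "\<And>x. norm (A x) \<le> norm x * c" using A.nonneg_bounded by blast
  have "dist (A (p s)) (A (p t)) \<le> c * dist (p s) (p t)" for s t
    using c(2)[of "p s - p t"] by (simp add: dist_norm A.diff mult.commute)
  then show "abs_continuous_on 0 S (\<lambda>t. A (p t))"
    using assms(1) c(1) unfolding has_velocity_def
    by (blast intro: abs_continuous_on_dominated)
  show "AE t in lebesgue_on {0..S}. ((\<lambda>t. A (p t)) has_vector_derivative A (\<zeta> t)) (at t)"
    using assms(1) unfolding has_velocity_def
    by (auto elim!: eventually_mono intro: A.has_vector_derivative)
qed

lemma has_velocity_Pair:
  assumes "has_velocity S p \<zeta>" "has_velocity S q \<xi>"
  shows "has_velocity S (\<lambda>t. (p t, q t)) (\<lambda>t. (\<zeta> t, \<xi> t))"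
proof -
  have "AE t in lebesgue_on {0..S}. (p has_vector_derivative \<zeta> t) (at t)"
    "AE t in lebesgue_on {0..S}. (q has_vector_derivative \<xi> t) (at t)"
    using assms by (auto simp: has_velocity_def)
  then have "AE t in lebesgue_on {0..S}. ((\<lambda>t. (p t, q t)) has_vector_derivative (\<zeta> t, \<xi> t)) (at t)"
    by eventually_elim (rule has_vector_derivative_Pair)
  then show ?thesis
    using assms by (auto simp: has_velocity_def intro: abs_continuous_on_Pair)
qed

lemma has_velocity_integral:
  fixes p :: "real \<Rightarrow> 'a::euclidean_space"
  assumes "has_velocity S p \<zeta>" "0 \<le> S"
  shows "\<zeta> absolutely_integrable_on {0..S}"
    and "\<And>s t. 0 \<le> s \<Longrightarrow> s \<le> t \<Longrightarrow> t \<le> S \<Longrightarrow> (\<zeta> has_integral p t - p s) {s..t}"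
  using assms abs_continuous_on_has_integral_derivative[of 0 S p \<zeta>] by (auto simp: has_velocity_def)

lemma has_velocity_indefinite_integral:
  fixes \<zeta> :: "real \<Rightarrow> 'a::euclidean_space"
  assumes \<zeta>: "\<zeta> absolutely_integrable_on {0..S}"
  shows "has_velocity S (\<lambda>t. integral {0..t} \<zeta>) \<zeta>"
proof -
  have int: "\<zeta> integrable_on {s..t}" if "0 \<le> s" "t \<le> S" for s t
    by (rule set_lebesgue_integral_eq_integral(1)[OF set_integrable_subset[OF \<zeta>]]) (use that in auto)
  have h: "(\<zeta> has_integral integral {0..t} \<zeta> - integral {0..s} \<zeta>) {s..t}" if st: "0 \<le> s" "s \<le> t" "t \<le> S" for s t
  proof -
    have "integral {0..s} \<zeta> + integral {s..t} \<zeta> = integral {0..t} \<zeta>"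
      by (rule Henstock_Kurzweil_Integration.integral_combine[OF st(1,2) int]) (use st in auto)
    then have "integral {0..t} \<zeta> - integral {0..s} \<zeta> = integral {s..t} \<zeta>" by (simp add: algebra_simps)
    then show ?thesis using integrable_integral[OF int[OF st(1,3)]] by simp
  qed
  show ?thesis
    unfolding has_velocity_def
    using abs_continuous_on_indefinite_integral[OF \<zeta> h] indefinite_integral_has_vector_derivative[OF \<zeta> h]
    by simp
qed

lemma has_velocity_exists:
  fixes p :: "real \<Rightarrow> 'a::euclidean_space"
  assumes "abs_continuous_on 0 S p" "0 \<le> S"
  obtains \<rho> where "has_velocity S p \<rho>" "\<rho> \<in> borel_measurable borel"
  using abs_continuous_on_integral[OF assms] assms(1) unfolding has_velocity_def by metis

lemma has_velocity_unique:
  fixes p :: "real \<Rightarrow> 'a::euclidean_space"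
  assumes "has_velocity S p \<zeta>" "has_velocity S p \<xi>"
  shows "AE t in lebesgue_on {0..S}. \<zeta> t = \<xi> t"
proof -
  have "AE t in lebesgue_on {0..S}. (p has_vector_derivative \<zeta> t) (at t)"
    "AE t in lebesgue_on {0..S}. (p has_vector_derivative \<xi> t) (at t)"
    using assms by (auto simp: has_velocity_def)
  then show ?thesis by eventually_elim (rule vector_derivative_unique_at)
qed

lemma has_velocity_cong_AE:
  assumes "has_velocity S p \<zeta>" "AE t in lebesgue_on {0..S}. \<zeta> t = \<xi> t"
  shows "has_velocity S p \<xi>"
proof -
  have "AE t in lebesgue_on {0..S}. (p has_vector_derivative \<zeta> t) (at t)"
    using assms by (auto simp: has_velocity_def)
  then have "AE t in lebesgue_on {0..S}. (p has_vector_derivative \<xi> t) (at t)"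
    using assms(2) by eventually_elim simp
  then show ?thesis using assms(1) by (simp add: has_velocity_def)
qed

lemma has_velocity_norm_diff_le:
  fixes p :: "real \<Rightarrow> 'a::euclidean_space" and \<psi> :: "real \<Rightarrow> real"
  assumes "has_velocity S p \<zeta>" "has_velocity S \<psi> \<psi>'"
    "AE t in lebesgue_on {0..S}. norm (\<zeta> t) \<le> \<psi>' t" "0 \<le> s" "s \<le> t" "t \<le> S"
  shows "norm (p t - p s) \<le> \<psi> t - \<psi> s"
  using assms unfolding has_velocity_def
  by (intro abs_continuous_on_norm_diff_le[of 0 S p \<psi> \<zeta> \<psi>']) auto

lemma has_velocity_arclength:
  fixes \<zeta> :: "real \<Rightarrow> 'a::euclidean_space"
  assumes "\<zeta> absolutely_integrable_on {0..S}"
  shows "has_velocity S (\<lambda>t. integral {0..t} (\<lambda>r. norm (\<zeta> r))) (\<lambda>t. norm (\<zeta> t))"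
  using absolutely_integrable_norm[OF assms] by (intro has_velocity_indefinite_integral) (simp add: o_def)

section \<open>Difference quotients, a discrete Gronwall estimate and factorization through a
  clock\<close>

lemma has_vector_derivative_quotient_limit:
  assumes "(F has_vector_derivative v) (at x)"
  shows "((\<lambda>h. (F (x + h) - F x) /\<^sub>R h) \<longlongrightarrow> v) (at (0::real))"
  unfolding Lim_at dist_norm
proof (intro allI impI)
  fix e :: real assume "e > 0"
  then obtain d where d: "d > 0" "\<And>y. \<bar>y - x\<bar> < d \<Longrightarrow> norm (F y - F x - (y - x) *\<^sub>R v) \<le> e / 2 * \<bar>y - x\<bar>"
    using assms unfolding has_vector_derivative_at_alt by (metis half_gt_zero)
  have "norm ((F (x + h) - F x) /\<^sub>R h - v) < e" if "h \<noteq> 0" "\<bar>h\<bar> < d" for h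
  proof -
    have "\<bar>h\<bar> * norm ((F (x + h) - F x) /\<^sub>R h - v) = norm (F (x + h) - F x - h *\<^sub>R v)"
      unfolding norm_scaleR[symmetric] using that(1) by (simp add: scaleR_diff_right)
    also have "\<dots> \<le> e / 2 * \<bar>h\<bar>" using d(2)[of "x + h"] that by simp
    also have "\<dots> = \<bar>h\<bar> * (e / 2)" by simp
    finally have "norm ((F (x + h) - F x) /\<^sub>R h - v) \<le> e / 2"
      using that(1) mult_le_cancel_left_pos[of "\<bar>h\<bar>"] by simp
    then show ?thesis using \<open>e > 0\<close> by simp
  qed
  with d(1) show "\<exists>d>0. \<forall>h. 0 < norm (h - 0) \<and> norm (h - 0) < d \<longrightarrow> norm ((F (x + h) - F x) /\<^sub>R h - v) < e"
    by auto
qed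

text \<open>The range \<open>[0, \<psi> t]\<close> is cut into \<open>N\<close> equal pieces of
  length \<open>d\<close>; the intermediate value theorem supplies a time for each level
  \<open>j * d\<close>. Each step adds an error \<open>C * d\<^sup>2\<close>, amplified by at most
  \<open>exp (K * \<psi> t)\<close> in total. Because the error is quadratic, \<open>N\<close> of
  them sum to a multiple of \<open>1 / N\<close>.\<close>

lemma discrete_gronwall:
  fixes h \<psi> :: "real \<Rightarrow> real"
  assumes cont: "continuous_on {0..S} \<psi>" and "\<psi> 0 = 0" and K: "K \<ge> 0" and C: "C \<ge> 0" and h0: "h 0 \<le> 0"
    and step: "\<And>s t. 0 \<le> s \<Longrightarrow> s \<le> t \<Longrightarrow> t \<le> S \<Longrightarrow>
      h t \<le> h s * (1 + K * (\<psi> t - \<psi> s)) + C * (\<psi> t - \<psi> s)\<^sup>2"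
    and t: "0 \<le> t" "t \<le> S" and pos: "\<psi> t \<ge> 0"
  shows "h t \<le> 0"
proof -
  define T where "T = \<psi> t"
  have bound: "h t \<le> C * T\<^sup>2 * exp (K * T) / real N" if N: "N > 0" for N
  proof -
    define d where "d = T / N"
    have d: "d \<ge> 0" using pos by (simp add: d_def T_def)
    have *: "h \<tau> \<le> j * (C * d\<^sup>2) * (1 + K * d) ^ j" if "0 \<le> \<tau>" "\<tau> \<le> S" "\<psi> \<tau> = j * d" for j \<tau>
      using that
    proof (induction j arbitrary: \<tau>)
      case 0
      then show ?case using step[of 0 \<tau>] h0 \<open>\<psi> 0 = 0\<close> by simp
    next
      case (Suc j)
      have "j * d \<le> \<psi> \<tau>" using Suc.prems d by (simp add: algebra_simps)
      then obtain s where s: "0 \<le> s" "s \<le> \<tau>" "\<psi> s = j * d"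
        using IVT'[of \<psi> 0 "j * d" \<tau>] Suc.prems d \<open>\<psi> 0 = 0\<close> continuous_on_subset[OF cont, of "{0..\<tau>}"]
        by (auto simp: mult_nonneg_nonneg)
      have diff: "\<psi> \<tau> - \<psi> s = d" using Suc.prems s by (simp add: algebra_simps)
      have "1 \<le> (1 + K * d) ^ Suc j" using K d by (intro one_le_power) simp
      then have "C * d\<^sup>2 \<le> (C * d\<^sup>2) * (1 + K * d) ^ Suc j"
        using mult_left_mono[of 1 "(1 + K * d) ^ Suc j" "C * d\<^sup>2"] C by simp
      moreover have "h s * (1 + K * d) \<le> (j * (C * d\<^sup>2) * (1 + K * d) ^ j) * (1 + K * d)"
        using Suc.IH[OF s(1) _ s(3)] s Suc.prems K d by (intro mult_right_mono) auto
      ultimately have "h \<tau> \<le> (j * (C * d\<^sup>2) * (1 + K * d) ^ j) * (1 + K * d) + (C * d\<^sup>2) * (1 + K * d) ^ Suc j"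
        using step[OF s(1,2)] Suc.prems unfolding diff by simp
      also have "\<dots> = Suc j * (C * d\<^sup>2) * (1 + K * d) ^ Suc j" by (simp add: algebra_simps)
      finally show ?case .
    qed
    have "h t \<le> N * (C * d\<^sup>2) * (1 + K * d) ^ N"
      using *[of t N] t N by (simp add: d_def T_def)
    also have "\<dots> \<le> N * (C * d\<^sup>2) * exp (K * d) ^ N"
      using K d C by (intro mult_left_mono power_mono exp_ge_add_one_self) auto
    also have "exp (K * d) ^ N = exp (K * T)"
      using N by (simp add: exp_of_nat_mult[symmetric] d_def)
    also have "N * (C * d\<^sup>2) * exp (K * T) = C * T\<^sup>2 * exp (K * T) / N"
      using N by (simp add: d_def power2_eq_square)
    finally show ?thesis .
  qed
  have "(\<lambda>N. C * T\<^sup>2 * exp (K * T) / real N) \<longlonglongrightarrow> 0"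
    by (rule tendsto_divide_0[OF tendsto_const filterlim_at_top_imp_at_infinity[OF filterlim_real_sequentially]])
  then show ?thesis
    by (rule tendsto_lowerbound) (use bound in \<open>auto simp: eventually_sequentially intro!: exI[of _ 1]\<close>)
qed

text \<open>\<open>\<psi>\<close> may pause, but the bound makes \<open>F\<close> pause with it.
  Hence \<open>F\<close> factors through \<open>\<psi>\<close>, whichever preimage
  \<open>\<tau>\<close> selects.\<close>

lemma reparametrization_exists:
  fixes \<psi> :: "real \<Rightarrow> real" and F :: "real \<Rightarrow> 'a::metric_space"
  assumes S: "0 \<le> S" and cont: "continuous_on {0..S} \<psi>" and \<psi>0: "\<psi> 0 = 0" and c: "c \<ge> 0"
    and dist_le: "\<And>s t. 0 \<le> s \<Longrightarrow> s \<le> t \<Longrightarrow> t \<le> S \<Longrightarrow> dist (F s) (F t) \<le> c * (\<psi> t - \<psi> s)"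
    and mono: "mono_on {0..S} \<psi>"
  obtains G where "\<And>t. t \<in> {0..S} \<Longrightarrow> G (\<psi> t) = F t" "c-lipschitz_on {0..\<psi> S} G"
proof -
  have dist_le': "dist (F s) (F t) \<le> c * dist (\<psi> s) (\<psi> t)" if st: "s \<in> {0..S}" "t \<in> {0..S}" for s t
  proof (cases "s \<le> t")
    case True
    then have "\<psi> s \<le> \<psi> t" using mono st by (auto simp: mono_on_def)
    then show ?thesis using dist_le[of s t] st True by (simp add: dist_real_def)
  next
    case False
    then have "\<psi> t \<le> \<psi> s" using mono st by (auto simp: mono_on_def)
    then show ?thesis using dist_le[of t s] st False by (simp add: dist_real_def dist_commute)
  qed
  define \<tau> where "\<tau> = (\<lambda>r. SOME t. t \<in> {0..S} \<and> \<psi> t = r)"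
  have \<tau>: "\<tau> r \<in> {0..S} \<and> \<psi> (\<tau> r) = r" if "\<exists>t. t \<in> {0..S} \<and> \<psi> t = r" for r
    unfolding \<tau>_def by (rule someI_ex[OF that])
  show ?thesis
  proof
    show "(F \<circ> \<tau>) (\<psi> t) = F t" if t: "t \<in> {0..S}" for t
    proof -
      have "\<tau> (\<psi> t) \<in> {0..S} \<and> \<psi> (\<tau> (\<psi> t)) = \<psi> t" using \<tau>[of "\<psi> t"] t by blast
      with dist_le'[of "\<tau> (\<psi> t)" t] t show ?thesis by simp
    qed
    show "c-lipschitz_on {0..\<psi> S} (F \<circ> \<tau>)"
    proof (rule lipschitz_onI[OF _ c])
      fix x y assume xy: "x \<in> {0..\<psi> S}" "y \<in> {0..\<psi> S}"
      have "\<exists>t. t \<in> {0..S} \<and> \<psi> t = r" if "r \<in> {0..\<psi> S}" for r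
        using IVT'[of \<psi> 0 r S] that S cont \<psi>0 by auto
      with xy \<tau> dist_le'[of "\<tau> x" "\<tau> y"] show "dist ((F \<circ> \<tau>) x) ((F \<circ> \<tau>) y) \<le> c * dist x y" by auto
    qed
  qed
qed

text \<open>Linearity in \<open>z\<close> is essential: it identifies the increment
  \<open>\<Phi> y (p t - p s)\<close> with the integral of \<open>\<Phi> y\<close> along the
  velocity of \<open>p\<close> when \<open>y\<close> is frozen. The Lipschitz bound is proportional
  to the norm of \<open>z\<close> since velocities carry no bound in general.\<close>

locale control_system =
  fixes \<Phi> :: "'y::euclidean_space \<Rightarrow> 'z::euclidean_space \<Rightarrow> 'y"
  assumes linear: "linear (\<Phi> y)"
    and locally_lipschitz: "\<exists>K\<ge>0. \<forall>y\<in>cball 0 R. \<forall>y'\<in>cball 0 R. \<forall>z.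
      norm (\<Phi> y z) \<le> K * norm z \<and> norm (\<Phi> y z - \<Phi> y' z) \<le> K * norm (y - y') * norm z"
begin

lemma bounded_linear: "bounded_linear (\<Phi> y)"
  using linear by (simp add: linear_conv_bounded_linear)

text \<open>
  The second clause says that Euler steps are accurate to second order. It expresses that \<open>y\<close>
  is the solution driven by \<open>p\<close> without derivatives, hence survives reparametrizations and
  pointwise limits.
\<close>

definition driven :: "real \<Rightarrow> real \<Rightarrow> (real \<Rightarrow> real) \<Rightarrow> (real \<Rightarrow> 'z) \<Rightarrow> (real \<Rightarrow> 'y) \<Rightarrow> bool" where
  "driven C S \<psi> p y \<longleftrightarrow> C \<ge> 0 \<and> (\<forall>s t. 0 \<le> s \<longrightarrow> s \<le> t \<longrightarrow> t \<le> S \<longrightarrow>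
     norm (y t - y s) \<le> C * (\<psi> t - \<psi> s) \<and>
     norm (y t - y s - \<Phi> (y s) (p t - p s)) \<le> C * (\<psi> t - \<psi> s)\<^sup>2)"

text \<open>The derivative of \<open>y r - \<Phi> (y s) (p r)\<close> is bounded by \<open>K\<close>
  times the norms of \<open>y r - y s\<close> and \<open>\<zeta> r\<close>, hence by
  \<open>K * K * (\<psi> t - \<psi> s) * \<psi>' r\<close>; integrating over \<open>[s, t]\<close>
  gives the quadratic term. The constant depends only on the radius \<open>R\<close>, so it is
  common to all trajectories with the same bound.\<close>

lemma driven_of_velocity:
  assumes p: "has_velocity S p \<zeta>" and \<psi>: "has_velocity S \<psi> \<psi>'"
    and le: "AE t in lebesgue_on {0..S}. norm (\<zeta> t) \<le> \<psi>' t"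
    and y: "has_velocity S y (\<lambda>t. \<Phi> (y t) (\<zeta> t))"
    and R: "\<And>t. t \<in> {0..S} \<Longrightarrow> norm (y t) \<le> R"
    and K: "K \<ge> 0" "\<And>y y' z. y \<in> cball 0 R \<Longrightarrow> y' \<in> cball 0 R \<Longrightarrow>
      norm (\<Phi> y z) \<le> K * norm z \<and> norm (\<Phi> y z - \<Phi> y' z) \<le> K * norm (y - y') * norm z"
  shows "driven (K + K * K) S \<psi> p y"
proof -
  have Ky: "norm (\<Phi> (y t) z) \<le> K * norm z" if "t \<in> {0..S}" for t z
    using K(2)[of "y t" "y t" z] R[OF that] by auto
  have Kyy: "norm (\<Phi> (y t) z - \<Phi> (y s) z) \<le> K * norm (y t - y s) * norm z"
    if "t \<in> {0..S}" "s \<in> {0..S}" for t s z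
    using K(2)[of "y t" "y s" z] R[OF that(1)] R[OF that(2)] by auto
  have space: "AE t in lebesgue_on {0..S}. t \<in> {0..S}" using AE_space[of "lebesgue_on {0..S}"] by simp
  have scaled: "has_velocity S (\<lambda>t. c * \<psi> t) (\<lambda>t. c * \<psi>' t)" for c
    by (rule has_velocity_bounded_linear[OF \<psi> bounded_linear_mult_right])
  have first: "norm (y t - y s) \<le> K * (\<psi> t - \<psi> s)" if "0 \<le> s" "s \<le> t" "t \<le> S" for s t
  proof -
    have "AE t in lebesgue_on {0..S}. norm (\<Phi> (y t) (\<zeta> t)) \<le> K * \<psi>' t"
      using le space
    proof eventually_elim
      case (elim t)
      have "norm (\<Phi> (y t) (\<zeta> t)) \<le> K * norm (\<zeta> t)" by (rule Ky[OF elim(2)])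
      also have "\<dots> \<le> K * \<psi>' t" using elim(1) K(1) by (rule mult_left_mono)
      finally show ?case .
    qed
    from has_velocity_norm_diff_le[OF y scaled this that] show ?thesis by (simp add: algebra_simps)
  qed
  have \<psi>mono: "\<psi> s \<le> \<psi> t" if "0 \<le> s" "s \<le> t" "t \<le> S" for s t
    using has_velocity_norm_diff_le[OF p \<psi> le that] norm_ge_zero[of "p t - p s"] by linarith
  have second: "norm (y t - y s - \<Phi> (y s) (p t - p s)) \<le> K * K * (\<psi> t - \<psi> s)\<^sup>2"
    if st: "0 \<le> s" "s \<le> t" "t \<le> S" for s t
  proof -
    interpret A: bounded_linear "\<Phi> (y s)" by (rule bounded_linear)
    define c where "c = K * (K * (\<psi> t - \<psi> s))"
    have sub: "AE r in lebesgue_on {s..t}. P r" if "AE r in lebesgue_on {0..S}. P r" for P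
      using that st by (elim AE_lebesgue_on_subset) auto
    have pA: "has_velocity S (\<lambda>r. \<Phi> (y s) (p r)) (\<lambda>r. \<Phi> (y s) (\<zeta> r))"
      by (rule has_velocity_bounded_linear[OF p bounded_linear])
    have yd: "AE r in lebesgue_on {s..t}. (y has_vector_derivative \<Phi> (y r) (\<zeta> r)) (at r)"
      and pd: "AE r in lebesgue_on {s..t}. ((\<lambda>r. \<Phi> (y s) (p r)) has_vector_derivative \<Phi> (y s) (\<zeta> r)) (at r)"
      and \<psi>d: "AE r in lebesgue_on {s..t}. ((\<lambda>r. c * \<psi> r) has_vector_derivative c * \<psi>' r) (at r)"
      using y pA scaled[of c] by (auto simp: has_velocity_def intro: sub)
    have space': "AE r in lebesgue_on {s..t}. r \<in> {s..t}" using AE_space[of "lebesgue_on {s..t}"] by simp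
    have "norm ((y t - \<Phi> (y s) (p t)) - (y s - \<Phi> (y s) (p s))) \<le> c * \<psi> t - c * \<psi> s"
    proof (rule abs_continuous_on_norm_diff_le[where a = s and b = t])
      show "abs_continuous_on s t (\<lambda>r. y r - \<Phi> (y s) (p r))"
      proof (rule abs_continuous_on_dominated2[of s t y _ 1])
        show "abs_continuous_on s t y" "abs_continuous_on s t (\<lambda>r. \<Phi> (y s) (p r))"
          using y pA st by (auto simp: has_velocity_def elim: abs_continuous_on_subinterval)
        show "dist (y r - \<Phi> (y s) (p r)) (y r' - \<Phi> (y s) (p r'))
            \<le> 1 * (dist (y r) (y r') + dist (\<Phi> (y s) (p r)) (\<Phi> (y s) (p r')))" for r r'
          using norm_triangle_ineq4[of "y r - y r'" "\<Phi> (y s) (p r) - \<Phi> (y s) (p r')"]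
          by (simp add: dist_norm algebra_simps)
      qed simp
      show "abs_continuous_on s t (\<lambda>r. c * \<psi> r)"
        using scaled[of c] st by (auto simp: has_velocity_def elim: abs_continuous_on_subinterval)
      show "AE r in lebesgue_on {s..t}. ((\<lambda>r. y r - \<Phi> (y s) (p r)) has_vector_derivative
          \<Phi> (y r) (\<zeta> r) - \<Phi> (y s) (\<zeta> r)) (at r)"
        using yd pd by eventually_elim (rule has_vector_derivative_diff)
      show "AE r in lebesgue_on {s..t}. ((\<lambda>r. c * \<psi> r) has_vector_derivative c * \<psi>' r) (at r)" by (rule \<psi>d)
      show "AE r in lebesgue_on {s..t}. norm (\<Phi> (y r) (\<zeta> r) - \<Phi> (y s) (\<zeta> r)) \<le> c * \<psi>' r"
        using sub[OF le] space'
      proof eventually_elim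
        case (elim r)
        have "norm (\<Phi> (y r) (\<zeta> r) - \<Phi> (y s) (\<zeta> r)) \<le> K * norm (y r - y s) * norm (\<zeta> r)"
          using elim(2) st by (intro Kyy) auto
        also have "\<dots> \<le> K * (K * (\<psi> t - \<psi> s)) * \<psi>' r"
        proof (intro mult_mono mult_left_mono)
          have "norm (y r - y s) \<le> K * (\<psi> r - \<psi> s)" using elim(2) st by (intro first) auto
          also have "\<dots> \<le> K * (\<psi> t - \<psi> s)" using K(1) \<psi>mono[of r t] elim(2) st by (intro mult_left_mono) auto
          finally show "norm (y r - y s) \<le> K * (\<psi> t - \<psi> s)" .
        qed (use elim K(1) \<psi>mono[OF st] in auto)
        finally show ?case by (simp add: c_def)
      qed
    qed (use st in auto)
    then show ?thesis by (simp add: A.diff c_def power2_eq_square algebra_simps)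
  qed
  show ?thesis
    unfolding driven_def
  proof (intro conjI allI impI)
    fix s t assume st: "0 \<le> s" "s \<le> t" "t \<le> S"
    have "K * (\<psi> t - \<psi> s) \<le> (K + K * K) * (\<psi> t - \<psi> s)"
      "K * K * (\<psi> t - \<psi> s)\<^sup>2 \<le> (K + K * K) * (\<psi> t - \<psi> s)\<^sup>2"
      using \<psi>mono[OF st] K(1) by (auto intro!: mult_right_mono)
    then show "norm (y t - y s) \<le> (K + K * K) * (\<psi> t - \<psi> s)"
      "norm (y t - y s - \<Phi> (y s) (p t - p s)) \<le> (K + K * K) * (\<psi> t - \<psi> s)\<^sup>2"
      using first[OF st] second[OF st] by linarith+
  qed (use K in auto)
qed

text \<open>Divided by the step \<open>h\<close>, the second-order error is
  \<open>C * q h * q h * h\<close>, where the quotient \<open>q h\<close> of \<open>\<psi>\<close>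
  converges; so the error vanishes and the quotients of \<open>y\<close> and \<open>p\<close> are
  linked in the limit. Steps go to the right, which is why \<open>S\<close> is left out.\<close>

lemma velocity_of_driven:
  assumes S: "0 \<le> S" and dr: "driven C S \<psi> p y" and mono: "mono_on {0..S} \<psi>"
    and \<psi>: "has_velocity S \<psi> \<psi>'" and p: "has_velocity S p \<zeta>"
  shows "has_velocity S y (\<lambda>t. \<Phi> (y t) (\<zeta> t))"
proof -
  have C: "C \<ge> 0" using dr by (simp add: driven_def)
  have ac: "abs_continuous_on 0 S y"
  proof (rule abs_continuous_on_dominated[OF _ C])
    show "abs_continuous_on 0 S \<psi>" using \<psi> by (simp add: has_velocity_def)
    show "dist (y s) (y t) \<le> C * dist (\<psi> s) (\<psi> t)" if st: "0 \<le> s" "s \<le> t" "t \<le> S" for s t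
    proof -
      have "\<psi> s \<le> \<psi> t" using mono st by (auto simp: mono_on_def)
      moreover have "norm (y t - y s) \<le> C * (\<psi> t - \<psi> s)" using dr st by (simp add: driven_def)
      ultimately show ?thesis by (simp add: dist_norm norm_minus_commute)
    qed
  qed
  obtain \<rho> where \<rho>: "has_velocity S y \<rho>" using has_velocity_exists[OF ac S] by metis
  have "AE t in lebesgue_on {0..S}. t \<noteq> S"
    by (subst AE_lebesgue_on_iff_negligible) (auto intro: negligible_subset[of "{S}"])
  moreover have "AE t in lebesgue_on {0..S}. t \<in> {0..S}" using AE_space[of "lebesgue_on {0..S}"] by simp
  moreover have "AE t in lebesgue_on {0..S}. (y has_vector_derivative \<rho> t) (at t)"
    "AE t in lebesgue_on {0..S}. (p has_vector_derivative \<zeta> t) (at t)"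
    "AE t in lebesgue_on {0..S}. (\<psi> has_vector_derivative \<psi>' t) (at t)"
    using \<rho> p \<psi> by (auto simp: has_velocity_def)
  ultimately have "AE t in lebesgue_on {0..S}. \<rho> t = \<Phi> (y t) (\<zeta> t)"
  proof eventually_elim
    case (elim t)
    interpret A: bounded_linear "\<Phi> (y t)" by (rule bounded_linear)
    define q where "q = (\<lambda>h. (\<psi> (t + h) - \<psi> t) /\<^sub>R h)"
    have lim: "((\<lambda>h. (y (t + h) - y t) /\<^sub>R h) \<longlongrightarrow> \<rho> t) (at_right 0)"
      "((\<lambda>h. (p (t + h) - p t) /\<^sub>R h) \<longlongrightarrow> \<zeta> t) (at_right 0)"
      "(q \<longlongrightarrow> \<psi>' t) (at_right 0)"
      unfolding q_def
      by (rule tendsto_within_subset[OF has_vector_derivative_quotient_limit[OF elim(3)] subset_UNIV],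
          rule tendsto_within_subset[OF has_vector_derivative_quotient_limit[OF elim(4)] subset_UNIV],
          rule tendsto_within_subset[OF has_vector_derivative_quotient_limit[OF elim(5)] subset_UNIV])
    have id: "((\<lambda>h. h) \<longlongrightarrow> (0::real)) (at_right 0)" by (rule tendsto_ident_at)
    have "((\<lambda>h. (y (t + h) - y t) /\<^sub>R h - \<Phi> (y t) ((p (t + h) - p t) /\<^sub>R h)) \<longlongrightarrow> \<rho> t - \<Phi> (y t) (\<zeta> t)) (at_right 0)"
      by (intro tendsto_diff lim A.tendsto)
    moreover have "((\<lambda>h. (y (t + h) - y t) /\<^sub>R h - \<Phi> (y t) ((p (t + h) - p t) /\<^sub>R h)) \<longlongrightarrow> 0) (at_right 0)"
    proof (rule Lim_null_comparison)
      have "((\<lambda>h. C * (q h * (q h * h))) \<longlongrightarrow> C * (\<psi>' t * (\<psi>' t * 0))) (at_right 0)"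
        by (intro tendsto_mult tendsto_const lim id)
      then show "((\<lambda>h. C * (q h * (q h * h))) \<longlongrightarrow> 0) (at_right 0)" by simp
      have tS: "0 \<le> t" "t < S" using elim(1,2) by auto
      have "norm ((y (t + h) - y t) /\<^sub>R h - \<Phi> (y t) ((p (t + h) - p t) /\<^sub>R h)) \<le> C * (q h * (q h * h))"
        if h: "0 < h" "h < S - t" for h
      proof -
        have "(y (t + h) - y t) /\<^sub>R h - \<Phi> (y t) ((p (t + h) - p t) /\<^sub>R h)
            = (y (t + h) - y t - \<Phi> (y t) (p (t + h) - p t)) /\<^sub>R h"
          unfolding A.scaleR by (rule scaleR_diff_right[symmetric])
        also have "norm \<dots> = norm (y (t + h) - y t - \<Phi> (y t) (p (t + h) - p t)) / h"
          using h by (simp add: divide_inverse mult.commute)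
        also have "\<dots> \<le> C * (\<psi> (t + h) - \<psi> t)\<^sup>2 / h"
          using dr h tS by (intro divide_right_mono) (auto simp: driven_def)
        also have "\<dots> = C * (q h * (q h * h))"
          using h by (simp add: q_def power2_eq_square field_simps)
        finally show ?thesis .
      qed
      then show "\<forall>\<^sub>F h in at_right 0. norm ((y (t + h) - y t) /\<^sub>R h - \<Phi> (y t) ((p (t + h) - p t) /\<^sub>R h)) \<le> C * (q h * (q h * h))"
        unfolding eventually_at_right_field using tS by (intro exI[of _ "S - t"]) auto
    qed
    ultimately have "\<rho> t - \<Phi> (y t) (\<zeta> t) = 0" by (intro tendsto_unique[OF trivial_limit_at_right_real])
    then show ?case by simp
  qed
  then show ?thesis by (rule has_velocity_cong_AE[OF \<rho>])
qed

text \<open>Over one step, the difference of two trajectories is multiplied by at most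
  \<open>1 + K * (\<psi> t - \<psi> s)\<close> and receives two quadratic errors, as
  \<open>discrete_gronwall\<close> requires.\<close>

lemma driven_unique:
  assumes cont: "continuous_on {0..S} \<psi>" and mono: "mono_on {0..S} \<psi>" and \<psi>0: "\<psi> 0 = 0"
    and p: "\<And>s t. 0 \<le> s \<Longrightarrow> s \<le> t \<Longrightarrow> t \<le> S \<Longrightarrow> norm (p t - p s) \<le> \<psi> t - \<psi> s"
    and 1: "driven C S \<psi> p y" and 2: "driven C' S \<psi> p y'" and init: "y 0 = y' 0"
    and t: "0 \<le> t" "t \<le> S"
  shows "y t = y' t"
proof -
  have C: "C \<ge> 0" "C' \<ge> 0" using 1 2 by (auto simp: driven_def)
  have \<psi>pos: "0 \<le> \<psi> s" "\<psi> s \<le> \<psi> S" if "0 \<le> s" "s \<le> S" for s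
    using mono that \<psi>0 unfolding mono_on_def by (metis atLeastAtMost_iff order_trans order_refl)+
  \<comment> \<open>The first-order bound of \<open>driven\<close> keeps both trajectories in the
    ball of radius \<open>R\<close>, so one Lipschitz constant serves both.\<close>
  define R where "R = norm (y 0) + (C + C') * \<psi> S"
  have R: "norm (y s) \<le> R" "norm (y' s) \<le> R" if s: "0 \<le> s" "s \<le> S" for s
  proof -
    have "norm (y s - y 0) \<le> C * \<psi> s" "norm (y' s - y 0) \<le> C' * \<psi> s"
      using 1 2 s \<psi>0 init unfolding driven_def by (metis diff_zero order_refl)+
    moreover have "C * \<psi> s \<le> (C + C') * \<psi> S" "C' * \<psi> s \<le> (C + C') * \<psi> S"
      using C \<psi>pos[OF s] by (auto intro!: mult_mono)
    ultimately show "norm (y s) \<le> R" "norm (y' s) \<le> R"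
      using norm_triangle_ineq2[of "y s" "y 0"] norm_triangle_ineq2[of "y' s" "y 0"]
      unfolding R_def by linarith+
  qed
  obtain K where K: "K \<ge> 0" "\<And>y y' z. y \<in> cball 0 R \<Longrightarrow> y' \<in> cball 0 R \<Longrightarrow>
      norm (\<Phi> y z) \<le> K * norm z \<and> norm (\<Phi> y z - \<Phi> y' z) \<le> K * norm (y - y') * norm z"
    using locally_lipschitz[of R] by blast
  have "norm (y t - y' t) \<le> 0"
  proof (rule discrete_gronwall[OF cont \<psi>0 K(1), of "C + C'" "\<lambda>t. norm (y t - y' t)"])
    show "norm (y t - y' t) \<le> norm (y s - y' s) * (1 + K * (\<psi> t - \<psi> s)) + (C + C') * (\<psi> t - \<psi> s)\<^sup>2"
      if st: "0 \<le> s" "s \<le> t" "t \<le> S" for s t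
    proof -
      define e e' d where "e = y t - y s - \<Phi> (y s) (p t - p s)"
        and "e' = y' t - y' s - \<Phi> (y' s) (p t - p s)"
        and "d = \<Phi> (y s) (p t - p s) - \<Phi> (y' s) (p t - p s)"
      have "norm e \<le> C * (\<psi> t - \<psi> s)\<^sup>2" "norm e' \<le> C' * (\<psi> t - \<psi> s)\<^sup>2"
        using 1 2 st by (auto simp: driven_def e_def e'_def)
      moreover have "norm d \<le> K * norm (y s - y' s) * (\<psi> t - \<psi> s)"
      proof -
        have "norm d \<le> K * norm (y s - y' s) * norm (p t - p s)"
          unfolding d_def using K(2)[of "y s" "y' s"] R[of s] st by auto
        also have "\<dots> \<le> K * norm (y s - y' s) * (\<psi> t - \<psi> s)"
          using p[OF st] K(1) by (intro mult_left_mono) auto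
        finally show ?thesis .
      qed
      moreover have "y t - y' t = (y s - y' s) + d + (e - e')" by (simp add: e_def e'_def d_def)
      then have "norm (y t - y' t) = norm ((y s - y' s) + d + (e - e'))" by simp
      then have "norm (y t - y' t) \<le> norm (y s - y' s) + norm d + (norm e + norm e')"
        using norm_triangle_ineq[of "y s - y' s + d" "e - e'"] norm_triangle_ineq[of "y s - y' s" d]
          norm_triangle_ineq4[of e e'] by linarith
      ultimately show ?thesis by (simp add: algebra_simps)
    qed
  qed (use C init t \<psi>pos in auto)
  then show ?thesis by simp
qed

lemma solution_driven:
  assumes S: "0 \<le> S" and p: "has_velocity S p \<zeta>" and \<psi>: "has_velocity S \<psi> \<psi>'"
    and le: "AE t in lebesgue_on {0..S}. norm (\<zeta> t) \<le> \<psi>' t"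
    and y: "has_velocity S y (\<lambda>t. \<Phi> (y t) (\<zeta> t))"
  obtains C where "driven C S \<psi> p y"
proof -
  have "bounded (y ` {0..S})"
    using y by (intro compact_imp_bounded compact_continuous_image has_velocity_continuous_on) auto
  then obtain R where R: "\<And>t. t \<in> {0..S} \<Longrightarrow> norm (y t) \<le> R" unfolding bounded_iff by blast
  obtain K where K: "K \<ge> 0" "\<And>y y' z. y \<in> cball 0 R \<Longrightarrow> y' \<in> cball 0 R \<Longrightarrow>
      norm (\<Phi> y z) \<le> K * norm z \<and> norm (\<Phi> y z - \<Phi> y' z) \<le> K * norm (y - y') * norm z"
    using locally_lipschitz[of R] by blast
  from that[OF driven_of_velocity[OF p \<psi> le y R K]] show ?thesis by simp
qed

lemma solution_unique:
  assumes S: "0 \<le> S" and p: "has_velocity S p \<zeta>"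
    and y: "solves_ode_on S (\<lambda>t y. \<Phi> y (\<zeta> t)) x0 y" and y': "solves_ode_on S (\<lambda>t y. \<Phi> y (\<zeta> t)) x0 y'"
    and t: "0 \<le> t" "t \<le> S"
  shows "y t = y' t"
proof -
  define \<psi> where "\<psi> = (\<lambda>t. integral {0..t} (\<lambda>r. norm (\<zeta> r)))"
  have \<psi>: "has_velocity S \<psi> (\<lambda>t. norm (\<zeta> t))"
    unfolding \<psi>_def by (intro has_velocity_arclength has_velocity_integral[OF p S])
  have le: "AE t in lebesgue_on {0..S}. norm (\<zeta> t) \<le> norm (\<zeta> t)" by simp
  have pd: "norm (p t - p s) \<le> \<psi> t - \<psi> s" if "0 \<le> s" "s \<le> t" "t \<le> S" for s t
    by (rule has_velocity_norm_diff_le[OF p \<psi> le that])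
  have mono: "mono_on {0..S} \<psi>"
  proof (rule mono_onI)
    fix s t assume "s \<in> {0..S}" "t \<in> {0..S}" "s \<le> t"
    then have "norm (p t - p s) \<le> \<psi> t - \<psi> s" by (intro pd) auto
    then show "\<psi> s \<le> \<psi> t" using norm_ge_zero[of "p t - p s"] by linarith
  qed
  obtain C where C: "driven C S \<psi> p y"
    using solution_driven[OF S p \<psi> le] y by (auto simp: solves_ode_on_iff)
  obtain C' where C': "driven C' S \<psi> p y'"
    using solution_driven[OF S p \<psi> le] y' by (auto simp: solves_ode_on_iff)
  show ?thesis
    by (rule driven_unique[OF has_velocity_continuous_on[OF \<psi>] mono _ pd C C' _ t])
       (use y y' in \<open>auto simp: \<psi>_def solves_ode_on_iff\<close>)
qed

lemma max_solution_eq: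
  assumes p: "has_velocity S p \<zeta>"
    and y: "solves_ode_on S (\<lambda>t y. \<Phi> y (\<zeta> t)) x0 y" and t: "0 \<le> t" "t \<le> S"
  shows "max_solution (\<lambda>t y. \<Phi> y (\<zeta> t)) x0 t = y t"
  unfolding max_solution_def
proof (rule the_equality)
  have y': "solves_ode_on t (\<lambda>t y. \<Phi> y (\<zeta> t)) x0 y"
    using y has_velocity_subinterval[OF _ t(2)] by (auto simp: solves_ode_on_iff)
  then show "\<exists>z. solves_ode_on t (\<lambda>t y. \<Phi> y (\<zeta> t)) x0 z \<and> z t = y t" by blast
  fix c assume "\<exists>z. solves_ode_on t (\<lambda>t y. \<Phi> y (\<zeta> t)) x0 z \<and> z t = c"
  then obtain z where z: "solves_ode_on t (\<lambda>t y. \<Phi> y (\<zeta> t)) x0 z" "z t = c" by blast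
  from solution_unique[OF t(1) has_velocity_subinterval[OF p t(2)] z(1) y' t(1)] z(2)
  show "c = y t" by simp
qed

lemma driven_reparametrize:
  assumes S: "0 \<le> S" and cont: "continuous_on {0..S} \<psi>" and mono: "mono_on {0..S} \<psi>" and \<psi>0: "\<psi> 0 = 0"
    and p: "\<And>s t. 0 \<le> s \<Longrightarrow> s \<le> t \<Longrightarrow> t \<le> S \<Longrightarrow> norm (p t - p s) \<le> \<psi> t - \<psi> s"
    and dr: "driven C S \<psi> p y"
  obtains P Y where "\<And>t. t \<in> {0..S} \<Longrightarrow> P (\<psi> t) = p t" "\<And>t. t \<in> {0..S} \<Longrightarrow> Y (\<psi> t) = y t"
    "1-lipschitz_on {0..\<psi> S} P" "driven C (\<psi> S) (\<lambda>t. t) P Y"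
proof -
  have C: "C \<ge> 0" using dr by (simp add: driven_def)
  have "dist (p s) (p t) \<le> 1 * (\<psi> t - \<psi> s)" if "0 \<le> s" "s \<le> t" "t \<le> S" for s t
    using p[OF that] by (simp add: dist_norm norm_minus_commute)
  then obtain P where P: "\<And>t. t \<in> {0..S} \<Longrightarrow> P (\<psi> t) = p t" "1-lipschitz_on {0..\<psi> S} P"
    using reparametrization_exists[OF S cont \<psi>0 zero_le_one _ mono, of p] by metis
  have "dist (y s) (y t) \<le> C * (\<psi> t - \<psi> s)" if "0 \<le> s" "s \<le> t" "t \<le> S" for s t
    using dr that by (simp add: driven_def dist_norm norm_minus_commute)
  then obtain Y where Y: "\<And>t. t \<in> {0..S} \<Longrightarrow> Y (\<psi> t) = y t"
    using reparametrization_exists[OF S cont \<psi>0 C _ mono, of y] by metis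
  have "driven C (\<psi> S) (\<lambda>t. t) P Y"
    unfolding driven_def
  proof (intro conjI allI impI)
    show "C \<ge> 0" by (rule C)
    fix s t assume st: "0 \<le> s" "s \<le> t" "t \<le> \<psi> S"
    have "\<exists>r. r \<in> {0..S} \<and> \<psi> r = x" if "0 \<le> x" "x \<le> \<psi> S" for x
      using IVT'[of \<psi> 0 x S] that S cont \<psi>0 by auto
    then obtain s' t' where s't': "s' \<in> {0..S}" "\<psi> s' = s" "t' \<in> {0..S}" "\<psi> t' = t"
      using st by (meson order_trans)
    \<comment> \<open>The chosen preimages can come in the wrong order only if \<open>s = t\<close>;
      then a single one is used twice.\<close>
    have "\<exists>s' t'. s' \<in> {0..S} \<and> \<psi> s' = s \<and> t' \<in> {0..S} \<and> \<psi> t' = t \<and> s' \<le> t'"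
    proof (cases "s' \<le> t'")
      case False
      then have "t \<le> s" using mono_onD[OF mono s't'(3,1)] s't' by auto
      then show ?thesis using s't' st by (intro exI[of _ s'] exI[of _ s']) auto
    qed (use s't' in blast)
    then obtain s' t' where s't': "s' \<in> {0..S}" "\<psi> s' = s" "t' \<in> {0..S}" "\<psi> t' = t" "s' \<le> t'" by blast
    then have "norm (y t' - y s') \<le> C * (t - s) \<and> norm (y t' - y s' - \<Phi> (y s') (p t' - p s')) \<le> C * (t - s)\<^sup>2"
      using dr unfolding driven_def by auto
    then show "norm (Y t - Y s) \<le> C * (t - s)" "norm (Y t - Y s - \<Phi> (Y s) (P t - P s)) \<le> C * (t - s)\<^sup>2"
      using P(1)[OF s't'(1)] P(1)[OF s't'(3)] Y[OF s't'(1)] Y[OF s't'(3)] s't' by auto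
  qed
  with P Y that show ?thesis by blast
qed

lemma driven_compose:
  assumes dr: "driven C T (\<lambda>t. t) P Y" and m: "mono_on {0..S} m" "m 0 = 0" "m S \<le> T"
    and "\<And>t. t \<in> {0..S} \<Longrightarrow> p t = P (m t)" "\<And>t. t \<in> {0..S} \<Longrightarrow> y t = Y (m t)"
  shows "driven C S m p y"
  unfolding driven_def
proof (intro conjI allI impI)
  show "C \<ge> 0" using dr by (simp add: driven_def)
  fix s t assume st: "0 \<le> s" "s \<le> t" "t \<le> S"
  have "0 \<le> m s" "m s \<le> m t" "m t \<le> m S"
    using mono_onD[OF m(1), of 0 s] mono_onD[OF m(1), of s t] mono_onD[OF m(1), of t S] st m(2) by auto
  then have "norm (Y (m t) - Y (m s)) \<le> C * (m t - m s)"
    "norm (Y (m t) - Y (m s) - \<Phi> (Y (m s)) (P (m t) - P (m s))) \<le> C * (m t - m s)\<^sup>2"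
    using dr m(3) unfolding driven_def by auto
  then show "norm (y t - y s) \<le> C * (m t - m s)" "norm (y t - y s - \<Phi> (y s) (p t - p s)) \<le> C * (m t - m s)\<^sup>2"
    using assms(5,6) st by auto
qed

end

text \<open>The chain rule gives \<open>\<zeta> t = \<psi>' t *\<^sub>R \<rho> (\<psi> t)\<close>,
  and homogeneity moves the factor \<open>\<psi>' t\<close> out of \<open>lam\<close>, which leaves
  the substitution formula. Where \<open>\<psi>' t = 0\<close> the velocity is zero and both
  integrands vanish.\<close>

lemma nn_integral_reparametrize:
  fixes lam :: "'y::euclidean_space \<Rightarrow> 'z::euclidean_space \<Rightarrow> ennreal" and \<psi> \<psi>' :: "real \<Rightarrow> real"
  assumes meas: "(\<lambda>(y, z). lam y z) \<in> borel_measurable borel"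
    and hom: "\<And>y z c. c \<ge> 0 \<Longrightarrow> lam y (c *\<^sub>R z) = ennreal c * lam y z"
    and S: "0 \<le> S" and \<psi>: "has_velocity S \<psi> \<psi>'" and mono: "mono_on {0..S} \<psi>" and \<psi>0: "\<psi> 0 = 0"
    and p: "has_velocity S p \<zeta>" and le: "AE t in lebesgue_on {0..S}. norm (\<zeta> t) \<le> \<psi>' t"
    and P: "has_velocity (\<psi> S) P \<rho>" and Y: "continuous_on {0..\<psi> S} Y"
    and pP: "\<And>t. t \<in> {0..S} \<Longrightarrow> p t = P (\<psi> t)" and yY: "\<And>t. t \<in> {0..S} \<Longrightarrow> y t = Y (\<psi> t)"
  shows "(\<integral>\<^sup>+t. lam (y t) (\<zeta> t) \<partial>lebesgue_on {0..S}) = (\<integral>\<^sup>+s. lam (Y s) (\<rho> s) \<partial>lebesgue_on {0..\<psi> S})"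
proof -
  define T where "T = \<psi> S"
  have T: "T \<ge> 0" unfolding T_def using mono_onD[OF mono, of 0 S] S \<psi>0 by simp
  have range: "\<psi> t \<in> {0..T}" if "t \<in> {0..S}" for t
    unfolding T_def using mono_onD[OF mono, of 0 t] mono_onD[OF mono, of t S] that S \<psi>0 by auto
  \<comment> \<open>Substitution takes a Borel integrand on the whole line. So the velocity is
    replaced by a Borel version \<open>\<rho>0\<close>, and the trajectory is continued by its end
    values.\<close>
  have "abs_continuous_on 0 T P" using P by (simp add: has_velocity_def T_def)
  then obtain \<rho>0 where \<rho>0: "has_velocity T P \<rho>0" and [measurable]: "\<rho>0 \<in> borel_measurable borel"
    using has_velocity_exists[OF _ T] by metis
  define Z where "Z = (\<lambda>s. Y (max 0 (min T s)))"
  have "continuous_on UNIV Z"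
    unfolding Z_def
    by (rule continuous_on_compose2[OF Y]) (use T in \<open>auto simp: T_def intro!: continuous_intros\<close>)
  then have [measurable]: "Z \<in> borel_measurable borel" by (rule borel_measurable_continuous_onI)
  define h where "h = (\<lambda>s. lam (Z s) (\<rho>0 s))"
  have "(\<lambda>s. (\<lambda>(y, z). lam y z) (Z s, \<rho>0 s)) \<in> borel_measurable borel"
    by (rule measurable_compose[OF _ meas]) measurable
  then have [measurable]: "h \<in> borel_measurable borel" by (simp add: h_def)
  have lam0: "lam y 0 = 0" for y using hom[of 0 y 0] by simp
  have "AE s in lebesgue_on {0..T}. (P has_vector_derivative \<rho>0 s) (at s)"
    using \<rho>0 by (simp add: has_velocity_def)
  then have "AE s in lebesgue. s \<in> {0..T} \<longrightarrow> (P has_vector_derivative \<rho>0 s) (at s)"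
    by (subst (asm) AE_restrict_space_iff) auto
  then have "AE s in lborel. s \<in> {0..T} \<longrightarrow> (P has_vector_derivative \<rho>0 s) (at s)"
    by (simp only: AE_completion_iff)
  then obtain N where N: "N \<in> null_sets lborel"
      "{s. \<not> (s \<in> {0..T} \<longrightarrow> (P has_vector_derivative \<rho>0 s) (at s))} \<subseteq> N"
    by (auto simp: eventually_ae_filter)
  have [measurable]: "N \<in> sets borel" using N(1) by auto
  have \<psi>ac: "abs_continuous_on 0 S \<psi>" "AE t in lebesgue_on {0..S}. (\<psi> has_vector_derivative \<psi>' t) (at t)"
    using \<psi> by (auto simp: has_velocity_def)
  have \<psi>m: "\<psi> \<in> borel_measurable (lebesgue_on {0..S})"
    by (intro continuous_imp_measurable_on_sets_lebesgue has_velocity_continuous_on[OF \<psi>]) simp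
  have \<psi>'m: "\<psi>' \<in> borel_measurable (lebesgue_on {0..S})"
    using has_velocity_integral(1)[OF \<psi> S] by (rule absolutely_integrable_measurable[THEN iffD1, THEN conjunct1, rotated]) simp
  \<comment> \<open>\<open>P\<close> fails to be differentiable only on the null set
    \<open>N\<close>, which \<open>\<psi>\<close> may still visit for a set of times of positive
    measure. Substituting the indicator of \<open>N\<close> shows that \<open>\<psi>'\<close>
    vanishes at almost all of these times.\<close>
  have "(\<integral>\<^sup>+t. indicator N (\<psi> t) * ennreal (\<psi>' t) \<partial>lebesgue_on {0..S}) = (\<integral>\<^sup>+s. indicator N s \<partial>lebesgue_on {\<psi> 0..\<psi> S})"
    by (rule nn_integral_substitution_abs_continuous[OF \<psi>ac(1) mono S \<psi>ac(2)]) measurable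
  also have "\<dots> = (\<integral>\<^sup>+(s::real). 0 \<partial>lborel)"
  proof -
    have "(\<integral>\<^sup>+s. indicator N s \<partial>lebesgue_on {\<psi> 0..\<psi> S}) = (\<integral>\<^sup>+s. indicator N s * indicator {\<psi> 0..\<psi> S} s \<partial>lborel)"
      by (rule nn_integral_lebesgue_on) simp
    also have "\<dots> = (\<integral>\<^sup>+(s::real). 0 \<partial>lborel)"
    proof (rule nn_integral_cong_AE)
      show "AE s in lborel. indicator N s * indicator {\<psi> 0..\<psi> S} s = (0::ennreal)"
        using AE_not_in[OF N(1)] by eventually_elim simp
    qed
    finally show ?thesis .
  qed
  finally have "(\<integral>\<^sup>+t. indicator N (\<psi> t) * ennreal (\<psi>' t) \<partial>lebesgue_on {0..S}) = 0" by simp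
  moreover have "(\<lambda>t. indicator N (\<psi> t) * ennreal (\<psi>' t)) \<in> borel_measurable (lebesgue_on {0..S})"
    using measurable_compose[OF \<psi>m, of "indicator N" borel] \<psi>'m by measurable
  ultimately have avoid: "AE t in lebesgue_on {0..S}. indicator N (\<psi> t) * ennreal (\<psi>' t) = 0"
    by (subst (asm) nn_integral_0_iff_AE) auto
  have "AE t in lebesgue_on {0..S}. t \<noteq> 0 \<and> t \<noteq> S"
    by (subst AE_lebesgue_on_iff_negligible) (auto intro: negligible_subset[of "{0, S}"])
  moreover have "AE t in lebesgue_on {0..S}. t \<in> {0..S}" using AE_space[of "lebesgue_on {0..S}"] by simp
  moreover have "AE t in lebesgue_on {0..S}. (p has_vector_derivative \<zeta> t) (at t)" using p by (simp add: has_velocity_def)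
  ultimately have "AE t in lebesgue_on {0..S}. lam (y t) (\<zeta> t) = h (\<psi> t) * ennreal (\<psi>' t)"
    using \<psi>ac(2) le avoid
  proof eventually_elim
    case (elim t)
    have \<psi>'pos: "\<psi>' t \<ge> 0" using elim(5) norm_ge_zero[of "\<zeta> t"] by linarith
    show ?case
    proof (cases "\<psi>' t = 0")
      case True
      then show ?thesis using elim(5) lam0 by simp
    next
      case False
      then have "\<psi> t \<notin> N" using elim(6) \<psi>'pos by (auto simp: indicator_def split: if_splits)
      then have "(P has_vector_derivative \<rho>0 (\<psi> t)) (at (\<psi> t))" using N(2) range[OF elim(2)] by blast
      from vector_diff_chain_at[OF elim(4) this]
      have "((P \<circ> \<psi>) has_vector_derivative \<psi>' t *\<^sub>R \<rho>0 (\<psi> t)) (at t)" .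
      then have "(p has_vector_derivative \<psi>' t *\<^sub>R \<rho>0 (\<psi> t)) (at t)"
        by (rule has_vector_derivative_transform_within_open[where S = "{0<..<S}"]) (use elim(1,2) pP in auto)
      then have "\<zeta> t = \<psi>' t *\<^sub>R \<rho>0 (\<psi> t)" using elim(3) by (metis vector_derivative_unique_at)
      moreover have "Z (\<psi> t) = y t" using range[OF elim(2)] yY[OF elim(2)] by (simp add: Z_def)
      ultimately show ?thesis using hom[OF \<psi>'pos] by (simp add: h_def mult.commute)
    qed
  qed
  then have "(\<integral>\<^sup>+t. lam (y t) (\<zeta> t) \<partial>lebesgue_on {0..S}) = (\<integral>\<^sup>+t. h (\<psi> t) * ennreal (\<psi>' t) \<partial>lebesgue_on {0..S})"
    by (rule nn_integral_cong_AE)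
  also have "\<dots> = (\<integral>\<^sup>+s. h s \<partial>lebesgue_on {\<psi> 0..\<psi> S})"
    by (rule nn_integral_substitution_abs_continuous[OF \<psi>ac(1) mono S \<psi>ac(2)]) measurable
  also have "\<dots> = (\<integral>\<^sup>+s. lam (Y s) (\<rho> s) \<partial>lebesgue_on {0..\<psi> S})"
  proof (unfold \<psi>0, rule nn_integral_cong_AE)
    have "AE s in lebesgue_on {0..\<psi> S}. \<rho>0 s = \<rho> s" using has_velocity_unique[OF \<rho>0[unfolded T_def] P] .
    moreover have "AE s in lebesgue_on {0..\<psi> S}. s \<in> {0..\<psi> S}" using AE_space[of "lebesgue_on {0..\<psi> S}"] by simp
    ultimately show "AE s in lebesgue_on {0..\<psi> S}. h s = lam (Y s) (\<rho> s)"
      by eventually_elim (simp add: h_def Z_def T_def)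
  qed
  finally show ?thesis .
qed

section \<open>The extended Lagrangian\<close>

lemma scaleR_divideR_cancel:
  fixes w :: "'a::real_vector"
  assumes "c \<noteq> 0"
  shows "(c *\<^sub>R w) /\<^sub>R (c * v) = w /\<^sub>R v"
proof -
  have "(c *\<^sub>R w) /\<^sub>R (c * v) = (c * inverse c) *\<^sub>R (w /\<^sub>R v)" by (simp add: mult_ac)
  then show ?thesis using assms by simp
qed

text \<open>The Lagrangian after subtraction of a constant: the lower bound is
  \<open>b * norm u\<close> without an additive term, hence \<open>L\<close> is nonnegative.\<close>

locale lagrangian =
  fixes L :: "real^'n \<Rightarrow> real^'k \<Rightarrow> real" and b :: real
  assumes continuous: "continuous_on UNIV (\<lambda>(x, u). L x u)"
    and convex: "\<And>x. convex_on UNIV (L x)"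
    and b_pos: "b > 0"
    and coercive: "\<And>x u. b * norm u \<le> L x u"
begin

lemma L_nonneg: "0 \<le> L x u"
proof -
  have "0 \<le> b * norm u" using b_pos by simp
  also have "\<dots> \<le> L x u" by (rule coercive)
  finally show ?thesis .
qed

lemma continuous_L:
  assumes "continuous_on A f" "continuous_on A g"
  shows "continuous_on A (\<lambda>z. L (f z) (g z))"
proof -
  have "continuous_on A (\<lambda>z. case (f z, g z) of (x, u) \<Rightarrow> L x u)"
    by (rule continuous_on_compose2[OF continuous continuous_on_Pair[OF assms] subset_UNIV])
  then show ?thesis by (simp only: prod.case)
qed

lemma L_shrink_le:
  assumes "0 \<le> t" "t \<le> 1"
  shows "L x (t *\<^sub>R u) \<le> t * L x u + (1 - t) * L x 0"
proof -
  have "L x ((1 - t) *\<^sub>R 0 + t *\<^sub>R u) \<le> (1 - t) * L x 0 + t * L x u"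
    by (rule convex_onD[OF convex[of x] assms UNIV_I UNIV_I])
  then show ?thesis by simp
qed

text \<open>The recession function of the convex function \<open>L y\<close>; it prices
  impulses.\<close>

abbreviation "lam0 y w \<equiv> ext_lagrangian L y 0 w"

text \<open>
  By convexity the difference quotient \<open>\<eta> (L (w / \<eta>) - L 0)\<close> increases as \<open>\<eta>\<close> decreases to 0,
  so the limit in the definition of the extended Lagrangian exists.
\<close>

lemma tendsto_lam0: "((\<lambda>\<eta>. ereal (L y (w /\<^sub>R \<eta>) * \<eta>)) \<longlongrightarrow> lam0 y w) (at_right 0)"
proof -
  define g where "g = (\<lambda>\<eta>. (L y (w /\<^sub>R \<eta>) - L y 0) * \<eta>)"
  have mono: "g \<eta>' \<le> g \<eta>" if "0 < \<eta>" "\<eta> \<le> \<eta>'" for \<eta> \<eta>'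
  proof -
    have "L y ((\<eta> / \<eta>') *\<^sub>R (w /\<^sub>R \<eta>)) \<le> (\<eta> / \<eta>') * L y (w /\<^sub>R \<eta>) + (1 - \<eta> / \<eta>') * L y 0"
      using that by (intro L_shrink_le) auto
    moreover have "(\<eta> / \<eta>') *\<^sub>R (w /\<^sub>R \<eta>) = w /\<^sub>R \<eta>'" using that by (simp add: divide_inverse)
    ultimately have "L y (w /\<^sub>R \<eta>') * \<eta>' \<le> ((\<eta> / \<eta>') * L y (w /\<^sub>R \<eta>) + (1 - \<eta> / \<eta>') * L y 0) * \<eta>'"
      using that by (intro mult_right_mono) auto
    also have "\<dots> = \<eta> * L y (w /\<^sub>R \<eta>) + (\<eta>' - \<eta>) * L y 0" using that by (simp add: field_simps)
    finally show ?thesis by (simp add: g_def algebra_simps)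
  qed
  define l where "l = (SUP \<eta>\<in>{0<..}. ereal (g \<eta>))"
  have "((\<lambda>\<eta>. ereal (g \<eta>)) \<longlongrightarrow> l) (at_right 0)"
  proof (rule order_tendstoI)
    fix c assume "c < l"
    then obtain \<eta>0 where \<eta>0: "\<eta>0 > 0" "c < ereal (g \<eta>0)" by (auto simp: l_def less_SUP_iff)
    have "c < ereal (g \<eta>)" if "0 < \<eta>" "\<eta> < \<eta>0" for \<eta>
      using \<eta>0(2) mono[of \<eta> \<eta>0] that by (metis ereal_less_eq(3) less_le_trans less_imp_le)
    then show "\<forall>\<^sub>F \<eta> in at_right 0. c < ereal (g \<eta>)"
      unfolding eventually_at_right_field using \<eta>0(1) by blast
  next
    fix c assume "l < c"
    moreover have "ereal (g \<eta>) \<le> l" if "\<eta> > 0" for \<eta>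
      unfolding l_def by (rule SUP_upper) (use that in simp)
    ultimately have "ereal (g \<eta>) < c" if "\<eta> > 0" for \<eta> using that by (meson le_less_trans)
    then show "\<forall>\<^sub>F \<eta> in at_right 0. ereal (g \<eta>) < c"
      unfolding eventually_at_right_field by (intro exI[of _ 1]) auto
  qed
  moreover have "((\<lambda>\<eta>. ereal (L y 0 * \<eta>)) \<longlongrightarrow> ereal (L y 0 * 0)) (at_right 0)"
    by (intro tendsto_intros)
  moreover have "l \<noteq> -\<infinity>"
  proof -
    have "ereal (g 1) \<le> l" unfolding l_def by (rule SUP_upper) simp
    then show ?thesis by auto
  qed
  ultimately have "((\<lambda>\<eta>. ereal (g \<eta>) + ereal (L y 0 * \<eta>)) \<longlongrightarrow> l + ereal (L y 0 * 0)) (at_right 0)"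
    by (intro tendsto_add_ereal_nonneg) auto
  then have lim: "((\<lambda>\<eta>. ereal (L y (w /\<^sub>R \<eta>) * \<eta>)) \<longlongrightarrow> l) (at_right 0)"
    by (simp add: g_def algebra_simps)
  then have "lam0 y w = l"
    unfolding ext_lagrangian_def by (simp add: tendsto_Lim[OF trivial_limit_at_right_real])
  with lim show ?thesis by simp
qed

lemma ext_lagrangian_nonpos: "v \<le> 0 \<Longrightarrow> ext_lagrangian L y v w = lam0 y w"
  by (simp add: ext_lagrangian_def)

lemma lam0_lowerbound:
  assumes "\<And>\<eta>. \<eta> > 0 \<Longrightarrow> A + B * \<eta> \<le> L y (w /\<^sub>R \<eta>) * \<eta>"
  shows "ereal A \<le> lam0 y w"
proof (rule tendsto_le[OF trivial_limit_at_right_real tendsto_lam0])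
  have "((\<lambda>\<eta>. ereal (A + B * \<eta>)) \<longlongrightarrow> ereal (A + B * 0)) (at_right 0)" by (intro tendsto_intros)
  then show "((\<lambda>\<eta>. ereal (A + B * \<eta>)) \<longlongrightarrow> ereal A) (at_right 0)" by simp
  show "\<forall>\<^sub>F \<eta> in at_right 0. ereal (A + B * \<eta>) \<le> ereal (L y (w /\<^sub>R \<eta>) * \<eta>)"
    unfolding eventually_at_right_field using assms by (intro exI[of _ 1]) auto
qed

text \<open>The inequality is homogenized: evaluate it at \<open>w / \<eta>\<close>, multiply by
  \<open>\<eta>\<close>, and let \<open>\<eta>\<close> be \<open>v\<close> or tend to 0. The error
  \<open>\<epsilon> * (1 + norm u)\<close> becomes \<open>\<epsilon> * (v + norm w)\<close>, which
  is uniformly small for controls in the unit ball.\<close>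

lemma ext_lagrangian_lowerbound:
  assumes "v \<ge> 0" and "\<And>u. \<alpha> + q \<bullet> u - \<epsilon> * (1 + norm u) \<le> L y u"
  shows "ereal (\<alpha> * v + q \<bullet> w - \<epsilon> * (v + norm w)) \<le> ext_lagrangian L y v w"
proof -
  have *: "q \<bullet> w - \<epsilon> * norm w + (\<alpha> - \<epsilon>) * \<eta> \<le> L y (w /\<^sub>R \<eta>) * \<eta>" if "\<eta> > 0" for \<eta>
  proof -
    have "(\<alpha> + q \<bullet> (w /\<^sub>R \<eta>) - \<epsilon> * (1 + norm (w /\<^sub>R \<eta>))) * \<eta> \<le> L y (w /\<^sub>R \<eta>) * \<eta>"
      using mult_right_mono[OF assms(2)[of "w /\<^sub>R \<eta>"], of \<eta>] that by simp
    also have "q \<bullet> (w /\<^sub>R \<eta>) = (q \<bullet> w) / \<eta>" by (simp add: divide_inverse)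
    also have "norm (w /\<^sub>R \<eta>) = norm w / \<eta>" using that by (simp add: divide_inverse)
    also have "(\<alpha> + (q \<bullet> w) / \<eta> - \<epsilon> * (1 + norm w / \<eta>)) * \<eta> = q \<bullet> w - \<epsilon> * norm w + (\<alpha> - \<epsilon>) * \<eta>"
      using that by (simp add: field_simps)
    finally show ?thesis .
  qed
  show ?thesis
  proof (cases "v = 0")
    case True
    then show ?thesis using lam0_lowerbound[OF *] by simp
  next
    case False
    then show ?thesis using *[of v] assms(1) by (simp add: ext_lagrangian_def algebra_simps)
  qed
qed

lemma ext_lagrangian_coercive:
  assumes "v \<ge> 0"
  shows "ereal (b * norm w) \<le> ext_lagrangian L y v w"
proof -
  have *: "b * norm w + 0 * \<eta> \<le> L y (w /\<^sub>R \<eta>) * \<eta>" if "\<eta> > 0" for \<eta>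
  proof -
    have "b * norm (w /\<^sub>R \<eta>) * \<eta> \<le> L y (w /\<^sub>R \<eta>) * \<eta>"
      using mult_right_mono[OF coercive[of "w /\<^sub>R \<eta>" y], of \<eta>] that by simp
    then show ?thesis using that by (simp add: field_simps)
  qed
  show ?thesis
  proof (cases "v = 0")
    case True
    then show ?thesis using lam0_lowerbound[OF *] by simp
  next
    case False
    then show ?thesis using *[of v] assms(1) by (simp add: ext_lagrangian_def)
  qed
qed

lemma ext_lagrangian_nonneg: "0 \<le> ext_lagrangian L y v w"
proof (cases "v \<le> 0")
  case True
  have "ereal 0 \<le> ereal (b * norm w)" using b_pos by simp
  also have "\<dots> \<le> lam0 y w" by (rule ext_lagrangian_coercive) simp
  finally show ?thesis unfolding ext_lagrangian_nonpos[OF True] zero_ereal_def .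
next
  case False
  then show ?thesis using L_nonneg by (simp add: ext_lagrangian_def)
qed

text \<open>For \<open>v < 0\<close> the value is the one at \<open>v = 0\<close>, so homogeneity
  holds for every \<open>z\<close>, without a sign condition.\<close>

definition lam :: "real^'n \<Rightarrow> real \<times> (real^'k) \<Rightarrow> ennreal" where
  "lam y z = e2ennreal (ext_lagrangian L y (fst z) (snd z))"

lemma lam_pos: "v > 0 \<Longrightarrow> lam y (v, w) = ennreal (L y (w /\<^sub>R v) * v)"
  by (simp add: lam_def ext_lagrangian_def)

lemma tendsto_lam: "v \<le> 0 \<Longrightarrow> ((\<lambda>\<eta>. ennreal (L y (w /\<^sub>R \<eta>) * \<eta>)) \<longlongrightarrow> lam y (v, w)) (at_right 0)"
  using tendsto_e2ennrealI[OF tendsto_lam0[of y w]] ext_lagrangian_nonpos[of v y w] by (simp add: lam_def)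

text \<open>Homogeneity of degree one is what makes the cost independent of the parametrization. For
  \<open>v \<le> 0\<close> it comes from replacing \<open>\<eta>\<close> by
  \<open>c * \<eta>\<close> in the limit.\<close>

lemma lam_scale:
  assumes "c \<ge> 0"
  shows "lam y (c *\<^sub>R z) = ennreal c * lam y z"
proof -
  obtain v w where z: "z = (v, w)" by (cases z)
  consider "c = 0" | "c > 0" "v > 0" | "c > 0" "v \<le> 0" using assms by linarith
  then show ?thesis
  proof cases
    case 1
    have "((\<lambda>\<eta>. ennreal (L y (0 /\<^sub>R \<eta>) * \<eta>)) \<longlongrightarrow> ennreal (L y 0 * 0)) (at_right 0)"
      unfolding scaleR_zero_right by (intro tendsto_intros)
    then have "lam y (0, 0) = 0"
      using tendsto_unique[OF trivial_limit_at_right_real tendsto_lam[of 0 y 0]] by simp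
    then show ?thesis using 1 by (simp add: z zero_prod_def)
  next
    case 2
    then have "lam y (c *\<^sub>R z) = ennreal (c * (L y (w /\<^sub>R v) * v))"
      using scaleR_divideR_cancel[where c = c and w = w and v = v] by (simp add: z lam_pos mult_ac del: scaleR_scaleR inverse_mult_distrib)
    then show ?thesis using 2 L_nonneg by (simp add: z lam_pos ennreal_mult)
  next
    case 3
    have "filterlim (\<lambda>\<eta>. c * \<eta>) (at_right 0) (at_right (0::real))"
    proof -
      have "((\<lambda>\<eta>. c * \<eta>) \<longlongrightarrow> c * 0) (at_right 0)" by (intro tendsto_intros)
      moreover have "\<forall>\<^sub>F \<eta> in at_right 0. c * \<eta> \<in> {0<..} \<and> c * \<eta> \<noteq> 0"
        unfolding eventually_at_right_field using 3(1) by (intro exI[of _ 1]) auto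
      ultimately show ?thesis unfolding filterlim_at by simp
    qed
    from filterlim_compose[OF tendsto_lam[of "c * v" y "c *\<^sub>R w"] this]
    have "((\<lambda>\<eta>. ennreal (L y ((c *\<^sub>R w) /\<^sub>R (c * \<eta>)) * (c * \<eta>))) \<longlongrightarrow> lam y (c *\<^sub>R z)) (at_right 0)"
      using 3 by (simp add: z mult_nonneg_nonpos)
    moreover have "ennreal (L y ((c *\<^sub>R w) /\<^sub>R (c * \<eta>)) * (c * \<eta>)) = ennreal c * ennreal (L y (w /\<^sub>R \<eta>) * \<eta>)"
      if "\<eta> > 0" for \<eta>
    proof -
      have "(c *\<^sub>R w) /\<^sub>R (c * \<eta>) = w /\<^sub>R \<eta>" using 3 by (intro scaleR_divideR_cancel) simp
      then show ?thesis using 3 that L_nonneg[of y "w /\<^sub>R \<eta>"]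
        by (simp add: ennreal_mult[symmetric] mult_ac del: scaleR_scaleR inverse_mult_distrib)
    qed
    then have "\<forall>\<^sub>F \<eta> in at_right 0. ennreal (L y ((c *\<^sub>R w) /\<^sub>R (c * \<eta>)) * (c * \<eta>)) = ennreal c * ennreal (L y (w /\<^sub>R \<eta>) * \<eta>)"
      unfolding eventually_at_right_field by (intro exI[of _ 1]) auto
    ultimately have "((\<lambda>\<eta>. ennreal c * ennreal (L y (w /\<^sub>R \<eta>) * \<eta>)) \<longlongrightarrow> lam y (c *\<^sub>R z)) (at_right 0)"
      by (rule Lim_transform_eventually)
    moreover have "((\<lambda>\<eta>. ennreal c * ennreal (L y (w /\<^sub>R \<eta>) * \<eta>)) \<longlongrightarrow> ennreal c * lam y z) (at_right 0)"
      unfolding z by (intro tendsto_lam[OF 3(2)] ennreal_tendsto_cmult) simp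
    ultimately show ?thesis by (rule tendsto_unique[OF trivial_limit_at_right_real])
  qed
qed

text \<open>On \<open>v \<le> 0\<close> the function is a pointwise limit of Borel functions along
  \<open>\<eta> = 1 / (n + 1)\<close>; on \<open>v > 0\<close> it is explicit.\<close>

lemma borel_measurable_lam: "(\<lambda>(y, z). lam y z) \<in> borel_measurable borel"
proof -
  have [measurable]: "(\<lambda>(x, u). L x u) \<in> borel_measurable borel"
    by (rule borel_measurable_continuous_onI[OF continuous])
  have m: "(\<lambda>x. L (f x) (g x)) \<in> borel_measurable borel"
    if [measurable]: "f \<in> borel_measurable borel" "g \<in> borel_measurable borel"
    for f :: "(real^'n) \<times> (real \<times> (real^'k)) \<Rightarrow> real^'n" and g
    using measurable_compose[OF borel_measurable_Pair[OF that] borel_measurable_continuous_onI[OF continuous]] by simp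
  have c: "fst \<in> borel_measurable (borel :: ((real^'n) \<times> (real \<times> (real^'k))) measure)"
    "(\<lambda>x. fst (snd x)) \<in> borel_measurable (borel :: ((real^'n) \<times> (real \<times> (real^'k))) measure)"
    "(\<lambda>x. snd (snd x)) \<in> borel_measurable (borel :: ((real^'n) \<times> (real \<times> (real^'k))) measure)"
    by (intro borel_measurable_continuous_onI continuous_intros)+
  note [measurable] = c
  define r where "r = (\<lambda>x::(real^'n) \<times> (real \<times> (real^'k)). lam (fst x) (0, snd (snd x)))"
  have [measurable]: "r \<in> borel_measurable borel"
  proof (rule borel_measurable_LIMSEQ_order)
    fix x :: "(real^'n) \<times> (real \<times> (real^'k))"
    have "filterlim (\<lambda>n. inverse (real (Suc n))) (at_right 0) sequentially"
      using LIMSEQ_inverse_real_of_nat by (simp add: filterlim_at)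
    from filterlim_compose[OF tendsto_lam this]
    show "(\<lambda>n. ennreal (L (fst x) (snd (snd x) /\<^sub>R inverse (real (Suc n))) * inverse (real (Suc n)))) \<longlonglongrightarrow> r x"
      by (simp add: r_def)
    have [measurable]: "(\<lambda>x::(real^'n) \<times> (real \<times> (real^'k)). L (fst x) (snd (snd x) /\<^sub>R inverse (real (Suc n)))) \<in> borel_measurable borel" for n
      by (rule m) (intro borel_measurable_continuous_onI continuous_intros; simp)+
    show "(\<lambda>x::(real^'n) \<times> (real \<times> (real^'k)). ennreal (L (fst x) (snd (snd x) /\<^sub>R inverse (real (Suc n))) * inverse (real (Suc n)))) \<in> borel_measurable borel" for n
      by measurable
  qed
  have "(\<lambda>x. L (fst x) (snd (snd x) /\<^sub>R fst (snd x))) \<in> borel_measurable borel"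
    by (rule m) measurable
  then have "(\<lambda>x. if fst (snd x) > 0 then ennreal (L (fst x) (snd (snd x) /\<^sub>R fst (snd x)) * fst (snd x)) else r x) \<in> borel_measurable borel"
    by measurable
  also have "(\<lambda>x. if fst (snd x) > 0 then ennreal (L (fst x) (snd (snd x) /\<^sub>R fst (snd x)) * fst (snd x)) else r x)
      = (\<lambda>(y, z). lam y z)"
    by (auto simp: fun_eq_iff r_def lam_def ext_lagrangian_def)
  finally show ?thesis .
qed

text \<open>A hyperplane separates the closed convex epigraph from the point at distance
  \<open>\<epsilon>\<close> below the graph over \<open>u0\<close>.\<close>

lemma exists_affine_minorant:
  assumes "\<epsilon> > 0"
  obtains \<alpha> q where "\<And>u. \<alpha> + q \<bullet> u \<le> L y u" "L y u0 - \<epsilon> < \<alpha> + q \<bullet> u0"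
proof -
  define E where "E = {x :: (real^'k) \<times> real. L y (fst x) \<le> snd x}"
  have "convex E"
    unfolding convex_alt
  proof (intro ballI allI impI)
    fix x x' and t :: real assume x: "x \<in> E" "x' \<in> E" and t: "0 \<le> t \<and> t \<le> 1"
    have "L y ((1 - t) *\<^sub>R fst x + t *\<^sub>R fst x') \<le> (1 - t) * L y (fst x) + t * L y (fst x')"
      using convex_onD[OF convex[of y], of t "fst x" "fst x'"] t by simp
    also have "\<dots> \<le> (1 - t) * snd x + t * snd x'"
      using x t by (intro add_mono mult_left_mono) (auto simp: E_def)
    finally show "(1 - t) *\<^sub>R x + t *\<^sub>R x' \<in> E" by (simp add: E_def)
  qed
  moreover have "closed E"
    unfolding E_def by (intro closed_Collect_le continuous_L continuous_intros)
  moreover have "(u0, L y u0 - \<epsilon>) \<notin> E" using assms by (simp add: E_def)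
  ultimately obtain a \<beta> where a: "a \<bullet> (u0, L y u0 - \<epsilon>) < \<beta>" "\<And>x. x \<in> E \<Longrightarrow> a \<bullet> x > \<beta>"
    using separating_hyperplane_closed_point by metis
  obtain p r where pr: "a = (p, r)" by (cases a)
  have lower: "p \<bullet> u + r * L y u > \<beta>" for u
    using a(2)[of "(u, L y u)"] by (simp add: E_def pr)
  have "p \<bullet> u0 + r * (L y u0 - \<epsilon>) < \<beta>" using a(1) by (simp add: pr)
  \<comment> \<open>The hyperplane is not vertical: it separates two points over the same
    \<open>u0\<close>, so the coefficient \<open>r\<close> of the height is positive and can be
    divided by.\<close>
  with lower[of u0] have "r * \<epsilon> > 0" by (simp add: algebra_simps)
  then have r: "r > 0" using assms by (simp add: zero_less_mult_iff)
  show ?thesis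
  proof
    show "\<beta> / r + (- (p /\<^sub>R r)) \<bullet> u \<le> L y u" for u
      using lower[of u] r by (simp add: field_simps)
    show "L y u0 - \<epsilon> < \<beta> / r + (- (p /\<^sub>R r)) \<bullet> u0"
      using \<open>p \<bullet> u0 + r * (L y u0 - \<epsilon>) < \<beta>\<close> r by (simp add: field_simps)
  qed
qed

text \<open>
  Convexity propagates the estimate from a large ball of controls, on which \<open>L\<close> is uniformly
  continuous, to all controls.
\<close>

lemma affine_minorant_perturb:
  assumes minorant: "\<And>u. \<alpha> + q \<bullet> u \<le> L y0 u" and "\<epsilon> > 0"
  obtains \<delta> where "\<delta> > 0" "\<And>y u. dist y y0 < \<delta> \<Longrightarrow> \<alpha> + q \<bullet> u - \<epsilon> * (1 + norm u) \<le> L y u"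
proof -
  define H where "H = (\<lambda>y u. L y u - \<alpha> - q \<bullet> u)"
  have "continuous_on (cball y0 1) (\<lambda>y. H y 0)"
    unfolding H_def by (intro continuous_intros continuous_L)
  then have "bounded ((\<lambda>y. H y 0) ` cball y0 1)"
    by (intro compact_imp_bounded compact_continuous_image) auto
  then obtain M where M: "\<And>y. y \<in> cball y0 1 \<Longrightarrow> \<bar>H y 0\<bar> \<le> M" unfolding bounded_iff real_norm_def by blast
  have "M \<ge> 0" using M[of y0] by simp
  \<comment> \<open>Outside this radius the loss \<open>\<epsilon> / 2 + M\<close> of the convexity
    estimate is absorbed by \<open>\<epsilon> * norm u\<close>; the summand 1 keeps \<open>u\<close>
    away from zero there.\<close>
  define R where "R = (\<epsilon> / 2 + M) / \<epsilon> + 1"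
  have R: "R \<ge> 1" "\<epsilon> / 2 + M \<le> \<epsilon> * R" using \<open>\<epsilon> > 0\<close> \<open>M \<ge> 0\<close> by (auto simp: R_def field_simps)
  have "continuous_on (cball y0 1 \<times> cball 0 R) (\<lambda>z. H (fst z) (snd z))"
    unfolding H_def by (intro continuous_intros continuous_L)
  then have "uniformly_continuous_on (cball y0 1 \<times> cball 0 R) (\<lambda>z. H (fst z) (snd z))"
    by (intro compact_uniformly_continuous compact_Times) auto
  then obtain d where d: "d > 0" "\<And>z z'. z \<in> cball y0 1 \<times> cball 0 R \<Longrightarrow> z' \<in> cball y0 1 \<times> cball 0 R \<Longrightarrow>
      dist z' z < d \<Longrightarrow> dist (H (fst z') (snd z')) (H (fst z) (snd z)) < \<epsilon> / 2"
    unfolding uniformly_continuous_on_def using \<open>\<epsilon> > 0\<close> by (metis half_gt_zero)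
  have H0: "H y0 u \<ge> 0" for u using minorant[of u] by (simp add: H_def)
  have near: "H y u \<ge> - \<epsilon> / 2" if "dist y y0 < min d 1" "norm u \<le> R" for y u
  proof -
    have "dist (H y u) (H y0 u) < \<epsilon> / 2"
      using d(2)[of "(y0, u)" "(y, u)"] that by (simp add: dist_Pair_Pair dist_commute)
    then show ?thesis using H0[of u] unfolding dist_real_def by linarith
  qed
  show ?thesis
  proof
    show "min d 1 > 0" using d(1) by simp
    fix y u assume y: "dist y y0 < min d 1"
    have "H y u \<ge> - \<epsilon> * (1 + norm u)"
    proof (cases "norm u \<le> R")
      case True
      have "\<epsilon> / 2 \<le> \<epsilon> * (1 + norm u)" using \<open>\<epsilon> > 0\<close> by (simp add: algebra_simps)
      with near[OF y True] show ?thesis by simp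
    next
      case False
      \<comment> \<open>\<open>t *\<^sub>R u\<close> lies on the sphere of radius \<open>R\<close>,
        where the estimate \<open>near\<close> holds; convexity along the ray from 0 carries it to
        \<open>u\<close>.\<close>
      define t where "t = R / norm u"
      have "norm u > 0" using False R by linarith
      then have t: "0 < t" "t < 1" "norm (t *\<^sub>R u) \<le> R" "t * norm u = R"
        using False R by (auto simp: t_def field_simps)
      have "H y (t *\<^sub>R u) \<le> t * H y u + (1 - t) * H y 0"
        using L_shrink_le[of t y u] t by (simp add: H_def algebra_simps)
      moreover have "(1 - t) * H y 0 \<le> (1 - t) * M"
        using M[of y] y t by (intro mult_left_mono) (auto simp: dist_commute)
      moreover have "(1 - t) * M \<le> 1 * M" using t \<open>M \<ge> 0\<close> by (intro mult_right_mono) auto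
      ultimately have "- (\<epsilon> / 2 + M) \<le> t * H y u" using near[OF y t(3)] by linarith
      then have "- (\<epsilon> * (t * norm u)) \<le> t * H y u" using R(2) t(4) by simp
      then have "t * (- (\<epsilon> * norm u)) \<le> t * H y u" by (simp add: mult_ac)
      then have "- (\<epsilon> * norm u) \<le> H y u" using t(1) by (simp only: mult_le_cancel_left_pos)
      then show ?thesis using \<open>\<epsilon> > 0\<close> by (simp add: algebra_simps)
    qed
    then show "\<alpha> + q \<bullet> u - \<epsilon> * (1 + norm u) \<le> L y u" by (simp add: H_def)
  qed
qed

text \<open>The extended Lagrangian is the supremum of \<open>\<alpha> * v + q \<bullet> w\<close>
  over the affine minorants \<open>\<alpha> + q \<bullet> u\<close> of \<open>L y\<close>. At
  \<open>v0 = 0\<close> only the slope \<open>q\<close> counts, and a steep enough minorant is found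
  by touching \<open>L y\<close> far out, at \<open>w0 / \<eta>\<close>.\<close>

lemma exists_linear_minorant:
  assumes v: "v0 \<ge> 0" and c: "ereal c < ext_lagrangian L y v0 w0"
  obtains \<alpha> q where "c < \<alpha> * v0 + q \<bullet> w0" "\<And>u. \<alpha> + q \<bullet> u \<le> L y u"
proof (cases "v0 = 0")
  case False
  then have v0: "v0 > 0" using v by simp
  define \<epsilon> where "\<epsilon> = L y (w0 /\<^sub>R v0) - c / v0"
  have "c < L y (w0 /\<^sub>R v0) * v0" using c v0 by (simp add: ext_lagrangian_def)
  then have "\<epsilon> > 0" using v0 by (simp add: \<epsilon>_def field_simps)
  then obtain \<alpha> q where \<alpha>q: "\<And>u. \<alpha> + q \<bullet> u \<le> L y u" "L y (w0 /\<^sub>R v0) - \<epsilon> < \<alpha> + q \<bullet> (w0 /\<^sub>R v0)"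
    using exists_affine_minorant[of \<epsilon> y "w0 /\<^sub>R v0"] by metis
  have "c / v0 < \<alpha> + q \<bullet> (w0 /\<^sub>R v0)" using \<alpha>q(2) by (simp add: \<epsilon>_def)
  then have "c < \<alpha> * v0 + q \<bullet> w0" using v0 by (simp add: field_simps)
  then show ?thesis using that \<alpha>q(1) by blast
next
  case True
  obtain c' where c': "c < c'" "ereal c' < lam0 y w0"
    using ereal_dense2[OF c] True by (metis ereal_less(2) less_ereal.simps(1))
  have "\<forall>\<^sub>F \<eta> in at_right 0. ereal c' < ereal (L y (w0 /\<^sub>R \<eta>) * \<eta>)"
    by (rule order_tendstoD(1)[OF tendsto_lam0 c'(2)])
  then obtain \<eta>1 where \<eta>1: "\<eta>1 > 0" "\<And>\<eta>. 0 < \<eta> \<Longrightarrow> \<eta> < \<eta>1 \<Longrightarrow> c' < L y (w0 /\<^sub>R \<eta>) * \<eta>"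
    unfolding eventually_at_right_field by auto
  \<comment> \<open>The touching gap 1 and the constant term, which is at most \<open>L y 0\<close>,
    cost together at most \<open>\<eta> * (1 + L y 0)\<close>. This must fit into
    \<open>c' - c\<close>. Halving \<open>\<eta>1\<close> keeps the inequality strict.\<close>
  define \<eta> where "\<eta> = min (\<eta>1 / 2) ((c' - c) / (1 + L y 0))"
  have pos: "1 + L y 0 > 0" using L_nonneg[of y 0] by linarith
  have "\<eta> \<le> (c' - c) / (1 + L y 0)" by (simp add: \<eta>_def)
  then have "\<eta> * (1 + L y 0) \<le> c' - c" using pos by (simp only: pos_le_divide_eq)
  moreover have "\<eta> > 0" using \<eta>1(1) c'(1) pos by (simp add: \<eta>_def)
  moreover have "\<eta> < \<eta>1" using \<eta>1(1) unfolding \<eta>_def by linarith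
  ultimately have \<eta>: "\<eta> > 0" "\<eta> < \<eta>1" "\<eta> * (1 + L y 0) \<le> c' - c" by auto
  obtain \<alpha> q where \<alpha>q: "\<And>u. \<alpha> + q \<bullet> u \<le> L y u" "L y (w0 /\<^sub>R \<eta>) - 1 < \<alpha> + q \<bullet> (w0 /\<^sub>R \<eta>)"
    using exists_affine_minorant[of 1 y "w0 /\<^sub>R \<eta>"] by (metis zero_less_one)
  have "\<alpha> \<le> L y 0" using \<alpha>q(1)[of 0] by simp
  then have "L y (w0 /\<^sub>R \<eta>) - 1 - L y 0 < q \<bullet> (w0 /\<^sub>R \<eta>)" using \<alpha>q(2) by linarith
  then have "(L y (w0 /\<^sub>R \<eta>) - 1 - L y 0) * \<eta> < q \<bullet> (w0 /\<^sub>R \<eta>) * \<eta>" using \<eta>(1) by simp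
  also have "q \<bullet> (w0 /\<^sub>R \<eta>) * \<eta> = q \<bullet> w0" using \<eta>(1) by simp
  finally have "L y (w0 /\<^sub>R \<eta>) * \<eta> - \<eta> * (1 + L y 0) < q \<bullet> w0" by (simp add: algebra_simps)
  then have "c < q \<bullet> w0" using \<eta>1(2)[OF \<eta>(1,2)] \<eta>(3) by linarith
  then show ?thesis using that[of \<alpha> q] \<alpha>q(1) True by simp
qed

end

section \<open>Integrals of increments and growth estimates\<close>

text \<open>The integral of \<open>G (t + h) - G t\<close> telescopes to the integral of
  \<open>G\<close> over \<open>[T, T + h]\<close> minus that over \<open>[0, h]\<close>, which
  monotonicity bounds by \<open>h * (G (T + h) - G 0)\<close>.\<close>

lemma nn_integral_shift_difference_le:
  fixes G :: "real \<Rightarrow> real"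
  assumes G: "continuous_on UNIV G" "mono G" and T: "0 \<le> T" and h: "0 < h"
  shows "(\<integral>\<^sup>+t. ennreal ((G (t + h) - G t) / h) \<partial>lebesgue_on {0..T}) \<le> ennreal (G (T + h) - G 0)"
proof -
  have int: "G integrable_on {s..t}" for s t
    by (rule integrable_continuous_real) (rule continuous_on_subset[OF G(1) subset_UNIV])
  have int': "(\<lambda>t. G (t + h)) integrable_on {s..t}" for s t
    by (intro integrable_continuous_real continuous_on_compose2[OF G(1)] continuous_intros) auto
  have "integral {0..T} (\<lambda>t. G (t + h)) = integral {h..T + h} G"
    using integral_shift[of 0 h T G] continuous_on_subset[OF G(1) subset_UNIV] by (simp add: o_def add.commute)
  moreover have "integral {0..h} G + integral {h..T + h} G = integral {0..T + h} G"
    by (rule Henstock_Kurzweil_Integration.integral_combine) (use T h int in auto)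
  moreover have "integral {0..T} G + integral {T..T + h} G = integral {0..T + h} G"
    by (rule Henstock_Kurzweil_Integration.integral_combine) (use T h int in auto)
  moreover have "integral {T..T + h} G \<le> integral {T..T + h} (\<lambda>_. G (T + h))"
    by (rule integral_le) (use int G(2) in \<open>auto simp: mono_def\<close>)
  moreover have "integral {0..h} (\<lambda>_. G 0) \<le> integral {0..h} G"
    by (rule integral_le) (use int G(2) in \<open>auto simp: mono_def\<close>)
  ultimately have le: "integral {0..T} (\<lambda>t. G (t + h)) - integral {0..T} G \<le> h * (G (T + h) - G 0)"
    using h by (simp add: algebra_simps)
  define I where "I = (integral {0..T} (\<lambda>t. G (t + h)) - integral {0..T} G) / h"
  have "((\<lambda>t. (G (t + h) - G t) / h) has_integral I) {0..T}"
    unfolding I_def by (intro has_integral_divide has_integral_diff integrable_integral int int')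
  moreover have "0 \<le> (G (t + h) - G t) / h" for t
    using G(2) h by (simp add: mono_def)
  ultimately have "(\<integral>\<^sup>+t. ennreal ((G (t + h) - G t) / h) * indicator {0..T} t \<partial>lborel) = ennreal I"
    by (intro nn_integral_has_integral_lebesgue') auto
  moreover have "I \<le> G (T + h) - G 0" using le h by (simp add: I_def field_simps)
  ultimately show ?thesis by (simp add: nn_integral_lebesgue_on ennreal_leI)
qed

text \<open>
  Fatou's lemma, applied twice to difference quotients: it replaces both the weak lower
  semicontinuity of integral functionals and the differentiation of measures.
\<close>

lemma nn_integral_le_liminf_increments:
  fixes \<Theta> :: "nat \<Rightarrow> real \<Rightarrow> real" and \<phi> :: "real \<Rightarrow> ennreal"
  assumes T: "0 \<le> T" and cont: "\<And>n. continuous_on {0..T} (\<Theta> n)" and mono: "\<And>n. mono_on {0..T} (\<Theta> n)"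
    and h: "\<And>k. h k > 0"
    and le: "AE t in lebesgue_on {0..T}.
      \<phi> t \<le> liminf (\<lambda>k. liminf (\<lambda>n. ennreal ((\<Theta> n (min T (t + h k)) - \<Theta> n t) / h k)))"
  shows "(\<integral>\<^sup>+t. \<phi> t \<partial>lebesgue_on {0..T}) \<le> liminf (\<lambda>n. ennreal (\<Theta> n T - \<Theta> n 0))"
proof -
  \<comment> \<open>Continued by its end values, the function has no increment beyond
    \<open>T\<close>, so the shifted bound still ends at \<open>\<Theta> n T\<close>.\<close>
  define G where "G = (\<lambda>n x. \<Theta> n (max 0 (min T x)))"
  have cl: "max 0 (min T x) \<in> {0..T}" for x using T by auto
  have Gcont: "continuous_on UNIV (G n)" for n
    unfolding G_def by (rule continuous_on_compose2[OF cont]) (use cl in \<open>auto intro!: continuous_intros\<close>)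
  have Gmono: "mono (G n)" for n
    unfolding G_def mono_def by (intro allI impI mono_onD[OF mono] cl) auto
  have [measurable]: "G n \<in> borel_measurable borel" for n
    by (rule borel_measurable_continuous_onI[OF Gcont])
  define D where "D = (\<lambda>k n t. ennreal ((G n (t + h k) - G n t) / h k))"
  have "D k n \<in> borel_measurable lborel" for k n unfolding D_def by measurable
  then have [measurable]: "D k n \<in> borel_measurable (lebesgue_on {0..T})" for k n
    by (intro measurable_restrict_space1 measurable_completion)
  have "AE t in lebesgue_on {0..T}. t \<in> {0..T}" using AE_space[of "lebesgue_on {0..T}"] by simp
  with le have "AE t in lebesgue_on {0..T}. \<phi> t \<le> liminf (\<lambda>k. liminf (\<lambda>n. D k n t))"
  proof eventually_elim
    case (elim t)
    have "G n (t + h k) = \<Theta> n (min T (t + h k))" "G n t = \<Theta> n t" for n k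
      using elim(2) h[of k] T by (auto simp: G_def)
    with elim(1) show ?case by (simp add: D_def)
  qed
  then have "(\<integral>\<^sup>+t. \<phi> t \<partial>lebesgue_on {0..T}) \<le> (\<integral>\<^sup>+t. liminf (\<lambda>k. liminf (\<lambda>n. D k n t)) \<partial>lebesgue_on {0..T})"
    by (rule nn_integral_mono_AE)
  also have "\<dots> \<le> liminf (\<lambda>k. \<integral>\<^sup>+t. liminf (\<lambda>n. D k n t) \<partial>lebesgue_on {0..T})"
    by (rule nn_integral_liminf) measurable
  also have "\<dots> \<le> liminf (\<lambda>k::nat. liminf (\<lambda>n. ennreal (\<Theta> n T - \<Theta> n 0)))"
  proof (rule Liminf_mono, rule always_eventually, rule allI)
    fix k
    have "(\<integral>\<^sup>+t. liminf (\<lambda>n. D k n t) \<partial>lebesgue_on {0..T}) \<le> liminf (\<lambda>n. \<integral>\<^sup>+t. D k n t \<partial>lebesgue_on {0..T})"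
      by (rule nn_integral_liminf) measurable
    also have "\<dots> \<le> liminf (\<lambda>n. ennreal (\<Theta> n T - \<Theta> n 0))"
    proof (rule Liminf_mono, rule always_eventually, rule allI)
      fix n
      have "(\<integral>\<^sup>+t. D k n t \<partial>lebesgue_on {0..T}) \<le> ennreal (G n (T + h k) - G n 0)"
        unfolding D_def by (rule nn_integral_shift_difference_le[OF Gcont Gmono T h])
      also have "G n (T + h k) = \<Theta> n T" using T h[of k] by (simp add: G_def)
      also have "G n 0 = \<Theta> n 0" using T by (simp add: G_def)
      finally show "(\<integral>\<^sup>+t. D k n t \<partial>lebesgue_on {0..T}) \<le> ennreal (\<Theta> n T - \<Theta> n 0)" .
    qed
    finally show "(\<integral>\<^sup>+t. liminf (\<lambda>n. D k n t) \<partial>lebesgue_on {0..T}) \<le> liminf (\<lambda>n. ennreal (\<Theta> n T - \<Theta> n 0))" .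
  qed
  also have "\<dots> = liminf (\<lambda>n. ennreal (\<Theta> n T - \<Theta> n 0))" by (simp add: Liminf_const)
  finally show ?thesis .
qed

lemma gronwall:
  fixes h :: "real \<Rightarrow> real"
  assumes cont: "continuous_on {0..S} h" and K: "K \<ge> 0"
    and le: "\<And>t. 0 \<le> t \<Longrightarrow> t \<le> S \<Longrightarrow> h t \<le> c + K * integral {0..t} h" and t: "0 \<le> t" "t \<le> S"
  shows "h t \<le> c * exp (K * t)"
proof -
  define I where "I = (\<lambda>t. integral {0..t} h)"
  define g where "g = (\<lambda>t. (c + K * I t) * exp (- K * t))"
  have I: "(I has_real_derivative h x) (at x)" if "0 < x" "x < t" for x
  proof -
    have "(I has_vector_derivative h x) (at x within {0..S})"
      unfolding I_def using cont that t by (intro integral_has_vector_derivative) auto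
    then show ?thesis
      using that t at_within_Icc_at[of 0 x S] by (simp add: has_real_derivative_iff_has_vector_derivative)
  qed
  have Icont: "continuous_on {0..t} I"
    unfolding I_def using cont t
    by (intro indefinite_integral_continuous_1 integrable_continuous_real) (auto elim: continuous_on_subset)
  have "g t \<le> g 0"
  proof (rule DERIV_nonpos_imp_decreasing_open[OF t(1)])
    fix x assume x: "0 < x" "x < t"
    have "(g has_real_derivative K * exp (- K * x) * (h x - (c + K * I x))) (at x)"
      unfolding g_def by (rule derivative_eq_intros I[OF x] refl)+ (simp add: algebra_simps)
    moreover have "K * exp (- K * x) * (h x - (c + K * I x)) \<le> 0"
      using le[of x] x t K unfolding I_def by (intro mult_nonneg_nonpos) auto
    ultimately show "\<exists>y. (g has_real_derivative y) (at x) \<and> y \<le> 0" by blast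
  next
    show "continuous_on {0..t} g" unfolding g_def by (intro continuous_intros Icont)
  qed
  also have "g 0 = c" by (simp add: g_def I_def)
  finally have "(c + K * I t) * exp (- K * t) * exp (K * t) \<le> c * exp (K * t)"
    unfolding g_def by (intro mult_right_mono) auto
  moreover have "(c + K * I t) * exp (- K * t) * exp (K * t) = c + K * I t"
    by (simp add: mult.assoc mult_exp_exp)
  ultimately have "c + K * I t \<le> c * exp (K * t)" by linarith
  then show ?thesis using le[OF t] by (simp add: I_def)
qed

section \<open>Velocities of monotone and of Lipschitz curves\<close>

lemma has_velocity_nonneg:
  fixes q :: "real \<Rightarrow> real"
  assumes q: "has_velocity S q \<xi>" and mono: "mono_on {0..S} q"
  shows "AE t in lebesgue_on {0..S}. \<xi> t \<ge> 0"
proof -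
  have "AE t in lebesgue_on {0..S}. t \<noteq> S"
    by (subst AE_lebesgue_on_iff_negligible) (auto intro: negligible_subset[of "{S}"])
  moreover have "AE t in lebesgue_on {0..S}. t \<in> {0..S}" using AE_space[of "lebesgue_on {0..S}"] by simp
  moreover have "AE t in lebesgue_on {0..S}. (q has_vector_derivative \<xi> t) (at t)"
    using q by (simp add: has_velocity_def)
  ultimately show ?thesis
  proof eventually_elim
    case (elim t)
    have "((\<lambda>h. (q (t + h) - q t) /\<^sub>R h) \<longlongrightarrow> \<xi> t) (at_right 0)"
      by (rule tendsto_within_subset[OF has_vector_derivative_quotient_limit[OF elim(3)] subset_UNIV])
    moreover have "0 \<le> (q (t + h) - q t) /\<^sub>R h" if "0 < h" "h < S - t" for h
      using mono_onD[OF mono, of t "t + h"] elim(2) that by simp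
    then have "\<forall>\<^sub>F h in at_right 0. 0 \<le> (q (t + h) - q t) /\<^sub>R h"
      unfolding eventually_at_right_field using elim(1,2) by (intro exI[of _ "S - t"]) auto
    ultimately show ?case by (rule tendsto_lowerbound) (simp add: trivial_limit_at_right_real)
  qed
qed

lemma has_velocity_lipschitz_norm_le:
  fixes p :: "real \<Rightarrow> 'a::real_normed_vector"
  assumes p: "has_velocity S p \<zeta>" and lip: "c-lipschitz_on {0..S} p"
  shows "AE t in lebesgue_on {0..S}. norm (\<zeta> t) \<le> c"
proof -
  have "AE t in lebesgue_on {0..S}. t \<noteq> S"
    by (subst AE_lebesgue_on_iff_negligible) (auto intro: negligible_subset[of "{S}"])
  moreover have "AE t in lebesgue_on {0..S}. t \<in> {0..S}" using AE_space[of "lebesgue_on {0..S}"] by simp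
  moreover have "AE t in lebesgue_on {0..S}. (p has_vector_derivative \<zeta> t) (at t)"
    using p by (simp add: has_velocity_def)
  ultimately show ?thesis
  proof eventually_elim
    case (elim t)
    have "((\<lambda>h. norm ((p (t + h) - p t) /\<^sub>R h)) \<longlongrightarrow> norm (\<zeta> t)) (at_right 0)"
      by (intro tendsto_norm tendsto_within_subset[OF has_vector_derivative_quotient_limit[OF elim(3)] subset_UNIV])
    moreover have "norm ((p (t + h) - p t) /\<^sub>R h) \<le> c" if "0 < h" "h < S - t" for h
    proof -
      have "norm (p (t + h) - p t) \<le> c * h"
        using lipschitz_onD[OF lip, of "t + h" t] elim(2) that by (simp add: dist_norm)
      moreover have "norm ((p (t + h) - p t) /\<^sub>R h) = norm (p (t + h) - p t) / h"
        using that by (simp only: norm_scaleR abs_inverse divide_inverse mult.commute abs_of_pos)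
      ultimately show ?thesis using that by (simp add: pos_divide_le_eq)
    qed
    then have "\<forall>\<^sub>F h in at_right 0. norm ((p (t + h) - p t) /\<^sub>R h) \<le> c"
      unfolding eventually_at_right_field using elim(1,2) by (intro exI[of _ "S - t"]) auto
    ultimately show ?case by (rule tendsto_upperbound) (simp add: trivial_limit_at_right_real)
  qed
qed

section \<open>The control system of the relaxed problem\<close>

lemma ctrl_map_linear: "linear (ctrl_map g y)"
  by (rule linearI) (simp_all add: ctrl_map_def scaleR_add_left sum.distrib scaleR_sum_right)

lemma norm_ctrl_map_diff_le:
  "norm (ctrl_map g y u - ctrl_map g' y' u) \<le> (\<Sum>i\<in>UNIV. norm (g i y - g' i y')) * norm u"
proof -
  have "ctrl_map g y u - ctrl_map g' y' u = (\<Sum>i\<in>UNIV. (u $ i) *\<^sub>R (g i y - g' i y'))"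
    by (simp add: ctrl_map_def sum_subtractf scaleR_diff_right)
  also have "norm \<dots> \<le> (\<Sum>i\<in>UNIV. norm u * norm (g i y - g' i y'))"
    by (rule sum_norm_le) (simp add: mult_right_mono component_le_norm_cart)
  finally show ?thesis by (simp add: sum_distrib_left mult.commute)
qed

lemma local_lipschitz_cball:
  fixes F :: "real^'n \<Rightarrow> real^'n"
  assumes "local_lipschitz (UNIV::real set) UNIV (\<lambda>_. F)"
  shows "\<exists>K\<ge>0. \<forall>y\<in>cball 0 R. \<forall>y'\<in>cball 0 R. norm (F y) \<le> K \<and> norm (F y - F y') \<le> K * norm (y - y')"
proof -
  have ll: "local_lipschitz {0::real} (cball 0 R) (\<lambda>_. F)"
    by (rule local_lipschitz_subset[OF assms]) auto
  obtain K where K: "\<And>t. t \<in> {0::real} \<Longrightarrow> K-lipschitz_on (cball 0 R) F"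
    using local_lipschitz_compact_implies_lipschitz[OF ll compact_cball compact_sing] by (metis continuous_on_const)
  then have lip: "K-lipschitz_on (cball 0 R) F" by simp
  have "bounded (F ` cball 0 R)"
    by (intro compact_imp_bounded compact_continuous_image lipschitz_on_continuous_on[OF lip]) auto
  then obtain M where M: "\<And>y. y \<in> cball 0 R \<Longrightarrow> norm (F y) \<le> M" unfolding bounded_iff by blast
  have "K \<ge> 0" by (rule lipschitz_on_nonneg[OF lip])
  show ?thesis
  proof (intro exI[of _ "max K M"] conjI ballI)
    show "0 \<le> max K M" using \<open>K \<ge> 0\<close> by simp
    fix y y' :: "real^'n" assume y: "y \<in> cball 0 R" "y' \<in> cball 0 R"
    show "norm (F y) \<le> max K M" using M[OF y(1)] by simp
    have "norm (F y - F y') \<le> K * norm (y - y')" using lipschitz_onD[OF lip y] by (simp add: dist_norm)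
    also have "\<dots> \<le> max K M * norm (y - y')" by (intro mult_right_mono) auto
    finally show "norm (F y - F y') \<le> max K M * norm (y - y')" .
  qed
qed

text \<open>Since the drift \<open>f\<close> is multiplied by the control \<open>v\<close>, the
  right-hand side is linear in the pair \<open>(v, w)\<close> and fits
  \<open>control_system\<close>.\<close>

definition ctrl :: "(real^'n \<Rightarrow> real^'n) \<Rightarrow> ('k \<Rightarrow> real^'n \<Rightarrow> real^'n) \<Rightarrow> real^'n \<Rightarrow> real \<times> (real^'k) \<Rightarrow> real^'n" where
  "ctrl f g y z = fst z *\<^sub>R f y + ctrl_map g y (snd z)"

lemma ctrl_field_eq: "ctrl_field f g v w = (\<lambda>t y. ctrl f g y (v t, w t))"
  by (simp add: fun_eq_iff ctrl_field_def ctrl_def)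

lemma control_system_ctrl:
  fixes f :: "real^'n \<Rightarrow> real^'n" and g :: "'k::finite \<Rightarrow> real^'n \<Rightarrow> real^'n"
  assumes f: "local_lipschitz (UNIV::real set) UNIV (\<lambda>_. f)"
    and g: "\<And>i. local_lipschitz (UNIV::real set) UNIV (\<lambda>_. g i)"
  shows "control_system (ctrl f g)"
proof (rule control_system.intro)
  fix y :: "real^'n"
  interpret A: Vector_Spaces.linear "(*\<^sub>R)" "(*\<^sub>R)" "ctrl_map g y"
    using ctrl_map_linear[of g y] by (simp add: linear_def)
  show "linear (ctrl f g y)"
    by (rule linearI) (simp_all add: ctrl_def A.add A.scale algebra_simps)
next
  fix R :: real
  obtain K0 where K0: "K0 \<ge> 0" "\<And>y y'. y \<in> cball 0 R \<Longrightarrow> y' \<in> cball 0 R \<Longrightarrow>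
      norm (f y) \<le> K0 \<and> norm (f y - f y') \<le> K0 * norm (y - y')"
    using local_lipschitz_cball[OF f] by blast
  have "\<forall>i. \<exists>K\<ge>0. \<forall>y\<in>cball 0 R. \<forall>y'\<in>cball 0 R. norm (g i y) \<le> K \<and> norm (g i y - g i y') \<le> K * norm (y - y')"
    using local_lipschitz_cball[OF g] by blast
  then obtain K1 where K1: "\<And>i. K1 i \<ge> 0" "\<And>i y y'. y \<in> cball 0 R \<Longrightarrow> y' \<in> cball 0 R \<Longrightarrow>
      norm (g i y) \<le> K1 i \<and> norm (g i y - g i y') \<le> K1 i * norm (y - y')"
    by metis
  define K where "K = K0 + (\<Sum>i\<in>UNIV. K1 i)"
  have sum_pos: "(\<Sum>i\<in>UNIV. K1 i) \<ge> 0" using K1(1) by (simp add: sum_nonneg)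
  \<comment> \<open>Used with \<open>c = 1\<close> for the growth bound and with \<open>c\<close>
    the distance of the two states for the Lipschitz bound.\<close>
  have comb: "norm (v *\<^sub>R x + y) \<le> (K0 * c + (\<Sum>i\<in>UNIV. K1 i) * c) * norm (v, w)"
    if "norm x \<le> K0 * c" "norm y \<le> (\<Sum>i\<in>UNIV. K1 i) * c * norm w" "c \<ge> 0"
    for v c :: real and x y :: "real^'n" and w :: "real^'k"
  proof -
    have "norm (v *\<^sub>R x + y) \<le> \<bar>v\<bar> * norm x + norm y"
      using norm_triangle_ineq[of "v *\<^sub>R x" y] by simp
    also have "\<dots> \<le> norm (v, w) * (K0 * c) + (\<Sum>i\<in>UNIV. K1 i) * c * norm (v, w)"
    proof (intro add_mono mult_mono)
      show "\<bar>v\<bar> \<le> norm (v, w)" using norm_fst_le[of v w] by simp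
      show "norm x \<le> K0 * c" by (rule that(1))
      have "(\<Sum>i\<in>UNIV. K1 i) * c * norm w \<le> (\<Sum>i\<in>UNIV. K1 i) * c * norm (v, w)"
        using norm_snd_le[of w v] sum_pos that(3) by (intro mult_left_mono) auto
      with that(2) show "norm y \<le> (\<Sum>i\<in>UNIV. K1 i) * c * norm (v, w)" by linarith
    qed auto
    finally show ?thesis by (simp add: algebra_simps)
  qed
  show "\<exists>K\<ge>0. \<forall>y\<in>cball 0 R. \<forall>y'\<in>cball 0 R. \<forall>z.
      norm (ctrl f g y z) \<le> K * norm z \<and> norm (ctrl f g y z - ctrl f g y' z) \<le> K * norm (y - y') * norm z"
  proof (intro exI[of _ K] conjI ballI allI)
    show "K \<ge> 0" using K0(1) sum_pos by (simp add: K_def)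
    fix y y' :: "real^'n" and z :: "real \<times> (real^'k)" assume y: "y \<in> cball 0 R" "y' \<in> cball 0 R"
    obtain v w where z: "z = (v, w)" by (cases z)
    have "norm (ctrl_map g y w) \<le> (\<Sum>i\<in>UNIV. norm (g i y)) * norm w"
      using norm_ctrl_map_diff_le[of g y w "\<lambda>_ _. 0" y] by (simp add: ctrl_map_def)
    also have "\<dots> \<le> (\<Sum>i\<in>UNIV. K1 i) * norm w"
      using K1(2)[OF y] by (intro mult_right_mono sum_mono) auto
    finally have "norm (ctrl_map g y w) \<le> (\<Sum>i\<in>UNIV. K1 i) * norm w" .
    with comb[of "f y" 1 "ctrl_map g y w" w v] K0(2)[OF y]
    show "norm (ctrl f g y z) \<le> K * norm z" by (simp add: z ctrl_def K_def)
    have "norm (ctrl_map g y w - ctrl_map g y' w) \<le> (\<Sum>i\<in>UNIV. norm (g i y - g i y')) * norm w"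
      by (rule norm_ctrl_map_diff_le)
    also have "\<dots> \<le> (\<Sum>i\<in>UNIV. K1 i * norm (y - y')) * norm w"
      using K1(2)[OF y] by (intro mult_right_mono sum_mono) auto
    finally have "norm (ctrl_map g y w - ctrl_map g y' w) \<le> (\<Sum>i\<in>UNIV. K1 i) * norm (y - y') * norm w"
      by (simp add: sum_distrib_right)
    moreover have eq: "ctrl f g y z - ctrl f g y' z = v *\<^sub>R (f y - f y') + (ctrl_map g y w - ctrl_map g y' w)"
      by (simp add: z ctrl_def scaleR_diff_right)
    ultimately have "norm (v *\<^sub>R (f y - f y') + (ctrl_map g y w - ctrl_map g y' w))
        \<le> (K0 * norm (y - y') + (\<Sum>i\<in>UNIV. K1 i) * norm (y - y')) * norm (v, w)"
      using K0(2)[OF y] by (intro comb) auto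
    then show "norm (ctrl f g y z - ctrl f g y' z) \<le> K * norm (y - y') * norm z"
      unfolding eq by (simp only: z K_def distrib_right)
  qed
qed

lemma has_integral_le_AE:
  fixes f g :: "real \<Rightarrow> real"
  assumes le: "AE x in lebesgue_on {s..t}. f x \<le> g x"
    and f: "(f has_integral i) {s..t}" and g: "(g has_integral j) {s..t}"
  shows "i \<le> j"
proof -
  have neg: "negligible {x\<in>{s..t}. \<not> f x \<le> g x}"
    using le by (subst (asm) AE_lebesgue_on_iff_negligible) auto
  have "((\<lambda>x. if f x \<le> g x then g x else f x) has_integral j) {s..t}"
    by (rule has_integral_spike[OF neg _ g]) auto
  then show ?thesis by (rule has_integral_le[OF f]) auto
qed

section \<open>Paths and their cost\<close>

text \<open>\<open>L\<close> is the Lagrangian after the shift, and \<open>A\<close>,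
  \<open>B\<close> are nonnegative growth constants adapted to it.\<close>

locale bolza = lagrangian L b
  for L :: "real^'n \<Rightarrow> real^'k \<Rightarrow> real" and b :: real +
  fixes f :: "real^'n \<Rightarrow> real^'n" and g :: "'k \<Rightarrow> real^'n \<Rightarrow> real^'n" and x0 x1 :: "real^'n" and A B :: real
  assumes f_lipschitz: "local_lipschitz (UNIV::real set) UNIV (\<lambda>_. f)"
    and g_lipschitz: "\<And>i. local_lipschitz (UNIV::real set) UNIV (\<lambda>_. g i)"
    and AB: "A \<ge> 0" "B \<ge> 0"
    and g_growth: "\<And>x u. norm (ctrl_map g x u) \<le> (A + B * norm x) * norm u + B * L x u"
    and f_growth: "\<And>x u. norm (f x) \<le> A + B * (norm x + L x u)"
begin

sublocale control_system "ctrl f g"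
  by (rule control_system_ctrl[OF f_lipschitz g_lipschitz])

lemma lam_eq_ennreal_iff:
  "l \<ge> 0 \<Longrightarrow> lam y (v, w) = ennreal l \<longleftrightarrow> ext_lagrangian L y v w = ereal l"
  unfolding lam_def fst_conv snd_conv
  by (metis e2ennreal_ereal enn2ereal_e2ennreal enn2ereal_ennreal ext_lagrangian_nonneg)

lemma lam_coercive: "v \<ge> 0 \<Longrightarrow> ennreal (b * norm w) \<le> lam y (v, w)"
  using e2ennreal_mono[OF ext_lagrangian_coercive[of v w y]] by (simp add: lam_def)

text \<open>The two growth conditions in homogeneous form. For \<open>v > 0\<close> they are taken
  at \<open>w / v\<close> and multiplied by \<open>v\<close>; each contributes \<open>B * l\<close>,
  whence the factor 2. For \<open>v = 0\<close> the condition on the control fields is taken at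
  \<open>w / \<eta>\<close>, multiplied by \<open>\<eta>\<close>, and \<open>\<eta>\<close> tends to
  0.\<close>

lemma ctrl_growth:
  assumes v: "v \<ge> 0" and l: "l \<ge> 0" "lam y (v, w) = ennreal l"
  shows "norm (ctrl f g y (v, w)) \<le> (A + B * norm y) * (v + norm w) + 2 * B * l"
proof (cases "v = 0")
  case True
  define c where "c = norm (ctrl_map g y w) - (A + B * norm y) * norm w"
  have "c \<le> B * l"
  proof (rule tendsto_le[OF trivial_limit_at_right_real _ tendsto_const])
    have "((\<lambda>\<eta>. ereal (L y (w /\<^sub>R \<eta>) * \<eta>)) \<longlongrightarrow> ereal l) (at_right 0)"
      using tendsto_lam0[of y w] l True by (simp add: lam_eq_ennreal_iff)
    then show "((\<lambda>\<eta>. B * (L y (w /\<^sub>R \<eta>) * \<eta>)) \<longlongrightarrow> B * l) (at_right 0)"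
      by (intro tendsto_mult tendsto_const) simp
    have "c \<le> B * (L y (w /\<^sub>R \<eta>) * \<eta>)" if "\<eta> > 0" for \<eta>
    proof -
      interpret cm: Vector_Spaces.linear "(*\<^sub>R)" "(*\<^sub>R)" "ctrl_map g y"
        using ctrl_map_linear[of g y] by (simp add: linear_def)
      have "norm (ctrl_map g y (w /\<^sub>R \<eta>)) * \<eta> \<le> ((A + B * norm y) * norm (w /\<^sub>R \<eta>) + B * L y (w /\<^sub>R \<eta>)) * \<eta>"
        using mult_right_mono[OF g_growth[of y "w /\<^sub>R \<eta>"], of \<eta>] that by simp
      moreover have "norm (ctrl_map g y (w /\<^sub>R \<eta>)) * \<eta> = norm (ctrl_map g y w)"
        using that by (simp add: cm.scale)
      moreover have "norm (w /\<^sub>R \<eta>) * \<eta> = norm w" using that by simp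
      then have "((A + B * norm y) * norm (w /\<^sub>R \<eta>) + B * L y (w /\<^sub>R \<eta>)) * \<eta>
          = (A + B * norm y) * norm w + B * (L y (w /\<^sub>R \<eta>) * \<eta>)"
        by (simp only: distrib_right mult.assoc)
      ultimately show ?thesis by (simp add: c_def)
    qed
    then show "\<forall>\<^sub>F \<eta> in at_right 0. c \<le> B * (L y (w /\<^sub>R \<eta>) * \<eta>)"
      unfolding eventually_at_right_field by (intro exI[of _ 1]) auto
  qed
  moreover have "0 \<le> B * l" using AB l by simp
  ultimately show ?thesis using True by (simp add: ctrl_def c_def)
next
  case False
  then have vp: "v > 0" using v by simp
  define u where "u = w /\<^sub>R v"
  have w: "w = v *\<^sub>R u" using vp by (simp add: u_def)
  interpret cm: Vector_Spaces.linear "(*\<^sub>R)" "(*\<^sub>R)" "ctrl_map g y"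
    using ctrl_map_linear[of g y] by (simp add: linear_def)
  have leq: "l = L y u * v"
    using l lam_pos[OF vp, of y w] L_nonneg[of y u] vp by (simp add: u_def)
  have "norm (ctrl f g y (v, w)) \<le> v * norm (f y) + v * norm (ctrl_map g y u)"
    using norm_triangle_ineq[of "v *\<^sub>R f y" "ctrl_map g y w"] vp by (simp add: ctrl_def w cm.scale)
  also have "\<dots> \<le> v * (A + B * (norm y + L y u)) + v * ((A + B * norm y) * norm u + B * L y u)"
    using f_growth g_growth vp by (intro add_mono mult_left_mono) auto
  also have "\<dots> = (A + B * norm y) * (v + norm w) + 2 * B * l"
    using vp by (simp add: leq w algebra_simps)
  finally show ?thesis .
qed

text \<open>The common competitor of both problems. The Lipschitz bound encodes controls in
  \<open>Bk_plus\<close> and the clock of \<open>driven\<close> is the identity. No clause mentions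
  a derivative, so each of them can pass to pointwise limits.\<close>

definition path :: "(real \<Rightarrow> real \<times> (real^'k)) \<Rightarrow> (real \<Rightarrow> real^'n) \<Rightarrow> real \<Rightarrow> bool" where
  "path P Y S \<longleftrightarrow> 0 \<le> S \<and> 1-lipschitz_on {0..S} P \<and> P 0 = 0 \<and> mono_on {0..S} (\<lambda>t. fst (P t)) \<and>
     fst (P S) = 1 \<and> (\<exists>C. driven C S (\<lambda>t. t) P Y) \<and> Y 0 = x0 \<and> Y S = x1"

definition cost :: "(real \<Rightarrow> real \<times> (real^'k)) \<Rightarrow> (real \<Rightarrow> real^'n) \<Rightarrow> real \<Rightarrow> ennreal" where
  "cost P Y S = (\<integral>\<^sup>+t. lam (Y t) (vector_derivative P (at t)) \<partial>lebesgue_on {0..S})"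

lemma cost_eq:
  assumes "has_velocity S P \<rho>"
  shows "cost P Y S = (\<integral>\<^sup>+t. lam (Y t) (\<rho> t) \<partial>lebesgue_on {0..S})"
  unfolding cost_def
proof (rule nn_integral_cong_AE)
  have "AE t in lebesgue_on {0..S}. (P has_vector_derivative \<rho> t) (at t)"
    using assms by (simp add: has_velocity_def)
  then show "AE t in lebesgue_on {0..S}. lam (Y t) (vector_derivative P (at t)) = lam (Y t) (\<rho> t)"
    by eventually_elim (simp add: vector_derivative_at)
qed

lemma path_velocity:
  assumes "path P Y S"
  obtains \<rho> where "has_velocity S P \<rho>" "\<rho> \<in> borel_measurable borel"
    "AE t in lebesgue_on {0..S}. norm (\<rho> t) \<le> 1" "AE t in lebesgue_on {0..S}. fst (\<rho> t) \<ge> 0"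
    "has_velocity S Y (\<lambda>t. ctrl f g (Y t) (\<rho> t))"
proof -
  have S: "0 \<le> S" and lip: "1-lipschitz_on {0..S} P" and mono: "mono_on {0..S} (\<lambda>t. fst (P t))"
    using assms by (auto simp: path_def)
  obtain C where C: "driven C S (\<lambda>t. t) P Y" using assms by (auto simp: path_def)
  obtain \<rho> where \<rho>: "has_velocity S P \<rho>" "\<rho> \<in> borel_measurable borel"
    using has_velocity_exists[OF abs_continuous_on_lipschitz[OF lip] S] by metis
  have "has_velocity S (\<lambda>t. fst (P t)) (\<lambda>t. fst (\<rho> t))"
    by (rule has_velocity_bounded_linear[OF \<rho>(1) bounded_linear_fst])
  from has_velocity_nonneg[OF this mono] has_velocity_lipschitz_norm_le[OF \<rho>(1) lip]
  have *: "AE t in lebesgue_on {0..S}. norm (\<rho> t) \<le> 1" "AE t in lebesgue_on {0..S}. fst (\<rho> t) \<ge> 0" by auto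
  have "has_velocity S (\<lambda>t. t) (\<lambda>_. 1)"
    by (simp add: has_velocity_def abs_continuous_on_id)
  from velocity_of_driven[OF S C _ this \<rho>(1)]
  have "has_velocity S Y (\<lambda>t. ctrl f g (Y t) (\<rho> t))" by (simp add: mono_on_def)
  with that \<rho> * show ?thesis by blast
qed

lemma borel_measurable_lam_curve:
  fixes S :: real
  assumes Y: "continuous_on {0..S} Y" and \<rho>: "\<rho> \<in> borel_measurable (lebesgue_on {0..S})"
  shows "(\<lambda>t. lam (Y t) (\<rho> t)) \<in> borel_measurable (lebesgue_on {0..S})"
proof -
  have "Y \<in> borel_measurable (lebesgue_on {0..S})"
    by (rule continuous_imp_measurable_on_sets_lebesgue[OF Y]) simp
  from measurable_compose[OF borel_measurable_Pair[OF this \<rho>] borel_measurable_lam] show ?thesis by simp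
qed

text \<open>Every control steering \<open>x0\<close> to \<open>x1\<close> in unit
  \<open>\<theta>\<close>-time yields a path of the same cost. The identity
  \<open>p t = P (\<psi> t)\<close> is recorded so that the path can be found again in all curves
  with the same arclength parametrization.\<close>

lemma exists_arclength_path:
  assumes S: "0 \<le> S" and p: "has_velocity S p \<zeta>" and p0: "p 0 = 0"
    and mono: "mono_on {0..S} (\<lambda>t. fst (p t))" and pS: "fst (p S) = 1"
    and y: "has_velocity S y (\<lambda>t. ctrl f g (y t) (\<zeta> t))" and y0: "y 0 = x0" and yS: "y S = x1"
  defines "\<psi> \<equiv> \<lambda>t. integral {0..t} (\<lambda>r. norm (\<zeta> r))"
  obtains P Y where "path P Y (\<psi> S)" "cost P Y (\<psi> S) = (\<integral>\<^sup>+t. lam (y t) (\<zeta> t) \<partial>lebesgue_on {0..S})"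
    "\<And>t. t \<in> {0..S} \<Longrightarrow> p t = P (\<psi> t)" "\<And>t. t \<in> {0..S} \<Longrightarrow> y t = Y (\<psi> t)"
proof -
  have \<psi>: "has_velocity S \<psi> (\<lambda>t. norm (\<zeta> t))"
    unfolding \<psi>_def by (intro has_velocity_arclength has_velocity_integral[OF p S])
  have cont: "continuous_on {0..S} \<psi>" by (rule has_velocity_continuous_on[OF \<psi>])
  have le: "AE t in lebesgue_on {0..S}. norm (\<zeta> t) \<le> norm (\<zeta> t)" by simp
  have pd: "norm (p t - p s) \<le> \<psi> t - \<psi> s" if "0 \<le> s" "s \<le> t" "t \<le> S" for s t
    by (rule has_velocity_norm_diff_le[OF p \<psi> le that])
  have \<psi>mono: "mono_on {0..S} \<psi>"
  proof (rule mono_onI)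
    fix s t assume "s \<in> {0..S}" "t \<in> {0..S}" "s \<le> t"
    then have "norm (p t - p s) \<le> \<psi> t - \<psi> s" by (intro pd) auto
    then show "\<psi> s \<le> \<psi> t" using norm_ge_zero[of "p t - p s"] by linarith
  qed
  have \<psi>0: "\<psi> 0 = 0" by (simp add: \<psi>_def)
  have \<psi>S: "0 \<le> \<psi> S" using mono_onD[OF \<psi>mono, of 0 S] S \<psi>0 by simp
  obtain C where C: "driven C S \<psi> p y" using solution_driven[OF S p \<psi> le y] by metis
  obtain P Y where PY: "\<And>t. t \<in> {0..S} \<Longrightarrow> P (\<psi> t) = p t" "\<And>t. t \<in> {0..S} \<Longrightarrow> Y (\<psi> t) = y t"
    "1-lipschitz_on {0..\<psi> S} P" "driven C (\<psi> S) (\<lambda>t. t) P Y"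
    by (rule driven_reparametrize[OF S cont \<psi>mono \<psi>0 _ C]; use pd in blast)
  have preimage: "\<exists>r. r \<in> {0..S} \<and> \<psi> r = x" if "x \<in> {0..\<psi> S}" for x
    using IVT'[of \<psi> 0 x S] that S cont \<psi>0 by auto
  have "mono_on {0..\<psi> S} (\<lambda>t. fst (P t))"
  proof (rule mono_onI)
    fix s t assume st: "s \<in> {0..\<psi> S}" "t \<in> {0..\<psi> S}" "s \<le> t"
    obtain s' t' where s't': "s' \<in> {0..S}" "\<psi> s' = s" "t' \<in> {0..S}" "\<psi> t' = t"
      using preimage st by meson
    show "fst (P s) \<le> fst (P t)"
    proof (cases "s' \<le> t'")
      case True
      then show ?thesis using mono_onD[OF mono s't'(1,3)] PY(1) s't' by auto
    next
      case False
      then have "s = t" using mono_onD[OF \<psi>mono s't'(3,1)] s't' st by auto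
      then show ?thesis by simp
    qed
  qed
  then have path: "path P Y (\<psi> S)"
    unfolding path_def using \<psi>S PY PY(1,2)[of 0] PY(1,2)[of S] S \<psi>0 p0 pS y0 yS by auto
  obtain \<rho> where \<rho>: "has_velocity (\<psi> S) P \<rho>" "has_velocity (\<psi> S) Y (\<lambda>t. ctrl f g (Y t) (\<rho> t))"
    using path_velocity[OF path] by metis
  have "(\<integral>\<^sup>+t. lam (y t) (\<zeta> t) \<partial>lebesgue_on {0..S}) = (\<integral>\<^sup>+s. lam (Y s) (\<rho> s) \<partial>lebesgue_on {0..\<psi> S})"
    by (rule nn_integral_reparametrize[OF borel_measurable_lam lam_scale S \<psi> \<psi>mono \<psi>0 p le \<rho>(1)
        has_velocity_continuous_on[OF \<rho>(2)]]) (use PY in auto)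
  then show ?thesis using that path PY(1,2) cost_eq[OF \<rho>(1), of Y] by metis
qed

text \<open>The norm of the velocity is at most \<open>v + norm w\<close>. The integral of
  \<open>v\<close> is 1 by the end conditions, and by coercivity the cost bounds \<open>b\<close>
  times the integral of \<open>norm w\<close>.\<close>

lemma arclength_le:
  assumes path: "path P Y S" and \<rho>: "has_velocity S P \<rho>" and finite: "cost P Y S \<le> ennreal M" "M \<ge> 0"
  shows "integral {0..S} (\<lambda>r. norm (\<rho> r)) \<le> 1 + M / b"
proof -
  have S: "0 \<le> S" using path by (simp add: path_def)
  have int: "\<rho> absolutely_integrable_on {0..S}" by (rule has_velocity_integral(1)[OF \<rho> S])
  have fsti: "((\<lambda>t. fst (\<rho> t)) has_integral fst (P S) - fst (P 0)) {0..S}"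
    using has_integral_linear[OF has_velocity_integral(2)[OF \<rho> S, of 0 S] bounded_linear_fst] S
    by (simp add: o_def)
  have sndi: "(\<lambda>t. norm (snd (\<rho> t))) absolutely_integrable_on {0..S}"
    using absolutely_integrable_norm[OF absolutely_integrable_linear[OF int bounded_linear_snd]] by (simp add: o_def)
  have normi: "(\<lambda>t. norm (\<rho> t)) absolutely_integrable_on {0..S}"
    using absolutely_integrable_norm[OF int] by (simp add: o_def)
  have "has_velocity S (\<lambda>t. fst (P t)) (\<lambda>t. fst (\<rho> t))"
    by (rule has_velocity_bounded_linear[OF \<rho> bounded_linear_fst])
  then have pos: "AE t in lebesgue_on {0..S}. fst (\<rho> t) \<ge> 0"
    by (rule has_velocity_nonneg) (use path in \<open>simp add: path_def\<close>)
  have "ennreal (b * integral {0..S} (\<lambda>t. norm (snd (\<rho> t)))) \<le> ennreal M"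
  proof -
    have "((\<lambda>t. b * norm (snd (\<rho> t))) has_integral b * integral {0..S} (\<lambda>t. norm (snd (\<rho> t)))) {0..S}"
      using set_lebesgue_integral_eq_integral(1)[OF sndi] by (intro has_integral_mult_right integrable_integral)
    then have "ennreal (b * integral {0..S} (\<lambda>t. norm (snd (\<rho> t)))) = (\<integral>\<^sup>+t. ennreal (b * norm (snd (\<rho> t))) \<partial>lebesgue_on {0..S})"
      using nn_integral_has_integral_lebesgue'[of "{0..S}" "\<lambda>t. b * norm (snd (\<rho> t))"] b_pos
      by (simp add: nn_integral_lebesgue_on)
    also have "\<dots> \<le> (\<integral>\<^sup>+t. lam (Y t) (\<rho> t) \<partial>lebesgue_on {0..S})"
    proof (rule nn_integral_mono_AE)
      show "AE t in lebesgue_on {0..S}. ennreal (b * norm (snd (\<rho> t))) \<le> lam (Y t) (\<rho> t)"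
        using pos by eventually_elim (metis lam_coercive prod.collapse)
    qed
    also have "\<dots> \<le> ennreal M" using finite(1) cost_eq[OF \<rho>, of Y] by simp
    finally show ?thesis .
  qed
  then have snd_le: "integral {0..S} (\<lambda>t. norm (snd (\<rho> t))) \<le> M / b"
    using finite(2) b_pos by (simp add: ennreal_le_iff pos_le_divide_eq mult.commute)
  have neg: "negligible {t\<in>{0..S}. \<not> fst (\<rho> t) \<ge> 0}"
    using pos by (subst (asm) AE_lebesgue_on_iff_negligible) auto
  have "(\<lambda>t. norm (\<rho> t)) integrable_on {0..S}" by (rule set_lebesgue_integral_eq_integral(1)[OF normi])
  moreover have "((\<lambda>t. if fst (\<rho> t) \<ge> 0 then fst (\<rho> t) + norm (snd (\<rho> t)) else norm (\<rho> t)) has_integral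
      fst (P S) - fst (P 0) + integral {0..S} (\<lambda>t. norm (snd (\<rho> t)))) {0..S}"
    by (rule has_integral_spike[OF neg _ has_integral_add[OF fsti
        integrable_integral[OF set_lebesgue_integral_eq_integral(1)[OF sndi]]]]) auto
  moreover have "norm (\<rho> t) \<le> (if fst (\<rho> t) \<ge> 0 then fst (\<rho> t) + norm (snd (\<rho> t)) else norm (\<rho> t))" for t
    using norm_Pair_le[of "fst (\<rho> t)" "snd (\<rho> t)"] by auto
  ultimately have "integral {0..S} (\<lambda>r. norm (\<rho> r)) \<le> fst (P S) - fst (P 0) + integral {0..S} (\<lambda>t. norm (snd (\<rho> t)))"
    by (intro has_integral_le[OF integrable_integral]) auto
  also have "fst (P S) - fst (P 0) = 1" using path by (simp add: path_def)
  finally show ?thesis using snd_le by simp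
qed

text \<open>The extended path is the old one composed with the clock
  \<open>t \<mapsto> min S t\<close>. Resting is free because \<open>lam\<close> vanishes at
  velocity zero, which is contained in the reparametrization formula.\<close>

lemma path_extend:
  assumes path: "path P Y S" and S': "S \<le> S'"
  defines "P' \<equiv> \<lambda>t. P (min S t)" and "Y' \<equiv> \<lambda>t. Y (min S t)"
  shows "path P' Y' S'" and "cost P' Y' S' = cost P Y S"
proof -
  have S: "0 \<le> S" and lip: "1-lipschitz_on {0..S} P" and mono: "mono_on {0..S} (\<lambda>t. fst (P t))"
    using path by (auto simp: path_def)
  obtain C where C: "driven C S (\<lambda>t. t) P Y" using path by (auto simp: path_def)
  define \<psi> where "\<psi> = (\<lambda>t. min S t)"
  have \<psi>mono: "mono_on {0..S'} \<psi>" by (auto simp: \<psi>_def mono_on_def)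
  have \<psi>0: "\<psi> 0 = 0" and \<psi>S: "\<psi> S' = S" using S S' by (auto simp: \<psi>_def)
  have dr: "driven C S' \<psi> P' Y'"
    by (rule driven_compose[OF C \<psi>mono \<psi>0]) (auto simp: \<psi>_def P'_def Y'_def)
  have "driven C S' (\<lambda>t. t) P' Y'"
    unfolding driven_def
  proof (intro conjI allI impI)
    show C0: "C \<ge> 0" using C by (simp add: driven_def)
    fix s t assume st: "0 \<le> s" "s \<le> t" "t \<le> S'"
    then have "0 \<le> \<psi> t - \<psi> s" "\<psi> t - \<psi> s \<le> t - s" by (auto simp: \<psi>_def)
    then have "C * (\<psi> t - \<psi> s) \<le> C * (t - s)" "C * (\<psi> t - \<psi> s)\<^sup>2 \<le> C * (t - s)\<^sup>2"
      using C0 by (auto intro!: mult_left_mono power_mono)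
    then show "norm (Y' t - Y' s) \<le> C * (t - s)"
      "norm (Y' t - Y' s - ctrl f g (Y' s) (P' t - P' s)) \<le> C * (t - s)\<^sup>2"
      using dr st unfolding driven_def by (meson order_trans)+
  qed
  moreover have "1-lipschitz_on {0..S'} P'"
  proof (rule lipschitz_onI)
    fix s t assume "s \<in> {0..S'}" "t \<in> {0..S'}"
    then have "dist (P (min S s)) (P (min S t)) \<le> 1 * dist (min S s) (min S t)"
      using S by (intro lipschitz_onD[OF lip]) auto
    also have "\<dots> \<le> 1 * dist s t" by (simp add: dist_real_def)
    finally show "dist (P' s) (P' t) \<le> 1 * dist s t" by (simp add: P'_def)
  qed simp
  moreover have "mono_on {0..S'} (\<lambda>t. fst (P' t))"
    using mono S by (auto simp: P'_def mono_on_def)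
  ultimately show path': "path P' Y' S'"
    using path S S' unfolding path_def P'_def Y'_def by (auto simp: min_absorb1)
  obtain \<rho> where \<rho>: "has_velocity S P \<rho>" "AE t in lebesgue_on {0..S}. norm (\<rho> t) \<le> 1"
    "has_velocity S Y (\<lambda>t. ctrl f g (Y t) (\<rho> t))"
    using path_velocity[OF path] by metis
  obtain \<rho>' where \<rho>': "has_velocity S' P' \<rho>'" using path_velocity[OF path'] by metis
  have "1-lipschitz_on {0..S'} \<psi>"
    by (rule lipschitz_onI) (auto simp: \<psi>_def dist_real_def)
  then obtain \<psi>' where \<psi>': "has_velocity S' \<psi> \<psi>'"
    using has_velocity_exists[OF abs_continuous_on_lipschitz, of 1 S' \<psi>] S S' by (metis order_trans)
  \<comment> \<open>\<open>P\<close> is 1-Lipschitz, so difference quotients of \<open>P'\<close>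
    are bounded by those of the clock.\<close>
  have *: "AE t in lebesgue_on {0..S'}. norm (\<rho>' t) \<le> \<psi>' t"
  proof -
    have "AE t in lebesgue_on {0..S'}. t \<noteq> S'"
      by (subst AE_lebesgue_on_iff_negligible) (auto intro: negligible_subset[of "{S'}"])
    moreover have "AE t in lebesgue_on {0..S'}. t \<in> {0..S'}" using AE_space[of "lebesgue_on {0..S'}"] by simp
    moreover have "AE t in lebesgue_on {0..S'}. (P' has_vector_derivative \<rho>' t) (at t)"
      "AE t in lebesgue_on {0..S'}. (\<psi> has_vector_derivative \<psi>' t) (at t)"
      using \<rho>' \<psi>' by (auto simp: has_velocity_def)
    ultimately show ?thesis
    proof eventually_elim
      case (elim t)
      have "((\<lambda>h. norm ((P' (t + h) - P' t) /\<^sub>R h)) \<longlongrightarrow> norm (\<rho>' t)) (at_right 0)"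
        "((\<lambda>h. (\<psi> (t + h) - \<psi> t) /\<^sub>R h) \<longlongrightarrow> \<psi>' t) (at_right 0)"
        by (intro tendsto_norm tendsto_within_subset[OF has_vector_derivative_quotient_limit[OF elim(3)] subset_UNIV],
            rule tendsto_within_subset[OF has_vector_derivative_quotient_limit[OF elim(4)] subset_UNIV])
      moreover have "norm ((P' (t + h) - P' t) /\<^sub>R h) \<le> (\<psi> (t + h) - \<psi> t) /\<^sub>R h" if h: "0 < h" "h < S' - t" for h
      proof -
        have "dist (P (min S (t + h))) (P (min S t)) \<le> 1 * dist (min S (t + h)) (min S t)"
          using S elim(2) h by (intro lipschitz_onD[OF lip]) auto
        also have "\<dots> = \<psi> (t + h) - \<psi> t" using h by (auto simp: dist_real_def \<psi>_def)
        finally show ?thesis using h by (simp add: P'_def dist_norm mult_left_mono)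
      qed
      then have "\<forall>\<^sub>F h in at_right 0. norm ((P' (t + h) - P' t) /\<^sub>R h) \<le> (\<psi> (t + h) - \<psi> t) /\<^sub>R h"
        unfolding eventually_at_right_field using elim(1,2) by (intro exI[of _ "S' - t"]) auto
      ultimately show ?case by (intro tendsto_le[OF trivial_limit_at_right_real])
    qed
  qed
  have "(\<integral>\<^sup>+t. lam (Y' t) (\<rho>' t) \<partial>lebesgue_on {0..S'}) = (\<integral>\<^sup>+s. lam (Y s) (\<rho> s) \<partial>lebesgue_on {0..\<psi> S'})"
  proof (rule nn_integral_reparametrize[OF borel_measurable_lam lam_scale _ \<psi>' \<psi>mono \<psi>0 \<rho>' *])
    show "has_velocity (\<psi> S') P \<rho>" "continuous_on {0..\<psi> S'} Y"
      unfolding \<psi>S by (rule \<rho>(1), rule has_velocity_continuous_on[OF \<rho>(3)])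
  qed (use S S' in \<open>auto simp: P'_def Y'_def \<psi>_def\<close>)
  then show "cost P' Y' S' = cost P Y S" using cost_eq[OF \<rho>(1)] cost_eq[OF \<rho>'] \<psi>S by simp
qed

lemma cost_density:
  assumes S: "0 \<le> S" and P: "has_velocity S P \<rho>" and Y: "continuous_on {0..S} Y" and finite: "cost P Y S < \<infinity>"
  obtains l where "\<And>t. l t \<ge> 0" "l absolutely_integrable_on {0..S}"
    "AE t in lebesgue_on {0..S}. lam (Y t) (\<rho> t) = ennreal (l t)" "cost P Y S = ennreal (integral {0..S} l)"
proof -
  define l where "l = (\<lambda>t. enn2real (lam (Y t) (\<rho> t)))"
  have "\<rho> \<in> borel_measurable (lebesgue_on {0..S})"
    using has_velocity_integral(1)[OF P S] by (rule absolutely_integrable_measurable[THEN iffD1, THEN conjunct1, rotated]) simp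
  then have lamm: "(\<lambda>t. lam (Y t) (\<rho> t)) \<in> borel_measurable (lebesgue_on {0..S})"
    by (rule borel_measurable_lam_curve[OF Y])
  have "(\<integral>\<^sup>+t. lam (Y t) (\<rho> t) \<partial>lebesgue_on {0..S}) \<noteq> \<infinity>" using finite cost_eq[OF P, of Y] by simp
  then have fin: "AE t in lebesgue_on {0..S}. lam (Y t) (\<rho> t) \<noteq> \<infinity>" by (rule nn_integral_PInf_AE[OF lamm])
  have ae: "AE t in lebesgue_on {0..S}. lam (Y t) (\<rho> t) = ennreal (l t)"
    using fin by eventually_elim (simp add: l_def less_top)
  have l_nn: "cost P Y S = (\<integral>\<^sup>+t. ennreal (l t) \<partial>lebesgue_on {0..S})"
    unfolding cost_eq[OF P] by (rule nn_integral_cong_AE[OF ae])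
  have "integrable (lebesgue_on {0..S}) l"
  proof (rule integrableI_bounded)
    show "l \<in> borel_measurable (lebesgue_on {0..S})" unfolding l_def using lamm by measurable
    have "(\<integral>\<^sup>+t. ennreal (norm (l t)) \<partial>lebesgue_on {0..S}) = cost P Y S"
      unfolding l_nn by (simp add: l_def)
    with finite show "(\<integral>\<^sup>+t. ennreal (norm (l t)) \<partial>lebesgue_on {0..S}) < \<infinity>" by simp
  qed
  then have l_abs: "l absolutely_integrable_on {0..S}"
    by (simp add: set_integrable_def integrable_restrict_space)
  have "(\<integral>\<^sup>+t. ennreal (l t) \<partial>lebesgue_on {0..S}) = ennreal (integral {0..S} l)"
    using nn_integral_has_integral_lebesgue'[OF _ integrable_integral[OF set_lebesgue_integral_eq_integral(1)[OF l_abs]]]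
    by (simp add: nn_integral_lebesgue_on l_def)
  with l_nn have "cost P Y S = ennreal (integral {0..S} l)" by simp
  then show ?thesis using that[OF _ l_abs ae] by (simp add: l_def)
qed

text \<open>On a path \<open>v + norm w\<close> is at most 2, so \<open>ctrl_growth\<close> bounds
  the speed of \<open>Y\<close> by \<open>2 * (A + B) * (1 + norm (Y t)) + 2 * B * l t\<close>. The
  density \<open>l\<close> integrates to at most \<open>M\<close>, and Gronwall is applied to
  \<open>1 + norm (Y t)\<close>.\<close>

lemma path_bound:
  assumes path: "path P Y S" and finite: "cost P Y S \<le> ennreal M" "M \<ge> 0" and t: "t \<in> {0..S}"
  shows "norm (Y t) \<le> (1 + norm x0 + 2 * B * M) * exp (2 * (A + B) * S)"
proof -
  have S: "0 \<le> S" using path by (simp add: path_def)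
  obtain \<rho> where \<rho>: "has_velocity S P \<rho>" "\<rho> \<in> borel_measurable borel"
    "AE t in lebesgue_on {0..S}. norm (\<rho> t) \<le> 1" "AE t in lebesgue_on {0..S}. fst (\<rho> t) \<ge> 0"
    "has_velocity S Y (\<lambda>t. ctrl f g (Y t) (\<rho> t))"
    by (rule path_velocity[OF path]) (rule that)
  have Y0: "Y 0 = x0" using path by (simp add: path_def)
  define K where "K = 2 * (A + B)"
  have K: "K \<ge> 0" using AB by (simp add: K_def)
  have Ycont: "continuous_on {0..S} Y" by (rule has_velocity_continuous_on[OF \<rho>(5)])
  have "cost P Y S < \<infinity>" using finite(1) by (metis ennreal_less_top infinity_ennreal_def le_less_trans)
  then obtain l where l: "\<And>t. l t \<ge> 0" and l_abs: "l absolutely_integrable_on {0..S}"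
    and lam_l: "AE t in lebesgue_on {0..S}. lam (Y t) (\<rho> t) = ennreal (l t)" and cost_l: "cost P Y S = ennreal (integral {0..S} l)"
    using cost_density[OF S \<rho>(1) Ycont] by metis
  have l_int: "integral {0..t} l \<le> M" if "t \<in> {0..S}" for t
  proof -
    have lS: "l integrable_on {0..S}" by (rule set_lebesgue_integral_eq_integral(1)[OF l_abs])
    have "integral {0..t} l \<le> integral {0..S} l"
      by (rule integral_subset_le) (use that lS l in \<open>auto intro: integrable_subinterval_real\<close>)
    moreover have "integral {0..S} l \<le> M" using cost_l finite by simp
    ultimately show ?thesis by simp
  qed
  define h where "h = (\<lambda>t. 1 + norm (Y t))"
  have hcont: "continuous_on {0..S} h" unfolding h_def by (intro continuous_intros Ycont)
  then have h_abs: "h absolutely_integrable_on {0..S}"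
    by (rule absolutely_integrable_continuous_real)
  define \<psi>' where "\<psi>' = (\<lambda>t. K * h t + 2 * B * l t)"
  have Kh: "(\<lambda>t. K * h t) absolutely_integrable_on {0..S}" "(\<lambda>t. 2 * B * l t) absolutely_integrable_on {0..S}"
    using h_abs l_abs by (auto intro: set_integrable_mult_right)
  then have \<psi>'_abs: "\<psi>' absolutely_integrable_on {0..S}"
    unfolding \<psi>'_def by (rule set_integral_add(1))
  have space: "AE t in lebesgue_on {0..S}. t \<in> {0..S}" using AE_space[of "lebesgue_on {0..S}"] by simp
  have le: "AE t in lebesgue_on {0..S}. norm (ctrl f g (Y t) (\<rho> t)) \<le> \<psi>' t"
    using \<rho>(3,4) lam_l space
  proof eventually_elim
    case (elim t)
    obtain v w where vw: "\<rho> t = (v, w)" by (cases "\<rho> t")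
    have "lam (Y t) (v, w) = ennreal (l t)" using elim(3) by (simp add: vw)
    then have "norm (ctrl f g (Y t) (v, w)) \<le> (A + B * norm (Y t)) * (v + norm w) + 2 * B * l t"
      using elim(2) l by (intro ctrl_growth) (auto simp: vw)
    also have "(A + B * norm (Y t)) * (v + norm w) \<le> ((A + B) * h t) * 2"
    proof (intro mult_mono)
      have "0 \<le> A * norm (Y t)" using AB by simp
      then show "A + B * norm (Y t) \<le> (A + B) * h t" using AB by (simp add: h_def algebra_simps)
      have "v \<le> norm (\<rho> t)" "norm w \<le> norm (\<rho> t)"
        using norm_fst_le[of v w] norm_snd_le[of w v] by (auto simp: vw)
      then show "v + norm w \<le> 2" using elim(1) by linarith
      show "0 \<le> v + norm w" using elim(2) by (simp add: vw)
      show "0 \<le> (A + B) * h t" using AB by (simp add: h_def)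
    qed
    finally show ?case by (simp add: vw \<psi>'_def K_def algebra_simps)
  qed
  have main: "h t \<le> (1 + norm x0 + 2 * B * M) + K * integral {0..t} h" if t: "0 \<le> t" "t \<le> S" for t
  proof -
    have sub: "{0..t} \<subseteq> {0..S}" using t by auto
    have hi: "(\<lambda>r. K * h r) integrable_on {0..t}" "(\<lambda>r. 2 * B * l r) integrable_on {0..t}"
      using Kh set_lebesgue_integral_eq_integral(1) integrable_on_subinterval[OF _ sub] by blast+
    have "norm (Y t - Y 0) \<le> integral {0..t} \<psi>' - integral {0..0} \<psi>'"
      by (rule has_velocity_norm_diff_le[OF \<rho>(5) has_velocity_indefinite_integral[OF \<psi>'_abs] le]) (use t in auto)
    also have "\<dots> = K * integral {0..t} h + 2 * B * integral {0..t} l"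
      unfolding \<psi>'_def using Henstock_Kurzweil_Integration.integral_add[OF hi] by simp
    also have "2 * B * integral {0..t} l \<le> 2 * B * M"
      using l_int[of t] t AB by (intro mult_left_mono) auto
    finally have "norm (Y t - x0) \<le> K * integral {0..t} h + 2 * B * M" by (simp add: Y0)
    then show ?thesis using norm_triangle_ineq2[of "Y t" x0] by (simp add: h_def)
  qed
  have "h t \<le> (1 + norm x0 + 2 * B * M) * exp (K * t)"
    by (rule gronwall[OF hcont K main]) (use t in auto)
  also have "\<dots> \<le> (1 + norm x0 + 2 * B * M) * exp (K * S)"
    using AB finite(2) K t by (intro mult_left_mono) (auto simp: mult_left_mono)
  finally show ?thesis by (simp add: h_def K_def)
qed

text \<open>
  At a point of differentiability the cost of nearby paths dominates a linear functional of their
  increments, which passes to the limit without any convergence of the velocities.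
\<close>

lemma cost_lower_semicontinuous:
  assumes path: "path P Y T" and paths: "\<And>n. path (Pn n) (Yn n) T"
    and finite: "\<And>n. cost (Pn n) (Yn n) T < \<infinity>"
    and driven: "\<And>n. driven C T (\<lambda>t. t) (Pn n) (Yn n)"
    and P_lim: "\<And>t. t \<in> {0..T} \<Longrightarrow> (\<lambda>n. Pn n t) \<longlonglongrightarrow> P t"
    and Y_lim: "\<And>t. t \<in> {0..T} \<Longrightarrow> (\<lambda>n. Yn n t) \<longlonglongrightarrow> Y t"
  shows "cost P Y T \<le> liminf (\<lambda>n. cost (Pn n) (Yn n) T)"
proof -
  have T: "0 \<le> T" using path by (simp add: path_def)
  have C: "C \<ge> 0" using driven[of 0] by (simp add: driven_def)
  obtain \<rho> where \<rho>: "has_velocity T P \<rho>" "AE t in lebesgue_on {0..T}. fst (\<rho> t) \<ge> 0"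
    using path_velocity[OF path] by metis
  have "\<exists>\<rho>. has_velocity T (Pn n) \<rho> \<and> (AE t in lebesgue_on {0..T}. norm (\<rho> t) \<le> 1) \<and>
      (AE t in lebesgue_on {0..T}. fst (\<rho> t) \<ge> 0) \<and> continuous_on {0..T} (Yn n)" for n
    by (rule path_velocity[OF paths[of n]]) (use has_velocity_continuous_on in blast)
  then obtain \<rho>n where \<rho>n: "\<And>n. has_velocity T (Pn n) (\<rho>n n)"
    "\<And>n. AE t in lebesgue_on {0..T}. norm (\<rho>n n t) \<le> 1"
    "\<And>n. AE t in lebesgue_on {0..T}. fst (\<rho>n n t) \<ge> 0" and Yn_cont: "\<And>n. continuous_on {0..T} (Yn n)"
    by metis
  have "\<exists>l. (\<forall>t. l t \<ge> 0) \<and> l absolutely_integrable_on {0..T} \<and>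
      (AE t in lebesgue_on {0..T}. lam (Yn n t) (\<rho>n n t) = ennreal (l t)) \<and>
      cost (Pn n) (Yn n) T = ennreal (integral {0..T} l)" for n
    by (rule cost_density[OF T \<rho>n(1) Yn_cont finite[of n]]) blast
  then have "\<exists>l. \<forall>n. (\<forall>t. l n t \<ge> 0) \<and> l n absolutely_integrable_on {0..T} \<and>
      (AE t in lebesgue_on {0..T}. lam (Yn n t) (\<rho>n n t) = ennreal (l n t)) \<and>
      cost (Pn n) (Yn n) T = ennreal (integral {0..T} (l n))"
    by (intro choice allI)
  then obtain l where "\<forall>n. (\<forall>t. l n t \<ge> 0) \<and> l n absolutely_integrable_on {0..T} \<and>
      (AE t in lebesgue_on {0..T}. lam (Yn n t) (\<rho>n n t) = ennreal (l n t)) \<and>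
      cost (Pn n) (Yn n) T = ennreal (integral {0..T} (l n))" ..
  then have l: "\<And>n t. l n t \<ge> 0" "\<And>n. l n absolutely_integrable_on {0..T}"
    "\<And>n. AE t in lebesgue_on {0..T}. lam (Yn n t) (\<rho>n n t) = ennreal (l n t)"
    "\<And>n. cost (Pn n) (Yn n) T = ennreal (integral {0..T} (l n))"
    by simp_all
  define \<Theta> where "\<Theta> = (\<lambda>n t. integral {0..t} (l n))"
  have \<Theta>: "has_velocity T (\<Theta> n) (l n)" for n
    unfolding \<Theta>_def by (rule has_velocity_indefinite_integral[OF l(2)])
  have \<Theta>_int: "(l n has_integral \<Theta> n t - \<Theta> n s) {s..t}" if "0 \<le> s" "s \<le> t" "t \<le> T" for n s t
    by (rule has_velocity_integral(2)[OF \<Theta> T that])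
  have \<Theta>_mono: "mono_on {0..T} (\<Theta> n)" for n
  proof (rule mono_onI)
    fix s t assume "s \<in> {0..T}" "t \<in> {0..T}" "s \<le> t"
    then have "0 \<le> \<Theta> n t - \<Theta> n s" using has_integral_nonneg[OF \<Theta>_int[of s t n]] l(1) by auto
    then show "\<Theta> n s \<le> \<Theta> n t" by simp
  qed
  define h where "h = (\<lambda>k::nat. inverse (real (Suc k)))"
  have h: "h k > 0" for k by (simp add: h_def)
  have h_lim: "filterlim h (at_right 0) sequentially"
    using LIMSEQ_inverse_real_of_nat h unfolding h_def by (simp add: filterlim_at)
  have "(\<integral>\<^sup>+t. lam (Y t) (\<rho> t) \<partial>lebesgue_on {0..T}) \<le> liminf (\<lambda>n. ennreal (\<Theta> n T - \<Theta> n 0))"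
  proof (rule nn_integral_le_liminf_increments[OF T _ \<Theta>_mono h])
    show "continuous_on {0..T} (\<Theta> n)" for n by (rule has_velocity_continuous_on[OF \<Theta>])
    have "AE t in lebesgue_on {0..T}. t \<noteq> T"
      by (subst AE_lebesgue_on_iff_negligible) (auto intro: negligible_subset[of "{T}"])
    moreover have "AE t in lebesgue_on {0..T}. t \<in> {0..T}" using AE_space[of "lebesgue_on {0..T}"] by simp
    moreover have "AE t in lebesgue_on {0..T}. (P has_vector_derivative \<rho> t) (at t)"
      using \<rho>(1) by (simp add: has_velocity_def)
    ultimately show "AE t in lebesgue_on {0..T}. lam (Y t) (\<rho> t) \<le>
        liminf (\<lambda>k. liminf (\<lambda>n. ennreal ((\<Theta> n (min T (t + h k)) - \<Theta> n t) / h k)))"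
      using \<rho>(2)
    proof eventually_elim
      case (elim t)
      have t: "0 \<le> t" "t < T" using elim(1,2) by auto
      obtain v0 w0 where vw: "\<rho> t = (v0, w0)" by (cases "\<rho> t")
      have v0: "v0 \<ge> 0" using elim(4) by (simp add: vw)
      show ?case
        unfolding le_Liminf_iff
      proof (intro allI impI)
        fix c assume "c < lam (Y t) (\<rho> t)"
        then obtain d where d: "c < d" "d < lam (Y t) (\<rho> t)" using dense by blast
        then obtain d0 where d0: "d0 \<ge> 0" "d = ennreal d0" by (cases d) (auto simp: top_unique)
        have "ereal d0 < ext_lagrangian L (Y t) v0 w0"
        proof (rule ccontr)
          assume "\<not> ?thesis"
          then have "lam (Y t) (\<rho> t) \<le> ennreal d0"
            using e2ennreal_mono[of "ext_lagrangian L (Y t) v0 w0" "ereal d0"] by (simp add: lam_def vw)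
          then show False using d(2) d0(2) by simp
        qed
        then obtain \<alpha> q where \<alpha>q: "d0 < \<alpha> * v0 + q \<bullet> w0" "\<And>u. \<alpha> + q \<bullet> u \<le> L (Y t) u"
          using exists_linear_minorant[OF v0] by metis
        define \<l> where "\<l> = (\<lambda>z::real \<times> (real^'k). \<alpha> * fst z + q \<bullet> snd z)"
        interpret \<l>: bounded_linear \<l>
          unfolding \<l>_def
          by (intro bounded_linear_add bounded_linear_compose[OF bounded_linear_mult_right bounded_linear_fst]
              bounded_linear_compose[OF bounded_linear_inner_right bounded_linear_snd])
        \<comment> \<open>A quarter of the gap: one part is spent on the difference quotient of
          \<open>P\<close>, two on the error \<open>\<epsilon> * (v + norm w)\<close>, which is at
          most \<open>2 * \<epsilon>\<close>, and one remains spare.\<close>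
        define \<epsilon> where "\<epsilon> = (\<l> (\<rho> t) - d0) / 4"
        have \<epsilon>: "\<epsilon> > 0" using \<alpha>q(1) by (simp add: \<epsilon>_def \<l>_def vw)
        have eps4: "\<l> (\<rho> t) = d0 + 4 * \<epsilon>" by (simp add: \<epsilon>_def field_simps)
        obtain \<delta> where \<delta>: "\<delta> > 0" "\<And>y u. dist y (Y t) < \<delta> \<Longrightarrow> \<alpha> + q \<bullet> u - \<epsilon> * (1 + norm u) \<le> L y u"
          using affine_minorant_perturb[OF \<alpha>q(2) \<epsilon>] by metis
        have "((\<lambda>h. \<l> ((P (t + h) - P t) /\<^sub>R h)) \<longlongrightarrow> \<l> (\<rho> t)) (at_right 0)"
          by (intro \<l>.tendsto tendsto_within_subset[OF has_vector_derivative_quotient_limit[OF elim(3)] subset_UNIV])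
        then have "\<forall>\<^sub>F h in at_right 0. d0 + 3 * \<epsilon> < \<l> ((P (t + h) - P t) /\<^sub>R h)"
          by (rule order_tendstoD(1)) (simp add: eps4 \<epsilon>)
        moreover have "((\<lambda>h. C * h) \<longlongrightarrow> C * 0) (at_right 0)" by (intro tendsto_intros)
        then have "\<forall>\<^sub>F h in at_right 0. C * h < \<delta> / 2"
          by (rule order_tendstoD(2)) (use \<delta> in simp)
        moreover have "\<forall>\<^sub>F h in at_right 0. h < T - t"
          unfolding eventually_at_right_field using t by (intro exI[of _ "T - t"]) auto
        ultimately have ev: "\<forall>\<^sub>F h in at_right 0. d0 + 3 * \<epsilon> < \<l> ((P (t + h) - P t) /\<^sub>R h) \<and> C * h < \<delta> / 2 \<and> h < T - t"
          by (intro eventually_conj)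
        have "\<forall>\<^sub>F k in sequentially. d0 + 3 * \<epsilon> < \<l> ((P (t + h k) - P t) /\<^sub>R h k) \<and> C * h k < \<delta> / 2 \<and> h k < T - t"
          by (rule eventually_compose_filterlim[OF ev h_lim])
        then show "\<forall>\<^sub>F k in sequentially. c < liminf (\<lambda>n. ennreal ((\<Theta> n (min T (t + h k)) - \<Theta> n t) / h k))"
        proof eventually_elim
          case (elim k)
          have th: "t \<in> {0..T}" "t + h k \<in> {0..T}" using t elim h[of k] by auto
          have "(\<lambda>n. \<l> ((Pn n (t + h k) - Pn n t) /\<^sub>R h k)) \<longlonglongrightarrow> \<l> ((P (t + h k) - P t) /\<^sub>R h k)"
            by (intro \<l>.tendsto tendsto_scaleR tendsto_const tendsto_diff P_lim th)
          then have "\<forall>\<^sub>F n in sequentially. d0 + 3 * \<epsilon> < \<l> ((Pn n (t + h k) - Pn n t) /\<^sub>R h k)"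
            by (rule order_tendstoD(1)) (use elim in simp)
          moreover have "\<forall>\<^sub>F n in sequentially. dist (Yn n t) (Y t) < \<delta> / 2"
            by (rule tendstoD[OF Y_lim[OF th(1)]]) (use \<delta> in simp)
          ultimately have "\<forall>\<^sub>F n in sequentially. ennreal d0 \<le> ennreal ((\<Theta> n (min T (t + h k)) - \<Theta> n t) / h k)"
          proof eventually_elim
            case (elim n)
            \<comment> \<open>One half of \<open>\<delta>\<close> comes from convergence at the
              single time \<open>t\<close>, the other from the common constant \<open>C\<close>,
              which bounds the motion during the step \<open>h k\<close>. Thus the perturbed
              minorant is available on the whole step.\<close>
            have near: "dist (Yn n s) (Y t) < \<delta>" if s: "s \<in> {t..t + h k}" for s
            proof -
              have "norm (Yn n s - Yn n t) \<le> C * (s - t)"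
                using driven[of n] s th unfolding driven_def by auto
              also have "\<dots> \<le> C * h k" using s C by (intro mult_left_mono) auto
              finally have "dist (Yn n s) (Yn n t) < \<delta> / 2"
                using \<open>d0 + 3 * \<epsilon> < \<l> ((P (t + h k) - P t) /\<^sub>R h k) \<and> C * h k < \<delta> / 2 \<and> h k < T - t\<close>
                by (simp add: dist_norm)
              then show ?thesis using elim(2) dist_triangle[of "Yn n s" "Y t" "Yn n t"] by linarith
            qed
            have sub: "AE s in lebesgue_on {t..t + h k}. Q s" if "AE s in lebesgue_on {0..T}. Q s" for Q
              using that th by (elim AE_lebesgue_on_subset) auto
            have space: "AE s in lebesgue_on {t..t + h k}. s \<in> {t..t + h k}"
              using AE_space[of "lebesgue_on {t..t + h k}"] by simp
            have "AE s in lebesgue_on {t..t + h k}. \<l> (\<rho>n n s) - 2 * \<epsilon> \<le> l n s"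
              using sub[OF \<rho>n(2)[of n]] sub[OF \<rho>n(3)[of n]] sub[OF l(3)[of n]] space
            proof eventually_elim
              case (elim s)
              obtain v w where vw: "\<rho>n n s = (v, w)" by (cases "\<rho>n n s")
              have v: "v \<ge> 0" using elim(2) by (simp add: vw)
              have "ereal (\<alpha> * v + q \<bullet> w - \<epsilon> * (v + norm w)) \<le> ext_lagrangian L (Yn n s) v w"
                by (rule ext_lagrangian_lowerbound[OF v \<delta>(2)[OF near[OF elim(4)]]])
              also have "\<dots> = ereal (l n s)"
                using elim(3) l(1) by (simp add: vw lam_eq_ennreal_iff)
              finally have "\<l> (\<rho>n n s) - \<epsilon> * (v + norm w) \<le> l n s" by (simp add: \<l>_def vw)
              moreover have "v \<le> norm (\<rho>n n s)" "norm w \<le> norm (\<rho>n n s)"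
                using norm_fst_le[of v w] norm_snd_le[of w v] by (auto simp: vw)
              then have "\<epsilon> * (v + norm w) \<le> \<epsilon> * 2" using elim(1) \<epsilon> by (intro mult_left_mono) auto
              ultimately show ?case by simp
            qed
            moreover have "((\<lambda>s. \<l> (\<rho>n n s) - 2 * \<epsilon>) has_integral
                \<l> (Pn n (t + h k) - Pn n t) - 2 * \<epsilon> * h k) {t..t + h k}"
            proof (rule has_integral_diff)
              have "(\<rho>n n has_integral Pn n (t + h k) - Pn n t) {t..t + h k}"
                using th h[of k] by (intro has_velocity_integral(2)[OF \<rho>n(1) T]) auto
              from has_integral_linear[OF this \<l>.bounded_linear_axioms]
              show "((\<lambda>s. \<l> (\<rho>n n s)) has_integral \<l> (Pn n (t + h k) - Pn n t)) {t..t + h k}"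
                by (simp add: o_def)
              show "((\<lambda>s. 2 * \<epsilon>) has_integral 2 * \<epsilon> * h k) {t..t + h k}"
                using has_integral_const_real[of "2 * \<epsilon>" t "t + h k"] h[of k] by (simp add: mult.commute)
            qed
            moreover have "(l n has_integral \<Theta> n (t + h k) - \<Theta> n t) {t..t + h k}"
              using th h[of k] by (intro \<Theta>_int) auto
            ultimately have "\<l> (Pn n (t + h k) - Pn n t) - 2 * \<epsilon> * h k \<le> \<Theta> n (t + h k) - \<Theta> n t"
              by (intro has_integral_le_AE)
            moreover have "(d0 + 3 * \<epsilon>) * h k \<le> \<l> ((Pn n (t + h k) - Pn n t) /\<^sub>R h k) * h k"
              using elim(1) h[of k] by (intro mult_right_mono) auto
            moreover have "\<l> ((Pn n (t + h k) - Pn n t) /\<^sub>R h k) * h k = \<l> (Pn n (t + h k) - Pn n t)"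
              using h[of k] unfolding \<l>.scaleR by simp
            moreover have "0 \<le> \<epsilon> * h k" using \<epsilon> h[of k] by simp
            ultimately have "d0 * h k \<le> \<Theta> n (t + h k) - \<Theta> n t" by (simp add: algebra_simps)
            then have "d0 \<le> (\<Theta> n (t + h k) - \<Theta> n t) / h k" using h[of k] by (simp add: pos_le_divide_eq)
            moreover have "min T (t + h k) = t + h k" using th by auto
            ultimately show ?case by (simp add: ennreal_leI)
          qed
          then have "ennreal d0 \<le> liminf (\<lambda>n. ennreal ((\<Theta> n (min T (t + h k)) - \<Theta> n t) / h k))"
            by (rule Liminf_bounded)
          then show ?case using d(1) d0(2) by simp
        qed
      qed
    qed
  qed
  then show ?thesis unfolding cost_eq[OF \<rho>(1)] l(4) by (simp add: \<Theta>_def)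
qed

section \<open>Existence of a minimal path\<close>

lemma path_normalize:
  assumes path: "path P Y S" and cost: "cost P Y S \<le> ennreal M" "M \<ge> 0"
  obtains P' Y' where "path P' Y' (1 + M / b)" "cost P' Y' (1 + M / b) = cost P Y S"
proof -
  have S: "0 \<le> S" and "P 0 = 0" "mono_on {0..S} (\<lambda>t. fst (P t))" "fst (P S) = 1" "Y 0 = x0" "Y S = x1"
    using path by (auto simp: path_def)
  note P = this
  obtain \<rho> where \<rho>: "has_velocity S P \<rho>" "has_velocity S Y (\<lambda>t. ctrl f g (Y t) (\<rho> t))"
    using path_velocity[OF path] by metis
  \<comment> \<open>The given path may rest for an arbitrarily long time, so \<open>S\<close> is not
    controlled by the cost. Its arclength \<open>T\<close> is.\<close>
  define T where "T = integral {0..S} (\<lambda>r. norm (\<rho> r))"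
  obtain P1 Y1 where 1: "path P1 Y1 T" "cost P1 Y1 T = (\<integral>\<^sup>+t. lam (Y t) (\<rho> t) \<partial>lebesgue_on {0..S})"
    unfolding T_def using exists_arclength_path[OF S \<rho>(1) P(2-4) \<rho>(2) P(5,6)] by metis
  have "T \<le> 1 + M / b" unfolding T_def by (rule arclength_le[OF path \<rho>(1) cost])
  from path_extend[OF 1(1) this] 1(2) cost_eq[OF \<rho>(1), of Y] that show ?thesis by simp
qed

text \<open>The only clause that mixes the two convergences is the Euler step
  \<open>ctrl f g (Yn n s) (Pn n t - Pn n s)\<close>. Its limit is found by freezing the state, with
  an error controlled by the Lipschitz constant on a ball containing all
  \<open>Yn n s\<close>.\<close>

lemma path_limit:
  assumes paths: "\<And>n. path (Pn n) (Yn n) T" and driven: "\<And>n. driven C T (\<lambda>t. t) (Pn n) (Yn n)"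
    and P_lim: "\<And>t. t \<in> {0..T} \<Longrightarrow> (\<lambda>n. Pn n t) \<longlonglongrightarrow> P t"
    and Y_lim: "\<And>t. t \<in> {0..T} \<Longrightarrow> (\<lambda>n. Yn n t) \<longlonglongrightarrow> Y t"
  shows "path P Y T"
proof -
  have T: "0 \<le> T" using paths[of 0] by (simp add: path_def)
  have C: "C \<ge> 0" using driven[of 0] by (simp add: driven_def)
  have "1-lipschitz_on {0..T} P"
  proof (rule lipschitz_onI)
    fix s t assume st: "s \<in> {0..T}" "t \<in> {0..T}"
    have "dist (Pn n s) (Pn n t) \<le> 1 * dist s t" for n
      by (rule lipschitz_onD[OF _ st]) (use paths[of n] in \<open>simp add: path_def\<close>)
    then show "dist (P s) (P t) \<le> 1 * dist s t"
      by (intro tendsto_upperbound[OF tendsto_dist[OF P_lim[OF st(1)] P_lim[OF st(2)]]] always_eventually) auto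
  qed simp
  moreover have "mono_on {0..T} (\<lambda>t. fst (P t))"
  proof (rule mono_onI)
    fix s t assume st: "s \<in> {0..T}" "t \<in> {0..T}" "s \<le> t"
    have "fst (Pn n s) \<le> fst (Pn n t)" for n
      using paths[of n] st by (auto simp: path_def mono_on_def)
    then show "fst (P s) \<le> fst (P t)"
      by (intro LIMSEQ_le[OF tendsto_fst[OF P_lim[OF st(1)]] tendsto_fst[OF P_lim[OF st(2)]]]) auto
  qed
  moreover have "driven C T (\<lambda>t. t) P Y"
    unfolding driven_def
  proof (intro conjI allI impI)
    fix s t assume st: "0 \<le> s" "s \<le> t" "t \<le> T"
    then have mem: "s \<in> {0..T}" "t \<in> {0..T}" by auto
    have n: "norm (Yn n t - Yn n s) \<le> C * (t - s)"
      "norm (Yn n t - Yn n s - ctrl f g (Yn n s) (Pn n t - Pn n s)) \<le> C * (t - s)\<^sup>2" for n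
      using driven[of n] st by (auto simp: driven_def)
    show "norm (Y t - Y s) \<le> C * (t - s)"
      by (rule tendsto_upperbound[OF tendsto_norm[OF tendsto_diff[OF Y_lim[OF mem(2)] Y_lim[OF mem(1)]]]])
         (use n(1) in auto)
    have "(\<lambda>n. ctrl f g (Yn n s) (Pn n t - Pn n s)) \<longlonglongrightarrow> ctrl f g (Y s) (P t - P s)"
    proof -
      have "bounded (range (\<lambda>n. Yn n s))" by (rule convergent_imp_bounded[OF Y_lim[OF mem(1)]])
      then obtain R0 where R0: "\<And>n. norm (Yn n s) \<le> R0" unfolding bounded_iff by blast
      define R where "R = max R0 (norm (Y s))"
      obtain K where K: "K \<ge> 0" "\<And>y y' z. y \<in> cball 0 R \<Longrightarrow> y' \<in> cball 0 R \<Longrightarrow>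
          norm (ctrl f g y z) \<le> K * norm z \<and> norm (ctrl f g y z - ctrl f g y' z) \<le> K * norm (y - y') * norm z"
        using locally_lipschitz[of R] by blast
      interpret lin: bounded_linear "ctrl f g (Y s)" by (rule bounded_linear)
      have Pd: "(\<lambda>n. Pn n t - Pn n s) \<longlonglongrightarrow> P t - P s" by (intro tendsto_diff P_lim mem)
      have "(\<lambda>n. ctrl f g (Yn n s) (Pn n t - Pn n s) - ctrl f g (Y s) (Pn n t - Pn n s)) \<longlonglongrightarrow> 0"
      proof (rule Lim_null_comparison)
        have "norm (ctrl f g (Yn n s) (Pn n t - Pn n s) - ctrl f g (Y s) (Pn n t - Pn n s))
            \<le> K * norm (Yn n s - Y s) * norm (Pn n t - Pn n s)" for n
          using K(2)[of "Yn n s" "Y s"] R0[of n] by (auto simp: R_def)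
        then show "\<forall>\<^sub>F n in sequentially. norm (ctrl f g (Yn n s) (Pn n t - Pn n s) - ctrl f g (Y s) (Pn n t - Pn n s))
            \<le> K * norm (Yn n s - Y s) * norm (Pn n t - Pn n s)" by simp
        have "(\<lambda>n. K * norm (Yn n s - Y s) * norm (Pn n t - Pn n s)) \<longlonglongrightarrow> K * norm (Y s - Y s) * norm (P t - P s)"
          by (intro tendsto_mult tendsto_norm tendsto_const tendsto_diff Y_lim mem P_lim)
        then show "(\<lambda>n. K * norm (Yn n s - Y s) * norm (Pn n t - Pn n s)) \<longlonglongrightarrow> 0" by simp
      qed
      from tendsto_add[OF this lin.tendsto[OF Pd]] show ?thesis by simp
    qed
    then show "norm (Y t - Y s - ctrl f g (Y s) (P t - P s)) \<le> C * (t - s)\<^sup>2"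
      by (rule tendsto_upperbound[OF tendsto_norm[OF tendsto_diff[OF tendsto_diff[OF Y_lim[OF mem(2)] Y_lim[OF mem(1)]]]]])
         (use n(2) in auto)
  qed (rule C)
  moreover have ends: "0 \<in> {0..T}" "T \<in> {0..T}" using T by auto
  have "P 0 = 0" "fst (P T) = 1" "Y 0 = x0" "Y T = x1"
    using LIMSEQ_unique[OF P_lim[OF ends(1)], of 0] LIMSEQ_unique[OF tendsto_fst[OF P_lim[OF ends(2)]], of 1]
      LIMSEQ_unique[OF Y_lim[OF ends(1)], of x0] LIMSEQ_unique[OF Y_lim[OF ends(2)], of x1] paths
    by (auto simp: path_def)
  ultimately show ?thesis using T unfolding path_def by blast
qed

theorem exists_minimal_path:
  assumes "path P0 Y0 S0"
  obtains P Y S where "path P Y S" "\<And>P' Y' S'. path P' Y' S' \<Longrightarrow> cost P Y S \<le> cost P' Y' S'"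
proof -
  define X where "X = {c. \<exists>P Y S. path P Y S \<and> c = cost P Y S}"
  have low: "Inf X \<le> cost P Y S" if "path P Y S" for P Y S
    by (rule Inf_lower) (use that in \<open>auto simp: X_def\<close>)
  show ?thesis
  proof (cases "Inf X")
    case top
    \<comment> \<open>If all paths have infinite cost, the given one is already minimal.\<close>
    then have "cost P' Y' S' = top" if "path P' Y' S'" for P' Y' S'
      using low[OF that] unfolding top by (simp add: top_unique)
    with that[OF assms] assms show ?thesis by (metis order_refl)
  next
    case (real m)
    then have m: "m \<ge> 0" "Inf X = ennreal m" by auto
    define \<epsilon> where "\<epsilon> = (\<lambda>n::nat. inverse (real (Suc n)))"
    have \<epsilon>: "\<epsilon> n > 0" "\<epsilon> n \<le> 1" for n by (auto simp: \<epsilon>_def field_simps)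
    \<comment> \<open>A common interval for all paths of cost at most \<open>m + 1\<close>, by
      \<open>path_normalize\<close>.\<close>
    define T where "T = 1 + (m + 1) / b"
    have T: "T \<ge> 0" using m b_pos by (simp add: T_def)
    have "\<exists>PY. path (fst PY) (snd PY) T \<and> cost (fst PY) (snd PY) T \<le> ennreal (m + \<epsilon> n)" for n
    proof -
      have "Inf X < ennreal (m + \<epsilon> n)" using m \<epsilon>(1)[of n] by (simp add: ennreal_less_iff)
      then obtain P Y S where PY: "path P Y S" "cost P Y S < ennreal (m + \<epsilon> n)"
        unfolding Inf_less_iff X_def by auto
      have "cost P Y S \<le> ennreal (m + 1)"
        using PY(2) \<epsilon>(2)[of n] by (meson add_left_mono ennreal_leI less_imp_le order_trans)
      then obtain P' Y' where "path P' Y' T" "cost P' Y' T = cost P Y S"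
        using path_normalize[OF PY(1)] m unfolding T_def by (metis add_nonneg_nonneg zero_le_one)
      with PY(2) show ?thesis by (intro exI[of _ "(P', Y')"]) simp
    qed
    then have "\<exists>PY. \<forall>n. path (fst (PY n)) (snd (PY n)) T \<and> cost (fst (PY n)) (snd (PY n)) T \<le> ennreal (m + \<epsilon> n)"
      by (intro choice allI)
    then obtain PY where PY: "\<And>n. path (fst (PY n)) (snd (PY n)) T"
      "\<And>n. cost (fst (PY n)) (snd (PY n)) T \<le> ennreal (m + \<epsilon> n)" by blast
    define Pn where "Pn = (\<lambda>n. fst (PY n))"
    define Yn where "Yn = (\<lambda>n. snd (PY n))"
    have paths: "path (Pn n) (Yn n) T" and costs: "cost (Pn n) (Yn n) T \<le> ennreal (m + \<epsilon> n)" for n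
      using PY by (auto simp: Pn_def Yn_def)
    have costs1: "cost (Pn n) (Yn n) T \<le> ennreal (m + 1)" for n
      using costs[of n] \<epsilon>(2)[of n] by (meson add_left_mono ennreal_leI order_trans)
    have finite: "cost (Pn n) (Yn n) T < \<infinity>" for n
      using costs1[of n] by (metis ennreal_less_top infinity_ennreal_def le_less_trans)
    define R where "R = (1 + norm x0 + 2 * B * (m + 1)) * exp (2 * (A + B) * T)"
    have R: "norm (Yn n t) \<le> R" if "t \<in> {0..T}" for n t
      unfolding R_def by (rule path_bound[OF paths costs1 _ that]) (use m in simp)
    obtain K where K: "K \<ge> 0" "\<And>y y' z. y \<in> cball 0 R \<Longrightarrow> y' \<in> cball 0 R \<Longrightarrow>
        norm (ctrl f g y z) \<le> K * norm z \<and> norm (ctrl f g y z - ctrl f g y' z) \<le> K * norm (y - y') * norm z"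
      using locally_lipschitz[of R] by blast
    \<comment> \<open>The constant of \<open>driven_of_velocity\<close> for the common bound
      \<open>R\<close>. Being independent of \<open>n\<close>, it gives equicontinuity of the
      trajectories and is inherited by the limit.\<close>
    define C where "C = K + K * K"
    have C: "C \<ge> 0" using K(1) by (simp add: C_def)
    have id: "has_velocity T (\<lambda>t. t) (\<lambda>_. 1)" by (simp add: has_velocity_def abs_continuous_on_id)
    have dr: "driven C T (\<lambda>t. t) (Pn n) (Yn n)" for n
    proof -
      obtain \<rho> where \<rho>: "has_velocity T (Pn n) \<rho>" "AE t in lebesgue_on {0..T}. norm (\<rho> t) \<le> 1"
        "has_velocity T (Yn n) (\<lambda>t. ctrl f g (Yn n t) (\<rho> t))"
        using path_velocity[OF paths[of n]] by metis
      show ?thesis unfolding C_def by (rule driven_of_velocity[OF \<rho>(1) id \<rho>(2,3) R K])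
    qed
    have lip: "norm (Pn n s - Pn n t) \<le> \<bar>s - t\<bar>" if "s \<in> {0..T}" "t \<in> {0..T}" for n s t
      using paths[of n] lipschitz_onD[of 1 "{0..T}" "Pn n" s t] that
      by (auto simp: path_def dist_norm)
    have lip': "norm (Yn n s - Yn n t) \<le> C * \<bar>s - t\<bar>" if "s \<in> {0..T}" "t \<in> {0..T}" for n s t
    proof (cases "s \<le> t")
      case True
      then show ?thesis using dr[of n] that by (auto simp: driven_def norm_minus_commute abs_real_def)
    next
      case False
      then show ?thesis using dr[of n] that by (auto simp: driven_def)
    qed
    define F where "F = (\<lambda>n t. (Pn n t, Yn n t))"
    obtain G k where Gk: "strict_mono (k :: nat \<Rightarrow> nat)"
      "\<And>e. 0 < e \<Longrightarrow> \<exists>N. \<forall>n x. n \<ge> N \<and> x \<in> {0..T} \<longrightarrow> norm (F (k n) x - G x) < e"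
    proof (rule Arzela_Ascoli[of "{0..T}" F "T + R"])
      show "norm (F n x) \<le> T + R" if x: "x \<in> {0..T}" for n x
      proof -
        have "norm (Pn n x) \<le> T" using lip[OF x, of 0 n] paths[of n] x by (auto simp: path_def)
        then show ?thesis using R[OF x, of n] norm_Pair_le[of "Pn n x" "Yn n x"] by (simp add: F_def)
      qed
      show "\<exists>d. 0 < d \<and> (\<forall>n y. y \<in> {0..T} \<and> norm (x - y) < d \<longrightarrow> norm (F n x - F n y) < e)"
        if x: "x \<in> {0..T}" and "0 < e" for x e
      proof (intro exI[of _ "e / (1 + C)"] conjI allI impI)
        show "0 < e / (1 + C)" using \<open>0 < e\<close> C by simp
        fix n y assume y: "y \<in> {0..T} \<and> norm (x - y) < e / (1 + C)"
        have "norm (F n x - F n y) \<le> norm (Pn n x - Pn n y) + norm (Yn n x - Yn n y)"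
          unfolding F_def by (simp add: norm_Pair_le)
        also have "\<dots> \<le> \<bar>x - y\<bar> + C * \<bar>x - y\<bar>"
          using lip[OF x, of y n] lip'[OF x, of y n] y by (intro add_mono) auto
        also have "\<dots> = (1 + C) * \<bar>x - y\<bar>" by (simp add: algebra_simps)
        also have "\<dots> < e" using y C by (simp add: pos_less_divide_eq mult.commute)
        finally show "norm (F n x - F n y) < e" .
      qed
    qed auto
    have G_lim: "(\<lambda>n. F (k n) t) \<longlonglongrightarrow> G t" if "t \<in> {0..T}" for t
      unfolding LIMSEQ_iff using Gk(2) that by blast
    define P where "P = (\<lambda>t. fst (G t))"
    define Y where "Y = (\<lambda>t. snd (G t))"
    have P_lim: "(\<lambda>n. Pn (k n) t) \<longlonglongrightarrow> P t" and Y_lim: "(\<lambda>n. Yn (k n) t) \<longlonglongrightarrow> Y t" if "t \<in> {0..T}" for t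
      using tendsto_fst[OF G_lim[OF that]] tendsto_snd[OF G_lim[OF that]] by (simp_all add: F_def P_def Y_def)
    have path: "path P Y T" by (rule path_limit[OF paths dr P_lim Y_lim])
    have "cost P Y T \<le> liminf (\<lambda>n. cost (Pn (k n)) (Yn (k n)) T)"
      by (rule cost_lower_semicontinuous[OF path paths finite dr P_lim Y_lim])
    also have "\<dots> \<le> liminf (\<lambda>n. ennreal (m + \<epsilon> (k n)))"
      by (rule Liminf_mono) (use costs in auto)
    also have "\<dots> = ennreal m"
    proof -
      have "\<epsilon> \<longlonglongrightarrow> 0" unfolding \<epsilon>_def by (rule LIMSEQ_inverse_real_of_nat)
      then have "(\<lambda>n. \<epsilon> (k n)) \<longlonglongrightarrow> 0"
        using LIMSEQ_subseq_LIMSEQ[OF _ Gk(1)] by (auto simp: o_def)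
      then have "(\<lambda>n. ennreal (m + \<epsilon> (k n))) \<longlonglongrightarrow> ennreal (m + 0)" by (intro tendsto_intros)
      then show ?thesis using lim_imp_Liminf[OF trivial_limit_sequentially] by fastforce
    qed
    finally have "cost P Y T \<le> Inf X" by (simp add: m)
    then show ?thesis using that[OF path] low by (metis order_trans)
  qed
qed

end

section \<open>Arclength of Frechet equivalent curves\<close>

definition len :: "(real \<Rightarrow> 'a::real_normed_vector) \<Rightarrow> real \<Rightarrow> real" where
  "len p t = integral {0..t} (\<lambda>r. norm (vector_derivative p (at r)))"

lemma len_0 [simp]: "len p 0 = 0"
  by (simp add: len_def)

lemma loc_abs_continuous_velocity:
  fixes p :: "real \<Rightarrow> 'a::euclidean_space"
  assumes "loc_abs_continuous p"
  shows "has_velocity T p (\<lambda>t. vector_derivative p (at t))"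
proof (cases "0 \<le> T")
  case True
  then have "abs_continuous_on 0 T p" using assms by (simp add: loc_abs_continuous_def)
  then obtain \<rho> where \<rho>: "has_velocity T p \<rho>" using has_velocity_exists[OF _ True] by metis
  have "AE t in lebesgue_on {0..T}. (p has_vector_derivative \<rho> t) (at t)" using \<rho> by (simp add: has_velocity_def)
  then have "AE t in lebesgue_on {0..T}. \<rho> t = vector_derivative p (at t)"
    by eventually_elim (simp add: vector_derivative_at)
  then show ?thesis by (rule has_velocity_cong_AE[OF \<rho>])
next
  case False
  have "abs_continuous_on 0 0 p" using assms by (simp add: loc_abs_continuous_def)
  then have "abs_continuous_on 0 T p" using False by (elim abs_continuous_on_subinterval) auto
  then show ?thesis using False by (simp add: has_velocity_def AE_lebesgue_on_iff_negligible)
qed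

lemma len_velocity:
  fixes p :: "real \<Rightarrow> 'a::euclidean_space"
  assumes p: "loc_abs_continuous p" and T: "0 \<le> T"
  shows "has_velocity T (len p) (\<lambda>t. norm (vector_derivative p (at t)))"
  unfolding len_def
  by (rule has_velocity_arclength[OF has_velocity_integral(1)[OF loc_abs_continuous_velocity[OF p] T]])

lemma norm_diff_le_len:
  fixes p :: "real \<Rightarrow> 'a::euclidean_space"
  assumes p: "loc_abs_continuous p" and st: "0 \<le> s" "s \<le> t"
  shows "norm (p t - p s) \<le> len p t - len p s"
proof -
  have t: "0 \<le> t" using st by simp
  show ?thesis
    by (rule has_velocity_norm_diff_le[OF loc_abs_continuous_velocity[OF p] len_velocity[OF p t]]) (use st in auto)
qed

lemma len_mono:
  fixes p :: "real \<Rightarrow> 'a::euclidean_space"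
  assumes p: "loc_abs_continuous p" and st: "0 \<le> s" "s \<le> t"
  shows "len p s \<le> len p t"
  using norm_diff_le_len[OF p st] norm_ge_zero[of "p t - p s"] by linarith

lemma len_nonneg:
  fixes p :: "real \<Rightarrow> 'a::euclidean_space"
  assumes p: "loc_abs_continuous p" and "0 \<le> t"
  shows "0 \<le> len p t"
  using len_mono[OF p order_refl assms(2)] by simp

lemma len_continuous_on:
  fixes p :: "real \<Rightarrow> 'a::euclidean_space"
  assumes p: "loc_abs_continuous p"
  shows "continuous_on {0..T} (len p)"
proof (cases "0 \<le> T")
  case True
  show ?thesis by (rule has_velocity_continuous_on[OF len_velocity[OF p True]])
qed simp

lemma loc_abs_continuous_continuous_on:
  assumes "loc_abs_continuous p"
  shows "continuous_on {0..T} p"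
proof (cases "0 \<le> T")
  case True
  then have "abs_continuous_on 0 T p" using assms by (simp add: loc_abs_continuous_def)
  then show ?thesis by (rule abs_continuous_on_imp_continuous_on)
qed simp

lemma eq_if_len_eq:
  fixes p :: "real \<Rightarrow> 'a::euclidean_space"
  assumes p: "loc_abs_continuous p" and "0 \<le> s" "0 \<le> t" "len p s = len p t"
  shows "p s = p t"
proof (cases "s \<le> t")
  case True
  then have "norm (p t - p s) \<le> 0" using norm_diff_le_len[OF p assms(2) True] assms(4) by linarith
  then show ?thesis by simp
next
  case False
  then have "norm (p s - p t) \<le> 0" using norm_diff_le_len[OF p assms(3), of s] assms(4) by linarith
  then show ?thesis by simp
qed

lemma exists_len_eq:
  fixes p :: "real \<Rightarrow> 'a::euclidean_space"
  assumes p: "loc_abs_continuous p" and unbounded: "\<And>B. \<exists>t\<ge>0. B < len p t" and s: "0 \<le> s"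
  obtains t where "0 \<le> t" "len p t = s"
proof -
  obtain t where t: "0 \<le> t" "s < len p t" using unbounded by blast
  then show ?thesis using IVT'[of "len p" 0 s t] s len_continuous_on[OF p] that by auto
qed

lemma nn_integral_len:
  fixes p :: "real \<Rightarrow> 'a::euclidean_space"
  assumes p: "loc_abs_continuous p" and T: "0 \<le> T"
  shows "(\<integral>\<^sup>+t. ennreal (norm (vector_derivative p (at t))) \<partial>lebesgue_on {0..T}) = ennreal (len p T)"
proof -
  have "((\<lambda>t. norm (vector_derivative p (at t))) has_integral len p T - len p 0) {0..T}"
    by (rule has_velocity_integral(2)[OF len_velocity[OF p T] T]) (use T in auto)
  then show ?thesis
    using nn_integral_has_integral_lebesgue'[of "{0..T}" "\<lambda>t. norm (vector_derivative p (at t))"]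
    by (simp add: nn_integral_lebesgue_on)
qed

lemma len_unbounded:
  fixes p :: "real \<Rightarrow> 'a::euclidean_space"
  assumes p: "loc_abs_continuous p"
    and infinite: "(\<integral>\<^sup>+t. ennreal (norm (vector_derivative p (at t))) \<partial>lebesgue_on {0..}) = \<infinity>"
  shows "\<exists>t\<ge>0. B < len p t"
proof (rule ccontr)
  assume "\<not> ?thesis"
  then have B: "len p t \<le> B" if "t \<ge> 0" for t using that by force
  define u where "u = (\<lambda>t. ennreal (norm (vector_derivative p (at t))))"
  have "(\<integral>\<^sup>+t. u t \<partial>lebesgue_on {0..}) = (\<integral>\<^sup>+t. u t * indicator {0..} t \<partial>lebesgue)"
    by (simp add: nn_integral_restrict_space)
  also have "\<dots> = (\<integral>\<^sup>+t. (SUP n::nat. u t * indicator {0..real n} t) \<partial>lebesgue)"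
  proof (rule nn_integral_cong)
    fix t :: real
    show "u t * indicator {0..} t = (SUP n::nat. u t * indicator {0..real n} t)"
    proof (cases "t \<ge> 0")
      case True
      obtain n where n: "t \<le> real n" using real_arch_simple by blast
      show ?thesis
      proof (rule antisym)
        show "u t * indicator {0..} t \<le> (SUP n::nat. u t * indicator {0..real n} t)"
          by (rule SUP_upper2[of n]) (use True n in auto)
        show "(SUP n::nat. u t * indicator {0..real n} t) \<le> u t * indicator {0..} t"
          by (rule SUP_least) (auto split: split_indicator)
      qed
    qed simp
  qed
  also have "\<dots> = (SUP n::nat. \<integral>\<^sup>+t. u t * indicator {0..real n} t \<partial>lebesgue)"
  proof (rule nn_integral_monotone_convergence_SUP)
    show "incseq (\<lambda>n t. u t * indicator {0..real n} t)"
      by (auto simp: incseq_def le_fun_def split: split_indicator)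
    show "(\<lambda>t. u t * indicator {0..real n} t) \<in> borel_measurable lebesgue" for n
    proof -
      have "(\<lambda>t. indicat_real {0..real n} t *\<^sub>R vector_derivative p (at t)) \<in> borel_measurable lebesgue"
        using has_velocity_integral(1)[OF loc_abs_continuous_velocity[OF p], of "real n"]
        unfolding set_integrable_def by (auto dest: borel_measurable_integrable)
      then have "(\<lambda>t. ennreal (norm (indicat_real {0..real n} t *\<^sub>R vector_derivative p (at t)))) \<in> borel_measurable lebesgue"
        by measurable
      also have "(\<lambda>t. ennreal (norm (indicat_real {0..real n} t *\<^sub>R vector_derivative p (at t)))) = (\<lambda>t. u t * indicator {0..real n} t)"
        by (auto simp: u_def fun_eq_iff split: split_indicator)
      finally show ?thesis .
    qed
  qed
  also have "\<dots> \<le> ennreal B"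
  proof (rule SUP_least)
    fix n :: nat
    have "(\<integral>\<^sup>+t. u t * indicator {0..real n} t \<partial>lebesgue) = ennreal (len p (real n))"
      using nn_integral_len[OF p, of "real n"] by (simp add: nn_integral_restrict_space u_def)
    also have "\<dots> \<le> ennreal B" by (intro ennreal_leI B) simp
    finally show "(\<integral>\<^sup>+t. u t * indicator {0..real n} t \<partial>lebesgue) \<le> ennreal B" .
  qed
  finally show False using infinite by (simp add: u_def top_unique)
qed

text \<open>The quotients of \<open>p\<close> are limits of quotients of \<open>q\<close> along
  \<open>\<gamma> n\<close>, and the latter are bounded by increments of
  \<open>len q (\<gamma> n s)\<close>. These increments are exactly what
  \<open>nn_integral_le_liminf_increments\<close> accepts.\<close>

lemma len_lower_semicontinuous:
  fixes p q :: "real \<Rightarrow> 'a::euclidean_space"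
  assumes p: "loc_abs_continuous p" and q: "loc_abs_continuous q" and t: "0 \<le> t"
    and \<gamma>: "\<And>n. continuous_on {0..t} (\<gamma> n)" "\<And>n. mono_on {0..t} (\<gamma> n)" "\<And>n. \<gamma> n 0 = 0"
    and lim: "\<And>s. s \<in> {0..t} \<Longrightarrow> (\<lambda>n. q (\<gamma> n s)) \<longlonglongrightarrow> p s"
  shows "ennreal (len p t) \<le> liminf (\<lambda>n. ennreal (len q (\<gamma> n t)))"
proof -
  define \<Theta> where "\<Theta> = (\<lambda>n s. len q (\<gamma> n s))"
  have \<gamma>_range: "\<gamma> n s \<in> {0..\<gamma> n t}" if "s \<in> {0..t}" for n s
    using mono_onD[OF \<gamma>(2)[of n], of 0 s] mono_onD[OF \<gamma>(2)[of n], of s t] that \<gamma>(3)[of n] by auto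
  have cont: "continuous_on {0..t} (\<Theta> n)" for n
    unfolding \<Theta>_def
    by (rule continuous_on_compose2[OF len_continuous_on[OF q, of "\<gamma> n t"] \<gamma>(1)]) (use \<gamma>_range in blast)
  have mono: "mono_on {0..t} (\<Theta> n)" for n
    unfolding \<Theta>_def
  proof (rule mono_onI)
    fix r s assume rs: "r \<in> {0..t}" "s \<in> {0..t}" "r \<le> s"
    show "len q (\<gamma> n r) \<le> len q (\<gamma> n s)"
      by (rule len_mono[OF q]) (use \<gamma>_range[OF rs(1), of n] mono_onD[OF \<gamma>(2) rs] in auto)
  qed
  define h where "h = (\<lambda>k::nat. inverse (real (Suc k)))"
  have h: "h k > 0" for k by (simp add: h_def)
  have h_lim: "filterlim h (at_right 0) sequentially"
    using LIMSEQ_inverse_real_of_nat h unfolding h_def by (simp add: filterlim_at)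
  have "(\<integral>\<^sup>+s. ennreal (norm (vector_derivative p (at s))) \<partial>lebesgue_on {0..t}) \<le> liminf (\<lambda>n. ennreal (\<Theta> n t - \<Theta> n 0))"
  proof (rule nn_integral_le_liminf_increments[OF t cont mono h])
    have "AE s in lebesgue_on {0..t}. s \<noteq> t"
      by (subst AE_lebesgue_on_iff_negligible) (auto intro: negligible_subset[of "{t}"])
    moreover have "AE s in lebesgue_on {0..t}. s \<in> {0..t}" using AE_space[of "lebesgue_on {0..t}"] by simp
    moreover have "AE s in lebesgue_on {0..t}. (p has_vector_derivative vector_derivative p (at s)) (at s)"
      using loc_abs_continuous_velocity[OF p, of t] by (simp add: has_velocity_def)
    ultimately show "AE s in lebesgue_on {0..t}. ennreal (norm (vector_derivative p (at s))) \<le>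
        liminf (\<lambda>k. liminf (\<lambda>n. ennreal ((\<Theta> n (min t (s + h k)) - \<Theta> n s) / h k)))"
    proof eventually_elim
      case (elim s)
      have s: "0 \<le> s" "s < t" using elim(1,2) by auto
      have "((\<lambda>h. norm ((p (s + h) - p s) /\<^sub>R h)) \<longlongrightarrow> norm (vector_derivative p (at s))) (at_right 0)"
        by (intro tendsto_norm tendsto_within_subset[OF has_vector_derivative_quotient_limit[OF elim(3)] subset_UNIV])
      from filterlim_compose[OF this h_lim]
      have "(\<lambda>k. ennreal (norm ((p (s + h k) - p s) /\<^sub>R h k))) \<longlonglongrightarrow> ennreal (norm (vector_derivative p (at s)))"
        by (rule tendsto_ennrealI)
      then have "ennreal (norm (vector_derivative p (at s))) = liminf (\<lambda>k. ennreal (norm ((p (s + h k) - p s) /\<^sub>R h k)))"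
        using lim_imp_Liminf[OF trivial_limit_sequentially] by metis
      also have "\<dots> \<le> liminf (\<lambda>k. liminf (\<lambda>n. ennreal ((\<Theta> n (min t (s + h k)) - \<Theta> n s) / h k)))"
      proof (rule Liminf_mono)
        have "\<forall>\<^sub>F h in at_right 0. h < t - s"
          unfolding eventually_at_right_field using s by (intro exI[of _ "t - s"]) auto
        then have "\<forall>\<^sub>F k in sequentially. h k < t - s" by (rule eventually_compose_filterlim[OF _ h_lim])
        then show "\<forall>\<^sub>F k in sequentially. ennreal (norm ((p (s + h k) - p s) /\<^sub>R h k)) \<le>
            liminf (\<lambda>n. ennreal ((\<Theta> n (min t (s + h k)) - \<Theta> n s) / h k))"
        proof eventually_elim
          case (elim k)
          have sh: "s \<in> {0..t}" "s + h k \<in> {0..t}" using s elim h[of k] by auto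
          have "(\<lambda>n. ennreal (norm ((q (\<gamma> n (s + h k)) - q (\<gamma> n s)) /\<^sub>R h k))) \<longlonglongrightarrow> ennreal (norm ((p (s + h k) - p s) /\<^sub>R h k))"
            by (intro tendsto_ennrealI tendsto_norm tendsto_scaleR tendsto_const tendsto_diff lim sh)
          then have "ennreal (norm ((p (s + h k) - p s) /\<^sub>R h k)) = liminf (\<lambda>n. ennreal (norm ((q (\<gamma> n (s + h k)) - q (\<gamma> n s)) /\<^sub>R h k)))"
            using lim_imp_Liminf[OF trivial_limit_sequentially] by metis
          also have "\<dots> \<le> liminf (\<lambda>n. ennreal ((\<Theta> n (min t (s + h k)) - \<Theta> n s) / h k))"
          proof (rule Liminf_mono, rule always_eventually, rule allI, rule ennreal_leI)
            fix n
            have "norm (q (\<gamma> n (s + h k)) - q (\<gamma> n s)) \<le> \<Theta> n (s + h k) - \<Theta> n s"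
              unfolding \<Theta>_def
              by (rule norm_diff_le_len[OF q]) (use \<gamma>_range[OF sh(1), of n] mono_onD[OF \<gamma>(2) sh] h[of k] in auto)
            then have "norm (q (\<gamma> n (s + h k)) - q (\<gamma> n s)) / h k \<le> (\<Theta> n (s + h k) - \<Theta> n s) / h k"
              using h[of k] by (intro divide_right_mono) auto
            moreover have "norm ((q (\<gamma> n (s + h k)) - q (\<gamma> n s)) /\<^sub>R h k) = norm (q (\<gamma> n (s + h k)) - q (\<gamma> n s)) / h k"
              using h[of k] by (simp only: norm_scaleR abs_inverse divide_inverse mult.commute abs_of_pos)
            moreover have "min t (s + h k) = s + h k" using sh by auto
            ultimately show "norm ((q (\<gamma> n (s + h k)) - q (\<gamma> n s)) /\<^sub>R h k) \<le> (\<Theta> n (min t (s + h k)) - \<Theta> n s) / h k"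
              by simp
          qed
          finally show ?case .
        qed
      qed
      finally show ?case .
    qed
  qed
  then show ?thesis by (simp add: nn_integral_len[OF p t] \<Theta>_def \<gamma>(3))
qed

section \<open>Frechet equivalence\<close>

lemma reparams_properties:
  assumes "\<alpha> \<in> reparams"
  defines "\<beta> \<equiv> inv_into {0..} \<alpha>"
  shows "\<And>t. 0 \<le> t \<Longrightarrow> 0 \<le> \<alpha> t" "\<And>t. 0 \<le> t \<Longrightarrow> 0 \<le> \<beta> t"
    "\<And>t. 0 \<le> t \<Longrightarrow> \<beta> (\<alpha> t) = t" "\<And>t. 0 \<le> t \<Longrightarrow> \<alpha> (\<beta> t) = t" "\<alpha> 0 = 0" "\<beta> 0 = 0"
    "\<And>s t. 0 \<le> s \<Longrightarrow> s \<le> t \<Longrightarrow> \<alpha> s \<le> \<alpha> t" "\<And>s t. 0 \<le> s \<Longrightarrow> s \<le> t \<Longrightarrow> \<beta> s \<le> \<beta> t"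
    "\<And>T. continuous_on {0..T} \<alpha>" "\<And>T. continuous_on {0..T} \<beta>"
proof -
  have bij: "bij_betw \<alpha> {0..} {0..}" and sm: "strict_mono_on {0..} \<alpha>"
    and ac: "loc_abs_continuous \<alpha>" "loc_abs_continuous \<beta>"
    using assms by (auto simp: reparams_def)
  have inj: "inj_on \<alpha> {0..}" and im: "\<alpha> ` {0..} = {0..}" using bij by (auto simp: bij_betw_def)
  show a0: "0 \<le> \<alpha> t" if "0 \<le> t" for t using im that by auto
  show b0: "0 \<le> \<beta> t" if "0 \<le> t" for t
    using inv_into_into[of t \<alpha> "{0..}"] im that by (auto simp: \<beta>_def)
  show ba: "\<beta> (\<alpha> t) = t" if "0 \<le> t" for t using inv_into_f_f[OF inj, of t] that by (simp add: \<beta>_def)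
  show ab: "\<alpha> (\<beta> t) = t" if "0 \<le> t" for t using f_inv_into_f[of t \<alpha> "{0..}"] im that by (simp add: \<beta>_def)
  show am: "\<alpha> s \<le> \<alpha> t" if "0 \<le> s" "s \<le> t" for s t
    using strict_mono_onD[OF sm, of s t] that by (cases "s = t") auto
  show "\<beta> s \<le> \<beta> t" if "0 \<le> s" "s \<le> t" for s t
  proof (rule ccontr)
    assume "\<not> ?thesis"
    then have "\<alpha> (\<beta> t) < \<alpha> (\<beta> s)" using strict_mono_onD[OF sm, of "\<beta> t" "\<beta> s"] b0 that by auto
    then show False using ab that by auto
  qed
  show "\<alpha> 0 = 0" using am[of 0 "\<beta> 0"] a0[of 0] b0[of 0] ab[of 0] by auto
  then show "\<beta> 0 = 0" using ba[of 0] by simp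
  show "continuous_on {0..T} \<alpha>" "continuous_on {0..T} \<beta>" for T
    by (rule loc_abs_continuous_continuous_on[OF ac(1)], rule loc_abs_continuous_continuous_on[OF ac(2)])
qed

text \<open>The infimum 0 need not be attained, so a reparametrization is obtained only for each
  \<open>\<epsilon>\<close>. The essential bound holds at every time by continuity: a violation at
  \<open>t\<close> would persist on an interval to the right of \<open>t\<close>.\<close>

lemma frechet_rel_approx:
  fixes p q :: "real \<Rightarrow> 'a::euclidean_space"
  assumes "(p, q) \<in> frechet_rel" and \<epsilon>: "\<epsilon> > 0"
  obtains \<alpha> where "\<alpha> \<in> reparams" "\<And>t. 0 \<le> t \<Longrightarrow> norm (p t - q (\<alpha> t)) \<le> \<epsilon>"
proof -
  have p: "loc_abs_continuous p" and q: "loc_abs_continuous q"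
    and inf: "(INF \<alpha>\<in>reparams. esssup (lebesgue_on {0..}) (\<lambda>t. ereal (norm (p t - q (\<alpha> t))))) = 0"
    using assms(1) by (auto simp: frechet_rel_def)
  have "(INF \<alpha>\<in>reparams. esssup (lebesgue_on {0..}) (\<lambda>t. ereal (norm (p t - q (\<alpha> t))))) < ereal \<epsilon>"
    unfolding inf using \<epsilon> by simp
  then obtain \<alpha> where \<alpha>: "\<alpha> \<in> reparams" "esssup (lebesgue_on {0..}) (\<lambda>t. ereal (norm (p t - q (\<alpha> t)))) < ereal \<epsilon>"
    unfolding INF_less_iff by blast
  note rp = reparams_properties[OF \<alpha>(1)]
  have "AE t in lebesgue_on {0..}. ereal (norm (p t - q (\<alpha> t))) \<le> esssup (lebesgue_on {0..}) (\<lambda>t. ereal (norm (p t - q (\<alpha> t))))"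
    by (rule esssup_AE)
  then have "AE t in lebesgue_on {0..}. norm (p t - q (\<alpha> t)) \<le> \<epsilon>"
  proof eventually_elim
    case (elim t)
    then have "ereal (norm (p t - q (\<alpha> t))) < ereal \<epsilon>" using \<alpha>(2) by (rule le_less_trans)
    then show ?case by simp
  qed
  then have neg: "negligible {t\<in>{0..}. \<not> norm (p t - q (\<alpha> t)) \<le> \<epsilon>}"
    by (subst (asm) AE_lebesgue_on_iff_negligible) auto
  have "norm (p t - q (\<alpha> t)) \<le> \<epsilon>" if t: "0 \<le> t" for t
  proof (rule ccontr)
    assume gt: "\<not> ?thesis"
    define \<phi> where "\<phi> = (\<lambda>t. norm (p t - q (\<alpha> t)))"
    have "continuous_on {0..t + 1} (\<lambda>t. q (\<alpha> t))"
      by (rule continuous_on_compose2[OF loc_abs_continuous_continuous_on[OF q, of "\<alpha> (t + 1)"] rp(9)])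
         (use rp(1,7) in auto)
    then have "continuous_on {0..t + 1} \<phi>"
      unfolding \<phi>_def by (intro continuous_intros loc_abs_continuous_continuous_on[OF p])
    then obtain d where d: "d > 0" "\<And>s. s \<in> {0..t + 1} \<Longrightarrow> dist s t < d \<Longrightarrow> dist (\<phi> s) (\<phi> t) < \<phi> t - \<epsilon>"
      unfolding continuous_on_iff using t gt
      by (metis \<phi>_def add_increasing2 atLeastAtMost_iff diff_gt_0_iff_gt le_add_same_cancel1 not_le zero_le_one)
    define e where "e = min (d / 2) 1"
    have e: "e > 0" "e < d" "e \<le> 1" using d(1) by (auto simp: e_def)
    have "{t..t + e} \<subseteq> {t\<in>{0..}. \<not> norm (p t - q (\<alpha> t)) \<le> \<epsilon>}"
    proof
      fix s assume s: "s \<in> {t..t + e}"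
      then have "dist (\<phi> s) (\<phi> t) < \<phi> t - \<epsilon>" using e t by (intro d(2)) (auto simp: dist_real_def)
      then have "\<phi> s > \<epsilon>" by (simp add: dist_real_def)
      then show "s \<in> {t\<in>{0..}. \<not> norm (p t - q (\<alpha> t)) \<le> \<epsilon>}" using s t by (simp add: \<phi>_def)
    qed
    then have "negligible {t..t + e}" by (rule negligible_subset[OF neg])
    then show False using e(1) negligible_interval(1)[of t "t + e"] by simp
  qed
  with that \<alpha>(1) show ?thesis by blast
qed

text \<open>
  Curves at Frechet distance zero have the same parametrization by arclength: both curves are
  uniform limits of reparametrizations of the other one, and length is lower semicontinuous.
  The infinite length of \<open>p\<close> keeps the parameters from escaping to infinity.
\<close>

lemma frechet_rel_same_arclength:
  fixes p q :: "real \<Rightarrow> 'a::euclidean_space"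
  assumes rel: "(p, q) \<in> frechet_rel" and unbounded: "\<And>B. \<exists>t\<ge>0. B < len p t" and t: "0 \<le> t"
  obtains \<tau> where "0 \<le> \<tau>" "len q \<tau> = len p t" "q \<tau> = p t"
proof -
  have p: "loc_abs_continuous p" and q: "loc_abs_continuous q"
    using rel by (auto simp: frechet_rel_def)
  define \<epsilon> where "\<epsilon> = (\<lambda>n::nat. inverse (real (Suc n)))"
  have \<epsilon>: "\<epsilon> n > 0" for n by (simp add: \<epsilon>_def)
  have \<epsilon>_lim: "\<epsilon> \<longlonglongrightarrow> 0" unfolding \<epsilon>_def by (rule LIMSEQ_inverse_real_of_nat)
  define close where "close = (\<lambda>n \<alpha>. \<alpha> \<in> reparams \<and> (\<forall>s\<ge>0. norm (p s - q (\<alpha> s)) \<le> \<epsilon> n))"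
  have ex_close: "\<exists>\<alpha>. close n \<alpha>" for n
    using frechet_rel_approx[OF rel \<epsilon>[of n]] unfolding close_def by metis
  have lim_p: "(\<lambda>n. q (\<alpha> n s)) \<longlonglongrightarrow> p s"
    if \<alpha>: "\<And>n. close (r n) (\<alpha> n)" and r: "(\<lambda>n. \<epsilon> (r n)) \<longlonglongrightarrow> 0" and s: "0 \<le> s" for \<alpha> r s
  proof -
    have "norm (q (\<alpha> n s) - p s) \<le> \<epsilon> (r n)" for n
      using \<alpha>[of n] s by (simp add: close_def norm_minus_commute)
    then have "(\<lambda>n. q (\<alpha> n s) - p s) \<longlonglongrightarrow> 0"
      by (intro Lim_null_comparison[OF _ r]) auto
    then show ?thesis by (rule LIM_zero_cancel)
  qed
  have lsc_p: "ennreal (len p s) \<le> liminf (\<lambda>n. ennreal (len q (\<alpha> n s)))"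
    if \<alpha>: "\<And>n. close (r n) (\<alpha> n)" and r: "(\<lambda>n. \<epsilon> (r n)) \<longlonglongrightarrow> 0" and s: "0 \<le> s" for \<alpha> r s
  proof (rule len_lower_semicontinuous[OF p q s])
    have rp: "\<alpha> n \<in> reparams" for n using \<alpha>[of n] by (simp add: close_def)
    show "continuous_on {0..s} (\<alpha> n)" "mono_on {0..s} (\<alpha> n)" "\<alpha> n 0 = 0" for n
      using reparams_properties[OF rp[of n]] by (auto simp: mono_on_def)
    show "(\<lambda>n. q (\<alpha> n r)) \<longlonglongrightarrow> p r" if "r \<in> {0..s}" for r
      using lim_p[OF \<alpha> r] that by simp
  qed
  have lsc_q: "ennreal (len q s) \<le> liminf (\<lambda>n. ennreal (len p (inv_into {0..} (\<alpha> n) s)))"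
    if \<alpha>: "\<And>n. close (r n) (\<alpha> n)" and r: "(\<lambda>n. \<epsilon> (r n)) \<longlonglongrightarrow> 0" and s: "0 \<le> s" for \<alpha> r s
  proof (rule len_lower_semicontinuous[OF q p s])
    have rp: "\<alpha> n \<in> reparams" for n using \<alpha>[of n] by (simp add: close_def)
    show "continuous_on {0..s} (inv_into {0..} (\<alpha> n))" "mono_on {0..s} (inv_into {0..} (\<alpha> n))"
      "inv_into {0..} (\<alpha> n) 0 = 0" for n
      using reparams_properties[OF rp[of n]] by (auto simp: mono_on_def)
    show "(\<lambda>n. p (inv_into {0..} (\<alpha> n) x)) \<longlonglongrightarrow> q x" if x: "x \<in> {0..s}" for x
    proof -
      have "norm (p (inv_into {0..} (\<alpha> n) x) - q x) \<le> \<epsilon> (r n)" for n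
      proof -
        have "0 \<le> inv_into {0..} (\<alpha> n) x" "\<alpha> n (inv_into {0..} (\<alpha> n) x) = x"
          using reparams_properties(2,4)[OF rp[of n], of x] x by auto
        then show ?thesis using \<alpha>[of n] by (metis close_def)
      qed
      then have "(\<lambda>n. p (inv_into {0..} (\<alpha> n) x) - q x) \<longlonglongrightarrow> 0"
        by (intro Lim_null_comparison[OF _ r]) auto
      then show ?thesis by (rule LIM_zero_cancel)
    qed
  qed
  \<comment> \<open>If \<open>s < \<alpha> n t\<close>, the inverse reparametrization takes
    \<open>s\<close> to a time before \<open>t\<close>. Semicontinuity along the inverses then
    bounds the length of \<open>q\<close> up to \<open>s\<close> by that of \<open>p\<close> up to
    \<open>t\<close>.\<close>
  have q_short: "len q s \<le> len p t"
    if \<alpha>: "\<And>n. close (r n) (\<alpha> n)" and r: "(\<lambda>n. \<epsilon> (r n)) \<longlonglongrightarrow> 0" and s: "0 \<le> s"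
      and ev: "\<forall>\<^sub>F n in sequentially. s < \<alpha> n t" for \<alpha> r s
  proof -
    have rp: "\<alpha> n \<in> reparams" for n using \<alpha>[of n] by (simp add: close_def)
    have "ennreal (len q s) \<le> liminf (\<lambda>n. ennreal (len p (inv_into {0..} (\<alpha> n) s)))"
      by (rule lsc_q[OF \<alpha> r s])
    also have "\<dots> \<le> liminf (\<lambda>n. ennreal (len p t))"
    proof (rule Liminf_mono)
      show "\<forall>\<^sub>F n in sequentially. ennreal (len p (inv_into {0..} (\<alpha> n) s)) \<le> ennreal (len p t)"
        using ev
      proof eventually_elim
        case (elim n)
        have "inv_into {0..} (\<alpha> n) s \<le> t"
          using reparams_properties(8)[OF rp[of n], of s "\<alpha> n t"] reparams_properties(3)[OF rp[of n] t] s elim by simp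
        then show ?case
          using reparams_properties(2)[OF rp[of n] s] by (intro ennreal_leI len_mono[OF p])
      qed
    qed
    also have "\<dots> = ennreal (len p t)" by (simp add: Liminf_const)
    finally show ?thesis using len_nonneg[OF p t] by (simp add: ennreal_le_iff)
  qed
  \<comment> \<open>Otherwise the parameters \<open>\<alpha> t\<close> escape to infinity along a
    sequence. By \<open>q_short\<close> the whole of \<open>q\<close> would then be no longer than
    \<open>len p t\<close>, and by semicontinuity neither would \<open>p\<close>, which has infinite
    length.\<close>
  have "\<exists>m. \<forall>\<alpha>. close m \<alpha> \<longrightarrow> \<alpha> t \<le> real m"
  proof (rule ccontr)
    assume "\<not> ?thesis"
    then have "\<forall>m. \<exists>\<alpha>. close m \<alpha> \<and> real m < \<alpha> t" by (auto simp: not_le)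
    then obtain \<alpha> where \<alpha>: "\<And>m. close m (\<alpha> m)" "\<And>m. real m < \<alpha> m t" by metis
    have short: "len q s \<le> len p t" if s: "0 \<le> s" for s
    proof (rule q_short[OF \<alpha>(1) \<epsilon>_lim s])
      obtain N where "s \<le> real N" using real_arch_simple by blast
      then have "s < \<alpha> n t" if "n \<ge> N" for n using \<alpha>(2)[of n] that by (smt (verit) of_nat_mono)
      then show "\<forall>\<^sub>F n in sequentially. s < \<alpha> n t" unfolding eventually_sequentially by blast
    qed
    obtain s where s: "0 \<le> s" "len p t < len p s" using unbounded by blast
    have "ennreal (len p s) \<le> liminf (\<lambda>n. ennreal (len q (\<alpha> n s)))" by (rule lsc_p[OF \<alpha>(1) \<epsilon>_lim s(1)])
    also have "\<dots> \<le> liminf (\<lambda>n. ennreal (len p t))"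
    proof (rule Liminf_mono, rule always_eventually, rule allI, rule ennreal_leI, rule short)
      show "0 \<le> \<alpha> n s" for n using reparams_properties(1)[of "\<alpha> n" s] \<alpha>(1)[of n] s(1) by (simp add: close_def)
    qed
    also have "\<dots> = ennreal (len p t)" by (simp add: Liminf_const)
    finally show False using s len_nonneg[OF p t] by (simp add: ennreal_le_iff)
  qed
  then obtain m where m: "\<And>\<alpha>. close m \<alpha> \<Longrightarrow> \<alpha> t \<le> real m" by blast
  \<comment> \<open>Starting at accuracy \<open>\<epsilon> m\<close> makes every member close of
    order \<open>m\<close>, so all parameters at \<open>t\<close> lie in the compact interval
    \<open>[0, m]\<close>.\<close>
  have "\<forall>n. \<exists>\<alpha>. close (m + n) \<alpha>" using ex_close by blast
  from choice[OF this] obtain \<alpha> where \<alpha>: "\<And>n. close (m + n) (\<alpha> n)" by blast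
  have rp: "\<alpha> n \<in> reparams" for n using \<alpha>[of n] by (simp add: close_def)
  have "close m (\<alpha> n)" for n
  proof -
    have "\<epsilon> (m + n) \<le> \<epsilon> m" by (simp add: \<epsilon>_def field_simps)
    then show ?thesis using \<alpha>[of n] unfolding close_def by fastforce
  qed
  then have range: "\<alpha> n t \<in> {0..real m}" for n using m reparams_properties(1)[OF rp t] by simp
  obtain \<tau> k where \<tau>: "\<tau> \<in> {0..real m}" "strict_mono (k :: nat \<Rightarrow> nat)" "((\<lambda>n. \<alpha> n t) \<circ> k) \<longlonglongrightarrow> \<tau>"
    using compact_Icc[of 0 "real m", unfolded compact_def] range by metis
  define \<alpha>' where "\<alpha>' = (\<lambda>n. \<alpha> (k n))"
  have \<alpha>': "close (m + k n) (\<alpha>' n)" for n using \<alpha> by (simp add: \<alpha>'_def)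
  have r: "(\<lambda>n. \<epsilon> (m + k n)) \<longlonglongrightarrow> 0"
  proof -
    have "(\<lambda>n. \<epsilon> (n + m)) \<longlonglongrightarrow> 0" by (rule LIMSEQ_ignore_initial_segment[OF \<epsilon>_lim])
    from LIMSEQ_subseq_LIMSEQ[OF this \<tau>(2)] show ?thesis by (simp add: o_def add.commute)
  qed
  have lim_\<tau>: "(\<lambda>n. \<alpha>' n t) \<longlonglongrightarrow> \<tau>" using \<tau>(3) by (simp add: o_def \<alpha>'_def)
  have range': "\<alpha>' n t \<in> {0..real m}" for n using range by (simp add: \<alpha>'_def)
  have "(\<lambda>n. q (\<alpha>' n t)) \<longlonglongrightarrow> q \<tau>"
    by (rule continuous_on_tendsto_compose[OF loc_abs_continuous_continuous_on[OF q] lim_\<tau> \<tau>(1)]) (use range' in auto)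
  with lim_p[OF \<alpha>' r t] have q\<tau>: "q \<tau> = p t" by (metis LIMSEQ_unique)
  have "(\<lambda>n. len q (\<alpha>' n t)) \<longlonglongrightarrow> len q \<tau>"
    by (rule continuous_on_tendsto_compose[OF len_continuous_on[OF q] lim_\<tau> \<tau>(1)]) (use range' in auto)
  then have "(\<lambda>n. ennreal (len q (\<alpha>' n t))) \<longlonglongrightarrow> ennreal (len q \<tau>)" by (rule tendsto_ennrealI)
  then have "liminf (\<lambda>n. ennreal (len q (\<alpha>' n t))) = ennreal (len q \<tau>)"
    by (rule lim_imp_Liminf[OF trivial_limit_sequentially])
  with lsc_p[OF \<alpha>' r t] have ge: "len p t \<le> len q \<tau>"
    using len_nonneg[OF q, of \<tau>] \<tau>(1) by (simp add: ennreal_le_iff)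
  have le: "len q \<tau> \<le> len p t"
  proof (cases "\<tau> = 0")
    case True
    then show ?thesis using len_nonneg[OF p t] by simp
  next
    case False
    then have "\<tau> > 0" using \<tau>(1) by simp
    have short: "len q s \<le> len p t" if "0 \<le> s" "s < \<tau>" for s
      by (rule q_short[OF \<alpha>' r that(1) order_tendstoD(1)[OF lim_\<tau> that(2)]])
    \<comment> \<open>\<open>q_short\<close> covers only parameters strictly below
      \<open>\<tau>\<close>; \<open>\<tau>\<close> is approached from the left and
      \<open>len q\<close> is continuous.\<close>
    define s where "s = (\<lambda>n. \<tau> - \<tau> * \<epsilon> n)"
    have s: "0 \<le> s n" "s n < \<tau>" for n
    proof -
      have "\<epsilon> n \<le> 1" by (simp add: \<epsilon>_def field_simps)
      then have "\<tau> * \<epsilon> n \<le> \<tau> * 1" using \<open>\<tau> > 0\<close> by (intro mult_left_mono) auto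
      then show "0 \<le> s n" by (simp add: s_def)
      show "s n < \<tau>" using \<open>\<tau> > 0\<close> \<epsilon>[of n] by (simp add: s_def)
    qed
    have "s \<longlonglongrightarrow> \<tau> - \<tau> * 0" unfolding s_def by (intro tendsto_intros \<epsilon>_lim)
    then have "s \<longlonglongrightarrow> \<tau>" by simp
    then have "(\<lambda>n. len q (s n)) \<longlonglongrightarrow> len q \<tau>"
      by (rule continuous_on_tendsto_compose[OF len_continuous_on[OF q, of \<tau>]])
         (use s \<open>\<tau> > 0\<close> in \<open>auto intro!: always_eventually less_imp_le\<close>)
    then show ?thesis by (rule LIMSEQ_le_const2) (intro exI[of _ 0] allI impI short s)
  qed
  show ?thesis using that[of \<tau>] \<tau>(1) q\<tau> ge le by simp
qed

section \<open>From minimal paths to minimizers\<close>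

lemma ext_integral_cong:
  assumes "\<And>t. t \<in> {0..T} \<Longrightarrow> h t = h' t"
  shows "ext_integral T h = ext_integral T h'"
proof -
  have "(\<integral>\<^sup>+t. e2ennreal (h t) \<partial>lebesgue_on {0..T}) = (\<integral>\<^sup>+t. e2ennreal (h' t) \<partial>lebesgue_on {0..T})"
    "(\<integral>\<^sup>+t. e2ennreal (- h t) \<partial>lebesgue_on {0..T}) = (\<integral>\<^sup>+t. e2ennreal (- h' t) \<partial>lebesgue_on {0..T})"
    using assms by (auto intro!: nn_integral_cong)
  then show ?thesis by (simp add: ext_integral_def)
qed

section \<open>Effect of an additive constant in the Lagrangian\<close>

context lagrangian
begin

lemma ext_lagrangian_shift:
  assumes "v \<ge> 0"
  shows "ext_lagrangian (\<lambda>x u. L x u + a) y v w = ext_lagrangian L y v w + ereal (a * v)"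
proof (cases "v = 0")
  case True
  have "((\<lambda>\<eta>. ereal (a * \<eta>)) \<longlongrightarrow> ereal (a * 0)) (at_right 0)" by (intro tendsto_intros)
  then have "((\<lambda>\<eta>. ereal (L y (w /\<^sub>R \<eta>) * \<eta>) + ereal (a * \<eta>)) \<longlongrightarrow> lam0 y w + ereal (a * 0)) (at_right 0)"
    using ext_lagrangian_nonneg[of y 0 w] by (intro tendsto_add_ereal_nonneg tendsto_lam0) auto
  then have "((\<lambda>\<eta>. ereal ((L y (w /\<^sub>R \<eta>) + a) * \<eta>)) \<longlongrightarrow> lam0 y w) (at_right 0)"
    by (simp add: distrib_right)
  from tendsto_Lim[OF trivial_limit_at_right_real this] True show ?thesis
    by (simp add: ext_lagrangian_def)
next
  case False
  then show ?thesis using assms by (simp add: ext_lagrangian_def distrib_right)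
qed

text \<open>This is \<open>x = x\<^sup>+ - x\<^sup>-\<close> for \<open>x = E + c\<close>, with the
  terms moved so that no difference in \<open>ennreal\<close> occurs; \<open>E\<close> may be
  infinite.\<close>

lemma positive_part_shift:
  fixes E :: ereal
  assumes "0 \<le> E" "c \<le> 0"
  shows "e2ennreal (E + ereal c) + ennreal (- c) = e2ennreal E + e2ennreal (- (E + ereal c))"
proof (cases E)
  case (real e)
  then have e: "e \<ge> 0" using assms(1) by simp
  show ?thesis
  proof (cases "0 \<le> e + c")
    case True
    then have "ennreal (e + c) + ennreal (- c) = ennreal e"
      using assms(2) by (subst ennreal_plus[symmetric]) auto
    moreover have "ennreal (- (e + c)) = 0" using True by (intro ennreal_neg) simp
    ultimately show ?thesis by (simp add: real)
  next
    case False
    then have "ennreal e + ennreal (- (e + c)) = ennreal (- c)"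
      using e by (subst ennreal_plus[symmetric]) auto
    moreover have "ennreal (e + c) = 0" using False by (intro ennreal_neg) simp
    ultimately show ?thesis by (simp add: real)
  qed
qed (use assms in auto)

text \<open>Since \<open>v\<close> has integral 1, the constant \<open>a\<close> enters the cost
  exactly once. Positive and negative parts are compared through sums, and a difference is formed
  only at the end: the negative part is dominated by \<open>- (a * v t)\<close>, so its integral is
  finite.\<close>

lemma ext_integral_shift:
  assumes S: "0 \<le> S" and p: "has_velocity S p \<zeta>" and y: "continuous_on {0..S} y" and a: "a \<le> 0"
    and mono: "mono_on {0..S} (\<lambda>t. fst (p t))" and one: "fst (p S) - fst (p 0) = 1"
  shows "ext_integral S (\<lambda>t. ext_lagrangian (\<lambda>x u. L x u + a) (y t) (fst (\<zeta> t)) (snd (\<zeta> t))) =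
    enn2ereal (\<integral>\<^sup>+t. lam (y t) (\<zeta> t) \<partial>lebesgue_on {0..S}) + ereal a"
proof -
  define M where "M = lebesgue_on {0..S}"
  define E where "E = (\<lambda>t. ext_lagrangian L (y t) (fst (\<zeta> t)) (snd (\<zeta> t)))"
  define v where "v = (\<lambda>t. fst (\<zeta> t))"
  define H where "H = (\<lambda>t. ext_lagrangian (\<lambda>x u. L x u + a) (y t) (fst (\<zeta> t)) (snd (\<zeta> t)))"
  have E0: "0 \<le> E t" for t by (simp add: E_def ext_lagrangian_nonneg)
  have lamE: "lam (y t) (\<zeta> t) = e2ennreal (E t)" for t by (simp add: lam_def E_def)
  have v_vel: "has_velocity S (\<lambda>t. fst (p t)) v"
    unfolding v_def by (rule has_velocity_bounded_linear[OF p bounded_linear_fst])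
  have v_pos: "AE t in M. v t \<ge> 0" unfolding M_def by (rule has_velocity_nonneg[OF v_vel mono])
  have \<zeta>m: "\<zeta> \<in> borel_measurable M"
    unfolding M_def using has_velocity_integral(1)[OF p S]
    by (rule absolutely_integrable_measurable[THEN iffD1, THEN conjunct1, rotated]) simp
  have ym: "y \<in> borel_measurable M"
    unfolding M_def by (rule continuous_imp_measurable_on_sets_lebesgue[OF y]) simp
  have lamm: "(\<lambda>t. lam (y t) (\<zeta> t)) \<in> borel_measurable M"
    using measurable_compose[OF borel_measurable_Pair[OF ym \<zeta>m] borel_measurable_lam] by simp
  have [measurable]: "v \<in> borel_measurable M"
    unfolding M_def using has_velocity_integral(1)[OF v_vel S]
    by (rule absolutely_integrable_measurable[THEN iffD1, THEN conjunct1, rotated]) simp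
  have "(\<lambda>t. enn2ereal (lam (y t) (\<zeta> t))) \<in> borel_measurable M" using lamm by measurable
  then have [measurable]: "E \<in> borel_measurable M"
    by (simp add: lamE enn2ereal_e2ennreal E0)
  define A B where "A = (\<integral>\<^sup>+t. e2ennreal (E t + ereal (a * v t)) \<partial>M)"
    and "B = (\<integral>\<^sup>+t. e2ennreal (- (E t + ereal (a * v t))) \<partial>M)"
  have Heq: "AE t in M. H t = E t + ereal (a * v t)"
    using v_pos by eventually_elim (simp add: H_def E_def v_def ext_lagrangian_shift)
  have HA: "(\<integral>\<^sup>+t. e2ennreal (H t) \<partial>M) = A" "(\<integral>\<^sup>+t. e2ennreal (- H t) \<partial>M) = B"
    unfolding A_def B_def using Heq by (auto intro!: nn_integral_cong_AE)
  have vint: "(\<integral>\<^sup>+t. ennreal (- (a * v t)) \<partial>M) = ennreal (- a)"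
  proof -
    have neg: "negligible {t\<in>{0..S}. \<not> v t \<ge> 0}"
      using v_pos unfolding M_def by (subst (asm) AE_lebesgue_on_iff_negligible) auto
    have "(v has_integral 1) {0..S}"
      using has_velocity_integral(2)[OF v_vel S, of 0 S] S one by simp
    \<comment> \<open>\<open>v\<close> is nonnegative only almost everywhere; its absolute value is
      so at every point.\<close>
    then have "((\<lambda>t. \<bar>v t\<bar>) has_integral 1) {0..S}"
      by (rule has_integral_spike[OF neg, rotated]) auto
    from has_integral_mult_right[OF this, of "- a"]
    have "((\<lambda>t. - a * \<bar>v t\<bar>) has_integral - a) {0..S}" by simp
    then have "(\<integral>\<^sup>+t. ennreal (- a * \<bar>v t\<bar>) \<partial>M) = ennreal (- a)"
      using nn_integral_has_integral_lebesgue'[of "{0..S}" "\<lambda>t. - a * \<bar>v t\<bar>"] a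
      by (simp add: M_def nn_integral_lebesgue_on mult_nonpos_nonneg)
    moreover have "(\<integral>\<^sup>+t. ennreal (- (a * v t)) \<partial>M) = (\<integral>\<^sup>+t. ennreal (- a * \<bar>v t\<bar>) \<partial>M)"
      using v_pos by (intro nn_integral_cong_AE) (auto elim!: eventually_mono)
    ultimately show ?thesis by simp
  qed
  have "A + ennreal (- a) = (\<integral>\<^sup>+t. e2ennreal (E t + ereal (a * v t)) + ennreal (- (a * v t)) \<partial>M)"
    unfolding A_def vint[symmetric] by (rule nn_integral_add[symmetric]) measurable
  also have "\<dots> = (\<integral>\<^sup>+t. e2ennreal (E t) + e2ennreal (- (E t + ereal (a * v t))) \<partial>M)"
  proof (rule nn_integral_cong_AE)
    show "AE t in M. e2ennreal (E t + ereal (a * v t)) + ennreal (- (a * v t)) =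
        e2ennreal (E t) + e2ennreal (- (E t + ereal (a * v t)))"
      using v_pos
    proof eventually_elim
      case (elim t)
      have "a * v t \<le> 0" using a elim by (rule mult_nonpos_nonneg)
      then show ?case by (rule positive_part_shift[OF E0])
    qed
  qed
  also have "\<dots> = (\<integral>\<^sup>+t. lam (y t) (\<zeta> t) \<partial>M) + B"
    unfolding B_def lamE by (rule nn_integral_add) measurable
  finally have sum: "A + ennreal (- a) = (\<integral>\<^sup>+t. lam (y t) (\<zeta> t) \<partial>M) + B" .
  have "B \<le> (\<integral>\<^sup>+t. ennreal (- (a * v t)) \<partial>M)"
    unfolding B_def
  proof (rule nn_integral_mono)
    fix t
    have "- (E t + ereal (a * v t)) \<le> ereal (- (a * v t))"
      using E0[of t] by (cases "E t") auto
    from e2ennreal_mono[OF this] show "e2ennreal (- (E t + ereal (a * v t))) \<le> ennreal (- (a * v t))" by simp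
  qed
  then have "B \<noteq> top" using vint by (auto simp: top_unique)
  then obtain \<beta> where \<beta>: "\<beta> \<ge> 0" "B = ennreal \<beta>" by (cases B) auto
  have "enn2ereal A - enn2ereal B = enn2ereal (\<integral>\<^sup>+t. lam (y t) (\<zeta> t) \<partial>M) + ereal a"
  proof (cases "(\<integral>\<^sup>+t. lam (y t) (\<zeta> t) \<partial>M)")
    case (real j)
    then have "A + ennreal (- a) = ennreal (j + \<beta>)" using sum \<beta> by simp
    then have "A \<noteq> top" by auto
    then obtain \<alpha> where \<alpha>: "\<alpha> \<ge> 0" "A = ennreal \<alpha>" by (cases A) auto
    then have "ennreal (\<alpha> - a) = ennreal (j + \<beta>)"
      using \<open>A + ennreal (- a) = ennreal (j + \<beta>)\<close> a by (simp add: ennreal_plus[symmetric] del: ennreal_plus)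
    then have "\<alpha> - a = j + \<beta>" using \<alpha> a real \<beta> by (simp add: ennreal_inj del: ennreal_plus)
    then show ?thesis using \<alpha> \<beta> real by (simp add: enn2ereal_ennreal)
  next
    case top
    then have "A + ennreal (- a) = top" using sum by simp
    then have "A = top" by (simp add: ennreal_add_eq_top)
    then show ?thesis using \<beta> top by (simp add: enn2ereal_ennreal)
  qed
  then have "enn2ereal (\<integral>\<^sup>+t. e2ennreal (H t) \<partial>M) - enn2ereal (\<integral>\<^sup>+t. e2ennreal (- H t) \<partial>M) =
      enn2ereal (\<integral>\<^sup>+t. lam (y t) (\<zeta> t) \<partial>M) + ereal a"
    unfolding HA .
  then show ?thesis unfolding ext_integral_def H_def M_def .
qed

end

section \<open>Control curves and their Frechet classes\<close>

lemma control_curve_properties: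
  assumes p: "p \<in> control_curves"
  shows "loc_abs_continuous p" "p 0 = 0" "\<And>s t. 0 \<le> s \<Longrightarrow> s \<le> t \<Longrightarrow> fst (p s) \<le> fst (p t)"
    "\<And>B. \<exists>t\<ge>0. B < len p t" "\<exists>t\<ge>0. 1 < fst (p t)"
proof -
  show ac: "loc_abs_continuous p" and "p 0 = 0" using p by (auto simp: control_curves_def zero_prod_def)
  have pos: "AE t in lebesgue_on {0..}. vel_v p t \<ge> 0"
    and inf: "(\<integral>\<^sup>+ t. ennreal (norm (vector_derivative p (at t))) \<partial>lebesgue_on {0..}) = \<infinity>"
    and Lim: "Lim at_top (\<lambda>t. ereal (fst (p t))) > 1"
    using p by (auto simp: control_curves_def)
  show "\<exists>t\<ge>0. B < len p t" for B by (rule len_unbounded[OF ac inf])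
  show mono: "fst (p s) \<le> fst (p t)" if st: "0 \<le> s" "s \<le> t" for s t
  proof -
    have "has_velocity t (\<lambda>r. fst (p r)) (vel_v p)"
      using has_velocity_bounded_linear[OF loc_abs_continuous_velocity[OF ac] bounded_linear_fst]
      by (simp add: vel_v_def[abs_def])
    then have "(vel_v p has_integral fst (p t) - fst (p s)) {s..t}"
      using st has_velocity_integral(2)[of t _ "vel_v p" s t] by simp
    moreover have "AE r in lebesgue_on {s..t}. 0 \<le> vel_v p r"
      by (rule AE_lebesgue_on_subset[OF pos]) (use st in auto)
    ultimately have "0 \<le> fst (p t) - fst (p s)" by (intro has_integral_le_AE[OF _ has_integral_0])
    then show ?thesis by simp
  qed
  show "\<exists>t\<ge>0. 1 < fst (p t)"
  proof (rule ccontr)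
    assume "\<not> ?thesis"
    then have le1: "fst (p t) \<le> 1" if "t \<ge> 0" for t using that by force
    \<comment> \<open>\<open>Lim\<close> denotes the limit only once convergence is known.
      Monotonicity gives convergence to the supremum, which would be at most 1.\<close>
    define l where "l = (SUP t\<in>{0..}. ereal (fst (p t)))"
    have "((\<lambda>t. ereal (fst (p t))) \<longlongrightarrow> l) at_top"
    proof (rule order_tendstoI)
      fix c assume "c < l"
      then obtain t0 where t0: "t0 \<ge> 0" "c < ereal (fst (p t0))" by (auto simp: l_def less_SUP_iff)
      have "c < ereal (fst (p t))" if "t \<ge> t0" for t
        using t0(2) mono[OF t0(1) that] by (meson ereal_less_eq(3) less_le_trans)
      then show "\<forall>\<^sub>F t in at_top. c < ereal (fst (p t))" unfolding eventually_at_top_linorder by blast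
    next
      fix c assume "l < c"
      have "ereal (fst (p t)) < c" if "t \<ge> 0" for t
      proof -
        have "ereal (fst (p t)) \<le> l" unfolding l_def by (rule SUP_upper) (use that in simp)
        then show ?thesis using \<open>l < c\<close> by (rule le_less_trans)
      qed
      then show "\<forall>\<^sub>F t in at_top. ereal (fst (p t)) < c" unfolding eventually_at_top_linorder by blast
    qed
    then have "Lim at_top (\<lambda>t. ereal (fst (p t))) = l" by (intro tendsto_Lim) auto
    moreover have "l \<le> 1" unfolding l_def by (rule SUP_least) (use le1 in auto)
    ultimately show False using Lim by simp
  qed
qed

text \<open>\<open>frechet_rel\<close> is a relation on all locally absolutely continuous curves, so
  an element \<open>q\<close> of the class of \<open>p\<close> does not carry the clauses of
  \<open>control_curves\<close> by definition. They are transported from \<open>p\<close>: each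
  point of one curve is the point of the other at the same arclength.\<close>

lemma frechet_rel_control_curve_properties:
  assumes p: "p \<in> control_curves" and rel: "(p, q) \<in> frechet_rel"
  shows "loc_abs_continuous q" "q 0 = 0" "\<And>s t. 0 \<le> s \<Longrightarrow> s \<le> t \<Longrightarrow> fst (q s) \<le> fst (q t)"
    "\<exists>t\<ge>0. 1 < fst (q t)" "\<And>t. 0 \<le> t \<Longrightarrow> \<exists>\<tau>\<ge>0. len q \<tau> = len p t \<and> q \<tau> = p t"
    "\<And>\<tau>. 0 \<le> \<tau> \<Longrightarrow> \<exists>t\<ge>0. len p t = len q \<tau> \<and> p t = q \<tau>"
proof -
  note pp = control_curve_properties[OF p]
  show q: "loc_abs_continuous q" using rel by (simp add: frechet_rel_def)
  show same: "\<exists>\<tau>\<ge>0. len q \<tau> = len p t \<and> q \<tau> = p t" if "0 \<le> t" for t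
    using frechet_rel_same_arclength[OF rel pp(4) that] by metis
  show same': "\<exists>t\<ge>0. len p t = len q \<tau> \<and> p t = q \<tau>" if \<tau>: "0 \<le> \<tau>" for \<tau>
  proof -
    obtain t where t: "0 \<le> t" "len p t = len q \<tau>"
      using exists_len_eq[OF pp(1,4) len_nonneg[OF q \<tau>]] by metis
    obtain \<tau>' where \<tau>': "\<tau>' \<ge> 0" "len q \<tau>' = len p t" "q \<tau>' = p t" using same[OF t(1)] by blast
    have "q \<tau>' = q \<tau>" by (rule eq_if_len_eq[OF q]) (use \<tau> \<tau>' t in auto)
    then show ?thesis using t \<tau>' by auto
  qed
  obtain \<tau> where "\<tau> \<ge> 0" "len q \<tau> = len p 0" "q \<tau> = p 0" using same[of 0] by auto
  then show "q 0 = 0" using eq_if_len_eq[OF q, of \<tau> 0] pp(2) by simp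
  show "fst (q s) \<le> fst (q t)" if st: "0 \<le> s" "s \<le> t" for s t
  proof -
    obtain s' where s': "s' \<ge> 0" "len p s' = len q s" "p s' = q s" using same'[OF st(1)] by blast
    obtain t' where t': "t' \<ge> 0" "len p t' = len q t" "p t' = q t" using same'[of t] st by auto
    show ?thesis
    proof (cases "s' \<le> t'")
      case True
      then show ?thesis using pp(3)[OF s'(1) True] s' t' by simp
    next
      case False
      then have "len q t \<le> len q s" using len_mono[OF pp(1) t'(1), of s'] s' t' by simp
      then have "len q s = len q t" using len_mono[OF q st] by simp
      then show ?thesis using eq_if_len_eq[OF q, of s t] st by simp
    qed
  qed
  show "\<exists>t\<ge>0. 1 < fst (q t)" using pp(5) same by metis
qed

lemma sharp1_properties:
  assumes q: "loc_abs_continuous q" and q0: "q 0 = 0"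
    and mono: "\<And>s t. 0 \<le> s \<Longrightarrow> s \<le> t \<Longrightarrow> fst (q s) \<le> fst (q t)" and ex: "\<exists>t\<ge>0. 1 < fst (q t)"
  shows "0 \<le> sharp1 q" "fst (q (sharp1 q)) = 1" "\<And>s. sharp1 q < s \<Longrightarrow> 1 < fst (q s)"
proof -
  obtain t1 where t1: "t1 \<ge> 0" "1 < fst (q t1)" using ex by blast
  define A where "A = {s. 0 \<le> s \<and> fst (q s) \<le> 1}"
  have sub: "A = {s\<in>{0..t1}. fst (q s) \<le> 1}"
  proof (intro set_eqI iffI)
    fix s assume s: "s \<in> A"
    then have "s \<le> t1" using mono[of t1 s] t1 by (force simp: A_def)
    then show "s \<in> {s\<in>{0..t1}. fst (q s) \<le> 1}" using s by (simp add: A_def)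
  qed (auto simp: A_def)
  have cont: "continuous_on {0..t1} (\<lambda>s. fst (q s))"
    by (intro continuous_intros loc_abs_continuous_continuous_on[OF q])
  have "closed A" unfolding sub by (rule continuous_on_closed_Collect_le[OF cont continuous_on_const]) simp
  moreover have "bounded A" by (rule bounded_subset[of "{0..t1}"]) (auto simp: sub)
  moreover have "0 \<in> A" using q0 by (simp add: A_def)
  ultimately obtain \<sigma> where \<sigma>: "\<sigma> \<in> A" "\<And>s. s \<in> A \<Longrightarrow> s \<le> \<sigma>"
    using compact_attains_sup[of A] by (auto simp: compact_eq_bounded_closed)
  have sharp: "sharp1 q = \<sigma>"
    unfolding sharp1_def A_def[symmetric] using \<sigma> by (rule cSup_eq_maximum)
  show "0 \<le> sharp1 q" using \<sigma>(1) by (simp add: sharp A_def)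
  obtain s where s: "0 \<le> s" "s \<le> t1" "fst (q s) = 1"
    using IVT'[of "\<lambda>s. fst (q s)" 0 1 t1] cont t1 q0 by auto
  then have "s \<le> \<sigma>" by (intro \<sigma>(2)) (simp add: A_def)
  then have "1 \<le> fst (q \<sigma>)" using mono[OF s(1)] s(3) by fastforce
  then show "fst (q (sharp1 q)) = 1" using \<sigma>(1) by (simp add: sharp A_def)
  show "1 < fst (q s)" if "sharp1 q < s" for s
  proof (rule ccontr)
    assume "\<not> ?thesis"
    then have "s \<in> A" using that \<sigma>(1) by (simp add: A_def sharp)
    then show False using \<sigma>(2) that by (force simp: sharp)
  qed
qed

section \<open>Translation between controls, curves and paths\<close>

context bolza
begin

lemma steers_iff:
  assumes S: "0 \<le> S" and p: "has_velocity S p \<zeta>"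
  shows "steers f g x0 x1 (\<lambda>t. fst (\<zeta> t)) (\<lambda>t. snd (\<zeta> t)) S \<longleftrightarrow>
    (\<exists>y. has_velocity S y (\<lambda>t. ctrl f g (y t) (\<zeta> t)) \<and> y 0 = x0 \<and> y S = x1)"
proof -
  have F: "ctrl_field f g (\<lambda>t. fst (\<zeta> t)) (\<lambda>t. snd (\<zeta> t)) = (\<lambda>t y. ctrl f g y (\<zeta> t))"
    by (simp add: ctrl_field_eq)
  have eq: "max_solution (\<lambda>t y. ctrl f g y (\<zeta> t)) x0 S = y S"
    if "solves_ode_on S (\<lambda>t y. ctrl f g y (\<zeta> t)) x0 y" for y
    by (rule max_solution_eq[OF p that S order_refl])
  show ?thesis
    unfolding steers_def F max_solution_dom_def
    using S eq by (auto simp: solves_ode_on_iff)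
qed

lemma ctrl_cost_eq:
  assumes S: "0 \<le> S" and p: "has_velocity S p \<zeta>" and a: "a \<le> 0"
    and mono: "mono_on {0..S} (\<lambda>t. fst (p t))" and one: "p 0 = 0" "fst (p S) = 1"
    and y: "has_velocity S y (\<lambda>t. ctrl f g (y t) (\<zeta> t))" "y 0 = x0"
  shows "ctrl_cost f g (\<lambda>x u. L x u + a) x0 (\<lambda>t. fst (\<zeta> t)) (\<lambda>t. snd (\<zeta> t)) S =
    enn2ereal (\<integral>\<^sup>+t. lam (y t) (\<zeta> t) \<partial>lebesgue_on {0..S}) + ereal a"
proof -
  have F: "ctrl_field f g (\<lambda>t. fst (\<zeta> t)) (\<lambda>t. snd (\<zeta> t)) = (\<lambda>t y. ctrl f g y (\<zeta> t))"
    by (simp add: ctrl_field_eq)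
  have sol: "solves_ode_on S (\<lambda>t y. ctrl f g y (\<zeta> t)) x0 y" using y by (simp add: solves_ode_on_iff)
  have "ctrl_cost f g (\<lambda>x u. L x u + a) x0 (\<lambda>t. fst (\<zeta> t)) (\<lambda>t. snd (\<zeta> t)) S =
      ext_integral S (\<lambda>t. ext_lagrangian (\<lambda>x u. L x u + a) (y t) (fst (\<zeta> t)) (snd (\<zeta> t)))"
    unfolding ctrl_cost_def F by (rule ext_integral_cong) (simp add: max_solution_eq[OF p sol])
  also have "\<dots> = enn2ereal (\<integral>\<^sup>+t. lam (y t) (\<zeta> t) \<partial>lebesgue_on {0..S}) + ereal a"
    by (rule ext_integral_shift[OF S p has_velocity_continuous_on[OF y(1)] a mono]) (simp add: one)
  finally show ?thesis .
qed

lemma path_of_control: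
  assumes S: "0 \<le> S" and p: "has_velocity S p \<zeta>" and a: "a \<le> 0"
    and mono: "mono_on {0..S} (\<lambda>t. fst (p t))" and one: "p 0 = 0" "fst (p S) = 1"
    and st: "steers f g x0 x1 (\<lambda>t. fst (\<zeta> t)) (\<lambda>t. snd (\<zeta> t)) S"
  obtains P Y T where "path P Y T"
    "ctrl_cost f g (\<lambda>x u. L x u + a) x0 (\<lambda>t. fst (\<zeta> t)) (\<lambda>t. snd (\<zeta> t)) S = enn2ereal (cost P Y T) + ereal a"
proof -
  obtain y where y: "has_velocity S y (\<lambda>t. ctrl f g (y t) (\<zeta> t))" "y 0 = x0" "y S = x1"
    using st steers_iff[OF S p] by blast
  show ?thesis
  proof (rule exists_arclength_path[OF S p one(1) mono one(2) y])
    fix P Y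
    assume "path P Y (integral {0..S} (\<lambda>r. norm (\<zeta> r)))"
      "cost P Y (integral {0..S} (\<lambda>r. norm (\<zeta> r))) = (\<integral>\<^sup>+t. lam (y t) (\<zeta> t) \<partial>lebesgue_on {0..S})"
    then show thesis using that ctrl_cost_eq[OF S p a mono one y(1,2)] by simp
  qed
qed

text \<open>The converse of \<open>path_of_control\<close>, for every curve whose arclength
  parametrization is the given path: all of them steer to \<open>x1\<close>, at the cost of the
  path.\<close>

lemma control_of_path:
  assumes path: "path P Y T" and S: "0 \<le> S" and q: "has_velocity S q \<zeta>" and a: "a \<le> 0"
    and T: "integral {0..S} (\<lambda>r. norm (\<zeta> r)) = T"
    and qP: "\<And>t. t \<in> {0..S} \<Longrightarrow> q t = P (integral {0..t} (\<lambda>r. norm (\<zeta> r)))"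
  shows "steers f g x0 x1 (\<lambda>t. fst (\<zeta> t)) (\<lambda>t. snd (\<zeta> t)) S"
    and "ctrl_cost f g (\<lambda>x u. L x u + a) x0 (\<lambda>t. fst (\<zeta> t)) (\<lambda>t. snd (\<zeta> t)) S = enn2ereal (cost P Y T) + ereal a"
proof -
  define \<psi> where "\<psi> = (\<lambda>t. integral {0..t} (\<lambda>r. norm (\<zeta> r)))"
  have \<psi>: "has_velocity S \<psi> (\<lambda>t. norm (\<zeta> t))"
    unfolding \<psi>_def by (rule has_velocity_arclength[OF has_velocity_integral(1)[OF q S]])
  have \<psi>0: "\<psi> 0 = 0" and \<psi>S: "\<psi> S = T" by (auto simp: \<psi>_def T)
  have le: "AE t in lebesgue_on {0..S}. norm (\<zeta> t) \<le> norm (\<zeta> t)" by simp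
  have \<psi>mono: "mono_on {0..S} \<psi>"
  proof (rule mono_onI)
    fix s t assume "s \<in> {0..S}" "t \<in> {0..S}" "s \<le> t"
    then have "norm (q t - q s) \<le> \<psi> t - \<psi> s" by (intro has_velocity_norm_diff_le[OF q \<psi> le]) auto
    then show "\<psi> s \<le> \<psi> t" using norm_ge_zero[of "q t - q s"] by linarith
  qed
  have \<psi>range: "\<psi> t \<in> {0..T}" if "t \<in> {0..S}" for t
    using mono_onD[OF \<psi>mono, of 0 t] mono_onD[OF \<psi>mono, of t S] that \<psi>0 \<psi>S by auto
  obtain C where C: "driven C T (\<lambda>t. t) P Y" using path by (auto simp: path_def)
  define y where "y = (\<lambda>t. Y (\<psi> t))"
  have qP': "q t = P (\<psi> t)" if "t \<in> {0..S}" for t using qP[OF that] by (simp add: \<psi>_def)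
  have "driven C S \<psi> q y"
    by (rule driven_compose[OF C \<psi>mono \<psi>0]) (auto simp: \<psi>S qP' y_def)
  from velocity_of_driven[OF S this \<psi>mono \<psi> q]
  have y: "has_velocity S y (\<lambda>t. ctrl f g (y t) (\<zeta> t))" .
  have y0: "y 0 = x0" and "y S = x1" using path \<psi>0 \<psi>S by (auto simp: y_def path_def)
  then show "steers f g x0 x1 (\<lambda>t. fst (\<zeta> t)) (\<lambda>t. snd (\<zeta> t)) S"
    using steers_iff[OF S q] y by blast
  have mono: "mono_on {0..S} (\<lambda>t. fst (q t))"
  proof (rule mono_onI)
    fix s t assume st: "s \<in> {0..S}" "t \<in> {0..S}" "s \<le> t"
    have "fst (P (\<psi> s)) \<le> fst (P (\<psi> t))"
      using path \<psi>range st mono_onD[OF \<psi>mono st] unfolding path_def mono_on_def by blast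
    then show "fst (q s) \<le> fst (q t)" using qP' st by simp
  qed
  have one: "q 0 = 0" "fst (q S) = 1" using qP'[of 0] qP'[of S] S \<psi>0 \<psi>S path by (auto simp: path_def)
  obtain \<rho> where \<rho>: "has_velocity T P \<rho>" "has_velocity T Y (\<lambda>t. ctrl f g (Y t) (\<rho> t))"
    using path_velocity[OF path] by metis
  have "(\<integral>\<^sup>+t. lam (y t) (\<zeta> t) \<partial>lebesgue_on {0..S}) = (\<integral>\<^sup>+s. lam (Y s) (\<rho> s) \<partial>lebesgue_on {0..\<psi> S})"
  proof (rule nn_integral_reparametrize[OF borel_measurable_lam lam_scale S \<psi> \<psi>mono \<psi>0 q le])
    show "has_velocity (\<psi> S) P \<rho>" "continuous_on {0..\<psi> S} Y"
      unfolding \<psi>S by (rule \<rho>(1), rule has_velocity_continuous_on[OF \<rho>(2)])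
  qed (use qP' in \<open>auto simp: y_def\<close>)
  then show "ctrl_cost f g (\<lambda>x u. L x u + a) x0 (\<lambda>t. fst (\<zeta> t)) (\<lambda>t. snd (\<zeta> t)) S = enn2ereal (cost P Y T) + ereal a"
    using ctrl_cost_eq[OF S q a mono one y y0] cost_eq[OF \<rho>(1), of Y] \<psi>S by simp
qed

lemma path_of_relaxed_admissible:
  assumes adm: "relaxed_admissible f g x0 x1 v w T" and a: "a \<le> 0"
  obtains P Y S where "path P Y S" "ctrl_cost f g (\<lambda>x u. L x u + a) x0 v w T = enn2ereal (cost P Y S) + ereal a"
proof -
  have T: "0 \<le> T" and wm: "w \<in> borel_measurable (lebesgue_on {0..T})"
    and Bk: "AE t in lebesgue_on {0..T}. (v t, w t) \<in> Bk_plus"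
    and st: "steers f g x0 x1 v w T"
    using adm by (auto simp: relaxed_admissible_def)
  obtain \<theta> where \<theta>: "has_velocity T \<theta> v" "\<theta> 0 = 0" "\<theta> T = 1"
    using adm by (auto simp: relaxed_admissible_def solves_ode_on_iff)
  have "integrable (lebesgue_on {0..T}) w"
  proof (rule finite_measure.integrable_const_bound[of _ _ 1])
    show "finite_measure (lebesgue_on {0..T})" by (rule finite_measure_lebesgue_on) simp
    show "AE t in lebesgue_on {0..T}. norm (w t) \<le> 1"
      using Bk
    proof eventually_elim
      case (elim t)
      then have "(norm (w t))\<^sup>2 \<le> 1" using zero_le_power2[of "v t"] by (auto simp: Bk_plus_def intro: order_trans[rotated])
      then show ?case using power2_le_imp_le[of "norm (w t)" 1] by simp
    qed
  qed (rule wm)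
  then have "w absolutely_integrable_on {0..T}"
    by (simp add: set_integrable_def integrable_restrict_space)
  then have "has_velocity T (\<lambda>t. integral {0..t} w) w" by (rule has_velocity_indefinite_integral)
  from has_velocity_Pair[OF \<theta>(1) this]
  have p: "has_velocity T (\<lambda>t. (\<theta> t, integral {0..t} w)) (\<lambda>t. (v t, w t))" .
  have mono: "mono_on {0..T} (\<lambda>t. fst (\<theta> t, integral {0..t} w))"
  proof (rule mono_onI)
    fix r s assume rs: "r \<in> {0..T}" "s \<in> {0..T}" "r \<le> s"
    have "AE t in lebesgue_on {r..s}. (v t, w t) \<in> Bk_plus"
      by (rule AE_lebesgue_on_subset[OF Bk]) (use rs in auto)
    then have "AE t in lebesgue_on {r..s}. 0 \<le> v t" by eventually_elim (simp add: Bk_plus_def)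
    moreover have "(v has_integral \<theta> s - \<theta> r) {r..s}"
      using has_velocity_integral(2)[OF \<theta>(1) T] rs by simp
    ultimately have "0 \<le> \<theta> s - \<theta> r" by (intro has_integral_le_AE[OF _ has_integral_0])
    then show "fst (\<theta> r, integral {0..r} w) \<le> fst (\<theta> s, integral {0..s} w)" by simp
  qed
  show ?thesis
    by (rule path_of_control[OF T p a mono]) (use \<theta> st that in \<open>auto simp: zero_prod_def\<close>)
qed

lemma relaxed_minimizer_of_minimal_path:
  assumes path: "path P Y S" and min: "\<And>P' Y' S'. path P' Y' S' \<Longrightarrow> cost P Y S \<le> cost P' Y' S'"
    and a: "a \<le> 0"
  shows "\<exists>v w T. relaxed_minimizer f g (\<lambda>x u. L x u + a) x0 x1 v w T"
proof -
  have S: "0 \<le> S" and P0: "P 0 = 0" and mono: "mono_on {0..S} (\<lambda>t. fst (P t))" and PS: "fst (P S) = 1"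
    and Y: "Y 0 = x0" "Y S = x1"
    using path by (auto simp: path_def)
  obtain \<rho> where \<rho>: "has_velocity S P \<rho>" "\<rho> \<in> borel_measurable borel"
    "AE t in lebesgue_on {0..S}. norm (\<rho> t) \<le> 1" "AE t in lebesgue_on {0..S}. fst (\<rho> t) \<ge> 0"
    "has_velocity S Y (\<lambda>t. ctrl f g (Y t) (\<rho> t))"
    by (rule path_velocity[OF path]) (rule that)
  have "\<rho> \<in> borel_measurable (lebesgue_on {0..S})"
    using \<rho>(2) by (simp add: measurable_completion measurable_restrict_space1)
  then have m: "(\<lambda>t. fst (\<rho> t)) \<in> borel_measurable (lebesgue_on {0..S})"
    "(\<lambda>t. snd (\<rho> t)) \<in> borel_measurable (lebesgue_on {0..S})"
    by (auto intro!: measurable_compose[OF _ borel_measurable_continuous_onI[of fst]]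
        measurable_compose[OF _ borel_measurable_continuous_onI[of snd]] continuous_intros)
  have "AE t in lebesgue_on {0..S}. (fst (\<rho> t), snd (\<rho> t)) \<in> Bk_plus"
    using \<rho>(3,4)
  proof eventually_elim
    case (elim t)
    have "(norm (\<rho> t))\<^sup>2 \<le> 1" using elim(1) by (simp add: power_le_one)
    moreover have "(norm (\<rho> t))\<^sup>2 = (fst (\<rho> t))\<^sup>2 + (norm (snd (\<rho> t)))\<^sup>2" by (simp add: norm_prod_def)
    ultimately show ?case using elim(2) by (cases "\<rho> t") (simp add: Bk_plus_def)
  qed
  moreover have "solves_ode_on S (\<lambda>t _. fst (\<rho> t)) 0 (\<lambda>t. fst (P t))"
    using has_velocity_bounded_linear[OF \<rho>(1) bounded_linear_fst] P0 by (simp add: solves_ode_on_iff)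
  moreover have "steers f g x0 x1 (\<lambda>t. fst (\<rho> t)) (\<lambda>t. snd (\<rho> t)) S"
    using steers_iff[OF S \<rho>(1)] \<rho>(5) Y by blast
  ultimately have adm: "relaxed_admissible f g x0 x1 (\<lambda>t. fst (\<rho> t)) (\<lambda>t. snd (\<rho> t)) S"
    unfolding relaxed_admissible_def using S m PS by blast
  have cost: "ctrl_cost f g (\<lambda>x u. L x u + a) x0 (\<lambda>t. fst (\<rho> t)) (\<lambda>t. snd (\<rho> t)) S = enn2ereal (cost P Y S) + ereal a"
    using ctrl_cost_eq[OF S \<rho>(1) a mono P0 PS \<rho>(5) Y(1)] cost_eq[OF \<rho>(1), of Y] by simp
  have "ctrl_cost f g (\<lambda>x u. L x u + a) x0 (\<lambda>t. fst (\<rho> t)) (\<lambda>t. snd (\<rho> t)) S \<le>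
      ctrl_cost f g (\<lambda>x u. L x u + a) x0 v w T" if vw: "relaxed_admissible f g x0 x1 v w T" for v w T
  proof -
    obtain P' Y' S' where "path P' Y' S'"
      "ctrl_cost f g (\<lambda>x u. L x u + a) x0 v w T = enn2ereal (cost P' Y' S') + ereal a"
      using path_of_relaxed_admissible[OF vw a] by metis
    with min show ?thesis unfolding cost by (simp add: add_right_mono less_eq_ennreal.rep_eq)
  qed
  with adm show ?thesis unfolding relaxed_minimizer_def by blast
qed

text \<open>After time \<open>S\<close> the curve runs with unit speed in the \<open>V\<close>
  direction. Thus \<open>V\<close> exceeds 1 immediately after \<open>S\<close>, which fixes
  \<open>sharp1\<close>, and both \<open>V\<close> and the length tend to infinity.\<close>

definition extend_curve :: "(real \<Rightarrow> real \<times> (real^'k)) \<Rightarrow> real \<Rightarrow> real \<Rightarrow> real \<times> (real^'k)" where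
  "extend_curve P S t = (if t \<le> S then P t else P S + (t - S, 0))"

lemma extend_curve_lipschitz:
  assumes "1-lipschitz_on {0..S} P" "0 \<le> s" "s \<le> t" "0 \<le> S"
  shows "norm (extend_curve P S t - extend_curve P S s) \<le> t - s"
proof -
  have lip: "norm (P t - P s) \<le> t - s" if "0 \<le> s" "s \<le> t" "t \<le> S" for s t
    using lipschitz_onD[OF assms(1), of t s] that by (simp add: dist_norm)
  have time: "norm (r, 0 :: real^'k) = r" if "r \<ge> 0" for r :: real using that by (simp add: norm_prod_def)
  consider "t \<le> S" | "s \<le> S" "S < t" | "S < s" by linarith
  then show ?thesis
  proof cases
    case 1
    then show ?thesis using lip[of s t] assms by (simp add: extend_curve_def)
  next
    case 2
    have "norm ((P S - P s) + (t - S, 0)) \<le> norm (P S - P s) + norm (t - S, 0 :: real^'k)"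
      by (rule norm_triangle_ineq)
    also have "\<dots> \<le> (S - s) + (t - S)" using lip[of s S] 2 assms time[of "t - S"] by (intro add_mono) auto
    finally have "norm ((P S - P s) + (t - S, 0)) \<le> t - s" by simp
    moreover have "extend_curve P S t - extend_curve P S s = (P S - P s) + (t - S, 0)"
      using 2 by (simp add: extend_curve_def)
    ultimately show ?thesis by simp
  next
    case 3
    then have "extend_curve P S t - extend_curve P S s = (t - s, 0)"
      using assms by (simp add: extend_curve_def)
    then show ?thesis using time[of "t - s"] assms by simp
  qed
qed

lemma extend_curve_control_curve:
  assumes path: "path P Y S"
  shows "extend_curve P S \<in> control_curves" and "sharp1 (extend_curve P S) = S"
proof -
  define p where "p = extend_curve P S"
  have S: "0 \<le> S" and lip: "1-lipschitz_on {0..S} P" and P0: "P 0 = 0"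
    and mono: "mono_on {0..S} (\<lambda>t. fst (P t))" and PS: "fst (P S) = 1"
    using path by (auto simp: path_def)
  have pl: "norm (p t - p s) \<le> t - s" if "0 \<le> s" "s \<le> t" for s t
    unfolding p_def by (rule extend_curve_lipschitz[OF lip that S])
  have p_late: "p t = P S + (t - S, 0)" if "S \<le> t" for t using that by (auto simp: p_def extend_curve_def zero_prod_def[symmetric])
  have p_early: "p t = P t" if "t \<le> S" for t using that by (simp add: p_def extend_curve_def)
  have fst_late: "fst (p t) = 1 + (t - S)" if "S \<le> t" for t using p_late[OF that] PS by simp
  have p0: "p 0 = 0" using p_early[of 0] S P0 by simp
  have lipT: "1-lipschitz_on {0..T} p" for T
  proof (rule lipschitz_onI)
    fix s t assume "s \<in> {0..T}" "t \<in> {0..T}"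
    then show "dist (p s) (p t) \<le> 1 * dist s t"
      using pl[of s t] pl[of t s] by (cases "s \<le> t") (auto simp: dist_norm norm_minus_commute)
  qed simp
  have ac: "loc_abs_continuous p"
    unfolding loc_abs_continuous_def using abs_continuous_on_lipschitz[OF lipT] by blast
  have pmono: "fst (p s) \<le> fst (p t)" if st: "0 \<le> s" "s \<le> t" for s t
  proof -
    consider "t \<le> S" | "s \<le> S" "S < t" | "S < s" by linarith
    then show ?thesis
    proof cases
      case 1
      then show ?thesis using mono_onD[OF mono, of s t] p_early st by simp
    next
      case 2
      then show ?thesis using mono_onD[OF mono, of s S] p_early[of s] fst_late[of t] PS st by simp
    next
      case 3
      then show ?thesis using fst_late st by simp
    qed
  qed
  have "negligible {t\<in>{0..}. \<not> 0 \<le> vel_v p t}"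
  proof -
    have "AE t in lebesgue_on {0..real n}. 0 \<le> fst (vector_derivative p (at t))" for n :: nat
      by (rule has_velocity_nonneg[OF has_velocity_bounded_linear[OF loc_abs_continuous_velocity[OF ac] bounded_linear_fst]])
         (use pmono in \<open>auto simp: mono_on_def\<close>)
    then have "negligible {t\<in>{0..real n}. \<not> 0 \<le> vel_v p t}" for n :: nat
      by (subst (asm) AE_lebesgue_on_iff_negligible) (auto simp: vel_v_def)
    then have "negligible (\<Union>n::nat. {t\<in>{0..real n}. \<not> 0 \<le> vel_v p t})"
      by (intro negligible_countable_Union) auto
    then show ?thesis
      by (rule negligible_subset) (use real_arch_simple in auto)
  qed
  then have pos: "AE t in lebesgue_on {0..}. 0 \<le> vel_v p t"
    by (subst AE_lebesgue_on_iff_negligible) auto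
  \<comment> \<open>Were the length a finite number \<open>c\<close>, the piece over
    \<open>[S, S + c + 1]\<close> alone, of length \<open>c + 1\<close>, would exceed it.\<close>
  have inf: "(\<integral>\<^sup>+t. ennreal (norm (vector_derivative p (at t))) \<partial>lebesgue_on {0..}) = \<infinity>" (is "?I = _")
  proof (rule ccontr)
    assume "?I \<noteq> \<infinity>"
    then obtain c where c: "c \<ge> 0" "?I = ennreal c" by (cases ?I) auto
    have T: "0 \<le> S + c + 1" using S c by simp
    have "norm (p (S + c + 1) - p S) \<le> len p (S + c + 1) - len p S"
      using S c by (intro norm_diff_le_len[OF ac]) auto
    moreover have "p (S + c + 1) - p S = (c + 1, 0)"
      using p_late[of S] p_late[of "S + c + 1"] c by simp
    then have "norm (p (S + c + 1) - p S) = c + 1" using c by (simp add: norm_prod_def)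
    ultimately have "c + 1 \<le> len p (S + c + 1)" using len_nonneg[OF ac S] by simp
    then have "ennreal (c + 1) \<le> ennreal (len p (S + c + 1))" by (rule ennreal_leI)
    also have "\<dots> = (\<integral>\<^sup>+t. ennreal (norm (vector_derivative p (at t))) \<partial>lebesgue_on {0..S + c + 1})"
      by (rule nn_integral_len[OF ac T, symmetric])
    also have "\<dots> \<le> ?I"
      by (simp add: nn_integral_lebesgue_on) (rule nn_integral_mono, auto split: split_indicator)
    finally show False using c by (simp add: ennreal_le_iff)
  qed
  have "filterlim (\<lambda>t. fst (p t)) at_top at_top"
  proof (rule filterlim_at_top_mono)
    show "filterlim (\<lambda>t. (1 - S) + t) at_top at_top"
      by (rule filterlim_tendsto_add_at_top[OF tendsto_const filterlim_ident])
    show "\<forall>\<^sub>F t in at_top. (1 - S) + t \<le> fst (p t)"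
      unfolding eventually_at_top_linorder using fst_late by (intro exI[of _ S]) auto
  qed
  then have "((\<lambda>t. ereal (fst (p t))) \<longlongrightarrow> \<infinity>) at_top" by (simp add: tendsto_PInfty_eq_at_top)
  then have "Lim at_top (\<lambda>t. ereal (fst (p t))) = \<infinity>" by (intro tendsto_Lim) auto
  with ac p0 pos inf show "extend_curve P S \<in> control_curves"
    unfolding p_def[symmetric] control_curves_def by (simp add: zero_prod_def)
  have ex: "\<exists>t\<ge>0. 1 < fst (p t)" using fst_late[of "S + 1"] S by (intro exI[of _ "S + 1"]) simp
  note sp = sharp1_properties[OF ac p0 pmono ex]
  have "fst (p S) = 1" using fst_late[of S] by simp
  then have "S \<le> sharp1 p" using sp(3)[of S] by force
  moreover have "\<not> S < sharp1 p" using fst_late[of "sharp1 p"] sp(2) by auto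
  ultimately show "sharp1 (extend_curve P S) = S" by (simp add: p_def)
qed

text \<open>The class of the extended minimal path is optimal. Its members share one arclength
  parametrization up to \<open>sharp1\<close>, so \<open>control_of_path\<close> gives all of them
  the minimal cost; admissible competitors from any class yield paths and cannot be cheaper.\<close>

lemma frechet_minimizer_of_minimal_path:
  assumes path: "path P Y S" and min: "\<And>P' Y' S'. path P' Y' S' \<Longrightarrow> cost P Y S \<le> cost P' Y' S'"
    and a: "a \<le> 0"
  shows "\<exists>C. frechet_generalized_minimizer f g (\<lambda>x u. L x u + a) x0 x1 C"
proof -
  have S: "0 \<le> S" and mono: "mono_on {0..S} (\<lambda>t. fst (P t))" and PS: "fst (P S) = 1"
    and Y: "Y 0 = x0" "Y S = x1"
    using path by (auto simp: path_def)
  define p where "p = extend_curve P S"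
  have p: "p \<in> control_curves" and sharp: "sharp1 p = S"
    unfolding p_def by (rule extend_curve_control_curve[OF path])+
  note pp = control_curve_properties[OF p]
  have pP: "p t = P t" if "t \<le> S" for t using that by (simp add: p_def extend_curve_def)
  define \<zeta> where "\<zeta> = (\<lambda>t. vector_derivative p (at t))"
  have p_vel: "has_velocity S p \<zeta>" unfolding \<zeta>_def by (rule loc_abs_continuous_velocity[OF pp(1)])
  obtain \<rho> where \<rho>: "has_velocity S P \<rho>" "has_velocity S Y (\<lambda>t. ctrl f g (Y t) (\<rho> t))"
    using path_velocity[OF path] by metis
  have "has_velocity S p \<rho>"
  proof -
    have "AE t in lebesgue_on {0..S}. t \<noteq> 0 \<and> t \<noteq> S"
      by (subst AE_lebesgue_on_iff_negligible) (auto intro: negligible_subset[of "{0, S}"])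
    moreover have "AE t in lebesgue_on {0..S}. t \<in> {0..S}" using AE_space[of "lebesgue_on {0..S}"] by simp
    moreover have "AE t in lebesgue_on {0..S}. (P has_vector_derivative \<rho> t) (at t)"
      using \<rho>(1) by (simp add: has_velocity_def)
    ultimately have "AE t in lebesgue_on {0..S}. (p has_vector_derivative \<rho> t) (at t)"
    proof eventually_elim
      case (elim t)
      show ?case
        by (rule has_vector_derivative_transform_within_open[OF elim(3), of "{0<..<S}"]) (use elim(1,2) pP in auto)
    qed
    then show ?thesis using p_vel by (simp add: has_velocity_def)
  qed
  then have ae: "AE t in lebesgue_on {0..S}. \<rho> t = \<zeta> t" using p_vel by (rule has_velocity_unique)
  have Y_vel: "has_velocity S Y (\<lambda>t. ctrl f g (Y t) (\<zeta> t))"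
    by (rule has_velocity_cong_AE[OF \<rho>(2)]) (use ae in eventually_elim, simp)
  have cost_\<zeta>: "(\<integral>\<^sup>+t. lam (Y t) (\<zeta> t) \<partial>lebesgue_on {0..S}) = cost P Y S"
    unfolding cost_eq[OF \<rho>(1)] by (rule nn_integral_cong_AE) (use ae in eventually_elim, simp)
  have len_p: "integral {0..t} (\<lambda>r. norm (\<zeta> r)) = len p t" for t by (simp add: len_def \<zeta>_def)
  have p_mono: "mono_on {0..S} (\<lambda>t. fst (p t))" using pp(3) by (auto simp: mono_on_def)
  have pS: "fst (p S) = 1" using pP[of S] PS by simp
  \<comment> \<open>The minimal path has speed at most 1, but it may be slower. \<open>P1\<close> is
    its arclength version, which is what all members of the class have in common.\<close>
  obtain P1 Y1 where 1: "path P1 Y1 (len p S)" "cost P1 Y1 (len p S) = cost P Y S"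
    "\<And>t. t \<in> {0..S} \<Longrightarrow> p t = P1 (len p t)"
  proof (rule exists_arclength_path[OF S p_vel pp(2) p_mono pS Y_vel Y])
    fix P1 Y1
    assume "path P1 Y1 (integral {0..S} (\<lambda>r. norm (\<zeta> r)))"
      "cost P1 Y1 (integral {0..S} (\<lambda>r. norm (\<zeta> r))) = (\<integral>\<^sup>+t. lam (Y t) (\<zeta> t) \<partial>lebesgue_on {0..S})"
      "\<And>t. t \<in> {0..S} \<Longrightarrow> p t = P1 (integral {0..t} (\<lambda>r. norm (\<zeta> r)))"
    then show thesis using that unfolding len_p cost_\<zeta> by blast
  qed
  define C where "C = frechet_rel `` {p}"
  have C: "C \<in> generalized_controls" unfolding C_def generalized_controls_def using p by (rule quotientI)
  have vel_eq: "vel_v q = (\<lambda>t. fst (vector_derivative q (at t)))" "vel_w q = (\<lambda>t. snd (vector_derivative q (at t)))"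
    for q :: "real \<Rightarrow> real \<times> (real^'k)"
    by (auto simp: vel_v_def vel_w_def)
  have in_C: "curve_admissible f g x0 x1 q \<and>
      curve_cost f g (\<lambda>x u. L x u + a) x0 q = enn2ereal (cost P Y S) + ereal a" if q: "q \<in> C" for q
  proof -
    have rel: "(p, q) \<in> frechet_rel" using q by (simp add: C_def)
    note qp = frechet_rel_control_curve_properties[OF p rel]
    note sq = sharp1_properties[OF qp(1-4)]
    note sp = sharp1_properties[OF pp(1-3,5), unfolded sharp]
    define \<sigma> where "\<sigma> = sharp1 q"
    have \<sigma>: "0 \<le> \<sigma>" "fst (q \<sigma>) = 1" using sq by (auto simp: \<sigma>_def)
    have q_vel: "has_velocity \<sigma> q (\<lambda>t. vector_derivative q (at t))" by (rule loc_abs_continuous_velocity[OF qp(1)])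
    have len_q: "integral {0..t} (\<lambda>r. norm (vector_derivative q (at r))) = len q t" for t by (simp add: len_def)
    \<comment> \<open>On either curve the parameter \<open>sharp1\<close> is the last one with
      \<open>V \<le> 1\<close>. Points matched by arclength agree, hence have the same
      \<open>V\<close>, so neither curve can be longer than the other up to this parameter.\<close>
    have T: "len q \<sigma> = len p S"
    proof (rule antisym)
      obtain t where t: "t \<ge> 0" "len p t = len q \<sigma>" "p t = q \<sigma>" using qp(6)[OF \<sigma>(1)] by blast
      then have "t \<le> S" using sp(3)[of t] \<sigma>(2) by force
      then show "len q \<sigma> \<le> len p S" using len_mono[OF pp(1) t(1)] t(2) by metis
      obtain \<tau> where \<tau>: "\<tau> \<ge> 0" "len q \<tau> = len p S" "q \<tau> = p S" using qp(5)[OF S] by blast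
      then have "\<tau> \<le> \<sigma>" using sq(3)[of \<tau>] pS by (force simp: \<sigma>_def)
      then show "len p S \<le> len q \<sigma>" using len_mono[OF qp(1) \<tau>(1)] \<tau>(2) by metis
    qed
    have qP: "q t = P1 (integral {0..t} (\<lambda>r. norm (vector_derivative q (at r))))" if t: "t \<in> {0..\<sigma>}" for t
    proof -
      obtain t' where t': "t' \<ge> 0" "len p t' = len q t" "p t' = q t" using qp(6)[of t] t by auto
      have "fst (q t) \<le> 1" using qp(3)[of t \<sigma>] t \<sigma>(2) by simp
      then have "t' \<le> S" using sp(3)[of t'] t'(3) by force
      then have "p t' = P1 (len p t')" using t'(1) by (intro 1(3)) simp
      then show ?thesis unfolding len_q using t' by simp
    qed
    from control_of_path[OF 1(1) \<sigma>(1) q_vel a T[folded len_q] qP] 1(2)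
    show ?thesis
      unfolding curve_admissible_def curve_cost_def vel_eq \<sigma>_def[symmetric] by simp
  qed
  have "curve_cost f g (\<lambda>x u. L x u + a) x0 p' \<le> curve_cost f g (\<lambda>x u. L x u + a) x0 q"
    if D: "D \<in> generalized_controls" "q \<in> D" "curve_admissible f g x0 x1 q" and p': "p' \<in> C" for D q p'
  proof -
    obtain d where d: "d \<in> control_curves" "(d, q) \<in> frechet_rel"
      using D(1,2) unfolding generalized_controls_def quotient_def by auto
    note qp = frechet_rel_control_curve_properties[OF d]
    note sq = sharp1_properties[OF qp(1-4)]
    define \<sigma> where "\<sigma> = sharp1 q"
    have \<sigma>: "0 \<le> \<sigma>" "fst (q \<sigma>) = 1" using sq by (auto simp: \<sigma>_def)
    have q_vel: "has_velocity \<sigma> q (\<lambda>t. vector_derivative q (at t))" by (rule loc_abs_continuous_velocity[OF qp(1)])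
    have mono: "mono_on {0..\<sigma>} (\<lambda>t. fst (q t))" using qp(3) by (auto simp: mono_on_def)
    have st: "steers f g x0 x1 (\<lambda>t. fst (vector_derivative q (at t))) (\<lambda>t. snd (vector_derivative q (at t))) \<sigma>"
      using D(3) unfolding curve_admissible_def vel_eq \<sigma>_def .
    obtain P' Y' T' where P': "path P' Y' T'"
      "ctrl_cost f g (\<lambda>x u. L x u + a) x0 (\<lambda>t. fst (vector_derivative q (at t))) (\<lambda>t. snd (vector_derivative q (at t))) \<sigma>
        = enn2ereal (cost P' Y' T') + ereal a"
      using path_of_control[OF \<sigma>(1) q_vel a mono qp(2) \<sigma>(2) st] by metis
    have "curve_cost f g (\<lambda>x u. L x u + a) x0 q = enn2ereal (cost P' Y' T') + ereal a"
      unfolding curve_cost_def vel_eq \<sigma>_def[symmetric] by (rule P'(2))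
    then show ?thesis
      using in_C[OF p'] min[OF P'(1)] by (simp add: add_right_mono less_eq_ennreal.rep_eq)
  qed
  with C in_C show ?thesis unfolding frechet_generalized_minimizer_def by blast
qed

theorem minimizers_exist:
  assumes u: "u absolutely_integrable_on {0..1}" "steers f g x0 x1 (\<lambda>_. 1) u 1" and a: "a \<le> 0"
  shows "(\<exists>v w T. relaxed_minimizer f g (\<lambda>x u. L x u + a) x0 x1 v w T) \<and>
    (\<exists>C. frechet_generalized_minimizer f g (\<lambda>x u. L x u + a) x0 x1 C)"
proof -
  have "has_velocity 1 (\<lambda>t. t) (\<lambda>_. 1)" by (simp add: has_velocity_def abs_continuous_on_id)
  from has_velocity_Pair[OF this has_velocity_indefinite_integral[OF u(1)]]
  have p: "has_velocity 1 (\<lambda>t. (t, integral {0..t} u)) (\<lambda>t. (1, u t))" .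
  obtain P0 Y0 S0 where "path P0 Y0 S0"
    by (rule path_of_control[OF _ p a]) (use u(2) in \<open>auto simp: mono_on_def zero_prod_def\<close>)
  from exists_minimal_path[OF this] obtain P Y S where
    "path P Y S" "\<And>P' Y' S'. path P' Y' S' \<Longrightarrow> cost P Y S \<le> cost P' Y' S'" by metis
  then show ?thesis
    using relaxed_minimizer_of_minimal_path[OF _ _ a] frechet_minimizer_of_minimal_path[OF _ _ a] by metis
qed

end

theorem proposition33:
  fixes f :: "real^'n \<Rightarrow> real^'n"
    and g :: "'k::finite \<Rightarrow> real^'n \<Rightarrow> real^'n"
    and L :: "real^'n \<Rightarrow> real^'k \<Rightarrow> real"
    and x0 x1 :: "real^'n"
    and a b a' b' :: real
  assumes "local_lipschitz (UNIV::real set) UNIV (\<lambda>_. f)"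
    and "\<And>i. local_lipschitz (UNIV::real set) UNIV (\<lambda>_. g i)"
    and "continuous_on UNIV (\<lambda>(x, u). L x u)"
    and "\<And>x. convex_on UNIV (L x)"
    and "b > 0"
    and "\<And>x u. L x u \<ge> a + b * norm u"
    and "\<And>x u. norm (ctrl_map g x u) \<le> (a' + b' * norm x) * norm u + b' * L x u"
    and "\<And>x u. norm (f x) \<le> a' + b' * (norm x + L x u)"
    and "\<exists>u. u absolutely_integrable_on {0..1} \<and> steers f g x0 x1 (\<lambda>_. 1) u 1"
  shows "(\<exists>v w T. relaxed_minimizer f g L x0 x1 v w T) \<and>
         (\<exists>C. frechet_generalized_minimizer f g L x0 x1 C)"
proof -
  \<comment> \<open>Since \<open>c\<close> is at most \<open>a\<close> and at most 0, the shifted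
    \<open>M\<close> satisfies \<open>M \<ge> b * norm u\<close> and \<open>M \<ge> L\<close>. With
    \<open>b' \<ge> 0\<close> the growth bounds survive for \<open>M\<close>, and raising
    \<open>a'\<close> to \<open>A\<close> only weakens them.\<close>
  define c where "c = min a 0"
  define A where "A = max a' 0"
  define M where "M = (\<lambda>x u. L x u - c)"
  \<comment> \<open>\<open>L\<close> is unbounded above, so the bound on \<open>f\<close> forces the sign of \<open>b'\<close>.\<close>
  have b': "b' \<ge> 0"
  proof (rule ccontr)
    assume neg: "\<not> b' \<ge> 0"
    \<comment> \<open>Chosen so that coercivity makes \<open>L 0 u\<close> larger than
      \<open>\<bar>a'\<bar> / (- b')\<close> once \<open>u\<close> has norm at least
      \<open>r\<close>; the bound on \<open>f 0\<close> would then be negative.\<close>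
    define r where "r = (\<bar>a\<bar> + \<bar>a'\<bar> / (- b') + 1) / b"
    define u :: "real^'k" where "u = (\<chi> i. r)"
    obtain i :: 'k where True by simp
    have "\<bar>r\<bar> \<le> norm u" using component_le_norm_cart[of u i] by (simp add: u_def)
    moreover have "\<bar>a'\<bar> / (- b') \<ge> 0" using neg by (intro divide_nonneg_pos) auto
    then have "r \<ge> 0" unfolding r_def using assms(5) by (intro divide_nonneg_pos) auto
    ultimately have "b * r \<le> b * norm u" using assms(5) by (intro mult_left_mono) auto
    then have "\<bar>a\<bar> + \<bar>a'\<bar> / (- b') + 1 \<le> L 0 u - a"
      using assms(5) assms(6)[where x=0 and u=u] by (simp add: r_def)
    then have "\<bar>a'\<bar> / (- b') < L 0 u" by linarith
    then have "\<bar>a'\<bar> < L 0 u * (- b')" using neg by (subst (asm) pos_divide_less_eq) simp_all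
    then have "a' + b' * (norm (0 :: real^'n) + L 0 u) < 0"
      using abs_ge_self[of a'] by (simp add: mult.commute)
    then show False using assms(8)[of 0 u] norm_ge_zero[of "f 0"] by linarith
  qed
  have c: "c \<le> 0" by (simp add: c_def)
  have bc: "b' * c \<le> 0" using b' c by (rule mult_nonneg_nonpos)
  interpret bolza M b f g x0 x1 A b'
  proof unfold_locales
    show "continuous_on UNIV (\<lambda>(x, u). M x u)"
      using continuous_on_diff[OF assms(3) continuous_on_const[of _ c]] by (simp add: M_def split_def)
    show "convex_on UNIV (M x)" for x
      using convex_on_diff[OF assms(4)[of x], of "\<lambda>_. c"] by (simp add: M_def[abs_def] concave_on_def convex_on_const)
    show "b > 0" by (rule assms(5))
    show "b * norm u \<le> M x u" for x u using assms(6)[of u x] by (simp add: M_def c_def)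
    show "local_lipschitz (UNIV::real set) UNIV (\<lambda>_. f)" "\<And>i. local_lipschitz (UNIV::real set) UNIV (\<lambda>_. g i)"
      by (rule assms(1), rule assms(2))
    show "A \<ge> 0" "b' \<ge> 0" by (simp_all add: A_def b')
    show "norm (ctrl_map g x u) \<le> (A + b' * norm x) * norm u + b' * M x u" for x u
    proof -
      have "(a' + b' * norm x) * norm u \<le> (A + b' * norm x) * norm u"
        by (intro mult_right_mono) (auto simp: A_def)
      then show ?thesis using assms(7)[of x u] bc by (simp add: M_def right_diff_distrib)
    qed
    show "norm (f x) \<le> A + b' * (norm x + M x u)" for x u
      using assms(8)[of x u] bc by (simp add: M_def A_def algebra_simps)
  qed
  have "(\<lambda>x u. M x u + c) = L" by (simp add: M_def)
  then show ?thesis using assms(9) minimizers_exist[OF _ _ c] by auto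
qed

end
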